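(* Let $\hbar\in\mathbb{C}$ with $\sinh\hbar\ne0$, and let $\widetilde U(\mathfrak{sl}_2)_\hbar$ be the universal HFG algebra generated by $E,F,H$ subject to the relations $$[H,E]=2E,\quad[H,F]=-2F,\quad[E,F]=\frac{\sinh\hbar H}{\sinh\hbar}.$$ Then $\widetilde U(\mathfrak{sl}_2)_\hbar$ is an infinite-dimensional HFG Hopf algebra with respect to the comultiplication $\Delta$, counit $\varepsilon$ and antipode $S$ determined by $$\Delta\colon H\mapsto H\otimes1+1\otimes H,\quad E\mapsto E\otimes e^{\hbar H}+1\otimes E,\quad F\mapsto F\otimes1+e^{-\hbar H}\otimes F;$$ $$S\colon H\mapsto-H,\quad E\mapsto-Ee^{-\hbar H},\quad F\mapsto-e^{\hbar H}F;\qquad\varepsilon\colon H,E,F\mapsto0.$$ Moreover, $S$ is invertible.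
   Context: The algebra $\mathscr{F}_n$ of free entire functions in generators $\zeta_1,\ldots,\zeta_n$ consists of all series $a=\sum_{\alpha\in W_n}c_\alpha\zeta_\alpha$ with $\|a\|_\rho:=\sum_\alpha|c_\alpha|\rho^{|\alpha|}<\infty$ for all $\rho>0$, where $W_n$ is the set of words in $1,\ldots,n$ and $\zeta_\alpha$ is the corresponding product of generators. A Fr\'echet Arens--Michael algebra (Fr\'echet algebra whose topology is given by submultiplicative seminorms) is HFG (holomorphically finitely generated) if it is topologically isomorphic to $\mathscr{F}_n/I$ for some $n$ and closed two-sided ideal $I$. The universal HFG algebra generated by given generators subject to given relations (possibly involving entire functions of the generators) is the quotient of the algebra of free entire functions in these generators by the closed two-sided ideal generated by the relations. $\mathbin{\widehat{\otimes}}$ is the complete projective tensor product. A Hopf $\mathbin{\widehat{\otimes}}$-algebra is a Hopf algebra in the monoidal category of complete locally convex spaces with product $\mathbin{\widehat{\otimes}}$ (all structure maps continuous). An HFG Hopf algebra is a Hopf $\mathbin{\widehat{\otimes}}$-algebra that is an HFG algebra. "Determined by" means that $\Delta$ and $\varepsilon$ are the continuous unital homomorphisms (with $\Delta$ taking values in $\widetilde U(\mathfrak{sl}_2)_\hbar\mathbin{\widehat{\otimes}}\widetilde U(\mathfrak{sl}_2)_\hbar$), and $S$ the continuous antihomomorphism, with the given values on generators. *)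

theory Defs
  imports
    "HOL-Analysis.Analysis"
    "HOL-Library.Poly_Mapping"
    "HOL-Algebra.QuotRing"
    "HOL-Algebra.Module"
begin

section \<open>Topological vector spaces and algebras over the complex numbers\<close>

text \<open>For a plain topological vector space the fields \<open>mult\<close> and \<open>one\<close> carry no meaning, as is
  usual for modules in HOL-Algebra.\<close>

record 'a talg = "(complex, 'a) module" +
  topo :: "'a topology"

definition with_topology :: "(complex, 'a) module \<Rightarrow> 'a topology \<Rightarrow> 'a talg" where
  "with_topology M \<tau> =
    \<lparr>carrier = carrier M, mult = mult M, one = one M, zero = zero M, add = add M,
     smult = smult M, topo = \<tau>\<rparr>"

definition complex_talg :: "complex talg" where
  "complex_talg =
    \<lparr>carrier = UNIV, mult = (*), one = 1, zero = 0, add = (+), smult = (*), topo = euclidean\<rparr>"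

definition seminorm :: "(complex, 'a, 'm) module_scheme \<Rightarrow> ('a \<Rightarrow> real) \<Rightarrow> bool" where
  "seminorm V p \<longleftrightarrow>
    (\<forall>x\<in>carrier V. 0 \<le> p x) \<and>
    (\<forall>x\<in>carrier V. \<forall>y\<in>carrier V. p (x \<oplus>\<^bsub>V\<^esub> y) \<le> p x + p y) \<and>
    (\<forall>c. \<forall>x\<in>carrier V. p (c \<odot>\<^bsub>V\<^esub> x) = cmod c * p x)"

definition lc_topology ::
    "(complex, 'a, 'm) module_scheme \<Rightarrow> ('a \<Rightarrow> real) set \<Rightarrow> 'a topology" where
  "lc_topology V P = topology (\<lambda>U. U \<subseteq> carrier V \<and>
    (\<forall>x\<in>U. \<exists>F r. finite F \<and> F \<subseteq> P \<and> 0 < r \<and>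
      {y \<in> carrier V. \<forall>p\<in>F. p (y \<ominus>\<^bsub>V\<^esub> x) < r} \<subseteq> U))"

definition cont_seminorm :: "'a talg \<Rightarrow> ('a \<Rightarrow> real) \<Rightarrow> bool" where
  "cont_seminorm V p \<longleftrightarrow> seminorm V p \<and> continuous_map (topo V) euclideanreal p"

definition cauchy_seq :: "'a talg \<Rightarrow> (nat \<Rightarrow> 'a) \<Rightarrow> bool" where
  "cauchy_seq V s \<longleftrightarrow> (\<forall>n. s n \<in> carrier V) \<and>
    (\<forall>U. openin (topo V) U \<and> \<zero>\<^bsub>V\<^esub> \<in> U \<longrightarrow>
      (\<exists>N. \<forall>m\<ge>N. \<forall>n\<ge>N. s m \<ominus>\<^bsub>V\<^esub> s n \<in> U))"

locale frechet_space = Module.module complex_talg V for V :: "'a talg" (structure) +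
  assumes countably_seminormed:
      "\<exists>P. countable P \<and> (\<forall>p\<in>P. seminorm V p) \<and> topo V = lc_topology V P"
    and hausdorff: "Hausdorff_space (topo V)"
    and complete: "cauchy_seq V s \<Longrightarrow> \<exists>l. limitin (topo V) s l sequentially"

locale frechet_algebra = frechet_space A + Ring.ring A for A :: "'a talg" (structure) +
  assumes smult_mult_left: "\<lbrakk>x \<in> carrier A; y \<in> carrier A\<rbrakk> \<Longrightarrow>
      (c \<odot>\<^bsub>A\<^esub> x) \<otimes>\<^bsub>A\<^esub> y = c \<odot>\<^bsub>A\<^esub> (x \<otimes>\<^bsub>A\<^esub> y)"
    and smult_mult_right: "\<lbrakk>x \<in> carrier A; y \<in> carrier A\<rbrakk> \<Longrightarrow>
      x \<otimes>\<^bsub>A\<^esub> (c \<odot>\<^bsub>A\<^esub> y) = c \<odot>\<^bsub>A\<^esub> (x \<otimes>\<^bsub>A\<^esub> y)"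
    and continuous_mult: "continuous_map (prod_topology (topo A) (topo A)) (topo A)
      (\<lambda>(x, y). x \<otimes>\<^bsub>A\<^esub> y)"

definition submultiplicative :: "'a talg \<Rightarrow> ('a \<Rightarrow> real) \<Rightarrow> bool" where
  "submultiplicative A p \<longleftrightarrow>
    (\<forall>x\<in>carrier A. \<forall>y\<in>carrier A. p (x \<otimes>\<^bsub>A\<^esub> y) \<le> p x * p y)"

locale frechet_arens_michael = frechet_algebra +
  assumes submultiplicatively_seminormed:
    "\<exists>P. (\<forall>p\<in>P. seminorm A p \<and> submultiplicative A p) \<and> topo A = lc_topology A P"

definition cont_linear :: "'a talg \<Rightarrow> 'b talg \<Rightarrow> ('a \<Rightarrow> 'b) \<Rightarrow> bool" where
  "cont_linear V W f \<longleftrightarrow> f \<in> carrier V \<rightarrow> carrier W \<and>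
    (\<forall>x\<in>carrier V. \<forall>y\<in>carrier V. f (x \<oplus>\<^bsub>V\<^esub> y) = f x \<oplus>\<^bsub>W\<^esub> f y) \<and>
    (\<forall>c. \<forall>x\<in>carrier V. f (c \<odot>\<^bsub>V\<^esub> x) = c \<odot>\<^bsub>W\<^esub> f x) \<and>
    continuous_map (topo V) (topo W) f"

definition cont_hom :: "'a talg \<Rightarrow> 'b talg \<Rightarrow> ('a \<Rightarrow> 'b) \<Rightarrow> bool" where
  "cont_hom A B f \<longleftrightarrow> cont_linear A B f \<and> f \<in> ring_hom A B"

definition cont_antihom :: "'a talg \<Rightarrow> 'b talg \<Rightarrow> ('a \<Rightarrow> 'b) \<Rightarrow> bool" where
  "cont_antihom A B f \<longleftrightarrow> cont_linear A B f \<and> f \<one>\<^bsub>A\<^esub> = \<one>\<^bsub>B\<^esub> \<and>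
    (\<forall>x\<in>carrier A. \<forall>y\<in>carrier A. f (x \<otimes>\<^bsub>A\<^esub> y) = f y \<otimes>\<^bsub>B\<^esub> f x)"

definition topologically_isomorphic :: "'a talg \<Rightarrow> 'b talg \<Rightarrow> bool" where
  "topologically_isomorphic A B \<longleftrightarrow>
    (\<exists>f. cont_hom A B f \<and> homeomorphic_map (topo A) (topo B) f)"

definition finite_dimensional :: "'a talg \<Rightarrow> bool" where
  "finite_dimensional V \<longleftrightarrow> (\<exists>B. finite B \<and> B \<subseteq> carrier V \<and>
    (\<forall>x\<in>carrier V. \<exists>c. x = finsum V (\<lambda>b. c b \<odot>\<^bsub>V\<^esub> b) B))"

definition alg_exp :: "'a talg \<Rightarrow> 'a \<Rightarrow> 'a" where
  "alg_exp A x = (THE y. limitin (topo A)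
    (\<lambda>N. finsum A (\<lambda>k. (1 / fact k) \<odot>\<^bsub>A\<^esub> (x [^]\<^bsub>A\<^esub> (k::nat))) {..N}) y sequentially)"

definition alg_sinh :: "'a talg \<Rightarrow> 'a \<Rightarrow> 'a" where
  "alg_sinh A x = (1 / 2) \<odot>\<^bsub>A\<^esub> (alg_exp A x \<ominus>\<^bsub>A\<^esub> alg_exp A (\<ominus>\<^bsub>A\<^esub> x))"


section \<open>Free entire functions and HFG algebras\<close>

text \<open>The generators are numbered \<open>0, \<dots>, n - 1\<close>; a series is identified with its family of
  coefficients, extended by zero to lists that are not words in these letters.\<close>

definition free_entire_norm :: "real \<Rightarrow> (nat list \<Rightarrow> complex) \<Rightarrow> real" where
  "free_entire_norm \<rho> a = (\<Sum>\<^sub>\<infinity>w. cmod (a w) * \<rho> ^ length w)"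

definition free_entire_module :: "nat \<Rightarrow> (complex, nat list \<Rightarrow> complex) module" where
  "free_entire_module n =
    \<lparr>carrier = {a. (\<forall>w. w \<notin> lists {..<n} \<longrightarrow> a w = 0) \<and>
       (\<forall>\<rho>>0. (\<lambda>w. cmod (a w) * \<rho> ^ length w) summable_on UNIV)},
     mult = (\<lambda>a b w. \<Sum>k\<le>length w. a (take k w) * b (drop k w)),
     one = (\<lambda>w. if w = [] then 1 else 0),
     zero = (\<lambda>w. 0),
     add = (\<lambda>a b w. a w + b w),
     smult = (\<lambda>c a w. c * a w)\<rparr>"

definition free_entire :: "nat \<Rightarrow> (nat list \<Rightarrow> complex) talg" where
  "free_entire n = with_topology (free_entire_module n)
    (lc_topology (free_entire_module n) (free_entire_norm ` {0<..}))"

definition free_gen :: "nat \<Rightarrow> nat list \<Rightarrow> complex" where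
  "free_gen i = (\<lambda>w. if w = [i] then 1 else 0)"

definition closed_ideal :: "'a set \<Rightarrow> 'a talg \<Rightarrow> bool" where
  "closed_ideal I A \<longleftrightarrow> ideal I A \<and> closedin (topo A) I"

definition closed_ideal_gen :: "'a talg \<Rightarrow> 'a set \<Rightarrow> 'a set" where
  "closed_ideal_gen A R = \<Inter>{I. closed_ideal I A \<and> R \<subseteq> I}"

definition quotient_talg :: "'a talg \<Rightarrow> 'a set \<Rightarrow> 'a set talg" where
  "quotient_talg A I =
    \<lparr>carrier = carrier (A Quot I), mult = mult (A Quot I), one = one (A Quot I),
     zero = zero (A Quot I), add = add (A Quot I),
     smult = (\<lambda>c X. \<Union>x\<in>X. I +>\<^bsub>A\<^esub> (c \<odot>\<^bsub>A\<^esub> x)),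
     topo = topology (\<lambda>U. U \<subseteq> carrier (A Quot I) \<and>
       openin (topo A) {x \<in> carrier A. I +>\<^bsub>A\<^esub> x \<in> U})\<rparr>"

definition hfg :: "'a talg \<Rightarrow> bool" where
  "hfg A \<longleftrightarrow> frechet_arens_michael A \<and>
    (\<exists>n I. closed_ideal I (free_entire n) \<and>
      topologically_isomorphic A (quotient_talg (free_entire n) I))"

definition universal_hfg ::
    "nat \<Rightarrow> (nat list \<Rightarrow> complex) set \<Rightarrow> (nat list \<Rightarrow> complex) set talg" where
  "universal_hfg n R = quotient_talg (free_entire n) (closed_ideal_gen (free_entire n) R)"

definition universal_hfg_gen ::
    "nat \<Rightarrow> (nat list \<Rightarrow> complex) set \<Rightarrow> nat \<Rightarrow> (nat list \<Rightarrow> complex) set" where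
  "universal_hfg_gen n R i =
    closed_ideal_gen (free_entire n) R +>\<^bsub>free_entire n\<^esub> free_gen i"


section \<open>The complete projective tensor product\<close>

text \<open>The algebraic tensor product is the free vector space on \<open>carrier A \<times> carrier B\<close> modulo the
  bilinearity relations; its elements are cosets.\<close>

definition free_vectors :: "'a talg \<Rightarrow> 'b talg \<Rightarrow> ('a \<times> 'b \<Rightarrow>\<^sub>0 complex) set" where
  "free_vectors A B = {u. Poly_Mapping.keys u \<subseteq> carrier A \<times> carrier B}"

definition free_scale :: "complex \<Rightarrow> ('k \<Rightarrow>\<^sub>0 complex) \<Rightarrow> 'k \<Rightarrow>\<^sub>0 complex" where
  "free_scale c u = Poly_Mapping.map ((*) c) u"

definition bilinearity_relations ::
    "'a talg \<Rightarrow> 'b talg \<Rightarrow> ('a \<times> 'b \<Rightarrow>\<^sub>0 complex) set" where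
  "bilinearity_relations A B =
    {Poly_Mapping.single (a \<oplus>\<^bsub>A\<^esub> a', b) 1 - Poly_Mapping.single (a, b) 1
       - Poly_Mapping.single (a', b) 1
     | a a' b. a \<in> carrier A \<and> a' \<in> carrier A \<and> b \<in> carrier B} \<union>
    {Poly_Mapping.single (a, b \<oplus>\<^bsub>B\<^esub> b') 1 - Poly_Mapping.single (a, b) 1
       - Poly_Mapping.single (a, b') 1
     | a b b'. a \<in> carrier A \<and> b \<in> carrier B \<and> b' \<in> carrier B} \<union>
    {Poly_Mapping.single (c \<odot>\<^bsub>A\<^esub> a, b) 1 - Poly_Mapping.single (a, b) c
     | c a b. a \<in> carrier A \<and> b \<in> carrier B} \<union>
    {Poly_Mapping.single (a, c \<odot>\<^bsub>B\<^esub> b) 1 - Poly_Mapping.single (a, b) c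
     | c a b. a \<in> carrier A \<and> b \<in> carrier B}"

definition tensor_class ::
    "'a talg \<Rightarrow> 'b talg \<Rightarrow> ('a \<times> 'b \<Rightarrow>\<^sub>0 complex) \<Rightarrow> ('a \<times> 'b \<Rightarrow>\<^sub>0 complex) set" where
  "tensor_class A B u =
    {v. v - u \<in> Modules.module.span free_scale (bilinearity_relations A B)}"

definition alg_tensor_module ::
    "'a talg \<Rightarrow> 'b talg \<Rightarrow> (complex, ('a \<times> 'b \<Rightarrow>\<^sub>0 complex) set) module" where
  "alg_tensor_module A B =
    \<lparr>carrier = tensor_class A B ` free_vectors A B,
     mult = (\<lambda>X Y. \<Union>u\<in>X. \<Union>v\<in>Y. tensor_class A B
       (\<Sum>(a, b)\<in>Poly_Mapping.keys u. \<Sum>(a', b')\<in>Poly_Mapping.keys v.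
         Poly_Mapping.single (a \<otimes>\<^bsub>A\<^esub> a', b \<otimes>\<^bsub>B\<^esub> b')
           (Poly_Mapping.lookup u (a, b) * Poly_Mapping.lookup v (a', b')))),
     one = tensor_class A B (Poly_Mapping.single (\<one>\<^bsub>A\<^esub>, \<one>\<^bsub>B\<^esub>) 1),
     zero = tensor_class A B 0,
     add = (\<lambda>X Y. \<Union>u\<in>X. \<Union>v\<in>Y. tensor_class A B (u + v)),
     smult = (\<lambda>c X. \<Union>u\<in>X. tensor_class A B (free_scale c u))\<rparr>"

definition projective_seminorm :: "'a talg \<Rightarrow> 'b talg \<Rightarrow> ('a \<Rightarrow> real) \<Rightarrow> ('b \<Rightarrow> real) \<Rightarrow>
    ('a \<times> 'b \<Rightarrow>\<^sub>0 complex) set \<Rightarrow> real" where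
  "projective_seminorm A B p q X =
    Inf {(\<Sum>(a, b)\<leftarrow>xs. p a * q b) | xs. set xs \<subseteq> carrier A \<times> carrier B \<and>
      X = tensor_class A B (\<Sum>z\<leftarrow>xs. Poly_Mapping.single z 1)}"

definition alg_tensor ::
    "'a talg \<Rightarrow> 'b talg \<Rightarrow> ('a \<times> 'b \<Rightarrow>\<^sub>0 complex) set talg" where
  "alg_tensor A B = with_topology (alg_tensor_module A B)
    (lc_topology (alg_tensor_module A B)
      {projective_seminorm A B p q | p q. cont_seminorm A p \<and> cont_seminorm B q})"

text \<open>Completion by Cauchy sequences modulo null sequences. This is the completion for metrizable
  spaces, and it is only used for those: the projective tensor product of two metrizable locally
  convex spaces is metrizable.\<close>

definition completion_class :: "'a talg \<Rightarrow> (nat \<Rightarrow> 'a) \<Rightarrow> (nat \<Rightarrow> 'a) set" where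
  "completion_class V s = {t. cauchy_seq V t \<and>
    limitin (topo V) (\<lambda>n. t n \<ominus>\<^bsub>V\<^esub> s n) \<zero>\<^bsub>V\<^esub> sequentially}"

definition completion_module :: "'a talg \<Rightarrow> (complex, (nat \<Rightarrow> 'a) set) module" where
  "completion_module V =
    \<lparr>carrier = completion_class V ` Collect (cauchy_seq V),
     mult = (\<lambda>X Y. \<Union>s\<in>X. \<Union>t\<in>Y. completion_class V (\<lambda>n. s n \<otimes>\<^bsub>V\<^esub> t n)),
     one = completion_class V (\<lambda>n. \<one>\<^bsub>V\<^esub>),
     zero = completion_class V (\<lambda>n. \<zero>\<^bsub>V\<^esub>),
     add = (\<lambda>X Y. \<Union>s\<in>X. \<Union>t\<in>Y. completion_class V (\<lambda>n. s n \<oplus>\<^bsub>V\<^esub> t n)),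
     smult = (\<lambda>c X. \<Union>s\<in>X. completion_class V (\<lambda>n. c \<odot>\<^bsub>V\<^esub> s n))\<rparr>"

definition completion_seminorm :: "('a \<Rightarrow> real) \<Rightarrow> (nat \<Rightarrow> 'a) set \<Rightarrow> real" where
  "completion_seminorm p X = lim (\<lambda>n. p ((SOME s. s \<in> X) n))"

definition completion :: "'a talg \<Rightarrow> (nat \<Rightarrow> 'a) set talg" where
  "completion V = with_topology (completion_module V)
    (lc_topology (completion_module V) (completion_seminorm ` Collect (cont_seminorm V)))"

type_synonym ('a, 'b) tensor = "(nat \<Rightarrow> ('a \<times> 'b \<Rightarrow>\<^sub>0 complex) set) set"

definition ptensor :: "'a talg \<Rightarrow> 'b talg \<Rightarrow> ('a, 'b) tensor talg" where
  "ptensor A B = completion (alg_tensor A B)"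

definition pure_tensor :: "'a talg \<Rightarrow> 'b talg \<Rightarrow> 'a \<Rightarrow> 'b \<Rightarrow> ('a, 'b) tensor" where
  "pure_tensor A B a b =
    completion_class (alg_tensor A B) (\<lambda>n. tensor_class A B (Poly_Mapping.single (a, b) 1))"

text \<open>The continuous linear map on the complete projective tensor product that a continuous
  bilinear map \<open>\<beta>\<close> into a complete space linearizes to. It is unique because pure tensors span a
  dense subspace.\<close>

definition tensor_lift ::
    "'a talg \<Rightarrow> 'b talg \<Rightarrow> 'c talg \<Rightarrow> ('a \<Rightarrow> 'b \<Rightarrow> 'c) \<Rightarrow> ('a, 'b) tensor \<Rightarrow> 'c" where
  "tensor_lift A B C \<beta> = (THE f. f \<in> extensional (carrier (ptensor A B)) \<and>
    cont_linear (ptensor A B) C f \<and>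
    (\<forall>a\<in>carrier A. \<forall>b\<in>carrier B. f (pure_tensor A B a b) = \<beta> a b))"

definition tensor_map :: "'a talg \<Rightarrow> 'b talg \<Rightarrow> 'c talg \<Rightarrow> 'd talg \<Rightarrow>
    ('a \<Rightarrow> 'c) \<Rightarrow> ('b \<Rightarrow> 'd) \<Rightarrow> ('a, 'b) tensor \<Rightarrow> ('c, 'd) tensor" where
  "tensor_map A B C D f g =
    tensor_lift A B (ptensor C D) (\<lambda>a b. pure_tensor C D (f a) (g b))"

definition tensor_assoc :: "'a talg \<Rightarrow> 'b talg \<Rightarrow> 'c talg \<Rightarrow>
    (('a, 'b) tensor, 'c) tensor \<Rightarrow> ('a, ('b, 'c) tensor) tensor" where
  "tensor_assoc A B C = (THE f. f \<in> extensional (carrier (ptensor (ptensor A B) C)) \<and>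
    cont_linear (ptensor (ptensor A B) C) (ptensor A (ptensor B C)) f \<and>
    (\<forall>a\<in>carrier A. \<forall>b\<in>carrier B. \<forall>c\<in>carrier C.
      f (pure_tensor (ptensor A B) C (pure_tensor A B a b) c) =
      pure_tensor A (ptensor B C) a (pure_tensor B C b c)))"

definition left_unitor :: "'a talg \<Rightarrow> (complex, 'a) tensor \<Rightarrow> 'a" where
  "left_unitor A = tensor_lift complex_talg A A (\<lambda>c a. c \<odot>\<^bsub>A\<^esub> a)"

definition right_unitor :: "'a talg \<Rightarrow> ('a, complex) tensor \<Rightarrow> 'a" where
  "right_unitor A = tensor_lift A complex_talg A (\<lambda>a c. c \<odot>\<^bsub>A\<^esub> a)"

definition mult_map :: "'a talg \<Rightarrow> ('a, 'a) tensor \<Rightarrow> 'a" where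
  "mult_map A = tensor_lift A A A (\<lambda>a b. a \<otimes>\<^bsub>A\<^esub> b)"


section \<open>Hopf algebras\<close>

text \<open>Hopf algebra objects in the category of complete locally convex spaces with the complete
  projective tensor product, whose underlying space is Frechet. The full subcategory of Frechet
  spaces is closed under this tensor product and contains the unit object, so nothing is lost for
  HFG algebras.\<close>

definition frechet_hopf_algebra ::
    "'a talg \<Rightarrow> ('a \<Rightarrow> ('a, 'a) tensor) \<Rightarrow> ('a \<Rightarrow> complex) \<Rightarrow> ('a \<Rightarrow> 'a) \<Rightarrow> bool" where
  "frechet_hopf_algebra A \<Delta> \<epsilon> S \<longleftrightarrow>
    frechet_algebra A \<and>
    cont_hom A (ptensor A A) \<Delta> \<and>
    cont_hom A complex_talg \<epsilon> \<and>
    cont_linear A A S \<and>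
    (\<forall>x\<in>carrier A.
      tensor_assoc A A A (tensor_map A A (ptensor A A) A \<Delta> (\<lambda>y. y) (\<Delta> x)) =
        tensor_map A A A (ptensor A A) (\<lambda>y. y) \<Delta> (\<Delta> x) \<and>
      left_unitor A (tensor_map A A complex_talg A \<epsilon> (\<lambda>y. y) (\<Delta> x)) = x \<and>
      right_unitor A (tensor_map A A A complex_talg (\<lambda>y. y) \<epsilon> (\<Delta> x)) = x \<and>
      mult_map A (tensor_map A A A A S (\<lambda>y. y) (\<Delta> x)) = \<epsilon> x \<odot>\<^bsub>A\<^esub> \<one>\<^bsub>A\<^esub> \<and>
      mult_map A (tensor_map A A A A (\<lambda>y. y) S (\<Delta> x)) = \<epsilon> x \<odot>\<^bsub>A\<^esub> \<one>\<^bsub>A\<^esub>)"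

definition hfg_hopf_algebra ::
    "'a talg \<Rightarrow> ('a \<Rightarrow> ('a, 'a) tensor) \<Rightarrow> ('a \<Rightarrow> complex) \<Rightarrow> ('a \<Rightarrow> 'a) \<Rightarrow> bool" where
  "hfg_hopf_algebra A \<Delta> \<epsilon> S \<longleftrightarrow> frechet_hopf_algebra A \<Delta> \<epsilon> S \<and> hfg A"

text \<open>Invertibility as an endomorphism in the category of complete locally convex spaces.\<close>

definition cont_invertible :: "'a talg \<Rightarrow> ('a \<Rightarrow> 'a) \<Rightarrow> bool" where
  "cont_invertible A S \<longleftrightarrow> (\<exists>T. cont_linear A A T \<and>
    (\<forall>x\<in>carrier A. T (S x) = x \<and> S (T x) = x))"


section \<open>The algebra generated by E, F and H\<close>

text \<open>The letters 0, 1, 2 stand for E, F, H.\<close>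

definition usl2_relations :: "complex \<Rightarrow> (nat list \<Rightarrow> complex) set" where
  "usl2_relations h =
    (let A = free_entire 3; E = free_gen 0; F = free_gen 1; H = free_gen 2;
         comm = (\<lambda>x y. x \<otimes>\<^bsub>A\<^esub> y \<ominus>\<^bsub>A\<^esub> y \<otimes>\<^bsub>A\<^esub> x)
     in {comm H E \<ominus>\<^bsub>A\<^esub> 2 \<odot>\<^bsub>A\<^esub> E,
         comm H F \<ominus>\<^bsub>A\<^esub> (-2) \<odot>\<^bsub>A\<^esub> F,
         comm E F \<ominus>\<^bsub>A\<^esub> (1 / sinh h) \<odot>\<^bsub>A\<^esub> alg_sinh A (h \<odot>\<^bsub>A\<^esub> H)})"

definition usl2 :: "complex \<Rightarrow> (nat list \<Rightarrow> complex) set talg" where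
  "usl2 h = universal_hfg 3 (usl2_relations h)"

definition usl2_E :: "complex \<Rightarrow> (nat list \<Rightarrow> complex) set" where
  "usl2_E h = universal_hfg_gen 3 (usl2_relations h) 0"

definition usl2_F :: "complex \<Rightarrow> (nat list \<Rightarrow> complex) set" where
  "usl2_F h = universal_hfg_gen 3 (usl2_relations h) 1"

definition usl2_H :: "complex \<Rightarrow> (nat list \<Rightarrow> complex) set" where
  "usl2_H h = universal_hfg_gen 3 (usl2_relations h) 2"

definition usl2_expH :: "complex \<Rightarrow> complex \<Rightarrow> (nat list \<Rightarrow> complex) set" where
  "usl2_expH h c = alg_exp (usl2 h) (c \<odot>\<^bsub>usl2 h\<^esub> usl2_H h)"

definition usl2_comult :: "complex \<Rightarrow> ((nat list \<Rightarrow> complex) set \<Rightarrow>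
    ((nat list \<Rightarrow> complex) set, (nat list \<Rightarrow> complex) set) tensor) \<Rightarrow> bool" where
  "usl2_comult h \<Delta> \<longleftrightarrow>
    (let U = usl2 h; T = ptensor U U; t = pure_tensor U U;
         E = usl2_E h; F = usl2_F h; H = usl2_H h
     in cont_hom U T \<Delta> \<and>
        \<Delta> H = t H \<one>\<^bsub>U\<^esub> \<oplus>\<^bsub>T\<^esub> t \<one>\<^bsub>U\<^esub> H \<and>
        \<Delta> E = t E (usl2_expH h h) \<oplus>\<^bsub>T\<^esub> t \<one>\<^bsub>U\<^esub> E \<and>
        \<Delta> F = t F \<one>\<^bsub>U\<^esub> \<oplus>\<^bsub>T\<^esub> t (usl2_expH h (- h)) F)"

definition usl2_counit :: "complex \<Rightarrow> ((nat list \<Rightarrow> complex) set \<Rightarrow> complex) \<Rightarrow> bool" where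
  "usl2_counit h \<epsilon> \<longleftrightarrow> cont_hom (usl2 h) complex_talg \<epsilon> \<and>
    \<epsilon> (usl2_H h) = 0 \<and> \<epsilon> (usl2_E h) = 0 \<and> \<epsilon> (usl2_F h) = 0"

definition usl2_antipode ::
    "complex \<Rightarrow> ((nat list \<Rightarrow> complex) set \<Rightarrow> (nat list \<Rightarrow> complex) set) \<Rightarrow> bool" where
  "usl2_antipode h S \<longleftrightarrow>
    (let U = usl2 h; E = usl2_E h; F = usl2_F h; H = usl2_H h
     in cont_antihom U U S \<and>
        S H = \<ominus>\<^bsub>U\<^esub> H \<and>
        S E = \<ominus>\<^bsub>U\<^esub> (E \<otimes>\<^bsub>U\<^esub> usl2_expH h (- h)) \<and>
        S F = \<ominus>\<^bsub>U\<^esub> (usl2_expH h h \<otimes>\<^bsub>U\<^esub> F))"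

end

theory Submission
  imports Defs "HOL-Algebra.RingHom" "HOL-Library.Function_Algebras"
begin

text \<open>
  The algebra \<open>U\<close> is a quotient of the free entire functions in three variables by a closed ideal.
  Two universal properties carry the proof. Continuous homomorphisms from \<open>U\<close> to a complete algebra
  with submultiplicative seminorms correspond to triples \<open>(e, f, t)\<close> satisfying the relations
  (\<open>usl2_hom_ex1\<close>); this is so because a free entire function can be evaluated at any tuple of elements
  (\<open>cont_hom_evaluation\<close>), and the kernel of an evaluation is a closed ideal. Continuous linear maps from
  a completed tensor product correspond to continuous bilinear maps (\<open>ptensor_lift\<close>). Uniqueness in
  all cases is density: \<open>U\<close> is topologically generated by \<open>E\<close>, \<open>F\<close>, \<open>H\<close>, and pure tensors span a dense
  subspace.

  Write \<open>K\<close> and \<open>L\<close> for the exponentials of \<open>h H\<close> and \<open>- h H\<close>. Exponentials of commuting elements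
  multiply (\<open>alg_exp_add\<close>), so \<open>K\<close> and \<open>L\<close> are mutually inverse, and \<open>H E = E (H + 2)\<close> implies
  \<open>K E = exp (2 h) E K\<close>; likewise for \<open>F\<close> with the opposite weight. Given this, the comultiplication
  exists because the proposed images of the generators form a triple in \<open>U \<otimes> U\<close>
  (\<open>comult_triple\<close>), and the antipode exists because its proposed values form a triple in the opposite
  algebra of \<open>U\<close> (\<open>opposite_triple\<close>). The counit comes from the zero triple in the complex numbers.

  Coassociativity and the counit laws are equations between continuous homomorphisms and are checked
  on generators, using that \<open>K\<close> and \<open>L\<close> are group-like. The antipode laws are not of this kind, but the
  elements that satisfy them form a closed subalgebra. The square of the antipode is conjugation
  by \<open>K\<close>, so the antipode is invertible. Finally, \<open>E = F = 0\<close> and \<open>H = k \<pi> i / h\<close> define a character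
  for every natural number \<open>k\<close>. As \<open>H\<close> takes infinitely many values under characters, its powers are
  linearly independent, and \<open>U\<close> has infinite dimension.

  All spaces that occur carry an explicit increasing sequence of seminorms. A completed tensor product
  is an image of Cauchy sequences, whose terms are images of lists of pairs, and quotients are images as
  well. The axioms of vector spaces and algebras pass to images (\<open>vspace_image\<close>, \<open>calgebra_image\<close>), and
  the seminorms of quotients and algebraic tensor products are infima over representatives
  (\<open>image_norm\<close>), which makes the three constructions uniform.
\<close>

section \<open>Complex vector spaces and algebras on carrier sets\<close>

lemma complex_talg_simps [simp]:
  "carrier complex_talg = UNIV" "mult complex_talg = (*)" "one complex_talg = 1"
  "zero complex_talg = 0" "add complex_talg = (+)" "smult complex_talg = (*)"
  "topo complex_talg = euclidean"
  by (simp_all add: complex_talg_def)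

lemma cring_complex_talg: "cring complex_talg"
  by (intro cringI abelian_groupI comm_monoidI)
     (auto simp: algebra_simps intro: exI[of _ "- x" for x :: complex])

text \<open>The module axioms over \<open>complex_talg\<close>, restated with scalars of type \<open>complex\<close> so that
  no membership conditions on scalars remain.\<close>

locale vspace = Module.module complex_talg V
  for V :: "(complex, 'a, 'm) module_scheme" (structure)
begin

lemma scale_closed [simp, intro]: "x \<in> carrier V \<Longrightarrow> c \<odot> x \<in> carrier V"
  by (rule smult_closed) auto

lemma scale_left_distrib: "x \<in> carrier V \<Longrightarrow> (a + b) \<odot> x = a \<odot> x \<oplus> b \<odot> x"
  using smult_l_distr[of a b x] by simp

lemma scale_right_distrib:
  "\<lbrakk>x \<in> carrier V; y \<in> carrier V\<rbrakk> \<Longrightarrow> a \<odot> (x \<oplus> y) = a \<odot> x \<oplus> a \<odot> y"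
  using smult_r_distr[of a x y] by simp

lemma scale_scale: "x \<in> carrier V \<Longrightarrow> a \<odot> (b \<odot> x) = (a * b) \<odot> x"
  using smult_assoc1[of a b x] by simp

lemma scale_one [simp]: "x \<in> carrier V \<Longrightarrow> 1 \<odot> x = x"
  using smult_one[of x] by simp

lemma scale_zero_left [simp]: "x \<in> carrier V \<Longrightarrow> 0 \<odot> x = \<zero>"
  using smult_l_null[of x] by simp

lemma scale_zero_right [simp]: "c \<odot> \<zero> = \<zero>"
  using smult_r_null[of c] by simp

lemma uminus_eq_scale: "x \<in> carrier V \<Longrightarrow> \<ominus> x = (-1) \<odot> x"
proof -
  assume x: "x \<in> carrier V"
  have "(-1) \<odot> x \<oplus> x = \<zero>"
    using scale_left_distrib[OF x, of "-1" 1] x by simp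
  thus ?thesis by (metis M.minus_equality x scale_closed)
qed

lemma minus_eq_scale:
  "\<lbrakk>x \<in> carrier V; y \<in> carrier V\<rbrakk> \<Longrightarrow> x \<ominus> y = x \<oplus> (-1) \<odot> y"
  by (simp add: a_minus_def uminus_eq_scale)

lemma minus_closed' [simp, intro]:
  "\<lbrakk>x \<in> carrier V; y \<in> carrier V\<rbrakk> \<Longrightarrow> x \<ominus> y \<in> carrier V"
  by (rule M.minus_closed)

lemma minus_self [simp]: "x \<in> carrier V \<Longrightarrow> x \<ominus> x = \<zero>"
  by (simp add: a_minus_def M.r_neg)

lemma minus_zero' [simp]: "x \<in> carrier V \<Longrightarrow> x \<ominus> \<zero> = x"
  by (simp add: a_minus_def)

lemma add_minus_cancel: "\<lbrakk>x \<in> carrier V; y \<in> carrier V\<rbrakk> \<Longrightarrow> y \<oplus> (x \<ominus> y) = x"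
  by (metis M.a_comm M.add.inv_solve_right a_minus_def minus_closed')

lemma minus_eq_zeroD: "\<lbrakk>x \<in> carrier V; y \<in> carrier V; x \<ominus> y = \<zero>\<rbrakk> \<Longrightarrow> x = y"
  by (metis add_minus_cancel M.r_zero)

lemma scale_minus_distrib:
  "\<lbrakk>x \<in> carrier V; y \<in> carrier V\<rbrakk> \<Longrightarrow> c \<odot> (x \<ominus> y) = c \<odot> x \<ominus> c \<odot> y"
  by (simp add: minus_eq_scale scale_right_distrib scale_scale mult.commute)

lemma add_diff_add:
  "\<lbrakk>x \<in> carrier V; y \<in> carrier V; x' \<in> carrier V; y' \<in> carrier V\<rbrakk> \<Longrightarrow>
    (x \<oplus> y) \<ominus> (x' \<oplus> y') = (x \<ominus> x') \<oplus> (y \<ominus> y')"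
  by (simp add: a_minus_def M.minus_add M.a_ac)

lemma diff_diff_eq_telescope:
  "\<lbrakk>x \<in> carrier V; y \<in> carrier V; z \<in> carrier V\<rbrakk> \<Longrightarrow> x \<ominus> z = (x \<ominus> y) \<oplus> (y \<ominus> z)"
  by (metis (no_types, lifting) M.a_assoc M.a_comm M.minus_closed a_minus_def add_minus_cancel M.a_inv_closed)

lemma uminus_diff: "\<lbrakk>x \<in> carrier V; y \<in> carrier V\<rbrakk> \<Longrightarrow> (-1) \<odot> (x \<ominus> y) = y \<ominus> x"
  by (simp add: minus_eq_scale scale_right_distrib scale_scale M.a_comm)

lemma scale_finsum:
  assumes "f \<in> S \<rightarrow> carrier V"
  shows "c \<odot> finsum V f S = finsum V (\<lambda>i. c \<odot> f i) S"
  using finsum_smult_ldistr[of S c f] assms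
  by (cases "finite S") (auto simp: M.finsum_infinite)

end

lemma complex_vspace: "vspace complex_talg"
  unfolding vspace_def
  by (intro moduleI cring_complex_talg cring.axioms ring.is_abelian_group)
     (auto simp: algebra_simps intro: abelian_groupI exI[of _ "- x" for x :: complex])

locale calgebra = vspace V + Ring.ring V for V :: "(complex, 'a, 'm) module_scheme" (structure) +
  assumes scale_mult_left:
      "\<lbrakk>x \<in> carrier V; y \<in> carrier V\<rbrakk> \<Longrightarrow> (c \<odot> x) \<otimes> y = c \<odot> (x \<otimes> y)"
    and scale_mult_right:
      "\<lbrakk>x \<in> carrier V; y \<in> carrier V\<rbrakk> \<Longrightarrow> x \<otimes> (c \<odot> y) = c \<odot> (x \<otimes> y)"
begin

lemma mult_diff_mult:
  "\<lbrakk>x \<in> carrier V; y \<in> carrier V; x' \<in> carrier V; y' \<in> carrier V\<rbrakk> \<Longrightarrow>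
    (x \<otimes> y) \<ominus> (x' \<otimes> y') = (x \<ominus> x') \<otimes> y \<oplus> x' \<otimes> (y \<ominus> y')"
proof -
  assume a: "x \<in> carrier V" "y \<in> carrier V" "x' \<in> carrier V" "y' \<in> carrier V"
  have "(x \<ominus> x') \<otimes> y \<oplus> x' \<otimes> (y \<ominus> y') = (x \<otimes> y \<ominus> x' \<otimes> y) \<oplus> (x' \<otimes> y \<ominus> x' \<otimes> y')"
    using a by (simp add: a_minus_def l_distr r_distr l_minus r_minus)
  also have "\<dots> = (x \<otimes> y) \<ominus> (x' \<otimes> y')"
    using a by (intro diff_diff_eq_telescope[symmetric]) auto
  finally show ?thesis ..
qed

end

text \<open>Quotients, algebraic tensor products and completions are all images of a simpler structure
  under a map that respects the operations; such an image inherits the axioms.\<close>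

lemma vspace_image:
  assumes X: "vspace X" and surj: "f ` carrier X = carrier Y"
    and add: "\<And>x y. \<lbrakk>x \<in> carrier X; y \<in> carrier X\<rbrakk> \<Longrightarrow> f (x \<oplus>\<^bsub>X\<^esub> y) = f x \<oplus>\<^bsub>Y\<^esub> f y"
    and zero: "f \<zero>\<^bsub>X\<^esub> = \<zero>\<^bsub>Y\<^esub>"
    and scale: "\<And>c x. x \<in> carrier X \<Longrightarrow> f (c \<odot>\<^bsub>X\<^esub> x) = c \<odot>\<^bsub>Y\<^esub> f x"
  shows "vspace Y"
proof -
  interpret X: vspace X by (rule X)
  have ex: "\<exists>x\<in>carrier X. y = f x" if "y \<in> carrier Y" for y
    using that surj by auto
  have cl: "f x \<in> carrier Y" if "x \<in> carrier X" for x using that surj by auto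
  have grp: "abelian_group Y"
  proof (rule abelian_groupI)
    fix x y assume "x \<in> carrier Y" "y \<in> carrier Y"
    then obtain u v where "u \<in> carrier X" "v \<in> carrier X" "x = f u" "y = f v"
      using ex by metis
    thus "x \<oplus>\<^bsub>Y\<^esub> y \<in> carrier Y" using cl[of "u \<oplus>\<^bsub>X\<^esub> v"] by (simp add: add)
    show "x \<oplus>\<^bsub>Y\<^esub> y = y \<oplus>\<^bsub>Y\<^esub> x"
      using \<open>u \<in> _\<close> \<open>v \<in> _\<close> \<open>x = _\<close> \<open>y = _\<close> by (metis add X.M.a_comm)
  next
    show "\<zero>\<^bsub>Y\<^esub> \<in> carrier Y" using cl[of "\<zero>\<^bsub>X\<^esub>"] by (simp add: zero)
  next
    fix x y z assume "x \<in> carrier Y" "y \<in> carrier Y" "z \<in> carrier Y"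
    then obtain u v w where "u \<in> carrier X" "v \<in> carrier X" "w \<in> carrier X"
      "x = f u" "y = f v" "z = f w" using ex by metis
    thus "x \<oplus>\<^bsub>Y\<^esub> y \<oplus>\<^bsub>Y\<^esub> z = x \<oplus>\<^bsub>Y\<^esub> (y \<oplus>\<^bsub>Y\<^esub> z)"
      by (simp add: add[symmetric] X.M.a_assoc)
  next
    fix x assume "x \<in> carrier Y"
    then obtain u where u: "u \<in> carrier X" "x = f u" using ex by metis
    thus "\<zero>\<^bsub>Y\<^esub> \<oplus>\<^bsub>Y\<^esub> x = x" using add[of "\<zero>\<^bsub>X\<^esub>" u] by (simp add: zero)
    show "\<exists>y\<in>carrier Y. y \<oplus>\<^bsub>Y\<^esub> x = \<zero>\<^bsub>Y\<^esub>"
      using u cl add[of "\<ominus>\<^bsub>X\<^esub> u" u]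
      by (intro bexI[of _ "f (\<ominus>\<^bsub>X\<^esub> u)"]) (auto simp: X.M.l_neg zero)
  qed
  show ?thesis unfolding vspace_def
  proof (intro moduleI cring_complex_talg grp)
    fix c x assume "x \<in> carrier Y"
    then obtain u where u: "u \<in> carrier X" "x = f u" using ex by metis
    thus "c \<odot>\<^bsub>Y\<^esub> x \<in> carrier Y" using cl[of "c \<odot>\<^bsub>X\<^esub> u"] by (simp add: scale)
    fix d :: complex
    show "(c \<oplus>\<^bsub>complex_talg\<^esub> d) \<odot>\<^bsub>Y\<^esub> x = c \<odot>\<^bsub>Y\<^esub> x \<oplus>\<^bsub>Y\<^esub> d \<odot>\<^bsub>Y\<^esub> x"
      using u by (simp add: add[symmetric] scale[symmetric] X.scale_left_distrib)
    show "(c \<otimes>\<^bsub>complex_talg\<^esub> d) \<odot>\<^bsub>Y\<^esub> x = c \<odot>\<^bsub>Y\<^esub> (d \<odot>\<^bsub>Y\<^esub> x)"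
      using u by (simp add: scale[symmetric] X.scale_scale)
  next
    fix x assume "x \<in> carrier Y"
    then obtain u where u: "u \<in> carrier X" "x = f u" using ex by metis
    thus "\<one>\<^bsub>complex_talg\<^esub> \<odot>\<^bsub>Y\<^esub> x = x" using scale[of u 1] by simp
  next
    fix c x y assume "x \<in> carrier Y" "y \<in> carrier Y"
    then obtain u v where "u \<in> carrier X" "v \<in> carrier X" "x = f u" "y = f v"
      using ex by metis
    thus "c \<odot>\<^bsub>Y\<^esub> (x \<oplus>\<^bsub>Y\<^esub> y) = c \<odot>\<^bsub>Y\<^esub> x \<oplus>\<^bsub>Y\<^esub> c \<odot>\<^bsub>Y\<^esub> y"
      by (simp add: add[symmetric] scale[symmetric] X.scale_right_distrib)
  qed
qed

lemma calgebra_image: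
  assumes X: "calgebra X" and surj: "f ` carrier X = carrier Y"
    and add: "\<And>x y. \<lbrakk>x \<in> carrier X; y \<in> carrier X\<rbrakk> \<Longrightarrow> f (x \<oplus>\<^bsub>X\<^esub> y) = f x \<oplus>\<^bsub>Y\<^esub> f y"
    and zero: "f \<zero>\<^bsub>X\<^esub> = \<zero>\<^bsub>Y\<^esub>"
    and scale: "\<And>c x. x \<in> carrier X \<Longrightarrow> f (c \<odot>\<^bsub>X\<^esub> x) = c \<odot>\<^bsub>Y\<^esub> f x"
    and mult: "\<And>x y. \<lbrakk>x \<in> carrier X; y \<in> carrier X\<rbrakk> \<Longrightarrow> f (x \<otimes>\<^bsub>X\<^esub> y) = f x \<otimes>\<^bsub>Y\<^esub> f y"
    and one: "f \<one>\<^bsub>X\<^esub> = \<one>\<^bsub>Y\<^esub>"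
  shows "calgebra Y"
proof -
  interpret X: calgebra X by (rule X)
  interpret Y: vspace Y
    by (rule vspace_image[OF X.vspace_axioms surj add zero scale])
  have ex: "\<exists>x\<in>carrier X. y = f x" if "y \<in> carrier Y" for y
    using that surj by auto
  have cl: "f x \<in> carrier Y" if "x \<in> carrier X" for x using that surj by auto
  have mon: "Group.monoid Y"
  proof (rule monoidI)
    fix x y assume "x \<in> carrier Y" "y \<in> carrier Y"
    then obtain u v where "u \<in> carrier X" "v \<in> carrier X" "x = f u" "y = f v"
      using ex by metis
    thus "x \<otimes>\<^bsub>Y\<^esub> y \<in> carrier Y" using cl[of "u \<otimes>\<^bsub>X\<^esub> v"] by (simp add: mult)
  next
    show "\<one>\<^bsub>Y\<^esub> \<in> carrier Y" using cl[of "\<one>\<^bsub>X\<^esub>"] by (simp add: one)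
  next
    fix x y z assume "x \<in> carrier Y" "y \<in> carrier Y" "z \<in> carrier Y"
    then obtain u v w where "u \<in> carrier X" "v \<in> carrier X" "w \<in> carrier X"
      "x = f u" "y = f v" "z = f w" using ex by metis
    thus "x \<otimes>\<^bsub>Y\<^esub> y \<otimes>\<^bsub>Y\<^esub> z = x \<otimes>\<^bsub>Y\<^esub> (y \<otimes>\<^bsub>Y\<^esub> z)"
      by (simp add: mult[symmetric] X.m_assoc)
  next
    fix x assume "x \<in> carrier Y"
    then obtain u where u: "u \<in> carrier X" "x = f u" using ex by metis
    thus "\<one>\<^bsub>Y\<^esub> \<otimes>\<^bsub>Y\<^esub> x = x" "x \<otimes>\<^bsub>Y\<^esub> \<one>\<^bsub>Y\<^esub> = x"
      using mult[of "\<one>\<^bsub>X\<^esub>" u] mult[of u "\<one>\<^bsub>X\<^esub>"] by (simp_all add: one)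
  qed
  have rng: "Ring.ring Y"
  proof (intro ringI Y.M.abelian_group_axioms mon)
    fix x y z assume "x \<in> carrier Y" "y \<in> carrier Y" "z \<in> carrier Y"
    then obtain u v w where *: "u \<in> carrier X" "v \<in> carrier X" "w \<in> carrier X"
      "x = f u" "y = f v" "z = f w" using ex by metis
    show "(x \<oplus>\<^bsub>Y\<^esub> y) \<otimes>\<^bsub>Y\<^esub> z = x \<otimes>\<^bsub>Y\<^esub> z \<oplus>\<^bsub>Y\<^esub> y \<otimes>\<^bsub>Y\<^esub> z"
      using * by (simp add: add[symmetric] mult[symmetric] X.l_distr)
    show "z \<otimes>\<^bsub>Y\<^esub> (x \<oplus>\<^bsub>Y\<^esub> y) = z \<otimes>\<^bsub>Y\<^esub> x \<oplus>\<^bsub>Y\<^esub> z \<otimes>\<^bsub>Y\<^esub> y"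
      using * by (simp add: add[symmetric] mult[symmetric] X.r_distr)
  qed
  show ?thesis
  proof (intro calgebra.intro Y.vspace_axioms rng calgebra_axioms.intro)
    fix c x y assume "x \<in> carrier Y" "y \<in> carrier Y"
    then obtain u v where *: "u \<in> carrier X" "v \<in> carrier X" "x = f u" "y = f v"
      using ex by metis
    show "c \<odot>\<^bsub>Y\<^esub> x \<otimes>\<^bsub>Y\<^esub> y = c \<odot>\<^bsub>Y\<^esub> (x \<otimes>\<^bsub>Y\<^esub> y)"
      using * by (simp add: scale[symmetric] mult[symmetric] X.scale_mult_left)
    show "x \<otimes>\<^bsub>Y\<^esub> (c \<odot>\<^bsub>Y\<^esub> y) = c \<odot>\<^bsub>Y\<^esub> (x \<otimes>\<^bsub>Y\<^esub> y)"
      using * by (simp add: scale[symmetric] mult[symmetric] X.scale_mult_right)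
  qed
qed

lemma tendsto_zero_le:
  fixes f g :: "nat \<Rightarrow> real"
  assumes "\<And>n. 0 \<le> f n" "\<And>n. f n \<le> g n" "g \<longlonglongrightarrow> 0"
  shows "f \<longlonglongrightarrow> 0"
  by (rule tendsto_sandwich[OF _ _ tendsto_const assms(3)]) (use assms in auto)

section \<open>Spaces with an increasing sequence of seminorms\<close>

lemma openin_lc_topology:
  "openin (lc_topology V P) U \<longleftrightarrow> U \<subseteq> carrier V \<and>
    (\<forall>x\<in>U. \<exists>F r. finite F \<and> F \<subseteq> P \<and> 0 < r \<and> {y \<in> carrier V. \<forall>p\<in>F. p (y \<ominus>\<^bsub>V\<^esub> x) < r} \<subseteq> U)"
  (is "_ \<longleftrightarrow> ?P U")
proof -
  have "istopology ?P"
  proof (unfold istopology_def, intro conjI allI impI)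
    fix S T assume S: "?P S" and T: "?P T"
    show "S \<inter> T \<subseteq> carrier V" using S by blast
    show "\<forall>x\<in>S \<inter> T. \<exists>F r. finite F \<and> F \<subseteq> P \<and> 0 < r \<and>
        {y \<in> carrier V. \<forall>p\<in>F. p (y \<ominus>\<^bsub>V\<^esub> x) < r} \<subseteq> S \<inter> T"
    proof
      fix x assume x: "x \<in> S \<inter> T"
      obtain F r where F: "finite F" "F \<subseteq> P" "0 < r"
        "{y \<in> carrier V. \<forall>p\<in>F. p (y \<ominus>\<^bsub>V\<^esub> x) < r} \<subseteq> S" using S x by blast
      obtain G s where G: "finite G" "G \<subseteq> P" "0 < s"
        "{y \<in> carrier V. \<forall>p\<in>G. p (y \<ominus>\<^bsub>V\<^esub> x) < s} \<subseteq> T" using T x by blast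
      show "\<exists>F r. finite F \<and> F \<subseteq> P \<and> 0 < r \<and>
          {y \<in> carrier V. \<forall>p\<in>F. p (y \<ominus>\<^bsub>V\<^esub> x) < r} \<subseteq> S \<inter> T"
        using F G by (intro exI[of _ "F \<union> G"] exI[of _ "min r s"]) auto
    qed
  next
    fix \<K> assume K: "\<forall>K\<in>\<K>. ?P K"
    thus "\<Union>\<K> \<subseteq> carrier V" by blast
    show "\<forall>x\<in>\<Union>\<K>. \<exists>F r. finite F \<and> F \<subseteq> P \<and> 0 < r \<and>
        {y \<in> carrier V. \<forall>p\<in>F. p (y \<ominus>\<^bsub>V\<^esub> x) < r} \<subseteq> \<Union>\<K>"
    proof
      fix x assume "x \<in> \<Union>\<K>"
      then obtain K where K': "K \<in> \<K>" "x \<in> K" by blast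
      then obtain F r where "finite F" "F \<subseteq> P" "0 < r"
        "{y \<in> carrier V. \<forall>p\<in>F. p (y \<ominus>\<^bsub>V\<^esub> x) < r} \<subseteq> K" using K by meson
      thus "\<exists>F r. finite F \<and> F \<subseteq> P \<and> 0 < r \<and>
          {y \<in> carrier V. \<forall>p\<in>F. p (y \<ominus>\<^bsub>V\<^esub> x) < r} \<subseteq> \<Union>\<K>"
        using K' by blast
    qed
  qed
  thus ?thesis unfolding lc_topology_def by simp
qed

lemma topspace_lc_topology [simp]: "topspace (lc_topology V P) = carrier V"
proof -
  have "openin (lc_topology V P) (carrier V)"
    unfolding openin_lc_topology
    by (auto intro!: exI[of _ "{}"] exI[of _ "1::real"])
  moreover have "U \<subseteq> carrier V" if "openin (lc_topology V P) U" for U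
    using that by (simp add: openin_lc_topology)
  ultimately show ?thesis by (meson openin_subset openin_topspace subset_antisym)
qed

lemma seminormD:
  assumes "seminorm V p"
  shows "x \<in> carrier V \<Longrightarrow> 0 \<le> p x"
    "\<lbrakk>x \<in> carrier V; y \<in> carrier V\<rbrakk> \<Longrightarrow> p (x \<oplus>\<^bsub>V\<^esub> y) \<le> p x + p y"
    "x \<in> carrier V \<Longrightarrow> p (c \<odot>\<^bsub>V\<^esub> x) = cmod c * p x"
  using assms by (auto simp: seminorm_def)

text \<open>Adding seminorms that are dominated by members of a sequence does not change the topology.
  The topologies of free entire functions, tensor products and completions are defined by
  uncountable families; this reduces each of them to a countable one.\<close>

lemma lc_topology_eqI:
  fixes p :: "nat \<Rightarrow> 'a \<Rightarrow> real"
  assumes V: "vspace V" and sub: "range p \<subseteq> P"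
    and dom: "\<And>q. q \<in> P \<Longrightarrow> \<exists>k C. \<forall>x\<in>carrier V. q x \<le> C * p k x"
    and nonneg: "\<And>k x. x \<in> carrier V \<Longrightarrow> 0 \<le> p k x"
  shows "lc_topology V P = lc_topology V (range p)"
proof (rule topology_eq[THEN iffD2], intro allI iffI)
  interpret vspace V by (rule V)
  fix U assume "openin (lc_topology V (range p)) U"
  thus "openin (lc_topology V P) U" using sub unfolding openin_lc_topology by (meson order_trans)
next
  interpret vspace V by (rule V)
  obtain k C where kC: "\<And>q x. q \<in> P \<Longrightarrow> x \<in> carrier V \<Longrightarrow> q x \<le> C q * p (k q) x"
    using dom by metis
  fix U assume U: "openin (lc_topology V P) U"
  show "openin (lc_topology V (range p)) U"
    unfolding openin_lc_topology
  proof (intro conjI ballI)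
    show "U \<subseteq> carrier V" using U by (simp add: openin_lc_topology)
    fix x assume x: "x \<in> U"
    hence xc: "x \<in> carrier V" using \<open>U \<subseteq> carrier V\<close> by blast
    obtain F r where F: "finite F" "F \<subseteq> P" "0 < r"
        "{y \<in> carrier V. \<forall>p\<in>F. p (y \<ominus>\<^bsub>V\<^esub> x) < r} \<subseteq> U"
      using U x unfolding openin_lc_topology by blast
    define D where "D = 1 + (\<Sum>q\<in>F. \<bar>C q\<bar>)"
    have D: "D > 0" "\<And>q. q \<in> F \<Longrightarrow> C q \<le> D"
    proof -
      show "D > 0" unfolding D_def by (simp add: add_pos_nonneg sum_nonneg)
      fix q assume "q \<in> F"
      hence "\<bar>C q\<bar> \<le> (\<Sum>q\<in>F. \<bar>C q\<bar>)"
        using F(1) member_le_sum[of q F "\<lambda>q. \<bar>C q\<bar>"] by simp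
      thus "C q \<le> D" unfolding D_def by simp
    qed
    have "{y \<in> carrier V. \<forall>q\<in>(\<lambda>q. p (k q)) ` F. q (y \<ominus>\<^bsub>V\<^esub> x) < r / D} \<subseteq> U"
    proof (rule subset_trans[OF _ F(4)], safe)
      fix y q assume y: "y \<in> carrier V" "\<forall>q\<in>(\<lambda>q. p (k q)) ` F. q (y \<ominus>\<^bsub>V\<^esub> x) < r / D" and q: "q \<in> F"
      have d: "y \<ominus>\<^bsub>V\<^esub> x \<in> carrier V" using y xc by auto
      have "q (y \<ominus>\<^bsub>V\<^esub> x) \<le> C q * p (k q) (y \<ominus>\<^bsub>V\<^esub> x)" using kC d q F(2) by blast
      also have "\<dots> \<le> D * p (k q) (y \<ominus>\<^bsub>V\<^esub> x)"
        using D(2)[OF q] nonneg[OF d] by (intro mult_right_mono) auto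
      also have "\<dots> < D * (r / D)" using y(2) q D(1) by (intro mult_strict_left_mono) auto
      finally show "q (y \<ominus>\<^bsub>V\<^esub> x) < r" using D(1) by simp
    qed
    thus "\<exists>F r. finite F \<and> F \<subseteq> range p \<and> 0 < r \<and> {y \<in> carrier V. \<forall>p\<in>F. p (y \<ominus>\<^bsub>V\<^esub> x) < r} \<subseteq> U"
      using F(1,3) D(1) by (intro exI[of _ "(\<lambda>q. p (k q)) ` F"] exI[of _ "r / D"]) auto
  qed
qed

lemma openin_lc_topology_range:
  fixes V (structure) and p :: "nat \<Rightarrow> 'a \<Rightarrow> real"
  assumes V: "vspace V" and p_Suc: "\<And>x k. x \<in> carrier V \<Longrightarrow> p k x \<le> p (Suc k) x"
  shows "openin (lc_topology V (range p)) U \<longleftrightarrow> U \<subseteq> carrier V \<and>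
    (\<forall>x\<in>U. \<exists>k r. 0 < r \<and> {y \<in> carrier V. p k (y \<ominus> x) < r} \<subseteq> U)"
proof safe
  interpret vspace V by (rule V)
  have p_mono: "p j x \<le> p k x" if "x \<in> carrier V" "j \<le> k" for j k x
    using lift_Suc_mono_le[of "\<lambda>k. p k x" j k] p_Suc that by auto
  fix x assume U: "openin (lc_topology V (range p)) U" and x: "x \<in> U"
  show xc: "x \<in> carrier V" using U x openin_lc_topology[of V "range p" U] by auto
  obtain F r where F: "finite F" "F \<subseteq> range p" "0 < r"
      "{y \<in> carrier V. \<forall>p\<in>F. p (y \<ominus>\<^bsub>V\<^esub> x) < r} \<subseteq> U"
    using U x unfolding openin_lc_topology by blast
  obtain K where K: "finite K" "F = p ` K" using F(1,2) by (meson finite_subset_image)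
  define k where "k = Max (insert 0 K)"
  have "j \<le> k" if "j \<in> K" for j using that K(1) by (simp add: k_def)
  hence "p j (y \<ominus> x) \<le> p k (y \<ominus> x)" if "j \<in> K" "y \<in> carrier V" for j y
    using that xc by (intro p_mono) auto
  hence "{y \<in> carrier V. p k (y \<ominus> x) < r} \<subseteq> {y \<in> carrier V. \<forall>p\<in>F. p (y \<ominus>\<^bsub>V\<^esub> x) < r}"
    unfolding K(2) by (auto intro: le_less_trans)
  hence "{y \<in> carrier V. p k (y \<ominus> x) < r} \<subseteq> U" using F(4) by (rule subset_trans)
  thus "\<exists>k r. 0 < r \<and> {y \<in> carrier V. p k (y \<ominus> x) < r} \<subseteq> U"
    using F(3) by (intro exI conjI)
next
  assume U: "U \<subseteq> carrier V" "\<forall>x\<in>U. \<exists>k r. 0 < r \<and> {y \<in> carrier V. p k (y \<ominus> x) < r} \<subseteq> U"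
  show "openin (lc_topology V (range p)) U"
    unfolding openin_lc_topology
  proof (intro conjI ballI U(1))
    fix x assume "x \<in> U"
    then obtain k r where "0 < r" "{y \<in> carrier V. p k (y \<ominus> x) < r} \<subseteq> U" using U(2) by blast
    thus "\<exists>F r. finite F \<and> F \<subseteq> range p \<and> 0 < r \<and> {y \<in> carrier V. \<forall>p\<in>F. p (y \<ominus> x) < r} \<subseteq> U"
      by (intro exI[of _ "{p k}"] exI[of _ r]) auto
  qed
qed

text \<open>A topological limit only controls a tail of the sequence, hence the condition on all terms.\<close>

definition converges :: "'a talg \<Rightarrow> (nat \<Rightarrow> 'a) \<Rightarrow> 'a \<Rightarrow> bool" where
  "converges V s l \<longleftrightarrow> (\<forall>n. s n \<in> carrier V) \<and> limitin (topo V) s l sequentially"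

text \<open>Since the sequence of seminorms is increasing, single balls form a base of neighbourhoods, and
  continuity of a linear map is an estimate by a single seminorm.\<close>

locale seminormed_space = vspace V for V :: "'a talg" (structure) +
  fixes p :: "nat \<Rightarrow> 'a \<Rightarrow> real"
  assumes seminorm_p: "seminorm V (p k)"
    and p_Suc: "x \<in> carrier V \<Longrightarrow> p k x \<le> p (Suc k) x"
    and topo_eq: "topo V = lc_topology V (range p)"
begin

lemma p_nonneg [simp]: "x \<in> carrier V \<Longrightarrow> 0 \<le> p k x"
  and p_triangle: "\<lbrakk>x \<in> carrier V; y \<in> carrier V\<rbrakk> \<Longrightarrow> p k (x \<oplus> y) \<le> p k x + p k y"
  and p_scale: "x \<in> carrier V \<Longrightarrow> p k (c \<odot> x) = cmod c * p k x"
  using seminormD[OF seminorm_p] by auto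

lemma p_mono: "x \<in> carrier V \<Longrightarrow> j \<le> k \<Longrightarrow> p j x \<le> p k x"
  using lift_Suc_mono_le[of "\<lambda>k. p k x" j k] p_Suc by auto

lemma p_zero [simp]: "p k \<zero> = 0"
  using p_scale[of \<zero> k 0] by simp

lemma p_uminus: "x \<in> carrier V \<Longrightarrow> p k (\<ominus> x) = p k x"
  by (simp add: uminus_eq_scale p_scale)

lemma p_diff_commute: "\<lbrakk>x \<in> carrier V; y \<in> carrier V\<rbrakk> \<Longrightarrow> p k (x \<ominus> y) = p k (y \<ominus> x)"
  using p_scale[of "x \<ominus> y" k "-1"] by (simp add: uminus_diff)

lemma p_diff_triangle:
  "\<lbrakk>x \<in> carrier V; y \<in> carrier V; z \<in> carrier V\<rbrakk> \<Longrightarrow> p k (x \<ominus> z) \<le> p k (x \<ominus> y) + p k (y \<ominus> z)"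
  by (subst diff_diff_eq_telescope[of x y z]) (auto intro: p_triangle)

lemma p_le_add_diff: "\<lbrakk>x \<in> carrier V; y \<in> carrier V\<rbrakk> \<Longrightarrow> p k x \<le> p k y + p k (x \<ominus> y)"
  using p_triangle[of y "x \<ominus> y" k] by (simp add: add_minus_cancel)

lemma p_abs_diff_le: "\<lbrakk>x \<in> carrier V; y \<in> carrier V\<rbrakk> \<Longrightarrow> \<bar>p k x - p k y\<bar> \<le> p k (x \<ominus> y)"
  using p_le_add_diff[of x y k] p_le_add_diff[of y x k] p_diff_commute[of x y k] by linarith

lemma p_finsum_le:
  assumes "finite S" "f \<in> S \<rightarrow> carrier V"
  shows "p k (finsum V f S) \<le> (\<Sum>i\<in>S. p k (f i))"
  using assms
proof (induction S rule: finite_induct)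
  case (insert i S)
  hence "p k (finsum V f (insert i S)) = p k (f i \<oplus> finsum V f S)"
    by (subst M.finsum_insert) (auto simp: Pi_def)
  also have "\<dots> \<le> p k (f i) + p k (finsum V f S)"
    using insert by (intro p_triangle M.finsum_closed) auto
  finally show ?case using insert by (auto simp: Pi_def)
qed auto

lemma topspace_V [simp]: "topspace (topo V) = carrier V"
  by (simp add: topo_eq)

lemma openin_iff:
  "openin (topo V) U \<longleftrightarrow> U \<subseteq> carrier V \<and>
    (\<forall>x\<in>U. \<exists>k r. 0 < r \<and> {y \<in> carrier V. p k (y \<ominus> x) < r} \<subseteq> U)"
  unfolding topo_eq by (rule openin_lc_topology_range[OF vspace_axioms]) (rule p_Suc)

lemma openin_ball: "x \<in> carrier V \<Longrightarrow> openin (topo V) {y \<in> carrier V. p k (y \<ominus> x) < r}"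
  unfolding openin_iff
proof safe
  fix z assume x: "x \<in> carrier V" and z: "z \<in> carrier V" "p k (z \<ominus> x) < r"
  have "{y \<in> carrier V. p k (y \<ominus> z) < r - p k (z \<ominus> x)} \<subseteq> {y \<in> carrier V. p k (y \<ominus> x) < r}"
    using p_diff_triangle[of _ z x k] x z by fastforce
  thus "\<exists>j s. 0 < s \<and> {y \<in> carrier V. p j (y \<ominus> z) < s} \<subseteq> {y \<in> carrier V. p k (y \<ominus> x) < r}"
    using z by (intro exI[of _ k] exI[of _ "r - p k (z \<ominus> x)"]) auto
qed

lemma converges_iff:
  "converges V s l \<longleftrightarrow>
    (\<forall>n. s n \<in> carrier V) \<and> l \<in> carrier V \<and> (\<forall>k. (\<lambda>n. p k (s n \<ominus> l)) \<longlonglongrightarrow> 0)"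
  (is "_ \<longleftrightarrow> ?R")
proof
  assume C: "converges V s l"
  hence L: "limitin (topo V) s l sequentially" and s: "\<And>n. s n \<in> carrier V"
    by (auto simp: converges_def)
  hence l: "l \<in> carrier V" by (metis limitin_topspace topspace_V)
  have "(\<lambda>n. p k (s n \<ominus> l)) \<longlonglongrightarrow> 0" for k
  proof (rule order_tendstoI)
    fix a :: real assume "a < 0"
    thus "\<forall>\<^sub>F n in sequentially. a < p k (s n \<ominus> l)"
      using s l by (intro always_eventually) (auto intro: less_le_trans)
  next
    fix r :: real assume "0 < r"
    hence "l \<in> {y \<in> carrier V. p k (y \<ominus> l) < r}" using l by auto
    hence "\<forall>\<^sub>F n in sequentially. s n \<in> {y \<in> carrier V. p k (y \<ominus> l) < r}"
      using L openin_ball[OF l] unfolding limitin_def by blast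
    thus "\<forall>\<^sub>F n in sequentially. p k (s n \<ominus> l) < r" by eventually_elim auto
  qed
  thus ?R using s l by simp
next
  assume L: ?R
  hence s: "\<And>n. s n \<in> carrier V" by simp
  have "limitin (topo V) s l sequentially"
    unfolding limitin_def
  proof (intro conjI allI impI)
    show "l \<in> topspace (topo V)" using L by simp
    fix U assume "openin (topo V) U \<and> l \<in> U"
    then obtain k r where "0 < r" and U: "{y \<in> carrier V. p k (y \<ominus> l) < r} \<subseteq> U"
      unfolding openin_iff by blast
    have "(\<lambda>n. p k (s n \<ominus> l)) \<longlonglongrightarrow> 0" using L by simp
    hence "\<forall>\<^sub>F n in sequentially. p k (s n \<ominus> l) < r" using \<open>0 < r\<close> by (rule order_tendstoD)
    thus "\<forall>\<^sub>F n in sequentially. s n \<in> U"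
      by eventually_elim (use U s in auto)
  qed
  thus "converges V s l" using s by (simp add: converges_def)
qed

lemma cauchy_seq_iff:
  "cauchy_seq V s \<longleftrightarrow> (\<forall>n. s n \<in> carrier V) \<and>
    (\<forall>k. \<forall>e>0. \<exists>N. \<forall>m\<ge>N. \<forall>n\<ge>N. p k (s m \<ominus> s n) < e)"
proof safe
  assume C: "cauchy_seq V s"
  show s: "\<And>n. s n \<in> carrier V" using C by (simp add: cauchy_seq_def)
  fix k and e :: real assume "0 < e"
  hence "openin (topo V) {y \<in> carrier V. p k (y \<ominus> \<zero>) < e} \<and> \<zero> \<in> {y \<in> carrier V. p k (y \<ominus> \<zero>) < e}"
    by (simp add: openin_ball)
  then obtain N where "\<forall>m\<ge>N. \<forall>n\<ge>N. s m \<ominus> s n \<in> {y \<in> carrier V. p k (y \<ominus> \<zero>) < e}"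
    using C unfolding cauchy_seq_def by blast
  hence "\<forall>m\<ge>N. \<forall>n\<ge>N. p k (s m \<ominus> s n) < e" using s by simp
  thus "\<exists>N. \<forall>m\<ge>N. \<forall>n\<ge>N. p k (s m \<ominus> s n) < e" by blast
next
  assume s: "\<forall>n. s n \<in> carrier V"
    and C: "\<forall>k. \<forall>e>0. \<exists>N. \<forall>m\<ge>N. \<forall>n\<ge>N. p k (s m \<ominus> s n) < e"
  show "cauchy_seq V s" unfolding cauchy_seq_def
  proof (intro conjI s allI impI)
    fix U assume "openin (topo V) U \<and> \<zero> \<in> U"
    then obtain k r where "0 < r" and U: "{y \<in> carrier V. p k (y \<ominus> \<zero>) < r} \<subseteq> U"
      unfolding openin_iff by blast
    then obtain N where "\<forall>m\<ge>N. \<forall>n\<ge>N. p k (s m \<ominus> s n) < r" using C by blast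
    thus "\<exists>N. \<forall>m\<ge>N. \<forall>n\<ge>N. s m \<ominus> s n \<in> U" using U s by (intro exI[of _ N]) auto
  qed
qed

lemma convergesI:
  assumes "\<And>n. s n \<in> carrier V" "l \<in> carrier V" "\<And>k. (\<lambda>n. p k (s n \<ominus> l)) \<longlonglongrightarrow> 0"
  shows "converges V s l"
  using assms by (simp add: converges_iff)

lemma convergesD:
  assumes "converges V s l"
  shows "s n \<in> carrier V" "l \<in> carrier V" "(\<lambda>n. p k (s n \<ominus> l)) \<longlonglongrightarrow> 0"
  using assms by (auto simp: converges_iff)

lemma converges_const: "l \<in> carrier V \<Longrightarrow> converges V (\<lambda>n. l) l"
  by (simp add: converges_iff)

lemma converges_add:
  assumes "converges V s x" "converges V t y"
  shows "converges V (\<lambda>n. s n \<oplus> t n) (x \<oplus> y)"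
proof (rule convergesI)
  note c = convergesD[OF assms(1)] convergesD[OF assms(2)]
  show "s n \<oplus> t n \<in> carrier V" "x \<oplus> y \<in> carrier V" for n using c by auto
  fix k
  show "(\<lambda>n. p k ((s n \<oplus> t n) \<ominus> (x \<oplus> y))) \<longlonglongrightarrow> 0"
  proof (rule tendsto_zero_le)
    show "(\<lambda>n. p k (s n \<ominus> x) + p k (t n \<ominus> y)) \<longlonglongrightarrow> 0"
      using tendsto_add[OF c(3)[of k] c(6)[of k]] by simp
    show "p k ((s n \<oplus> t n) \<ominus> (x \<oplus> y)) \<le> p k (s n \<ominus> x) + p k (t n \<ominus> y)" for n
      using c by (simp add: add_diff_add p_triangle)
    show "0 \<le> p k ((s n \<oplus> t n) \<ominus> (x \<oplus> y))" for n
      using c(1,2,4,5) by simp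
  qed
qed

lemma converges_scale:
  assumes "converges V s x"
  shows "converges V (\<lambda>n. c \<odot> s n) (c \<odot> x)"
proof (rule convergesI)
  note c = convergesD[OF assms]
  show "c \<odot> s n \<in> carrier V" "c \<odot> x \<in> carrier V" for n using c by auto
  show "(\<lambda>n. p k (c \<odot> s n \<ominus> c \<odot> x)) \<longlonglongrightarrow> 0" for k
    using tendsto_mult_left[OF c(3), of "cmod c" k] c by (simp add: scale_minus_distrib[symmetric] p_scale)
qed

lemma converges_p: 
  assumes "converges V s x"
  shows "(\<lambda>n. p k (s n)) \<longlonglongrightarrow> p k x"
proof -
  note c = convergesD[OF assms]
  have "(\<lambda>n. \<bar>p k (s n) - p k x\<bar>) \<longlonglongrightarrow> 0"
  proof (rule tendsto_zero_le)
    show "\<bar>p k (s n) - p k x\<bar> \<le> p k (s n \<ominus> x)" for n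
      by (rule p_abs_diff_le[OF c(1) c(2)])
    show "(\<lambda>n. p k (s n \<ominus> x)) \<longlonglongrightarrow> 0" by (rule c(3))
    show "0 \<le> \<bar>p k (s n) - p k x\<bar>" for n by simp
  qed
  thus ?thesis by (rule LIM_zero_cancel[OF tendsto_rabs_zero_cancel])
qed

end

section \<open>Continuous linear maps\<close>

definition linear_on :: "'a talg \<Rightarrow> 'b talg \<Rightarrow> ('a \<Rightarrow> 'b) \<Rightarrow> bool" where
  "linear_on V W f \<longleftrightarrow> f \<in> carrier V \<rightarrow> carrier W \<and>
    (\<forall>x\<in>carrier V. \<forall>y\<in>carrier V. f (x \<oplus>\<^bsub>V\<^esub> y) = f x \<oplus>\<^bsub>W\<^esub> f y) \<and>
    (\<forall>c. \<forall>x\<in>carrier V. f (c \<odot>\<^bsub>V\<^esub> x) = c \<odot>\<^bsub>W\<^esub> f x)"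

lemma cont_linear_iff:
  "cont_linear V W f \<longleftrightarrow> linear_on V W f \<and> continuous_map (topo V) (topo W) f"
  by (auto simp: cont_linear_def linear_on_def)

lemma linear_onD:
  assumes "linear_on V W f"
  shows "x \<in> carrier V \<Longrightarrow> f x \<in> carrier W"
    "\<lbrakk>x \<in> carrier V; y \<in> carrier V\<rbrakk> \<Longrightarrow> f (x \<oplus>\<^bsub>V\<^esub> y) = f x \<oplus>\<^bsub>W\<^esub> f y"
    "x \<in> carrier V \<Longrightarrow> f (c \<odot>\<^bsub>V\<^esub> x) = c \<odot>\<^bsub>W\<^esub> f x"
  using assms by (auto simp: linear_on_def)

lemma linear_on_minus:
  assumes "linear_on V W f" "vspace V" "vspace W" "x \<in> carrier V" "y \<in> carrier V"
  shows "f (x \<ominus>\<^bsub>V\<^esub> y) = f x \<ominus>\<^bsub>W\<^esub> f y"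
proof -
  interpret V: vspace V by fact
  interpret W: vspace W by fact
  show ?thesis using assms(4,5) linear_onD[OF assms(1)]
    by (simp add: V.minus_eq_scale W.minus_eq_scale)
qed

lemma linear_on_zero:
  assumes "linear_on V W f" "vspace V" "vspace W"
  shows "f \<zero>\<^bsub>V\<^esub> = \<zero>\<^bsub>W\<^esub>"
proof -
  interpret V: vspace V by fact
  interpret W: vspace W by fact
  have "f (0 \<odot>\<^bsub>V\<^esub> \<zero>\<^bsub>V\<^esub>) = 0 \<odot>\<^bsub>W\<^esub> f \<zero>\<^bsub>V\<^esub>"
    by (rule linear_onD(3)[OF assms(1) V.M.zero_closed])
  thus ?thesis using linear_onD(1)[OF assms(1) V.M.zero_closed] by simp
qed

lemma linear_on_finsum:
  assumes f: "linear_on V W f" and V: "vspace V" and W: "vspace W"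
    and S: "finite S" and g: "g \<in> S \<rightarrow> carrier V"
  shows "f (finsum V g S) = finsum W (\<lambda>i. f (g i)) S"
proof -
  interpret V: vspace V by fact
  interpret W: vspace W by fact
  show ?thesis using S g
  proof (induction S rule: finite_induct)
    case empty
    show ?case by (simp add: linear_on_zero[OF f V W])
  next
    case (insert i S)
    have gi: "g i \<in> carrier V" and gS: "g \<in> S \<rightarrow> carrier V" using insert.prems by auto
    have "f (finsum V g (insert i S)) = f (g i \<oplus>\<^bsub>V\<^esub> finsum V g S)"
      using insert.hyps gi gS by simp
    also have "\<dots> = f (g i) \<oplus>\<^bsub>W\<^esub> f (finsum V g S)"
      by (rule linear_onD(2)[OF f gi V.M.finsum_closed[OF gS]])
    also have "\<dots> = f (g i) \<oplus>\<^bsub>W\<^esub> finsum W (\<lambda>i. f (g i)) S" using insert.IH gS by simp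
    also have "\<dots> = finsum W (\<lambda>i. f (g i)) (insert i S)"
      using insert.hyps linear_onD(1)[OF f] insert.prems
      by (intro W.M.finsum_insert[symmetric]) auto
    finally show ?case .
  qed
qed

text \<open>The usual scaling argument: a seminorm that is small on a ball is bounded by a multiple of
  the seminorm that defines the ball.\<close>

lemma (in seminormed_space) bound_from_ball:
  assumes q: "seminorm V q" and r: "0 < r"
    and ball: "\<And>x. \<lbrakk>x \<in> carrier V; p j x < r\<rbrakk> \<Longrightarrow> q x < 1" and x: "x \<in> carrier V"
  shows "q x \<le> 2 / r * p j x"
proof (rule field_le_epsilon)
  fix e :: real assume e: "0 < e"
  define d where "d = e * r / 2"
  have d: "d > 0" using e r by (simp add: d_def)
  define t where "t = r / (2 * (p j x + d))"
  have pd: "p j x + d > 0" using d p_nonneg[OF x, of j] by linarith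
  have t: "t > 0" using r pd by (simp add: t_def)
  have "p j (complex_of_real t \<odot> x) = t * p j x" using t x by (simp add: p_scale)
  also have "\<dots> < r" using r pd d p_nonneg[OF x, of j]
    by (simp add: t_def field_simps) (smt (verit) mult_pos_pos mult_nonneg_nonneg)
  finally have "q (complex_of_real t \<odot> x) < 1" using x by (intro ball) auto
  hence "t * q x < 1" using t x seminormD(3)[OF q x] by simp
  hence "q x < 1 / t" using t by (simp add: field_simps)
  also have "1 / t = 2 / r * p j x + e" using r pd by (simp add: t_def d_def field_simps)
  finally show "q x \<le> 2 / r * p j x + e" by simp
qed

lemma (in seminormed_space) cont_seminorm_iff:
  "cont_seminorm V q \<longleftrightarrow> seminorm V q \<and> (\<exists>j C. \<forall>x\<in>carrier V. q x \<le> C * p j x)"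
proof (intro iffI conjI; (elim conjE exE)?)
  assume q: "cont_seminorm V q"
  thus sq: "seminorm V q" by (simp add: cont_seminorm_def)
  have "openin (topo V) {x \<in> carrier V. q x \<in> {..<1}}"
    using q openin_continuous_map_preimage[of "topo V" euclideanreal q "{..<1}"]
    by (simp add: cont_seminorm_def)
  moreover have "\<zero> \<in> {x \<in> carrier V. q x \<in> {..<1}}"
    using seminormD(3)[OF sq, of \<zero> 0] by simp
  ultimately obtain j r where r: "0 < r" "{y \<in> carrier V. p j (y \<ominus> \<zero>) < r} \<subseteq> {x \<in> carrier V. q x \<in> {..<1}}"
    unfolding openin_iff by blast
  have "q x < 1" if "x \<in> carrier V" "p j x < r" for x
  proof -
    have "x \<in> {y \<in> carrier V. p j (y \<ominus> \<zero>) < r}" using that by simp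
    thus ?thesis using r(2) by blast
  qed
  hence "q x \<le> 2 / r * p j x" if "x \<in> carrier V" for x
    by (intro bound_from_ball[OF sq r(1)] that)
  thus "\<exists>j C. \<forall>x\<in>carrier V. q x \<le> C * p j x" by metis
next
  fix j C assume sq: "seminorm V q" and C: "\<forall>x\<in>carrier V. q x \<le> C * p j x"
  have "continuous_map (topo V) euclideanreal q"
    unfolding continuous_map_def
  proof (intro conjI allI impI)
    fix U :: "real set" assume "openin euclidean U"
    hence U: "open U" by simp
    show "openin (topo V) {x \<in> topspace (topo V). q x \<in> U}"
      unfolding openin_iff
    proof (intro conjI ballI)
      fix x assume x: "x \<in> {x \<in> topspace (topo V). q x \<in> U}"
      hence xc: "x \<in> carrier V" by simp
      obtain e where e: "e > 0" "ball (q x) e \<subseteq> U" using x U by (metis (lifting) mem_Collect_eq open_contains_ball)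
      have "q y \<in> U" if y: "y \<in> carrier V" "p j (y \<ominus> x) < e / (\<bar>C\<bar> + 1)" for y
      proof -
        have d: "y \<ominus> x \<in> carrier V" "x \<ominus> y \<in> carrier V" using y xc by auto
        have "q y \<le> q x + q (y \<ominus> x)" "q x \<le> q y + q (x \<ominus> y)"
          using seminormD(2)[OF sq xc d(1)] seminormD(2)[OF sq y(1) d(2)] y xc
          by (simp_all add: add_minus_cancel)
        moreover have "q (x \<ominus> y) = q (y \<ominus> x)"
          using seminormD(3)[OF sq d(1), of "-1"] y xc by (simp add: uminus_diff)
        moreover have "q (y \<ominus> x) < e"
        proof -
          have "q (y \<ominus> x) \<le> C * p j (y \<ominus> x)" using C d by blast
          also have "\<dots> \<le> (\<bar>C\<bar> + 1) * p j (y \<ominus> x)" using d by (intro mult_right_mono) auto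
          also have "\<dots> < (\<bar>C\<bar> + 1) * (e / (\<bar>C\<bar> + 1))" using y by (intro mult_strict_left_mono) auto
          also have "\<dots> = e" by simp
          finally show ?thesis .
        qed
        ultimately show ?thesis using e(2) by (auto simp: dist_real_def)
      qed
      thus "\<exists>k r. 0 < r \<and> {y \<in> carrier V. p k (y \<ominus> x) < r} \<subseteq> {x \<in> topspace (topo V). q x \<in> U}"
        using e(1) by (intro exI[of _ j] exI[of _ "e / (\<bar>C\<bar> + 1)"]) auto
    qed auto
  qed auto
  thus "cont_seminorm V q" using sq by (simp add: cont_seminorm_def)
qed

lemma (in seminormed_space) cont_seminorm_p: "cont_seminorm V (p k)"
  unfolding cont_seminorm_iff using seminorm_p
  by (intro conjI exI[of _ k] exI[of _ "1::real"]) auto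

text \<open>By linearity only neighbourhoods of zero matter. For the forward direction a seminorm of the
  target is pulled back to a continuous seminorm on the source.\<close>

lemma continuous_linear_iff:
  assumes V: "seminormed_space V p" and W: "seminormed_space W q" and f: "linear_on V W f"
  shows "continuous_map (topo V) (topo W) f \<longleftrightarrow> (\<forall>k. \<exists>j C. \<forall>x\<in>carrier V. q k (f x) \<le> C * p j x)"
proof
  interpret V: seminormed_space V p by fact
  interpret W: seminormed_space W q by fact
  note fc = linear_onD(1)[OF f]
  assume c: "continuous_map (topo V) (topo W) f"
  show "\<forall>k. \<exists>j C. \<forall>x\<in>carrier V. q k (f x) \<le> C * p j x"
  proof
    fix k
    have s: "seminorm V (\<lambda>x. q k (f x))"
      unfolding seminorm_def using linear_onD[OF f]
      by (auto simp: W.p_triangle W.p_scale)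
    have "continuous_map (topo V) euclideanreal (q k \<circ> f)"
      using c W.cont_seminorm_p[of k] by (auto simp: cont_seminorm_def intro: continuous_map_compose)
    hence "cont_seminorm V (\<lambda>x. q k (f x))" using s by (simp add: cont_seminorm_def o_def)
    thus "\<exists>j C. \<forall>x\<in>carrier V. q k (f x) \<le> C * p j x" by (simp add: V.cont_seminorm_iff)
  qed
next
  interpret V: seminormed_space V p by fact
  interpret W: seminormed_space W q by fact
  note fc = linear_onD(1)[OF f]
  assume b: "\<forall>k. \<exists>j C. \<forall>x\<in>carrier V. q k (f x) \<le> C * p j x"
  show "continuous_map (topo V) (topo W) f"
    unfolding continuous_map_def
  proof (intro conjI allI impI)
    show "f \<in> topspace (topo V) \<rightarrow> topspace (topo W)" using fc by auto
    fix U assume U: "openin (topo W) U"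
    show "openin (topo V) {x \<in> topspace (topo V). f x \<in> U}"
      unfolding V.openin_iff
    proof (intro conjI ballI)
      fix x assume x: "x \<in> {x \<in> topspace (topo V). f x \<in> U}"
      hence xc: "x \<in> carrier V" "f x \<in> U" by auto
      obtain k r where r: "r > 0" "{y \<in> carrier W. q k (y \<ominus>\<^bsub>W\<^esub> f x) < r} \<subseteq> U"
        using U xc(2) unfolding W.openin_iff by metis
      obtain j C where C: "\<forall>x\<in>carrier V. q k (f x) \<le> C * p j x" using b by metis
      have "f y \<in> U" if y: "y \<in> carrier V" "p j (y \<ominus>\<^bsub>V\<^esub> x) < r / (\<bar>C\<bar> + 1)" for y
      proof -
        have d: "y \<ominus>\<^bsub>V\<^esub> x \<in> carrier V" using y xc by auto
        have "q k (f y \<ominus>\<^bsub>W\<^esub> f x) = q k (f (y \<ominus>\<^bsub>V\<^esub> x))"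
          using linear_on_minus[OF f V.vspace_axioms W.vspace_axioms y(1) xc(1)] by simp
        also have "\<dots> \<le> C * p j (y \<ominus>\<^bsub>V\<^esub> x)" using C d by blast
        also have "\<dots> \<le> (\<bar>C\<bar> + 1) * p j (y \<ominus>\<^bsub>V\<^esub> x)" using d by (intro mult_right_mono) auto
        also have "\<dots> < (\<bar>C\<bar> + 1) * (r / (\<bar>C\<bar> + 1))" using y by (intro mult_strict_left_mono) auto
        also have "\<dots> = r" by simp
        finally show ?thesis using r(2) fc[OF y(1)] by blast
      qed
      thus "\<exists>k r. 0 < r \<and> {y \<in> carrier V. p k (y \<ominus>\<^bsub>V\<^esub> x) < r} \<subseteq> {x \<in> topspace (topo V). f x \<in> U}"
        using r(1) by (intro exI[of _ j] exI[of _ "r / (\<bar>C\<bar> + 1)"]) auto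
    qed auto
  qed
qed

lemma cont_linearI:
  assumes "seminormed_space V p" "seminormed_space W q" "linear_on V W f"
    "\<And>k. \<exists>j C. \<forall>x\<in>carrier V. q k (f x) \<le> C * p j x"
  shows "cont_linear V W f"
  using continuous_linear_iff[OF assms(1-3)] assms(3,4) by (simp add: cont_linear_iff)

lemma cont_linear_bound:
  assumes "seminormed_space V p" "seminormed_space W q" "cont_linear V W f"
  obtains j C where "C \<ge> 0" "\<And>x. x \<in> carrier V \<Longrightarrow> q k (f x) \<le> C * p j x"
proof -
  interpret V: seminormed_space V p by fact
  obtain j C where *: "\<forall>x\<in>carrier V. q k (f x) \<le> C * p j x"
    using continuous_linear_iff[OF assms(1,2)] assms(3) unfolding cont_linear_iff by metis
  have "q k (f x) \<le> \<bar>C\<bar> * p j x" if "x \<in> carrier V" for x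
    using * that V.p_nonneg[OF that, of j] by (meson abs_ge_self mult_right_mono order_trans)
  thus thesis using that[of "\<bar>C\<bar>" j] by auto
qed

lemma cont_linear_converges:
  assumes "cont_linear V W f" "converges V s l"
  shows "converges W (\<lambda>n. f (s n)) (f l)"
  using assms continuous_map_limit[of "topo V" "topo W" f s l sequentially]
  by (auto simp: converges_def cont_linear_def o_def)

lemma cont_linear_compose:
  "cont_linear U V f \<Longrightarrow> cont_linear V W g \<Longrightarrow> cont_linear U W (\<lambda>x. g (f x))"
  using continuous_map_compose[of "topo U" "topo V" f "topo W" g]
  by (auto simp: cont_linear_def o_def Pi_iff)

lemma cont_hom_compose:
  "cont_hom U V f \<Longrightarrow> cont_hom V W g \<Longrightarrow> cont_hom U W (\<lambda>x. g (f x))"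
  using cont_linear_compose[of U V f W g] unfolding cont_hom_def ring_hom_def
  by (auto simp: Pi_iff)

lemma cont_linear_add:
  assumes V: "seminormed_space V p" and W: "seminormed_space W q"
    and f: "cont_linear V W f" and g: "cont_linear V W g"
  shows "cont_linear V W (\<lambda>x. f x \<oplus>\<^bsub>W\<^esub> g x)"
proof (rule cont_linearI[OF V W])
  interpret V: seminormed_space V p by fact
  interpret W: seminormed_space W q by fact
  have lin: "linear_on V W f" "linear_on V W g" using f g by (auto simp: cont_linear_iff)
  note l = linear_onD[OF lin(1)] linear_onD[OF lin(2)]
  show "linear_on V W (\<lambda>x. f x \<oplus>\<^bsub>W\<^esub> g x)"
    unfolding linear_on_def using l by (simp add: W.scale_right_distrib W.M.a_ac)
  fix k
  obtain i K where K: "K \<ge> 0" "\<And>x. x \<in> carrier V \<Longrightarrow> q k (f x) \<le> K * p i x"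
    using cont_linear_bound[OF V W f, of k] by metis
  obtain j L where L: "L \<ge> 0" "\<And>x. x \<in> carrier V \<Longrightarrow> q k (g x) \<le> L * p j x"
    using cont_linear_bound[OF V W g, of k] by metis
  have "q k (f x \<oplus>\<^bsub>W\<^esub> g x) \<le> (K + L) * p (max i j) x" if x: "x \<in> carrier V" for x
  proof -
    have "q k (f x \<oplus>\<^bsub>W\<^esub> g x) \<le> q k (f x) + q k (g x)" by (rule W.p_triangle[OF l(1)[OF x] l(4)[OF x]])
    also have "\<dots> \<le> K * p i x + L * p j x" by (rule add_mono[OF K(2)[OF x] L(2)[OF x]])
    also have "\<dots> \<le> K * p (max i j) x + L * p (max i j) x"
      using K(1) L(1) by (intro add_mono mult_left_mono V.p_mono[OF x]) auto
    finally show ?thesis by (simp add: algebra_simps)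
  qed
  thus "\<exists>j C. \<forall>x\<in>carrier V. q k (f x \<oplus>\<^bsub>W\<^esub> g x) \<le> C * p j x" by blast
qed

lemma cont_linear_scale:
  assumes V: "seminormed_space V p" and W: "seminormed_space W q" and f: "cont_linear V W f"
  shows "cont_linear V W (\<lambda>x. d \<odot>\<^bsub>W\<^esub> f x)"
proof (rule cont_linearI[OF V W])
  interpret V: seminormed_space V p by fact
  interpret W: seminormed_space W q by fact
  have lin: "linear_on V W f" using f by (simp add: cont_linear_iff)
  note l = linear_onD[OF lin]
  show "linear_on V W (\<lambda>x. d \<odot>\<^bsub>W\<^esub> f x)"
    unfolding linear_on_def using l by (simp add: W.scale_right_distrib W.scale_scale mult.commute)
  fix k
  obtain i K where K: "K \<ge> 0" "\<And>x. x \<in> carrier V \<Longrightarrow> q k (f x) \<le> K * p i x"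
    using cont_linear_bound[OF V W f, of k] by metis
  have "q k (d \<odot>\<^bsub>W\<^esub> f x) \<le> (cmod d * K) * p i x" if x: "x \<in> carrier V" for x
    using mult_left_mono[OF K(2)[OF x] norm_ge_zero[of d]] W.p_scale[OF l(1)[OF x], of k d]
    by (simp add: mult.assoc)
  thus "\<exists>j C. \<forall>x\<in>carrier V. q k (d \<odot>\<^bsub>W\<^esub> f x) \<le> C * p j x" by blast
qed

lemma cont_linear_id: "cont_linear V V (\<lambda>x. x)"
  by (auto simp: cont_linear_def)

lemma cont_hom_id: "cont_hom V V (\<lambda>x. x)"
  by (auto simp: cont_hom_def cont_linear_id ring_hom_def)

text \<open>Only values on the carrier matter; this passes from arbitrary to extensional functions.\<close>

lemma cont_linear_cong:
  assumes "seminormed_space V p" "cont_linear V W f" "\<And>x. x \<in> carrier V \<Longrightarrow> f x = g x"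
  shows "cont_linear V W g"
proof -
  interpret seminormed_space V p by fact
  have "continuous_map (topo V) (topo W) g"
    by (rule continuous_map_eq[of _ _ f]) (use assms in \<open>auto simp: cont_linear_def\<close>)
  moreover have "linear_on V W g"
    using assms(2,3) M.a_closed scale_closed unfolding cont_linear_iff linear_on_def Pi_iff by simp
  ultimately show ?thesis by (simp add: cont_linear_iff)
qed

section \<open>Completeness\<close>

locale complete_space = seminormed_space +
  assumes separated: "\<lbrakk>x \<in> carrier V; \<And>k. p k x = 0\<rbrakk> \<Longrightarrow> x = \<zero>"
    and complete: "cauchy_seq V s \<Longrightarrow> \<exists>l. converges V s l"
begin

lemma separatedE:
  assumes "x \<in> carrier V" "x \<noteq> \<zero>"
  obtains k where "p k x \<noteq> 0"
  using separated assms by auto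

lemma Hausdorff: "Hausdorff_space (topo V)"
  unfolding Hausdorff_space_def
proof (intro allI impI)
  fix x y assume a: "x \<in> topspace (topo V) \<and> y \<in> topspace (topo V) \<and> x \<noteq> y"
  hence x: "x \<in> carrier V" and y: "y \<in> carrier V" by auto
  have "x \<ominus> y \<noteq> \<zero>" using a minus_eq_zeroD[OF x y] by metis
  then obtain k where "p k (x \<ominus> y) \<noteq> 0" using separatedE[of "x \<ominus> y"] x y by auto
  hence r: "p k (x \<ominus> y) > 0" using p_nonneg[of "x \<ominus> y" k] x y by (simp add: less_le)
  define r where "r = p k (x \<ominus> y) / 2"
  have "disjnt {z \<in> carrier V. p k (z \<ominus> x) < r} {z \<in> carrier V. p k (z \<ominus> y) < r}"
    unfolding disjnt_iff
  proof (intro allI notI)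
    fix z assume "z \<in> {z \<in> carrier V. p k (z \<ominus> x) < r} \<and> z \<in> {z \<in> carrier V. p k (z \<ominus> y) < r}"
    hence z: "z \<in> carrier V" "p k (z \<ominus> x) < r" "p k (z \<ominus> y) < r" by auto
    have "p k (x \<ominus> y) \<le> p k (x \<ominus> z) + p k (z \<ominus> y)" by (rule p_diff_triangle[OF x z(1) y])
    thus False using z p_diff_commute[OF x z(1), of k] by (simp add: r_def)
  qed
  moreover have "x \<in> {z \<in> carrier V. p k (z \<ominus> x) < r}" "y \<in> {z \<in> carrier V. p k (z \<ominus> y) < r}"
    using x y r by (auto simp: r_def)
  ultimately show "\<exists>U W. openin (topo V) U \<and> openin (topo V) W \<and> x \<in> U \<and> y \<in> W \<and> disjnt U W"
    using openin_ball[OF x, of k r] openin_ball[OF y, of k r]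
    by (intro exI[of _ "{z \<in> carrier V. p k (z \<ominus> x) < r}"]
        exI[of _ "{z \<in> carrier V. p k (z \<ominus> y) < r}"] conjI)
qed

lemma frechet_space: "frechet_space V"
proof (intro frechet_space.intro frechet_space_axioms.intro)
  show "Module.module complex_talg V" by (rule vspace_axioms[unfolded vspace_def])
  show "\<exists>P. countable P \<and> (\<forall>p\<in>P. seminorm V p) \<and> topo V = lc_topology V P"
    using topo_eq seminorm_p by (intro exI[of _ "range p"]) auto
  show "Hausdorff_space (topo V)" by (rule Hausdorff)
  show "\<exists>l. limitin (topo V) s l sequentially" if "cauchy_seq V s" for s
    using complete[OF that] by (auto simp: converges_def)
qed

lemma converges_unique: "\<lbrakk>converges V s x; converges V s y\<rbrakk> \<Longrightarrow> x = y"
  unfolding converges_def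
  by (elim conjE) (rule limitin_Hausdorff_unique[OF _ _ trivial_limit_sequentially Hausdorff])

end

text \<open>The form in which absolute convergence of series is used: \<open>f k\<close> consists of the partial sums of
  a convergent real series. The estimate for the \<open>k\<close>-th seminorm is only needed from index \<open>k\<close> on,
  where it may be deduced from one for a larger seminorm.\<close>

lemma (in seminormed_space) cauchy_seq_majorized:
  assumes s: "\<And>n. s n \<in> carrier V"
    and major: "\<And>k m n. k \<le> n \<Longrightarrow> n \<le> m \<Longrightarrow> p k (s m \<ominus> s n) \<le> f k m - f k n"
    and conv: "\<And>k. convergent (f k)"
  shows "cauchy_seq V s"
  unfolding cauchy_seq_iff
proof (intro conjI allI impI)
  show "s n \<in> carrier V" for n by (rule s)
  fix k and e :: real assume e: "e > 0"
  have "Cauchy (f k)" using conv by (simp add: convergent_Cauchy)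
  then obtain N where N: "\<forall>m\<ge>N. \<forall>n\<ge>N. dist (f k m) (f k n) < e"
    using e unfolding Cauchy_def by blast
  have *: "p k (s m \<ominus> s n) < e" if "n \<ge> max N k" "m \<ge> n" for m n
  proof -
    have "p k (s m \<ominus> s n) \<le> f k m - f k n" using that by (intro major) auto
    also have "\<dots> < e"
    proof -
      have "dist (f k m) (f k n) < e" using N that by simp
      thus ?thesis by (simp add: dist_real_def abs_less_iff)
    qed
    finally show ?thesis .
  qed
  show "\<exists>N. \<forall>m\<ge>N. \<forall>n\<ge>N. p k (s m \<ominus> s n) < e"
  proof (intro exI[of _ "max N k"] allI impI)
    fix m n assume mn: "max N k \<le> m" "max N k \<le> n"
    show "p k (s m \<ominus> s n) < e"
    proof (cases "n \<le> m")
      case True thus ?thesis using * mn by simp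
    next
      case False
      hence "p k (s n \<ominus> s m) < e" using * mn by simp
      thus ?thesis using p_diff_commute[OF s s] by simp
    qed
  qed
qed

lemma (in seminormed_space) cauchy_seq_fast:
  assumes s: "\<And>n. s n \<in> carrier V"
    and fast: "\<And>n. p n (s (Suc n) \<ominus> s n) \<le> c * (1 / 2) ^ n"
  shows "cauchy_seq V s"
proof -
  define f where "f = (\<lambda>n. \<Sum>i<n. c * (1 / 2 :: real) ^ i)"
  have "summable (\<lambda>i. c * (1 / 2 :: real) ^ i)"
    by (intro summable_mult) (simp add: summable_geometric)
  hence f: "convergent f" unfolding f_def summable_iff_convergent .
  show ?thesis
  proof (rule cauchy_seq_majorized[OF s _ f])
  show "p k (s m \<ominus> s n) \<le> f m - f n" if "k \<le> n" "n \<le> m" for k m n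
    using that(2)
  proof (induction m rule: dec_induct)
    case base
    show ?case using s by simp
  next
    case (step m)
    have "p k (s (Suc m) \<ominus> s n) \<le> p k (s (Suc m) \<ominus> s m) + p k (s m \<ominus> s n)"
      by (rule p_diff_triangle[OF s s s])
    also have "p k (s (Suc m) \<ominus> s m) \<le> p m (s (Suc m) \<ominus> s m)"
      using s step that by (intro p_mono) auto
    also have "\<dots> \<le> c * (1 / 2) ^ m" by (rule fast)
    finally show ?case using step.IH by (simp add: f_def)
  qed
  qed
qed

text \<open>Completeness can be tested on rapidly converging sequences, because every Cauchy sequence
  has a rapidly converging subsequence.\<close>

lemma (in seminormed_space) complete_if_fast:
  assumes fast: "\<And>s. \<lbrakk>\<And>n. s n \<in> carrier V; \<And>n. p n (s (Suc n) \<ominus> s n) < (1 / 2) ^ n\<rbrakk>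
      \<Longrightarrow> \<exists>l. converges V s l"
    and s: "cauchy_seq V s"
  shows "\<exists>l. converges V s l"
proof -
  have sc: "\<And>n. s n \<in> carrier V" using s by (simp add: cauchy_seq_iff)
  have "\<forall>k. \<exists>N. \<forall>m\<ge>N. \<forall>n\<ge>N. p k (s m \<ominus> s n) < (1 / 2) ^ k"
    using s unfolding cauchy_seq_iff by simp
  then obtain N where N: "\<And>k m n. m \<ge> N k \<Longrightarrow> n \<ge> N k \<Longrightarrow> p k (s m \<ominus> s n) < (1 / 2) ^ k"
    by metis
  \<comment> \<open>the summand \<open>k\<close> makes the chosen indices unbounded even if those given by \<open>N\<close> are not\<close>
  define \<sigma> where "\<sigma> k = k + (\<Sum>i\<le>k. N i)" for k
  have \<sigma>: "\<sigma> k \<ge> N k" "\<sigma> (Suc k) \<ge> N k" "\<sigma> k \<ge> k" for k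
  proof -
    have "N k \<le> (\<Sum>i\<le>k. N i)" by (intro member_le_sum) auto
    thus "\<sigma> k \<ge> N k" "\<sigma> (Suc k) \<ge> N k" "\<sigma> k \<ge> k" by (auto simp: \<sigma>_def)
  qed
  obtain l where l: "converges V (\<lambda>k. s (\<sigma> k)) l"
    using fast[of "\<lambda>k. s (\<sigma> k)"] N \<sigma> sc by blast
  have lc: "l \<in> carrier V" by (rule convergesD(2)[OF l])
  have "converges V s l"
  proof (rule convergesI[OF sc lc])
    fix k
    show "(\<lambda>n. p k (s n \<ominus> l)) \<longlonglongrightarrow> 0"
    proof (rule LIMSEQ_I)
      fix e :: real assume e: "e > 0"
      obtain M where M: "\<And>m n. m \<ge> M \<Longrightarrow> n \<ge> M \<Longrightarrow> p k (s m \<ominus> s n) < e / 2"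
        using s e unfolding cauchy_seq_iff by (meson half_gt_zero)
      obtain M' where M': "\<And>m. m \<ge> M' \<Longrightarrow> norm (p k (s (\<sigma> m) \<ominus> l) - 0) < e / 2"
        using LIMSEQ_D[OF convergesD(3)[OF l, of k], of "e / 2"] e by auto
      define m where "m = max M M'"
      have m: "\<sigma> m \<ge> M" "m \<ge> M'" using \<sigma>(3)[of m] by (auto simp: m_def)
      have "norm (p k (s n \<ominus> l) - 0) < e" if "n \<ge> M" for n
      proof -
        have "p k (s n \<ominus> l) \<le> p k (s n \<ominus> s (\<sigma> m)) + p k (s (\<sigma> m) \<ominus> l)"
          by (rule p_diff_triangle[OF sc sc lc])
        thus ?thesis using M[OF that m(1)] M'[OF m(2)] sc lc by simp
      qed
      thus "\<exists>M. \<forall>n\<ge>M. norm (p k (s n \<ominus> l) - 0) < e" by blast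
    qed
  qed
  thus ?thesis ..
qed

section \<open>Total and generating sets\<close>

text \<open>Density of the span of a set and topological generation of an algebra are phrased as induction
  principles: a closed subspace (subalgebra) that contains the set is everything.\<close>

definition closed_subspace :: "'a talg \<Rightarrow> 'a set \<Rightarrow> bool" where
  "closed_subspace V M \<longleftrightarrow> M \<subseteq> carrier V \<and> \<zero>\<^bsub>V\<^esub> \<in> M \<and>
    (\<forall>x\<in>M. \<forall>y\<in>M. x \<oplus>\<^bsub>V\<^esub> y \<in> M) \<and> (\<forall>c. \<forall>x\<in>M. c \<odot>\<^bsub>V\<^esub> x \<in> M) \<and>
    (\<forall>s l. (\<forall>n. s n \<in> M) \<and> converges V s l \<longrightarrow> l \<in> M)"

definition total :: "'a talg \<Rightarrow> 'a set \<Rightarrow> bool" where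
  "total V G \<longleftrightarrow> G \<subseteq> carrier V \<and> (\<forall>M. closed_subspace V M \<and> G \<subseteq> M \<longrightarrow> carrier V \<subseteq> M)"

lemma total_induct:
  assumes "total V G" "x \<in> carrier V" "closed_subspace V {x \<in> carrier V. Q x}"
    "\<And>g. g \<in> G \<Longrightarrow> Q g"
  shows "Q x"
  using assms unfolding total_def by blast

definition closed_subalgebra :: "'a talg \<Rightarrow> 'a set \<Rightarrow> bool" where
  "closed_subalgebra A M \<longleftrightarrow> closed_subspace A M \<and> \<one>\<^bsub>A\<^esub> \<in> M \<and> (\<forall>x\<in>M. \<forall>y\<in>M. x \<otimes>\<^bsub>A\<^esub> y \<in> M)"

definition generates :: "'a talg \<Rightarrow> 'a set \<Rightarrow> bool" where
  "generates A G \<longleftrightarrow> G \<subseteq> carrier A \<and> (\<forall>M. closed_subalgebra A M \<and> G \<subseteq> M \<longrightarrow> carrier A \<subseteq> M)"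

lemma closed_subspace_equalizer:
  assumes V: "seminormed_space V p" and W: "complete_space W q"
    and f: "cont_linear V W f" and g: "cont_linear V W g"
  shows "closed_subspace V {x \<in> carrier V. f x = g x}"
proof -
  interpret V: seminormed_space V p by fact
  interpret W: complete_space W q by fact
  have lf: "linear_on V W f" and lg: "linear_on V W g" using f g by (auto simp: cont_linear_iff)
  show ?thesis
    unfolding closed_subspace_def
  proof (intro conjI ballI allI impI)
    show "\<zero>\<^bsub>V\<^esub> \<in> {x \<in> carrier V. f x = g x}"
      using linear_on_zero[OF lf V.vspace_axioms W.vspace_axioms]
        linear_on_zero[OF lg V.vspace_axioms W.vspace_axioms] by simp
    fix x y assume "x \<in> {x \<in> carrier V. f x = g x}" "y \<in> {x \<in> carrier V. f x = g x}"
    thus "x \<oplus>\<^bsub>V\<^esub> y \<in> {x \<in> carrier V. f x = g x}"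
      by (simp add: linear_onD(2)[OF lf] linear_onD(2)[OF lg])
  next
    fix c x assume "x \<in> {x \<in> carrier V. f x = g x}"
    thus "c \<odot>\<^bsub>V\<^esub> x \<in> {x \<in> carrier V. f x = g x}"
      by (simp add: linear_onD(3)[OF lf] linear_onD(3)[OF lg])
  next
    fix s l assume sl: "(\<forall>n. s n \<in> {x \<in> carrier V. f x = g x}) \<and> converges V s l"
    hence l: "converges V s l" and eq: "(\<lambda>n. f (s n)) = (\<lambda>n. g (s n))" by auto
    have "f l = g l"
      using W.converges_unique[OF cont_linear_converges[OF f l]] cont_linear_converges[OF g l]
      unfolding eq .
    thus "l \<in> {x \<in> carrier V. f x = g x}" using V.convergesD(2)[OF l] by simp
  qed auto
qed

lemma cont_linear_eq_on_total:
  assumes "seminormed_space V p" "complete_space W q" "cont_linear V W f" "cont_linear V W g"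
    and "total V G" "\<And>x. x \<in> G \<Longrightarrow> f x = g x" "x \<in> carrier V"
  shows "f x = g x"
  by (rule total_induct[OF assms(5,7) closed_subspace_equalizer[OF assms(1-4)] assms(6)])

section \<open>Algebras with submultiplicative seminorms\<close>

locale seminormed_algebra = seminormed_space V p + calgebra V
    for V :: "'a talg" (structure) and p +
  assumes p_mult: "\<lbrakk>x \<in> carrier V; y \<in> carrier V\<rbrakk> \<Longrightarrow> p k (x \<otimes> y) \<le> p k x * p k y"
begin

lemma p_mult_diff_le:
  assumes "x \<in> carrier V" "y \<in> carrier V" "x' \<in> carrier V" "y' \<in> carrier V"
  shows "p k ((x \<otimes> y) \<ominus> (x' \<otimes> y')) \<le> p k (x \<ominus> x') * p k y + p k x' * p k (y \<ominus> y')"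
proof -
  have "p k ((x \<otimes> y) \<ominus> (x' \<otimes> y')) \<le> p k ((x \<ominus> x') \<otimes> y) + p k (x' \<otimes> (y \<ominus> y'))"
    using assms by (simp add: mult_diff_mult p_triangle)
  also have "\<dots> \<le> p k (x \<ominus> x') * p k y + p k x' * p k (y \<ominus> y')"
    using assms by (intro add_mono p_mult) auto
  finally show ?thesis .
qed

lemma converges_mult:
  assumes s: "converges V s x" and t: "converges V t y"
  shows "converges V (\<lambda>n. s n \<otimes> t n) (x \<otimes> y)"
proof (rule convergesI)
  note c = convergesD[OF s] convergesD[OF t]
  show "s n \<otimes> t n \<in> carrier V" "x \<otimes> y \<in> carrier V" for n using c(1,2,4,5) by auto
  show "(\<lambda>n. p k (s n \<otimes> t n \<ominus> x \<otimes> y)) \<longlonglongrightarrow> 0" for k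
  proof (rule tendsto_zero_le)
    have "(\<lambda>n. p k (s n \<ominus> x) * p k (t n) + p k x * p k (t n \<ominus> y)) \<longlonglongrightarrow> 0 * p k y + p k x * 0"
      by (intro tendsto_intros c(3,6) converges_p[OF t])
    thus "(\<lambda>n. p k (s n \<ominus> x) * p k (t n) + p k x * p k (t n \<ominus> y)) \<longlonglongrightarrow> 0" by simp
    show "p k (s n \<otimes> t n \<ominus> x \<otimes> y) \<le> p k (s n \<ominus> x) * p k (t n) + p k x * p k (t n \<ominus> y)" for n
      by (rule p_mult_diff_le[OF c(1) c(4) c(2) c(5)])
    show "0 \<le> p k (s n \<otimes> t n \<ominus> x \<otimes> y)" for n using c(1,2,4,5) by simp
  qed
qed

lemma continuous_mult:
  "continuous_map (prod_topology (topo V) (topo V)) (topo V) (\<lambda>(x, y). x \<otimes> y)"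
  unfolding continuous_map_def
proof (intro conjI allI impI)
  show "(\<lambda>(x, y). x \<otimes> y) \<in> topspace (prod_topology (topo V) (topo V)) \<rightarrow> topspace (topo V)"
    by auto
  fix U assume U: "openin (topo V) U"
  show "openin (prod_topology (topo V) (topo V))
      {z \<in> topspace (prod_topology (topo V) (topo V)). (case z of (x, y) \<Rightarrow> x \<otimes> y) \<in> U}"
    unfolding openin_prod_topology_alt
  proof (intro allI impI)
    fix x0 y0 assume "(x0, y0) \<in> {z \<in> topspace (prod_topology (topo V) (topo V)). (case z of (x, y) \<Rightarrow> x \<otimes> y) \<in> U}"
    hence c: "x0 \<in> carrier V" "y0 \<in> carrier V" "x0 \<otimes> y0 \<in> U" by auto
    obtain k r where r: "r > 0" "{y \<in> carrier V. p k (y \<ominus> x0 \<otimes> y0) < r} \<subseteq> U"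
      using U c(3) unfolding openin_iff by metis
    define D where "D = p k y0 + p k x0 + 2"
    have D: "D > 0" using p_nonneg[OF c(1), of k] p_nonneg[OF c(2), of k] by (simp add: D_def)
    define d where "d = min 1 (r / D)"
    have d: "0 < d" "d \<le> 1" "d * D \<le> r" using r(1) D by (auto simp: d_def min_def field_simps)
    let ?X = "{y \<in> carrier V. p k (y \<ominus> x0) < d}" and ?Y = "{y \<in> carrier V. p k (y \<ominus> y0) < d}"
    have "x \<otimes> y \<in> U" if xy: "x \<in> ?X" "y \<in> ?Y" for x y
    proof -
      have xc: "x \<in> carrier V" "y \<in> carrier V" "p k (x \<ominus> x0) < d" "p k (y \<ominus> y0) < d" using xy by auto
      have y: "p k y \<le> p k y0 + 1" using p_le_add_diff[OF xc(2) c(2), of k] xc d by linarith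
      have "p k (x \<otimes> y \<ominus> x0 \<otimes> y0) \<le> p k (x \<ominus> x0) * p k y + p k x0 * p k (y \<ominus> y0)"
        by (rule p_mult_diff_le[OF xc(1,2) c(1,2)])
      also have "\<dots> \<le> d * (p k y0 + 1) + p k x0 * d"
        using xc c d y by (intro add_mono mult_mono) auto
      also have "\<dots> < d * D" using d by (simp add: D_def algebra_simps)
      also have "\<dots> \<le> r" by (rule d)
      finally have "x \<otimes> y \<in> {y \<in> carrier V. p k (y \<ominus> x0 \<otimes> y0) < r}" using xc by auto
      thus ?thesis using r(2) by blast
    qed
    hence "?X \<times> ?Y \<subseteq> {z \<in> topspace (prod_topology (topo V) (topo V)). (case z of (x, y) \<Rightarrow> x \<otimes> y) \<in> U}"
      by auto
    moreover have "x0 \<in> ?X" "y0 \<in> ?Y" using c d by auto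
    ultimately show "\<exists>X Y. openin (topo V) X \<and> openin (topo V) Y \<and> x0 \<in> X \<and> y0 \<in> Y \<and>
        X \<times> Y \<subseteq> {z \<in> topspace (prod_topology (topo V) (topo V)). (case z of (x, y) \<Rightarrow> x \<otimes> y) \<in> U}"
      using openin_ball[OF c(1), of k d] openin_ball[OF c(2), of k d]
      by (intro exI[of _ ?X] exI[of _ ?Y] conjI)
  qed
qed

end

locale complete_algebra = complete_space V p + seminormed_algebra V p
  for V :: "'a talg" (structure) and p
begin

lemma frechet_algebra: "frechet_algebra V"
  using scale_mult_left scale_mult_right continuous_mult
  by (intro frechet_algebra.intro frechet_space frechet_algebra_axioms.intro ring_axioms)

lemma frechet_arens_michael: "frechet_arens_michael V"
proof (intro frechet_arens_michael.intro frechet_algebra frechet_arens_michael_axioms.intro)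
  show "\<exists>P. (\<forall>p\<in>P. seminorm V p \<and> submultiplicative V p) \<and> topo V = lc_topology V P"
    using topo_eq seminorm_p p_mult by (intro exI[of _ "range p"]) (auto simp: submultiplicative_def)
qed

end

lemma cont_linear_mult_left:
  assumes "seminormed_algebra A p" "a \<in> carrier A"
  shows "cont_linear A A (\<lambda>x. a \<otimes>\<^bsub>A\<^esub> x)"
proof -
  interpret seminormed_algebra A p by fact
  have "linear_on A A (\<lambda>x. a \<otimes>\<^bsub>A\<^esub> x)"
    using assms(2) by (auto simp: linear_on_def r_distr scale_mult_right)
  thus ?thesis
    by (rule cont_linearI[OF seminormed_space_axioms seminormed_space_axioms])
       (use p_mult assms(2) in metis)
qed

lemma cont_linear_mult_right:
  assumes "seminormed_algebra A p" "a \<in> carrier A"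
  shows "cont_linear A A (\<lambda>x. x \<otimes>\<^bsub>A\<^esub> a)"
proof -
  interpret seminormed_algebra A p by fact
  have "linear_on A A (\<lambda>x. x \<otimes>\<^bsub>A\<^esub> a)"
    using assms(2) by (auto simp: linear_on_def l_distr scale_mult_left)
  thus ?thesis
    by (rule cont_linearI[OF seminormed_space_axioms seminormed_space_axioms])
       (use p_mult assms(2) mult.commute in metis)
qed

text \<open>A continuous linear map is multiplicative as soon as it is so on a total set, because both
  sides of the equation are continuous and linear in each factor.\<close>

lemma mult_on_total:
  assumes A: "seminormed_algebra A p" and B: "complete_algebra B q" and f: "cont_linear A B f"
    and G: "total A G" and eq: "\<And>x y. \<lbrakk>x \<in> G; y \<in> G\<rbrakk> \<Longrightarrow> f (x \<otimes>\<^bsub>A\<^esub> y) = f x \<otimes>\<^bsub>B\<^esub> f y"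
    and x: "x \<in> carrier A" and y: "y \<in> carrier A"
  shows "f (x \<otimes>\<^bsub>A\<^esub> y) = f x \<otimes>\<^bsub>B\<^esub> f y"
proof -
  interpret A: seminormed_algebra A p by fact
  interpret B: complete_algebra B q by fact
  have GA: "G \<subseteq> carrier A" using G by (simp add: total_def)
  have fc: "f z \<in> carrier B" if "z \<in> carrier A" for z
    using f that linear_onD(1) by (metis cont_linear_iff)
  have 1: "f (x \<otimes>\<^bsub>A\<^esub> y) = f x \<otimes>\<^bsub>B\<^esub> f y" if "x \<in> carrier A" "y \<in> G" for x y
  proof (rule cont_linear_eq_on_total[OF A.seminormed_space_axioms B.complete_space_axioms _ _ G _ that(1)])
    have yc: "y \<in> carrier A" using GA that by blast
    show "cont_linear A B (\<lambda>x. f (x \<otimes>\<^bsub>A\<^esub> y))"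
      by (rule cont_linear_compose[OF cont_linear_mult_right[OF A yc] f])
    show "cont_linear A B (\<lambda>x. f x \<otimes>\<^bsub>B\<^esub> f y)"
      by (rule cont_linear_compose[OF f cont_linear_mult_right[OF B.seminormed_algebra_axioms fc[OF yc]]])
    show "f (x \<otimes>\<^bsub>A\<^esub> y) = f x \<otimes>\<^bsub>B\<^esub> f y" if "x \<in> G" for x using eq that \<open>y \<in> G\<close> by blast
  qed
  show ?thesis
  proof (rule cont_linear_eq_on_total[OF A.seminormed_space_axioms B.complete_space_axioms _ _ G _ y])
    show "cont_linear A B (\<lambda>y. f (x \<otimes>\<^bsub>A\<^esub> y))"
      by (rule cont_linear_compose[OF cont_linear_mult_left[OF A x] f])
    show "cont_linear A B (\<lambda>y. f x \<otimes>\<^bsub>B\<^esub> f y)"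
      by (rule cont_linear_compose[OF f cont_linear_mult_left[OF B.seminormed_algebra_axioms fc[OF x]]])
  qed (rule 1[OF x])
qed

lemma cont_hom_if_mult_on_total:
  assumes "seminormed_algebra A p" "complete_algebra B q" "cont_linear A B f" "total A G"
    "\<And>x y. \<lbrakk>x \<in> G; y \<in> G\<rbrakk> \<Longrightarrow> f (x \<otimes>\<^bsub>A\<^esub> y) = f x \<otimes>\<^bsub>B\<^esub> f y" "f \<one>\<^bsub>A\<^esub> = \<one>\<^bsub>B\<^esub>"
  shows "cont_hom A B f"
  using mult_on_total[OF assms(1-5)] assms(3,6)
  by (auto simp: cont_hom_def ring_hom_def cont_linear_def)

lemma cont_homD:
  assumes "cont_hom A B f"
  shows "cont_linear A B f" "linear_on A B f" "x \<in> carrier A \<Longrightarrow> f x \<in> carrier B"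
    "\<lbrakk>x \<in> carrier A; y \<in> carrier A\<rbrakk> \<Longrightarrow> f (x \<otimes>\<^bsub>A\<^esub> y) = f x \<otimes>\<^bsub>B\<^esub> f y" "f \<one>\<^bsub>A\<^esub> = \<one>\<^bsub>B\<^esub>"
    "\<lbrakk>x \<in> carrier A; y \<in> carrier A\<rbrakk> \<Longrightarrow> f (x \<oplus>\<^bsub>A\<^esub> y) = f x \<oplus>\<^bsub>B\<^esub> f y"
    "x \<in> carrier A \<Longrightarrow> f (c \<odot>\<^bsub>A\<^esub> x) = c \<odot>\<^bsub>B\<^esub> f x"
  using assms unfolding cont_hom_def ring_hom_def cont_linear_iff linear_on_def by auto

lemma cont_hom_eq_on_generators:
  assumes A: "seminormed_algebra A p" and B: "complete_algebra B q"
    and f: "cont_hom A B f" and g: "cont_hom A B g"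
    and G: "generates A G" and eq: "\<And>x. x \<in> G \<Longrightarrow> f x = g x" and x: "x \<in> carrier A"
  shows "f x = g x"
proof -
  interpret A: seminormed_algebra A p by fact
  interpret B: complete_algebra B q by fact
  let ?M = "{x \<in> carrier A. f x = g x}"
  have "closed_subspace A ?M"
    by (rule closed_subspace_equalizer[OF A.seminormed_space_axioms B.complete_space_axioms
          cont_homD(1)[OF f] cont_homD(1)[OF g]])
  hence "closed_subalgebra A ?M"
    using cont_homD(4,5)[OF f] cont_homD(4,5)[OF g] by (auto simp: closed_subalgebra_def)
  moreover have "G \<subseteq> ?M" using eq G by (auto simp: generates_def)
  ultimately have "carrier A \<subseteq> ?M" using G unfolding generates_def by blast
  thus ?thesis using x by blast
qed

section \<open>Infimum seminorms\<close>

text \<open>Quotient seminorms and projective seminorms are both infima of a cost over all the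
  representatives of an element.\<close>

definition image_norm :: "'r set \<Rightarrow> ('r \<Rightarrow> 'a) \<Rightarrow> ('r \<Rightarrow> real) \<Rightarrow> 'a \<Rightarrow> real" where
  "image_norm R f c X = Inf (c ` {r \<in> R. f r = X})"

lemma image_norm_le:
  assumes "\<And>r. r \<in> R \<Longrightarrow> 0 \<le> c r" "r \<in> R"
  shows "image_norm R f c (f r) \<le> c r"
  unfolding image_norm_def using assms by (intro cInf_lower) (auto intro!: bdd_belowI[of _ 0])

lemma image_norm_lessE:
  assumes "image_norm R f c X < t" "X \<in> f ` R"
  obtains r where "r \<in> R" "f r = X" "c r < t"
  using cInf_lessD[of "c ` {r \<in> R. f r = X}" t] assms by (auto simp: image_norm_def)

lemma image_norm_greatest:
  assumes "X \<in> f ` R" "\<And>r. \<lbrakk>r \<in> R; f r = X\<rbrakk> \<Longrightarrow> t \<le> c r"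
  shows "t \<le> image_norm R f c X"
  unfolding image_norm_def using assms by (intro cInf_greatest) auto

lemma le_mult_approx:
  fixes a b x :: real
  assumes "\<And>r s. \<lbrakk>a < r; b < s\<rbrakk> \<Longrightarrow> x \<le> r * s"
  shows "x \<le> a * b"
proof (rule LIMSEQ_le_const)
  have "(\<lambda>n. (a + inverse (real (Suc n))) * (b + inverse (real (Suc n)))) \<longlonglongrightarrow> (a + 0) * (b + 0)"
    by (intro tendsto_intros LIMSEQ_inverse_real_of_nat)
  thus "(\<lambda>n. (a + inverse (real (Suc n))) * (b + inverse (real (Suc n)))) \<longlonglongrightarrow> a * b" by simp
  show "\<exists>N. \<forall>n\<ge>N. x \<le> (a + inverse (real (Suc n))) * (b + inverse (real (Suc n)))"
    by (intro exI[of _ 0] allI impI assms) auto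
qed

lemma image_norm_mult_le:
  assumes c: "\<And>r. r \<in> R \<Longrightarrow> 0 \<le> c r" and X: "X \<in> f ` R" and Y: "Y \<in> f ` R"
    and mult: "\<And>r s. \<lbrakk>r \<in> R; s \<in> R; f r = X; f s = Y\<rbrakk> \<Longrightarrow> \<exists>t\<in>R. f t = Z \<and> c t \<le> c r * c s"
  shows "image_norm R f c Z \<le> image_norm R f c X * image_norm R f c Y"
proof (rule le_mult_approx)
  fix u v assume u: "image_norm R f c X < u" and v: "image_norm R f c Y < v"
  obtain r where r: "r \<in> R" "f r = X" "c r < u" using image_norm_lessE[OF u X] .
  obtain s where s: "s \<in> R" "f s = Y" "c s < v" using image_norm_lessE[OF v Y] .
  obtain t where t: "t \<in> R" "f t = Z" "c t \<le> c r * c s" using mult r s by metis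
  have "image_norm R f c Z \<le> c t" using image_norm_le[of R c t f, OF c t(1)] t(2) by simp
  also have "\<dots> \<le> c r * c s" by (rule t)
  also have "\<dots> \<le> u * v" using r s c[of r] c[of s] by (intro mult_mono) auto
  finally show "image_norm R f c Z \<le> u * v" .
qed

lemma image_norm_seminorm:
  assumes Y: "vspace Y" and f: "f ` R = carrier Y" and c: "\<And>r. r \<in> R \<Longrightarrow> 0 \<le> c r"
    and add: "\<And>r s. \<lbrakk>r \<in> R; s \<in> R\<rbrakk> \<Longrightarrow> \<exists>t\<in>R. f t = f r \<oplus>\<^bsub>Y\<^esub> f s \<and> c t \<le> c r + c s"
    and scale: "\<And>z r. r \<in> R \<Longrightarrow> \<exists>t\<in>R. f t = z \<odot>\<^bsub>Y\<^esub> f r \<and> c t \<le> cmod z * c r"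
  shows "seminorm Y (image_norm R f c)"
proof -
  interpret vspace Y by (rule Y)
  let ?N = "image_norm R f c"
  have nonneg: "0 \<le> ?N X" if "X \<in> carrier Y" for X
    using that c by (intro image_norm_greatest) (auto simp: f)
  have scale_le: "?N (z \<odot>\<^bsub>Y\<^esub> X) \<le> cmod z * ?N X" if X: "X \<in> carrier Y" for z X
  proof (rule le_mult_approx)
    fix u v assume u: "cmod z < u" and v: "?N X < v"
    obtain r where r: "r \<in> R" "f r = X" "c r < v" using image_norm_lessE[OF v] X f by auto
    obtain t where t: "t \<in> R" "f t = z \<odot>\<^bsub>Y\<^esub> X" "c t \<le> cmod z * c r" using scale[OF r(1), of z] r(2) by auto
    have "?N (z \<odot>\<^bsub>Y\<^esub> X) \<le> c t" using image_norm_le[of R c t f, OF c t(1)] t(2) by simp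
    also have "\<dots> \<le> cmod z * c r" by (rule t)
    also have "\<dots> \<le> u * v" using u r(3) c[OF r(1)] order_trans[OF norm_ge_zero[of z]] by (intro mult_mono) auto
    finally show "?N (z \<odot>\<^bsub>Y\<^esub> X) \<le> u * v" .
  qed
  show ?thesis
    unfolding seminorm_def
  proof (intro conjI ballI allI nonneg)
    fix X Z assume X: "X \<in> carrier Y" and Z: "Z \<in> carrier Y"
    show "?N (X \<oplus>\<^bsub>Y\<^esub> Z) \<le> ?N X + ?N Z"
    proof (rule field_le_epsilon)
      fix e :: real assume e: "0 < e"
      obtain r where r: "r \<in> R" "f r = X" "c r < ?N X + e / 2"
        using image_norm_lessE[of R f c X "?N X + e / 2"] e X f by auto
      obtain s where s: "s \<in> R" "f s = Z" "c s < ?N Z + e / 2"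
        using image_norm_lessE[of R f c Z "?N Z + e / 2"] e Z f by auto
      obtain t where t: "t \<in> R" "f t = X \<oplus>\<^bsub>Y\<^esub> Z" "c t \<le> c r + c s" using add[OF r(1) s(1)] r s by auto
      have "?N (X \<oplus>\<^bsub>Y\<^esub> Z) \<le> c t" using image_norm_le[of R c t f, OF c t(1)] t(2) by simp
      thus "?N (X \<oplus>\<^bsub>Y\<^esub> Z) \<le> ?N X + ?N Z + e" using t(3) r(3) s(3) by simp
    qed
  next
    fix z X assume X: "X \<in> carrier Y"
    show "?N (z \<odot>\<^bsub>Y\<^esub> X) = cmod z * ?N X"
    proof (cases "z = 0")
      case True
      thus ?thesis using scale_le[OF X, of z] nonneg[of "z \<odot>\<^bsub>Y\<^esub> X"] X by simp
    next
      case False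
      have "?N X = ?N (inverse z \<odot>\<^bsub>Y\<^esub> (z \<odot>\<^bsub>Y\<^esub> X))" using False X by (simp add: scale_scale)
      also have "\<dots> \<le> cmod (inverse z) * ?N (z \<odot>\<^bsub>Y\<^esub> X)" using X by (intro scale_le) auto
      finally have "cmod z * ?N X \<le> ?N (z \<odot>\<^bsub>Y\<^esub> X)"
        using False by (simp add: norm_divide field_simps)
      thus ?thesis using scale_le[OF X, of z] by simp
    qed
  qed
qed

section \<open>Quotients by closed ideals\<close>

lemma (in vspace) add_diff_cancel_left':
  assumes "x \<in> carrier V" "z \<in> carrier V"
  shows "(x \<oplus> z) \<ominus> x = z"
proof -
  have "(x \<oplus> z) \<ominus> x = z \<oplus> (x \<oplus> \<ominus> x)" using assms by (simp add: a_minus_def M.a_ac)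
  thus ?thesis using assms by (simp add: M.r_neg)
qed

lemma quotient_talg_simps:
  "carrier (quotient_talg A I) = a_rcosets\<^bsub>A\<^esub> I"
  "mult (quotient_talg A I) = rcoset_mult A I"
  "one (quotient_talg A I) = I +>\<^bsub>A\<^esub> \<one>\<^bsub>A\<^esub>"
  "zero (quotient_talg A I) = I"
  "add (quotient_talg A I) = set_add A"
  "smult (quotient_talg A I) = (\<lambda>c X. \<Union>x\<in>X. I +>\<^bsub>A\<^esub> (c \<odot>\<^bsub>A\<^esub> x))"
  by (simp_all add: quotient_talg_def FactRing_def)

definition quotient_norm :: "'a talg \<Rightarrow> 'a set \<Rightarrow> (nat \<Rightarrow> 'a \<Rightarrow> real) \<Rightarrow> nat \<Rightarrow> 'a set \<Rightarrow> real" where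
  "quotient_norm A I p k = image_norm (carrier A) ((+>\<^bsub>A\<^esub>) I) (p k)"

locale closed_ideal_quotient = complete_algebra A p for A :: "'a talg" (structure) and p +
  fixes I
  assumes closed_ideal: "closed_ideal I A"
begin

sublocale Id: ideal I A
  using closed_ideal by (simp add: closed_ideal_def)

abbreviation "Q \<equiv> quotient_talg A I"
abbreviation "proj x \<equiv> I +> x"
abbreviation "pq \<equiv> quotient_norm A I p"

lemma proj_surj: "proj ` carrier A = carrier Q"
  by (auto simp: quotient_talg_simps A_RCOSETS_def')

lemma projE:
  assumes "X \<in> carrier Q"
  obtains x where "x \<in> carrier A" "proj x = X"
  using assms unfolding proj_surj[symmetric] by (elim imageE) simp

lemma proj_eq_iff:
  "\<lbrakk>x \<in> carrier A; y \<in> carrier A\<rbrakk> \<Longrightarrow> proj x = proj y \<longleftrightarrow> x \<ominus> y \<in> I"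
  using Id.a_rcos_module_minus[OF ring_axioms, of y x] Id.a_repr_independence'[of x y]
    Id.a_repr_independenceD[of y x] Id.a_rcos_self[of x]
  by (auto simp: Id.abelian_subgroup_axioms M.abelian_group_axioms)

lemma scale_in_ideal: "x \<in> I \<Longrightarrow> c \<odot> x \<in> I"
  using Id.I_l_closed[of x "c \<odot> \<one>"] Id.Icarr[of x] by (simp add: scale_mult_left)

lemma proj_scale: "x \<in> carrier A \<Longrightarrow> proj (c \<odot> x) = c \<odot>\<^bsub>Q\<^esub> proj x"
proof -
  assume x: "x \<in> carrier A"
  have "proj (c \<odot> y) = proj (c \<odot> x)" if y: "y \<in> proj x" for y
  proof -
    have yc: "y \<in> carrier A" using y a_r_coset_subset_G[OF Id.a_subset x] by blast
    have "y \<ominus> x \<in> I" using y x yc Id.a_rcos_module_minus[OF ring_axioms x yc] by simp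
    thus ?thesis using x yc scale_in_ideal[of "y \<ominus> x" c]
      by (simp add: proj_eq_iff scale_minus_distrib)
  qed
  moreover have "x \<in> proj x" by (rule Id.a_rcos_self[OF x])
  ultimately have "(\<Union>y\<in>proj x. proj (c \<odot> y)) = proj (c \<odot> x)" by blast
  thus ?thesis by (simp only: quotient_talg_simps)
qed

lemma proj_add: "\<lbrakk>x \<in> carrier A; y \<in> carrier A\<rbrakk> \<Longrightarrow> proj (x \<oplus> y) = proj x \<oplus>\<^bsub>Q\<^esub> proj y"
  by (simp add: quotient_talg_simps Id.a_rcos_sum)

lemma proj_mult: "\<lbrakk>x \<in> carrier A; y \<in> carrier A\<rbrakk> \<Longrightarrow> proj (x \<otimes> y) = proj x \<otimes>\<^bsub>Q\<^esub> proj y"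
  by (simp add: quotient_talg_simps Id.rcoset_mult_add)

lemma proj_zero: "proj \<zero> = \<zero>\<^bsub>Q\<^esub>"
  by (simp add: quotient_talg_simps a_coset_add_zero[OF Id.a_subset])

lemma calgebra_Q: "calgebra Q"
  by (rule calgebra_image[of A proj])
     (use proj_add proj_mult proj_zero proj_scale proj_surj in
       \<open>auto simp: calgebra_axioms quotient_talg_simps(3)\<close>)

sublocale Q: calgebra Q by (rule calgebra_Q)

lemma linear_proj: "linear_on A Q proj"
  using proj_surj by (auto simp: linear_on_def proj_add proj_scale)

lemma proj_minus: "\<lbrakk>x \<in> carrier A; y \<in> carrier A\<rbrakk> \<Longrightarrow> proj (x \<ominus> y) = proj x \<ominus>\<^bsub>Q\<^esub> proj y"
  by (rule linear_on_minus[OF linear_proj vspace_axioms Q.vspace_axioms])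

lemma pq_le: "x \<in> carrier A \<Longrightarrow> pq k (proj x) \<le> p k x"
  unfolding quotient_norm_def by (rule image_norm_le) auto

lemma pq_lessE:
  assumes "pq k X < t" "X \<in> carrier Q"
  obtains x where "x \<in> carrier A" "proj x = X" "p k x < t"
  using image_norm_lessE[of "carrier A" proj "p k" X t] assms proj_surj
  by (auto simp: quotient_norm_def)

lemma seminorm_pq: "seminorm Q (pq k)"
  unfolding quotient_norm_def
proof (rule image_norm_seminorm[OF Q.vspace_axioms proj_surj])
  fix r s assume "r \<in> carrier A" "s \<in> carrier A"
  thus "\<exists>t\<in>carrier A. proj t = proj r \<oplus>\<^bsub>Q\<^esub> proj s \<and> p k t \<le> p k r + p k s"
    by (intro bexI[of _ "r \<oplus> s"]) (auto simp: proj_add p_triangle)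
next
  fix z r assume "r \<in> carrier A"
  thus "\<exists>t\<in>carrier A. proj t = z \<odot>\<^bsub>Q\<^esub> proj r \<and> p k t \<le> cmod z * p k r"
    by (intro bexI[of _ "z \<odot> r"]) (auto simp: proj_scale p_scale)
qed auto

lemma pq_Suc: "X \<in> carrier Q \<Longrightarrow> pq k X \<le> pq (Suc k) X"
proof -
  assume X: "X \<in> carrier Q"
  show ?thesis
    unfolding quotient_norm_def[of _ _ _ "Suc k"]
  proof (rule image_norm_greatest)
    show "X \<in> proj ` carrier A" using X proj_surj by simp
    fix r assume "r \<in> carrier A" "proj r = X"
    thus "pq k X \<le> p (Suc k) r" using pq_le[of r k] p_Suc[of r k] by auto
  qed
qed

lemma pq_mult: "\<lbrakk>X \<in> carrier Q; Y \<in> carrier Q\<rbrakk> \<Longrightarrow> pq k (X \<otimes>\<^bsub>Q\<^esub> Y) \<le> pq k X * pq k Y"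
  unfolding quotient_norm_def
proof (rule image_norm_mult_le)
  fix r s assume "r \<in> carrier A" "s \<in> carrier A" "proj r = X" "proj s = Y"
  thus "\<exists>t\<in>carrier A. proj t = X \<otimes>\<^bsub>Q\<^esub> Y \<and> p k t \<le> p k r * p k s"
    by (intro bexI[of _ "r \<otimes> s"] conjI) (simp_all add: proj_mult p_mult)
qed (simp_all add: proj_surj)

lemma openin_Q_iff:
  "openin (topo Q) U \<longleftrightarrow> U \<subseteq> carrier Q \<and> openin (topo A) {x \<in> carrier A. proj x \<in> U}"
proof -
  have "istopology (\<lambda>U. U \<subseteq> carrier Q \<and> openin (topo A) {x \<in> carrier A. proj x \<in> U})"
    unfolding istopology_def
  proof (intro conjI allI impI)
    fix S T assume "S \<subseteq> carrier Q \<and> openin (topo A) {x \<in> carrier A. proj x \<in> S}"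
      and "T \<subseteq> carrier Q \<and> openin (topo A) {x \<in> carrier A. proj x \<in> T}"
    moreover have "{x \<in> carrier A. proj x \<in> S \<inter> T} = {x \<in> carrier A. proj x \<in> S} \<inter> {x \<in> carrier A. proj x \<in> T}"
      by auto
    ultimately show "S \<inter> T \<subseteq> carrier Q" "openin (topo A) {x \<in> carrier A. proj x \<in> S \<inter> T}"
      by (auto intro: openin_Int)
  next
    fix \<K> assume K: "\<forall>K\<in>\<K>. K \<subseteq> carrier Q \<and> openin (topo A) {x \<in> carrier A. proj x \<in> K}"
    thus "\<Union>\<K> \<subseteq> carrier Q" by blast
    have "{x \<in> carrier A. proj x \<in> \<Union>\<K>} = (\<Union>K\<in>\<K>. {x \<in> carrier A. proj x \<in> K})" by auto
    thus "openin (topo A) {x \<in> carrier A. proj x \<in> \<Union>\<K>}" using K by auto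
  qed
  thus ?thesis by (simp add: quotient_talg_def)
qed

lemma openin_lc_pq:
  "openin (lc_topology Q (range pq)) U \<longleftrightarrow> U \<subseteq> carrier Q \<and>
    (\<forall>X\<in>U. \<exists>k r. 0 < r \<and> {Y \<in> carrier Q. pq k (Y \<ominus>\<^bsub>Q\<^esub> X) < r} \<subseteq> U)"
  by (rule openin_lc_topology_range[OF Q.vspace_axioms]) (rule pq_Suc)

text \<open>A seminorm value below \<open>r\<close> in the quotient is attained by a representative with value below
  \<open>r\<close>, so the balls of the quotient seminorms are the images of balls.\<close>

lemma topo_Q: "topo Q = lc_topology Q (range pq)"
proof (rule topology_eq[THEN iffD2], intro allI iffI)
  fix U assume U: "openin (topo Q) U"
  show "openin (lc_topology Q (range pq)) U"
    unfolding openin_lc_pq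
  proof (intro conjI ballI)
    show UQ: "U \<subseteq> carrier Q" using U by (simp add: openin_Q_iff)
    fix X assume X: "X \<in> U"
    obtain x where x: "x \<in> carrier A" "proj x = X" using projE[OF subsetD[OF UQ X]] .
    obtain k r where r: "0 < r" "{y \<in> carrier A. p k (y \<ominus> x) < r} \<subseteq> {x \<in> carrier A. proj x \<in> U}"
      using U x X unfolding openin_Q_iff openin_iff by blast
    have "Y \<in> U" if Y: "Y \<in> carrier Q" "pq k (Y \<ominus>\<^bsub>Q\<^esub> X) < r" for Y
    proof -
      have XQ: "X \<in> carrier Q" using X UQ by blast
      obtain z where z: "z \<in> carrier A" "proj z = Y \<ominus>\<^bsub>Q\<^esub> X" "p k z < r"
        using pq_lessE[OF Y(2)] Y(1) XQ by auto
      have "(x \<oplus> z) \<ominus> x = z" by (rule add_diff_cancel_left'[OF x(1) z(1)])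
      hence "x \<oplus> z \<in> {y \<in> carrier A. p k (y \<ominus> x) < r}" using x z by simp
      hence "proj (x \<oplus> z) \<in> U" using r(2) by blast
      moreover have "proj (x \<oplus> z) = Y" using x z Y XQ by (simp add: proj_add Q.add_minus_cancel)
      ultimately show ?thesis by simp
    qed
    thus "\<exists>k r. 0 < r \<and> {Y \<in> carrier Q. pq k (Y \<ominus>\<^bsub>Q\<^esub> X) < r} \<subseteq> U"
      using r(1) by (intro exI[of _ k] exI[of _ r]) auto
  qed
next
  fix U assume U: "openin (lc_topology Q (range pq)) U"
  have UQ: "U \<subseteq> carrier Q" and
    ball: "\<And>X. X \<in> U \<Longrightarrow> \<exists>k r. 0 < r \<and> {Y \<in> carrier Q. pq k (Y \<ominus>\<^bsub>Q\<^esub> X) < r} \<subseteq> U"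
    using U unfolding openin_lc_pq by auto
  show "openin (topo Q) U"
    unfolding openin_Q_iff openin_iff
  proof (intro conjI ballI UQ)
    fix x assume "x \<in> {x \<in> carrier A. proj x \<in> U}"
    hence x: "x \<in> carrier A" "proj x \<in> U" by auto
    obtain k r where r: "0 < r" "{Y \<in> carrier Q. pq k (Y \<ominus>\<^bsub>Q\<^esub> proj x) < r} \<subseteq> U"
      using ball[OF x(2)] by blast
    have "proj y \<in> U" if y: "y \<in> carrier A" "p k (y \<ominus> x) < r" for y
    proof -
      have "pq k (proj y \<ominus>\<^bsub>Q\<^esub> proj x) < r"
        using pq_le[of "y \<ominus> x" k] y x by (simp add: proj_minus)
      thus ?thesis using r(2) y(1) proj_surj by blast
    qed
    thus "\<exists>k r. 0 < r \<and> {y \<in> carrier A. p k (y \<ominus> x) < r} \<subseteq> {x \<in> carrier A. proj x \<in> U}"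
      using r(1) by (intro exI[of _ k] exI[of _ r]) auto
  qed auto
qed

lemma seminormed_algebra_Q: "seminormed_algebra Q pq"
  by (intro seminormed_algebra.intro seminormed_space.intro seminormed_space_axioms.intro
      seminormed_algebra_axioms.intro Q.vspace_axioms Q.calgebra_axioms seminorm_pq pq_Suc topo_Q pq_mult)

sublocale Q: seminormed_algebra Q pq by (rule seminormed_algebra_Q)

lemma cont_hom_proj: "cont_hom A Q proj"
proof -
  have "cont_linear A Q proj"
    by (rule cont_linearI[OF seminormed_space_axioms Q.seminormed_space_axioms linear_proj])
       (use pq_le in \<open>metis mult_1\<close>)
  thus ?thesis using proj_surj by (auto simp: cont_hom_def ring_hom_def proj_mult proj_add quotient_talg_simps(3))
qed

text \<open>The quotient is separated because the ideal is closed. It is complete because the increments of a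
  rapidly converging sequence have representatives of almost the same size, which sum to a
  convergent sequence upstairs.\<close>

lemma complete_algebra_Q: "complete_algebra Q pq"
proof (intro complete_algebra.intro complete_space.intro complete_space_axioms.intro
    seminormed_algebra_Q Q.seminormed_space_axioms)
  fix X assume X: "X \<in> carrier Q" and z: "\<And>k. pq k X = 0"
  obtain x where x: "x \<in> carrier A" "proj x = X" using projE[OF X] .
  have "\<exists>y. y \<in> carrier A \<and> proj y = X \<and> p k y < (1 / 2) ^ k" for k
  proof -
    have "pq k X < (1 / 2) ^ k" using z by simp
    thus ?thesis using pq_lessE[OF _ X] by metis
  qed
  then obtain y where y: "\<And>k. y k \<in> carrier A" "\<And>k. proj (y k) = X" "\<And>k. p k (y k) < (1 / 2) ^ k"
    by metis
  have "converges A (\<lambda>n. x \<ominus> y n) x"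
  proof (rule convergesI)
    fix k
    show "(\<lambda>n. p k (x \<ominus> y n \<ominus> x)) \<longlonglongrightarrow> 0"
    proof (rule tendsto_sandwich)
      show "(\<lambda>n. 0 :: real) \<longlonglongrightarrow> 0" by simp
      show "(\<lambda>n. (1 / 2 :: real) ^ n) \<longlonglongrightarrow> 0" by (rule LIMSEQ_realpow_zero) auto
      show "\<forall>\<^sub>F n in sequentially. 0 \<le> p k (x \<ominus> y n \<ominus> x)" using x y by auto
      show "\<forall>\<^sub>F n in sequentially. p k (x \<ominus> y n \<ominus> x) \<le> (1 / 2) ^ n"
        unfolding eventually_sequentially
      proof (intro exI[of _ k] allI impI)
        fix n assume n: "k \<le> n"
        have "x \<ominus> y n \<ominus> x = \<ominus> y n" 
          using x(1) y(1)[of n] add_diff_cancel_left'[of x "\<ominus> y n"] by (simp add: a_minus_def)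
        hence "p k (x \<ominus> y n \<ominus> x) = p k (y n)" using y by (simp add: p_uminus)
        also have "\<dots> \<le> p n (y n)" using n y by (intro p_mono)
        also have "\<dots> \<le> (1 / 2) ^ n" using y(3)[of n] by simp
        finally show "p k (x \<ominus> y n \<ominus> x) \<le> (1 / 2) ^ n" .
      qed
    qed
  qed (use x y in auto)
  hence "limitin (topo A) (\<lambda>n. x \<ominus> y n) x sequentially" by (simp add: converges_def)
  moreover have "x \<ominus> y n \<in> I" for n using proj_eq_iff[OF x(1) y(1)[of n]] x y by simp
  ultimately have "x \<in> I"
    using closed_ideal limitin_closedin[of "topo A" "\<lambda>n. x \<ominus> y n" x sequentially I]
    by (simp add: closed_ideal_def)
  thus "X = \<zero>\<^bsub>Q\<^esub>" using x proj_eq_iff[of x \<zero>] by (simp add: proj_zero)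
next
  fix s assume s: "cauchy_seq Q s"
  show "\<exists>l. converges Q s l"
  proof (rule Q.complete_if_fast[OF _ s])
    fix s assume sc: "\<And>n. s n \<in> carrier Q"
      and fast: "\<And>n. pq n (s (Suc n) \<ominus>\<^bsub>Q\<^esub> s n) < (1 / 2) ^ n"
    have "\<exists>d. d \<in> carrier A \<and> proj d = s (Suc n) \<ominus>\<^bsub>Q\<^esub> s n \<and> p n d < (1 / 2) ^ n" for n
      using pq_lessE[OF fast] sc Q.minus_closed' by metis
    then obtain d where d: "\<And>n. d n \<in> carrier A" "\<And>n. proj (d n) = s (Suc n) \<ominus>\<^bsub>Q\<^esub> s n"
      "\<And>n. p n (d n) < (1 / 2) ^ n" by metis
    obtain x0 where x0: "x0 \<in> carrier A" "proj x0 = s 0" using sc[of 0] proj_surj by (metis imageE)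
    define x where "x = rec_nat x0 (\<lambda>n y. y \<oplus> d n)"
    have x_simps: "x 0 = x0" "x (Suc n) = x n \<oplus> d n" for n by (simp_all add: x_def)
    have xc: "x n \<in> carrier A" for n by (induction n) (auto simp: x_simps x0 d)
    have px: "proj (x n) = s n" for n
    proof (induction n)
      case (Suc n)
      have "proj (x (Suc n)) = s n \<oplus>\<^bsub>Q\<^esub> (s (Suc n) \<ominus>\<^bsub>Q\<^esub> s n)"
        unfolding x_simps proj_add[OF xc d(1)] Suc.IH d(2) ..
      also have "\<dots> = s (Suc n)" by (rule Q.add_minus_cancel[OF sc sc])
      finally show ?case .
    qed (simp add: x_simps x0)
    have "cauchy_seq A x"
    proof (rule cauchy_seq_fast[OF xc])
      fix n
      have "x (Suc n) \<ominus> x n = d n"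
        unfolding x_simps by (rule add_diff_cancel_left'[OF xc d(1)])
      thus "p n (x (Suc n) \<ominus> x n) \<le> 1 * (1 / 2) ^ n" using d(3)[of n] by simp
    qed
    then obtain l where "converges A x l" using complete by blast
    from cont_linear_converges[OF cont_homD(1)[OF cont_hom_proj] this]
    show "\<exists>l. converges Q s l" by (auto simp: px)
  qed
qed

text \<open>Continuity of the induced map needs no estimate: the quotient topology is final with respect to
  the projection.\<close>

lemma quotient_lift:
  assumes B: "complete_algebra B q" and f: "cont_hom A B f" and I: "\<And>x. x \<in> I \<Longrightarrow> f x = \<zero>\<^bsub>B\<^esub>"
  obtains g where "cont_hom Q B g" "\<And>x. x \<in> carrier A \<Longrightarrow> g (proj x) = f x"
proof -
  interpret B: complete_algebra B q by fact
  have eq: "f x = f y" if "x \<in> carrier A" "y \<in> carrier A" "proj x = proj y" for x y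
  proof -
    have "f (x \<ominus> y) = \<zero>\<^bsub>B\<^esub>" using that by (intro I) (simp add: proj_eq_iff)
    hence "f x \<ominus>\<^bsub>B\<^esub> f y = \<zero>\<^bsub>B\<^esub>"
      using linear_on_minus[OF cont_homD(2)[OF f] vspace_axioms B.vspace_axioms] that by simp
    thus ?thesis using B.minus_eq_zeroD cont_homD(3)[OF f] that by metis
  qed
  define g where "g X = f (SOME x. x \<in> carrier A \<and> proj x = X)" for X
  have g: "g (proj x) = f x" if "x \<in> carrier A" for x
  proof -
    have "(SOME y. y \<in> carrier A \<and> proj y = proj x) \<in> carrier A \<and>
        proj (SOME y. y \<in> carrier A \<and> proj y = proj x) = proj x"
      by (rule someI[of "\<lambda>y. y \<in> carrier A \<and> proj y = proj x" x]) (use that in simp)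
    thus ?thesis unfolding g_def using eq that by metis
  qed
  have ex: "\<exists>x. x \<in> carrier A \<and> X = proj x" if "X \<in> carrier Q" for X using that proj_surj by blast
  have lin: "linear_on Q B g"
    unfolding linear_on_def
  proof (intro conjI ballI allI Pi_I)
    fix X assume "X \<in> carrier Q"
    then obtain x where x: "x \<in> carrier A" "X = proj x" using ex by metis
    show "g X \<in> carrier B" using x g cont_homD(3)[OF f] by simp
    show "g (c \<odot>\<^bsub>Q\<^esub> X) = c \<odot>\<^bsub>B\<^esub> g X" for c
      using x g[of "c \<odot> x"] g[of x] cont_homD(7)[OF f] by (simp add: proj_scale)
    fix Y assume "Y \<in> carrier Q"
    then obtain y where y: "y \<in> carrier A" "Y = proj y" using ex by metis
    show "g (X \<oplus>\<^bsub>Q\<^esub> Y) = g X \<oplus>\<^bsub>B\<^esub> g Y"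
      using x y g[of "x \<oplus> y"] g[of x] g[of y] cont_homD(6)[OF f] by (simp add: proj_add)
  qed
  have "continuous_map (topo Q) (topo B) g"
    unfolding continuous_map_def
  proof (intro conjI allI impI)
    show "g \<in> topspace (topo Q) \<rightarrow> topspace (topo B)" using lin by (simp add: linear_on_def)
    fix U assume U: "openin (topo B) U"
    have "{x \<in> carrier A. proj x \<in> {X \<in> topspace (topo Q). g X \<in> U}} = {x \<in> topspace (topo A). f x \<in> U}"
      using g proj_surj by auto
    moreover have "openin (topo A) {x \<in> topspace (topo A). f x \<in> U}"
      using cont_homD(1)[OF f] U unfolding cont_linear_iff
      by (intro openin_continuous_map_preimage) auto
    moreover have "{X \<in> topspace (topo Q). g X \<in> U} \<subseteq> carrier Q" by auto
    ultimately show "openin (topo Q) {X \<in> topspace (topo Q). g X \<in> U}"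
      unfolding openin_Q_iff by simp
  qed
  hence "cont_linear Q B g" using lin by (simp add: cont_linear_iff)
  moreover have "g (X \<otimes>\<^bsub>Q\<^esub> Y) = g X \<otimes>\<^bsub>B\<^esub> g Y" if XY: "X \<in> carrier Q" "Y \<in> carrier Q" for X Y
  proof -
    obtain x y where x: "x \<in> carrier A" "X = proj x" and y: "y \<in> carrier A" "Y = proj y"
      using ex XY by metis
    show ?thesis using x y g[of "x \<otimes> y"] g[of x] g[of y] cont_homD(4)[OF f] by (simp add: proj_mult)
  qed
  moreover have "g \<one>\<^bsub>Q\<^esub> = \<one>\<^bsub>B\<^esub>" using g[of \<one>] cont_homD(5)[OF f] by (simp add: quotient_talg_simps(3))
  ultimately have "cont_hom Q B g"
    using linear_onD[OF lin] by (auto simp: cont_hom_def ring_hom_def)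
  thus thesis using g that by blast
qed

text \<open>The preimage of a closed subalgebra under a continuous homomorphism is a closed subalgebra.\<close>

lemma generates_quotient:
  assumes "generates A G"
  shows "generates Q (proj ` G)"
  unfolding generates_def
proof (intro conjI allI impI)
  show "proj ` G \<subseteq> carrier Q" using assms proj_surj by (auto simp: generates_def)
  fix M assume M: "closed_subalgebra Q M \<and> proj ` G \<subseteq> M"
  let ?N = "{x \<in> carrier A. proj x \<in> M}"
  have "closed_subalgebra A ?N"
    unfolding closed_subalgebra_def closed_subspace_def
  proof (intro conjI allI ballI impI)
    fix s l assume sl: "(\<forall>n. s n \<in> ?N) \<and> converges A s l"
    hence "converges Q (\<lambda>n. proj (s n)) (proj l)"
      using cont_linear_converges[OF cont_homD(1)[OF cont_hom_proj], of s l] by simp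
    moreover have "\<forall>n. proj (s n) \<in> M" using sl by simp
    ultimately have "proj l \<in> M" using M unfolding closed_subalgebra_def closed_subspace_def by metis
    thus "l \<in> ?N" using convergesD(2)[of s l] sl by simp
  qed (use M in \<open>auto simp: closed_subalgebra_def closed_subspace_def proj_zero proj_add proj_scale
        proj_mult quotient_talg_simps(3)[symmetric]\<close>)
  moreover have "G \<subseteq> ?N" using assms M by (auto simp: generates_def)
  ultimately have "carrier A \<subseteq> ?N" using assms unfolding generates_def by metis
  hence "proj ` carrier A \<subseteq> M" by (intro image_subsetI) (drule subsetD, assumption, simp)
  thus "carrier Q \<subseteq> M" by (simp only: proj_surj)
qed

end

lemma closed_ideal_closed_ideal_gen:
  assumes "complete_algebra A p" and R: "R \<subseteq> carrier A"
  shows "closed_ideal (closed_ideal_gen A R) A"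
proof -
  interpret complete_algebra A p by fact
  let ?S = "{I. closed_ideal I A \<and> R \<subseteq> I}"
  have "closed_ideal (carrier A) A"
    unfolding closed_ideal_def using oneideal closedin_topspace[of "topo A"] by simp
  hence ne: "?S \<noteq> {}" using R by blast
  have "ideal (\<Inter>?S) A" by (rule i_Intersect) (use ne in \<open>auto simp: closed_ideal_def\<close>)
  moreover have "closedin (topo A) (\<Inter>?S)" using ne by (intro closedin_Inter) (auto simp: closed_ideal_def)
  ultimately show ?thesis by (simp add: closed_ideal_def closed_ideal_gen_def)
qed

text \<open>A continuous homomorphism that kills the relations kills the closed ideal they generate,
  since its kernel is a closed ideal.\<close>

lemma closed_ideal_gen_subset_kernel:
  assumes A: "complete_algebra A p" and B: "complete_algebra B q" and f: "cont_hom A B f"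
    and R: "R \<subseteq> carrier A" "\<And>r. r \<in> R \<Longrightarrow> f r = \<zero>\<^bsub>B\<^esub>" and x: "x \<in> closed_ideal_gen A R"
  shows "f x = \<zero>\<^bsub>B\<^esub>"
proof -
  interpret A: complete_algebra A p by fact
  interpret B: complete_algebra B q by fact
  interpret ring_hom_ring A B f
    using f by (intro ring_hom_ringI2 A.ring_axioms B.ring_axioms) (simp add: cont_hom_def)
  define K where "K = a_kernel A B f"
  have K: "K = {x \<in> topspace (topo A). f x \<in> {\<zero>\<^bsub>B\<^esub>}}"
    unfolding K_def a_kernel_def' A.topspace_V by blast
  have "closedin (topo B) {\<zero>\<^bsub>B\<^esub>}"
    using B.Hausdorff Hausdorff_imp_t1_space t1_space_closedin_singleton[of "topo B"]
    by (metis B.topspace_V B.M.zero_closed)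
  moreover have "continuous_map (topo A) (topo B) f" using f by (simp add: cont_hom_def cont_linear_iff)
  ultimately have "closedin (topo A) K"
    unfolding K by (intro closedin_continuous_map_preimage)
  hence "closed_ideal K A" using kernel_is_ideal unfolding closed_ideal_def K_def by (intro conjI)
  moreover have "R \<subseteq> K" using R unfolding K_def a_kernel_def' by (intro subsetI CollectI conjI) (drule (1) subsetD)
  ultimately have "x \<in> K" using x unfolding closed_ideal_gen_def by (simp only: Inter_iff mem_Collect_eq) 
  thus ?thesis unfolding K by (simp only: mem_Collect_eq singleton_iff)
qed

section \<open>Free entire functions\<close>

lemma lc_topology_with_topology: "lc_topology (with_topology M \<tau>) P = lc_topology M P"
  by (simp add: lc_topology_def with_topology_def a_minus_def a_inv_def m_inv_def)

lemma with_topology_simps [simp]: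
  "carrier (with_topology M \<tau>) = carrier M" "mult (with_topology M \<tau>) = mult M"
  "one (with_topology M \<tau>) = one M" "zero (with_topology M \<tau>) = zero M"
  "add (with_topology M \<tau>) = add M" "smult (with_topology M \<tau>) = smult M"
  "topo (with_topology M \<tau>) = \<tau>"
  by (simp_all add: with_topology_def)

text \<open>The product of formal power series in noncommuting variables. It makes sense for arbitrary
  coefficients, so the algebraic identities can be proved before convergence is considered.\<close>

definition word_conv :: "(nat list \<Rightarrow> complex) \<Rightarrow> (nat list \<Rightarrow> complex) \<Rightarrow> nat list \<Rightarrow> complex" where
  "word_conv a b w = (\<Sum>k\<le>length w. a (take k w) * b (drop k w))"

definition summable_at :: "real \<Rightarrow> (nat list \<Rightarrow> complex) \<Rightarrow> bool" where
  "summable_at \<rho> a \<longleftrightarrow> (\<lambda>w. cmod (a w) * \<rho> ^ length w) summable_on UNIV"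

lemma free_entire_simps:
  "carrier (free_entire n) = {a. (\<forall>w. w \<notin> lists {..<n} \<longrightarrow> a w = 0) \<and> (\<forall>\<rho>>0. summable_at \<rho> a)}"
  "mult (free_entire n) = word_conv"
  "one (free_entire n) = (\<lambda>w. if w = [] then 1 else 0)"
  "zero (free_entire n) = (\<lambda>w. 0)"
  "add (free_entire n) = (\<lambda>a b w. a w + b w)"
  "smult (free_entire n) = (\<lambda>c a w. c * a w)"
  by (simp_all add: free_entire_def free_entire_module_def summable_at_def word_conv_def fun_eq_iff)

lemma word_conv_Nil [simp]: "word_conv a b [] = a [] * b []"
  by (simp add: word_conv_def)

text \<open>Splitting off the first letter makes identities between products accessible to induction on words.\<close>

lemma word_conv_Cons:
  "word_conv a b (x # w) = a [] * b (x # w) + word_conv (\<lambda>v. a (x # v)) b w"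
  by (simp add: word_conv_def sum.atMost_Suc_shift del: sum.atMost_Suc)

lemma word_conv_add_left: "word_conv (\<lambda>w. a w + a' w) b w = word_conv a b w + word_conv a' b w"
  by (simp add: word_conv_def sum.distrib distrib_right)

lemma word_conv_add_right: "word_conv a (\<lambda>w. b w + b' w) w = word_conv a b w + word_conv a b' w"
  by (simp add: word_conv_def sum.distrib distrib_left)

lemma word_conv_scale_left: "word_conv (\<lambda>w. c * a w) b w = c * word_conv a b w"
  by (simp add: word_conv_def sum_distrib_left mult.assoc)

lemma word_conv_scale_right: "word_conv a (\<lambda>w. c * b w) w = c * word_conv a b w"
  by (simp add: word_conv_def sum_distrib_left mult_ac)

lemma word_conv_zero_left [simp]: "word_conv (\<lambda>w. 0) b w = 0"
  by (simp add: word_conv_def)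

lemma word_conv_assoc: "word_conv (word_conv a b) c w = word_conv a (word_conv b c) w"
proof (induction w arbitrary: a b)
  case (Cons x w)
  have "word_conv (word_conv a b) c (x # w) =
      a [] * b [] * c (x # w) + word_conv (\<lambda>v. a [] * b (x # v) + word_conv (\<lambda>u. a (x # u)) b v) c w"
    by (simp add: word_conv_Cons)
  also have "\<dots> = a [] * (b [] * c (x # w) + word_conv (\<lambda>v. b (x # v)) c w) +
      word_conv (word_conv (\<lambda>u. a (x # u)) b) c w"
    by (simp add: word_conv_add_left word_conv_scale_left algebra_simps)
  also have "\<dots> = word_conv a (word_conv b c) (x # w)"
    by (simp add: word_conv_Cons Cons.IH)
  finally show ?case .
qed simp

lemma word_conv_one_left: "word_conv (\<lambda>w. if w = [] then 1 else 0) b w = b w"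
  by (cases w) (simp_all add: word_conv_Cons)

lemma word_conv_one_right: "word_conv a (\<lambda>w. if w = [] then 1 else 0) w = a w"
  by (induction w arbitrary: a) (simp_all add: word_conv_Cons)

lemma word_conv_gen_Cons: "word_conv (free_gen i) a (x # w) = (if x = i then a w else 0)"
proof (cases "x = i")
  case True
  hence "(\<lambda>v. free_gen i (x # v)) = (\<lambda>w. if w = [] then 1 else 0)" by (auto simp: free_gen_def)
  thus ?thesis using True by (simp add: word_conv_Cons word_conv_one_left) (simp add: free_gen_def)
next
  case False
  hence "(\<lambda>v. free_gen i (x # v)) = (\<lambda>w. 0)" by (auto simp: free_gen_def)
  thus ?thesis using False by (simp add: word_conv_Cons) (simp add: free_gen_def)
qed

lemma finite_sum_le_free_entire_norm:
  assumes "summable_at \<rho> a" "0 < \<rho>" "finite F"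
  shows "(\<Sum>w\<in>F. cmod (a w) * \<rho> ^ length w) \<le> free_entire_norm \<rho> a"
  unfolding free_entire_norm_def using assms
  by (intro finite_sum_le_infsum) (auto simp: summable_at_def)

lemma summable_at_bounded:
  assumes "0 < \<rho>" "\<And>F. finite F \<Longrightarrow> (\<Sum>w\<in>F. cmod (a w) * \<rho> ^ length w) \<le> C"
  shows "summable_at \<rho> a" "free_entire_norm \<rho> a \<le> C"
proof -
  show s: "summable_at \<rho> a" unfolding summable_at_def
    using assms by (intro nonneg_bdd_above_summable_on) (auto simp: bdd_above_def)
  show "free_entire_norm \<rho> a \<le> C" unfolding free_entire_norm_def
    using s assms by (intro infsum_le_finite_sums) (auto simp: summable_at_def)
qed

lemma free_entire_norm_nonneg: "0 < \<rho> \<Longrightarrow> 0 \<le> free_entire_norm \<rho> a"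
  unfolding free_entire_norm_def by (intro infsum_nonneg) auto

lemma summable_at_add:
  assumes "0 < \<rho>" "summable_at \<rho> a" "summable_at \<rho> b"
  shows "summable_at \<rho> (\<lambda>w. a w + b w)"
    "free_entire_norm \<rho> (\<lambda>w. a w + b w) \<le> free_entire_norm \<rho> a + free_entire_norm \<rho> b"
proof -
  have *: "(\<Sum>w\<in>F. cmod (a w + b w) * \<rho> ^ length w) \<le> free_entire_norm \<rho> a + free_entire_norm \<rho> b"
    if "finite F" for F
  proof -
    have "(\<Sum>w\<in>F. cmod (a w + b w) * \<rho> ^ length w) \<le>
        (\<Sum>w\<in>F. cmod (a w) * \<rho> ^ length w) + (\<Sum>w\<in>F. cmod (b w) * \<rho> ^ length w)"
      unfolding sum.distrib[symmetric] distrib_right[symmetric] using assms(1)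
      by (intro sum_mono mult_right_mono norm_triangle_ineq) auto
    thus ?thesis using finite_sum_le_free_entire_norm[OF assms(2,1) that]
        finite_sum_le_free_entire_norm[OF assms(3,1) that] by linarith
  qed
  show "summable_at \<rho> (\<lambda>w. a w + b w)"
    "free_entire_norm \<rho> (\<lambda>w. a w + b w) \<le> free_entire_norm \<rho> a + free_entire_norm \<rho> b"
    using summable_at_bounded[where a = "\<lambda>w. a w + b w", OF assms(1) *] by auto
qed

lemma summable_at_scale:
  assumes "summable_at \<rho> a"
  shows "summable_at \<rho> (\<lambda>w. c * a w)"
    "free_entire_norm \<rho> (\<lambda>w. c * a w) = cmod c * free_entire_norm \<rho> a"
proof -
  have *: "(\<lambda>w. cmod (c * a w) * \<rho> ^ length w) = (\<lambda>w. cmod c * (cmod (a w) * \<rho> ^ length w))"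
    by (simp add: norm_mult mult.assoc)
  show "summable_at \<rho> (\<lambda>w. c * a w)"
    using assms unfolding summable_at_def * by (rule summable_on_cmult_right)
  show "free_entire_norm \<rho> (\<lambda>w. c * a w) = cmod c * free_entire_norm \<rho> a"
    using assms unfolding free_entire_norm_def * summable_at_def by (intro infsum_cmult_right) simp
qed

text \<open>Cutting words at all positions is an injection into pairs of words, so the partial sums for the
  product are bounded by products of partial sums for the factors.\<close>

lemma summable_at_word_conv:
  assumes \<rho>: "0 < \<rho>" and a: "summable_at \<rho> a" and b: "summable_at \<rho> b"
  shows "summable_at \<rho> (word_conv a b)"
    "free_entire_norm \<rho> (word_conv a b) \<le> free_entire_norm \<rho> a * free_entire_norm \<rho> b"
proof -
  define \<alpha> where "\<alpha> w = cmod (a w) * \<rho> ^ length w" for w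
  define \<beta> where "\<beta> w = cmod (b w) * \<rho> ^ length w" for w
  have nn: "0 \<le> \<alpha> w" "0 \<le> \<beta> w" for w using \<rho> by (auto simp: \<alpha>_def \<beta>_def)
  have *: "(\<Sum>w\<in>F. cmod (word_conv a b w) * \<rho> ^ length w) \<le> free_entire_norm \<rho> a * free_entire_norm \<rho> b"
    if F: "finite F" for F
  proof -
    let ?S = "SIGMA w:F. {..length w}"
    let ?g = "\<lambda>(w, k). (take k w, drop k w) :: nat list \<times> nat list"
    have fin: "finite ?S" using F by auto
    have inj: "inj_on ?g ?S"
    proof (rule inj_onI, clarify)
      fix w k w' k' assume "k \<le> length w" "k' \<le> length w'" "take k w = take k' w'" "drop k w = drop k' w'"
      thus "w = w' \<and> k = k'" by (metis append_take_drop_id length_take min.absorb2)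
    qed
    have "(\<Sum>w\<in>F. cmod (word_conv a b w) * \<rho> ^ length w) \<le> (\<Sum>w\<in>F. \<Sum>k\<le>length w. \<alpha> (take k w) * \<beta> (drop k w))"
    proof (rule sum_mono)
      fix w
      have "cmod (word_conv a b w) * \<rho> ^ length w \<le>
          (\<Sum>k\<le>length w. cmod (a (take k w)) * cmod (b (drop k w))) * \<rho> ^ length w"
        unfolding word_conv_def using \<rho>
        by (intro mult_right_mono order_trans[OF norm_sum] sum_mono) (auto simp: norm_mult)
      also have "\<dots> = (\<Sum>k\<le>length w. \<alpha> (take k w) * \<beta> (drop k w))"
        unfolding sum_distrib_right
      proof (rule sum.cong)
        fix k assume "k \<in> {..length w}"
        hence "\<rho> ^ length w = \<rho> ^ length (take k w) * \<rho> ^ length (drop k w)"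
          by (simp add: power_add[symmetric])
        thus "cmod (a (take k w)) * cmod (b (drop k w)) * \<rho> ^ length w = \<alpha> (take k w) * \<beta> (drop k w)"
          by (simp add: \<alpha>_def \<beta>_def)
      qed simp
      finally show "cmod (word_conv a b w) * \<rho> ^ length w \<le> (\<Sum>k\<le>length w. \<alpha> (take k w) * \<beta> (drop k w))" .
    qed
    also have "\<dots> = (\<Sum>(w, k)\<in>?S. \<alpha> (take k w) * \<beta> (drop k w))"
      using F by (subst sum.Sigma) auto
    also have "\<dots> = (\<Sum>(u, v)\<in>?g ` ?S. \<alpha> u * \<beta> v)"
      by (subst sum.reindex[OF inj]) (auto intro: sum.cong)
    also have "\<dots> \<le> (\<Sum>(u, v)\<in>fst ` ?g ` ?S \<times> snd ` ?g ` ?S. \<alpha> u * \<beta> v)"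
      using fin nn by (intro sum_mono2) (auto intro!: finite_cartesian_product, force, force)
    also have "\<dots> = (\<Sum>u\<in>fst ` ?g ` ?S. \<alpha> u) * (\<Sum>v\<in>snd ` ?g ` ?S. \<beta> v)"
      unfolding sum_product sum.cartesian_product ..
    also have "\<dots> \<le> free_entire_norm \<rho> a * free_entire_norm \<rho> b"
      unfolding \<alpha>_def \<beta>_def using fin
      by (intro mult_mono finite_sum_le_free_entire_norm a b \<rho> finite_imageI sum_nonneg
          free_entire_norm_nonneg) (use \<rho> in auto)
    finally show ?thesis .
  qed
  show "summable_at \<rho> (word_conv a b)"
    "free_entire_norm \<rho> (word_conv a b) \<le> free_entire_norm \<rho> a * free_entire_norm \<rho> b"
    using summable_at_bounded[where a = "word_conv a b", OF \<rho> *] by auto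
qed

lemma summable_at_finite_support:
  assumes "0 < \<rho>" "finite S" "\<And>w. w \<notin> S \<Longrightarrow> a w = 0"
  shows "summable_at \<rho> a"
  unfolding summable_at_def
  by (rule summable_on_cong_neutral[THEN iffD1, OF _ _ _ summable_on_finite[OF assms(2)]]) (use assms(3) in auto)

lemma free_entire_carrierI:
  assumes "\<And>w. w \<notin> lists {..<n} \<Longrightarrow> a w = 0" "\<And>\<rho>. 0 < \<rho> \<Longrightarrow> summable_at \<rho> a"
  shows "a \<in> carrier (free_entire n)"
  using assms by (simp add: free_entire_simps)

lemma free_entire_carrier_finite_support:
  assumes "finite S" "S \<subseteq> lists {..<n}" "\<And>w. w \<notin> S \<Longrightarrow> a w = 0"
  shows "a \<in> carrier (free_entire n)"
proof (rule free_entire_carrierI)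
  show "a w = 0" if "w \<notin> lists {..<n}" for w using that assms(2,3) by blast
  show "summable_at \<rho> a" if "0 < \<rho>" for \<rho>
    using that assms(1,3) by (rule summable_at_finite_support)
qed

lemma free_entire_carrierD:
  assumes "a \<in> carrier (free_entire n)"
  shows "w \<notin> lists {..<n} \<Longrightarrow> a w = 0" "0 < \<rho> \<Longrightarrow> summable_at \<rho> a"
  using assms by (simp_all add: free_entire_simps)

lemma word_conv_support:
  assumes "\<And>w. w \<notin> lists X \<Longrightarrow> a w = 0" "\<And>w. w \<notin> lists X \<Longrightarrow> b w = 0" "w \<notin> lists X"
  shows "word_conv a b w = 0"
  unfolding word_conv_def
proof (rule sum.neutral, rule ballI)
  fix k
  have "take k w \<notin> lists X \<or> drop k w \<notin> lists X"
    using assms(3) by (metis append_in_lists_conv append_take_drop_id)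
  thus "a (take k w) * b (drop k w) = 0" using assms(1,2) by auto
qed

lemma vspace_free_entire: "vspace (free_entire n)"
  unfolding vspace_def
proof (intro moduleI cring_complex_talg abelian_groupI)
  let ?A = "free_entire n"
  show "x \<oplus>\<^bsub>?A\<^esub> y \<in> carrier ?A" if "x \<in> carrier ?A" "y \<in> carrier ?A" for x y
    using that by (simp add: free_entire_simps summable_at_add)
  show "\<zero>\<^bsub>?A\<^esub> \<in> carrier ?A"
    by (rule free_entire_carrierI) (auto simp: free_entire_simps summable_at_def)
  show "c \<odot>\<^bsub>?A\<^esub> x \<in> carrier ?A" if "x \<in> carrier ?A" for c x
    using that by (simp add: free_entire_simps summable_at_scale)
  show "\<exists>y\<in>carrier ?A. y \<oplus>\<^bsub>?A\<^esub> x = \<zero>\<^bsub>?A\<^esub>" if x: "x \<in> carrier ?A" for x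
  proof
    show "(\<lambda>w. (-1) * x w) \<in> carrier ?A"
      using x summable_at_scale(1)[of _ x "-1"] unfolding free_entire_simps mem_Collect_eq by simp
  qed (simp add: free_entire_simps)
qed (auto simp: free_entire_simps algebra_simps)

lemma calgebra_free_entire: "calgebra (free_entire n)"
proof (intro calgebra.intro vspace_free_entire calgebra_axioms.intro ringI monoidI)
  let ?A = "free_entire n"
  interpret vspace ?A by (rule vspace_free_entire)
  show "abelian_group ?A" ..
  show "x \<otimes>\<^bsub>?A\<^esub> y \<in> carrier ?A" if "x \<in> carrier ?A" "y \<in> carrier ?A" for x y
    using that word_conv_support[of "{..<n}" x y] by (simp add: free_entire_simps summable_at_word_conv)
  show "\<one>\<^bsub>?A\<^esub> \<in> carrier ?A"
    by (rule free_entire_carrier_finite_support[of "{[]}"]) (auto simp: free_entire_simps)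
qed (simp_all add: free_entire_simps fun_eq_iff word_conv_assoc word_conv_one_left word_conv_one_right
    word_conv_add_left word_conv_add_right word_conv_scale_left word_conv_scale_right)

definition fe_norm :: "nat \<Rightarrow> (nat list \<Rightarrow> complex) \<Rightarrow> real" where
  "fe_norm k = free_entire_norm (real (Suc k))"

lemma summable_at_le:
  assumes "0 < \<rho>" "\<rho> \<le> \<sigma>" "summable_at \<sigma> a"
  shows "free_entire_norm \<rho> a \<le> free_entire_norm \<sigma> a"
proof (rule summable_at_bounded(2)[OF assms(1)])
  fix F :: "nat list set" assume F: "finite F"
  have "(\<Sum>w\<in>F. cmod (a w) * \<rho> ^ length w) \<le> (\<Sum>w\<in>F. cmod (a w) * \<sigma> ^ length w)"
    using assms by (intro sum_mono mult_left_mono power_mono) auto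
  also have "\<dots> \<le> free_entire_norm \<sigma> a"
    using assms F by (intro finite_sum_le_free_entire_norm) auto
  finally show "(\<Sum>w\<in>F. cmod (a w) * \<rho> ^ length w) \<le> free_entire_norm \<sigma> a" .
qed

lemma seminorm_free_entire_norm:
  assumes "0 < \<rho>" shows "seminorm (free_entire n) (free_entire_norm \<rho>)"
  unfolding seminorm_def using assms
  by (auto simp: free_entire_norm_nonneg free_entire_simps summable_at_add summable_at_scale)

lemma seminormed_algebra_free_entire: "seminormed_algebra (free_entire n) fe_norm"
proof (intro seminormed_algebra.intro seminormed_space.intro seminormed_space_axioms.intro
      seminormed_algebra_axioms.intro vspace_free_entire calgebra_free_entire)
  let ?A = "free_entire n"
  show "seminorm ?A (fe_norm k)" for k by (simp add: fe_norm_def seminorm_free_entire_norm)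
  show "fe_norm k x \<le> fe_norm (Suc k) x" if "x \<in> carrier ?A" for x k
    unfolding fe_norm_def by (rule summable_at_le) (use that in \<open>auto simp: free_entire_simps\<close>)
  show "fe_norm k (x \<otimes>\<^bsub>?A\<^esub> y) \<le> fe_norm k x * fe_norm k y"
    if "x \<in> carrier ?A" "y \<in> carrier ?A" for x y k
    using that by (simp add: free_entire_simps fe_norm_def summable_at_word_conv)
  have "topo ?A = lc_topology ?A (free_entire_norm ` {0<..})"
    by (simp add: free_entire_def lc_topology_with_topology)
  also have "\<dots> = lc_topology ?A (range fe_norm)"
  proof (rule lc_topology_eqI[OF vspace_free_entire])
    show "range fe_norm \<subseteq> free_entire_norm ` {0<..}" by (auto simp: fe_norm_def)
    fix q assume "q \<in> free_entire_norm ` {0<..}"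
    then obtain \<rho> where \<rho>: "\<rho> > 0" "q = free_entire_norm \<rho>" by auto
    obtain k0 where "\<rho> \<le> real k0" using real_arch_simple[of \<rho>] ..
      then obtain k where k: "\<rho> \<le> real (Suc k)" by (intro that[of k0]) simp
    have "q x \<le> 1 * fe_norm k x" if "x \<in> carrier ?A" for x
      using summable_at_le[OF \<rho>(1) k, of x] that \<rho> by (simp add: fe_norm_def free_entire_simps)
    thus "\<exists>k C. \<forall>x\<in>carrier ?A. q x \<le> C * fe_norm k x" by metis
  qed (simp add: fe_norm_def free_entire_norm_nonneg)
  finally show "topo ?A = lc_topology ?A (range fe_norm)" .
qed

lemma free_entire_minus:
  assumes "a \<in> carrier (free_entire n)" "b \<in> carrier (free_entire n)"
  shows "a \<ominus>\<^bsub>free_entire n\<^esub> b = (\<lambda>w. a w - b w)"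
proof -
  interpret vspace "free_entire n" by (rule vspace_free_entire)
  show ?thesis using assms by (simp add: minus_eq_scale) (simp add: free_entire_simps)
qed

lemma coeff_le_fe_norm:
  assumes "a \<in> carrier (free_entire n)"
  shows "cmod (a w) \<le> fe_norm k a"
proof -
  have "cmod (a w) \<le> cmod (a w) * real (Suc k) ^ length w" by (simp add: mult_left_le_one_le mult_le_cancel_left1)
  also have "\<dots> \<le> fe_norm k a"
    using finite_sum_le_free_entire_norm[of "real (Suc k)" a "{w}"] assms
    by (simp add: fe_norm_def free_entire_simps)
  finally show ?thesis .
qed

text \<open>The limit of a Cauchy sequence is taken coefficientwise. Estimates on finite partial sums survive
  this limit, which yields both membership of the limit and convergence in each norm.\<close>

lemma complete_algebra_free_entire: "complete_algebra (free_entire n) fe_norm"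
proof -
  let ?A = "free_entire n"
  interpret A: seminormed_algebra ?A fe_norm by (rule seminormed_algebra_free_entire)
  show ?thesis
  proof (intro complete_algebra.intro complete_space.intro complete_space_axioms.intro
      A.seminormed_algebra_axioms A.seminormed_space_axioms)
    fix x assume x: "x \<in> carrier ?A" and z: "\<And>k. fe_norm k x = 0"
    have "x w = 0" for w using coeff_le_fe_norm[OF x, of w 0] z[of 0] by simp
    thus "x = \<zero>\<^bsub>?A\<^esub>" by (simp add: free_entire_simps fun_eq_iff)
  next
    fix s assume s: "cauchy_seq ?A s"
    have sc: "s n \<in> carrier ?A" for n using s by (simp add: A.cauchy_seq_iff)
    have C: "\<exists>N. \<forall>m\<ge>N. \<forall>n\<ge>N. fe_norm k (s m \<ominus>\<^bsub>?A\<^esub> s n) < e" if "e > 0" for k and e :: real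
      using s that by (simp add: A.cauchy_seq_iff)
    have "convergent (\<lambda>m. s m w)" for w
    proof (rule Cauchy_convergent, rule metric_CauchyI)
      fix e :: real assume "e > 0"
      then obtain N where N: "\<forall>m\<ge>N. \<forall>n\<ge>N. fe_norm 0 (s m \<ominus>\<^bsub>?A\<^esub> s n) < e" using C by blast
      have "dist (s m w) (s n w) < e" if "m \<ge> N" "n \<ge> N" for m n
      proof -
        have "dist (s m w) (s n w) = cmod ((s m \<ominus>\<^bsub>?A\<^esub> s n) w)"
          using sc by (simp add: free_entire_minus dist_norm)
        also have "\<dots> \<le> fe_norm 0 (s m \<ominus>\<^bsub>?A\<^esub> s n)" using sc by (intro coeff_le_fe_norm) auto
        also have "\<dots> < e" using N that by blast
        finally show ?thesis .
      qed
      thus "\<exists>M. \<forall>m\<ge>M. \<forall>n\<ge>M. dist (s m w) (s n w) < e" by blast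
    qed
    then obtain l where l: "\<And>w. (\<lambda>m. s m w) \<longlonglongrightarrow> l w" unfolding convergent_def by metis
    have supp: "l w = 0" if "w \<notin> lists {..<n}" for w
      using l[of w] free_entire_carrierD(1)[OF sc that] by (simp add: LIMSEQ_const_iff)
    have key: "\<exists>N. \<forall>m\<ge>N. summable_at (real (Suc k)) (\<lambda>w. s m w - l w) \<and>
        fe_norm k (\<lambda>w. s m w - l w) \<le> e" if e: "e > 0" for k and e :: real
    proof -
      obtain N where N: "\<And>m n. m \<ge> N \<Longrightarrow> n \<ge> N \<Longrightarrow> fe_norm k (s m \<ominus>\<^bsub>?A\<^esub> s n) < e" using C[OF e] by metis
      have "(\<Sum>w\<in>F. cmod (s m w - l w) * real (Suc k) ^ length w) \<le> e"
        if F: "finite F" and m: "m \<ge> N" for F m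
      proof (rule LIMSEQ_le_const2)
        show "(\<lambda>j. \<Sum>w\<in>F. cmod (s m w - s j w) * real (Suc k) ^ length w) \<longlonglongrightarrow>
            (\<Sum>w\<in>F. cmod (s m w - l w) * real (Suc k) ^ length w)"
          by (intro tendsto_intros l)
        show "\<exists>N. \<forall>j\<ge>N. (\<Sum>w\<in>F. cmod (s m w - s j w) * real (Suc k) ^ length w) \<le> e"
        proof (intro exI allI impI)
          fix j assume j: "N \<le> j"
          have "(\<Sum>w\<in>F. cmod ((s m \<ominus>\<^bsub>?A\<^esub> s j) w) * real (Suc k) ^ length w) \<le> fe_norm k (s m \<ominus>\<^bsub>?A\<^esub> s j)"
            unfolding fe_norm_def
            by (rule finite_sum_le_free_entire_norm[OF free_entire_carrierD(2)[where n = n]])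
               (use sc F in auto)
          also have "\<dots> \<le> e" using N[OF m j] by simp
          finally show "(\<Sum>w\<in>F. cmod (s m w - s j w) * real (Suc k) ^ length w) \<le> e"
            using sc by (simp add: free_entire_minus)
        qed
      qed
      hence "summable_at (real (Suc k)) (\<lambda>w. s m w - l w) \<and> fe_norm k (\<lambda>w. s m w - l w) \<le> e"
        if "m \<ge> N" for m
        unfolding fe_norm_def using summable_at_bounded[of "real (Suc k)" "\<lambda>w. s m w - l w" e] that by auto
      thus ?thesis by blast
    qed
    have lc: "l \<in> carrier ?A"
    proof (rule free_entire_carrierI[OF supp])
      fix \<rho> :: real assume \<rho>: "0 < \<rho>"
      obtain k0 where "\<rho> \<le> real k0" using real_arch_simple[of \<rho>] ..
      then obtain k where k: "\<rho> \<le> real (Suc k)" by (intro that[of k0]) simp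
      obtain m where m: "summable_at (real (Suc k)) (\<lambda>w. s m w - l w)" using key[of 1 k] by auto
      have "summable_at (real (Suc k)) (\<lambda>w. s m w + (-1) * (s m w - l w))"
        by (intro summable_at_add summable_at_scale m free_entire_carrierD(2)[OF sc]) auto
      hence l': "summable_at (real (Suc k)) l" by simp
      show "summable_at \<rho> l"
      proof (rule summable_at_bounded(1)[OF \<rho>])
        fix F :: "nat list set" assume F: "finite F"
        have "(\<Sum>w\<in>F. cmod (l w) * \<rho> ^ length w) \<le> (\<Sum>w\<in>F. cmod (l w) * real (Suc k) ^ length w)"
          using \<rho> k by (intro sum_mono mult_left_mono power_mono) auto
        also have "\<dots> \<le> free_entire_norm (real (Suc k)) l"
          using l' F by (intro finite_sum_le_free_entire_norm) auto
        finally show "(\<Sum>w\<in>F. cmod (l w) * \<rho> ^ length w) \<le> free_entire_norm (real (Suc k)) l" .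
      qed
    qed
    have "converges ?A s l"
    proof (rule A.convergesI[OF sc lc])
      fix k
      show "(\<lambda>m. fe_norm k (s m \<ominus>\<^bsub>?A\<^esub> l)) \<longlonglongrightarrow> 0"
      proof (rule LIMSEQ_I)
        fix e :: real assume "e > 0"
        then obtain N where N: "\<And>m. m \<ge> N \<Longrightarrow> fe_norm k (\<lambda>w. s m w - l w) \<le> e / 2" using key[of "e / 2" k] by auto
        have "norm (fe_norm k (s m \<ominus>\<^bsub>?A\<^esub> l) - 0) < e" if "m \<ge> N" for m
          using N[OF that] \<open>e > 0\<close> free_entire_norm_nonneg[of "real (Suc k)" "\<lambda>w. s m w - l w"]
          by (simp add: free_entire_minus[OF sc lc] fe_norm_def)
        thus "\<exists>N. \<forall>m\<ge>N. norm (fe_norm k (s m \<ominus>\<^bsub>?A\<^esub> l) - 0) < e" by blast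
      qed
    qed
    thus "\<exists>l. converges ?A s l" by (intro exI[of _ l])
  qed
qed

lemma free_gen_carrier: "i < n \<Longrightarrow> free_gen i \<in> carrier (free_entire n)"
  by (rule free_entire_carrier_finite_support[of "{[i]}"]) (auto simp: free_gen_def)

text \<open>Only finitely many words have bounded length; the truncations of a series to them are polynomials.\<close>

definition words :: "nat \<Rightarrow> nat \<Rightarrow> nat list set" where
  "words n N = {w. set w \<subseteq> {..<n} \<and> length w \<le> N}"

lemma finite_words [simp]: "finite (words n N)"
  unfolding words_def by (rule finite_lists_length_le) simp

lemma words_mono: "M \<le> N \<Longrightarrow> words n M \<subseteq> words n N"
  by (auto simp: words_def)

lemma finite_subset_words:
  assumes "finite F" "F \<subseteq> lists {..<n}"
  obtains N where "F \<subseteq> words n N"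
proof
  show "F \<subseteq> words n (Max (insert 0 (length ` F)))"
  proof
    fix w assume w: "w \<in> F"
    hence "set w \<subseteq> {..<n}" using assms(2) by auto
    moreover have "length w \<le> Max (insert 0 (length ` F))" using assms(1) w by (intro Max_ge) auto
    ultimately show "w \<in> words n (Max (insert 0 (length ` F)))" unfolding words_def by blast
  qed
qed

definition truncate_series :: "nat \<Rightarrow> nat \<Rightarrow> (nat list \<Rightarrow> complex) \<Rightarrow> nat list \<Rightarrow> complex" where
  "truncate_series n N a = (\<lambda>w. if w \<in> words n N then a w else 0)"

lemma truncate_series_carrier: "truncate_series n N a \<in> carrier (free_entire n)"
  by (rule free_entire_carrier_finite_support[OF finite_words[of n N]])
     (auto simp: truncate_series_def words_def in_lists_conv_set)

lemma truncate_series_converges: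
  assumes a: "a \<in> carrier (free_entire n)"
  shows "converges (free_entire n) (\<lambda>N. truncate_series n N a) a"
proof -
  let ?A = "free_entire n"
  interpret A: complete_algebra ?A fe_norm by (rule complete_algebra_free_entire)
  show ?thesis
  proof (rule A.convergesI[OF truncate_series_carrier a])
    fix k
    define f where "f = (\<lambda>w. cmod (a w) * real (Suc k) ^ length w)"
    have f: "f summable_on UNIV" "\<And>w. 0 \<le> f w"
      using free_entire_carrierD(2)[OF a, of "real (Suc k)"] by (auto simp: f_def summable_at_def)
    show "(\<lambda>N. fe_norm k (truncate_series n N a \<ominus>\<^bsub>?A\<^esub> a)) \<longlonglongrightarrow> 0"
    proof (rule LIMSEQ_I)
      fix e :: real assume e: "e > 0"
      obtain F where F: "finite F" "infsum f UNIV - e / 2 < sum f F"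
      proof -
        have "(sum f \<longlongrightarrow> infsum f UNIV) (finite_subsets_at_top UNIV)"
          using has_sum_infsum[OF f(1)] by (simp add: has_sum_def)
        hence "\<forall>\<^sub>F F in finite_subsets_at_top UNIV. infsum f UNIV - e / 2 < sum f F"
          using e by (intro order_tendstoD) auto
        thus ?thesis using that unfolding eventually_finite_subsets_at_top by blast
      qed
      obtain M where M: "F \<inter> lists {..<n} \<subseteq> words n M"
        using finite_subset_words[of "F \<inter> lists {..<n}" n] F(1) by auto
      have "fe_norm k (truncate_series n N a \<ominus>\<^bsub>?A\<^esub> a) \<le> e / 2" if N: "N \<ge> M" for N
        unfolding free_entire_minus[OF truncate_series_carrier a] fe_norm_def
      proof (rule summable_at_bounded(2))
        fix G :: "nat list set" assume G: "finite G"
        have "(\<Sum>w\<in>G. cmod (truncate_series n N a w - a w) * real (Suc k) ^ length w) = sum f (G - words n N)"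
          using G by (intro sum.mono_neutral_cong_right) (auto simp: truncate_series_def f_def)
        also have "\<dots> + sum f (words n N) = sum f (G \<union> words n N)"
          using G sum.union_disjoint[of "G - words n N" "words n N" f] unfolding Un_Diff_cancel2
          by (simp add: Diff_Int_distrib2)
        also have "\<dots> \<le> infsum f UNIV" using G f by (intro finite_sum_le_infsum) auto
        also have "\<dots> \<le> sum f F + e / 2" using F(2) by simp
        also have "sum f F = sum f (F \<inter> lists {..<n})"
          using F(1) free_entire_carrierD(1)[OF a] by (intro sum.mono_neutral_right) (auto simp: f_def)
        also have "\<dots> \<le> sum f (words n N)"
          using M words_mono[OF N, of n] f(2) by (intro sum_mono2) auto
        finally show "(\<Sum>w\<in>G. cmod (truncate_series n N a w - a w) * real (Suc k) ^ length w) \<le> e / 2" by simp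
      qed simp
      hence "norm (fe_norm k (truncate_series n N a \<ominus>\<^bsub>?A\<^esub> a) - 0) < e" if "N \<ge> M" for N
        using that e A.p_nonneg[OF A.minus_closed'[OF truncate_series_carrier a], of k N] by fastforce
      thus "\<exists>M. \<forall>N\<ge>M. norm (fe_norm k (truncate_series n N a \<ominus>\<^bsub>?A\<^esub> a) - 0) < e" by blast
    qed
  qed
qed

text \<open>Monomials are products of generators, and every series is the limit of its truncations.\<close>

lemma free_entire_generates: "generates (free_entire n) (free_gen ` {..<n})"
  unfolding generates_def
proof (intro conjI allI impI subsetI)
  let ?A = "free_entire n"
  interpret A: complete_algebra ?A fe_norm by (rule complete_algebra_free_entire)
  show "x \<in> carrier ?A" if "x \<in> free_gen ` {..<n}" for x using that free_gen_carrier by auto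
  fix M a assume M: "closed_subalgebra ?A M \<and> free_gen ` {..<n} \<subseteq> M" and a: "a \<in> carrier ?A"
  have M0: "\<zero>\<^bsub>?A\<^esub> \<in> M" and M1: "\<one>\<^bsub>?A\<^esub> \<in> M"
    and Madd: "\<And>x y. x \<in> M \<Longrightarrow> y \<in> M \<Longrightarrow> x \<oplus>\<^bsub>?A\<^esub> y \<in> M" and Mscale: "\<And>c x. x \<in> M \<Longrightarrow> c \<odot>\<^bsub>?A\<^esub> x \<in> M"
    and Mmult: "\<And>x y. x \<in> M \<Longrightarrow> y \<in> M \<Longrightarrow> x \<otimes>\<^bsub>?A\<^esub> y \<in> M"
    and Mlim: "\<And>s l. (\<And>n. s n \<in> M) \<Longrightarrow> converges ?A s l \<Longrightarrow> l \<in> M"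
    and Mgen: "\<And>i. i < n \<Longrightarrow> free_gen i \<in> M"
    using M unfolding closed_subalgebra_def closed_subspace_def by blast+
  have wordM: "(\<lambda>v. if v = w then 1 else 0) \<in> M" if "set w \<subseteq> {..<n}" for w
    using that
  proof (induction w)
    case Nil
    show ?case using M1 by (simp add: free_entire_simps)
  next
    case (Cons i w)
    have "word_conv (free_gen i) (\<lambda>v. if v = w then 1 else 0) = (\<lambda>v. if v = i # w then 1 else 0)"
    proof
      fix v show "word_conv (free_gen i) (\<lambda>v. if v = w then 1 else 0) v = (if v = i # w then 1 else 0)"
      proof (cases v)
        case Nil
        thus ?thesis by (simp add: free_gen_def)
      qed (auto simp: word_conv_gen_Cons)
    qed
    moreover have "free_gen i \<in> M" using Mgen Cons.prems by simp
    moreover have "(\<lambda>v. if v = w then 1 else 0) \<in> M" using Cons by simp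
    ultimately show ?case using Mmult[of "free_gen i" "\<lambda>v. if v = w then 1 else 0"]
      unfolding free_entire_simps(2) by simp
  qed
  have partM: "(\<lambda>w. if w \<in> F then a w else 0) \<in> M" if "finite F" "F \<subseteq> words n N" for F N
    using that
  proof (induction F rule: finite_induct)
    case empty
    show ?case using M0 by (simp add: free_entire_simps)
  next
    case (insert w F)
    have "set w \<subseteq> {..<n}" using insert.prems by (auto simp: words_def)
    from Mscale[OF wordM[OF this], of "a w"]
    have "(\<lambda>v. a w * (if v = w then 1 else 0)) \<in> M" unfolding free_entire_simps(6) .
    moreover have "(\<lambda>w. if w \<in> F then a w else 0) \<in> M" using insert by simp
    ultimately have "(\<lambda>v. (\<lambda>v. a w * (if v = w then 1 else 0)) v + (\<lambda>w. if w \<in> F then a w else 0) v) \<in> M"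
      by (rule Madd[unfolded free_entire_simps(5)])
    moreover have "(\<lambda>v. (\<lambda>v. a w * (if v = w then 1 else 0)) v + (\<lambda>w. if w \<in> F then a w else 0) v) =
        (\<lambda>v. if v \<in> insert w F then a v else 0)"
      using insert.hyps by (auto simp: fun_eq_iff)
    ultimately show ?case by simp
  qed
  have "truncate_series n N a \<in> M" for N
    unfolding truncate_series_def by (rule partM) auto
  thus "a \<in> M" by (rule Mlim[OF _ truncate_series_converges[OF a]])
qed

section \<open>Evaluation of free entire functions\<close>

text \<open>Evaluation of free entire functions at a tuple of elements. Submultiplicativity gives words of
  elements geometric growth, which the coefficients of an entire series outweigh.\<close>

locale free_evaluation = complete_algebra B q for B :: "'b talg" (structure) and q +
  fixes n :: nat and b :: "nat \<Rightarrow> 'b"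
  assumes b_carrier: "i < n \<Longrightarrow> b i \<in> carrier B"
begin

definition word_eval :: "nat list \<Rightarrow> 'b" where
  "word_eval w = foldr (\<lambda>i y. b i \<otimes> y) w \<one>"

lemma word_eval_simps [simp]: "word_eval [] = \<one>" "word_eval (i # w) = b i \<otimes> word_eval w"
  by (simp_all add: word_eval_def)

lemma word_eval_carrier: "set w \<subseteq> {..<n} \<Longrightarrow> word_eval w \<in> carrier B"
  by (induction w) (auto simp: b_carrier)

lemma words_carrier: "w \<in> words n N \<Longrightarrow> word_eval w \<in> carrier B"
  by (simp add: words_def word_eval_carrier)

text \<open>The summand 1 keeps the radius positive when all the elements have seminorm zero.\<close>

definition radius :: "nat \<Rightarrow> real" where "radius k = 1 + (\<Sum>i<n. q k (b i))"

lemma radius_ge: "1 \<le> radius k" "i < n \<Longrightarrow> q k (b i) \<le> radius k"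
proof -
  have "0 \<le> (\<Sum>i<n. q k (b i))" by (rule sum_nonneg) (simp add: b_carrier)
  thus "1 \<le> radius k" by (simp add: radius_def)
  assume "i < n"
  hence "q k (b i) \<le> (\<Sum>i<n. q k (b i))" using b_carrier by (intro member_le_sum) auto
  thus "q k (b i) \<le> radius k" by (simp add: radius_def)
qed

lemma word_eval_le:
  assumes "set w \<subseteq> {..<n}" shows "q k (word_eval w) \<le> q k \<one> * radius k ^ length w"
  using assms
proof (induction w)
  case (Cons i w)
  have i: "i < n" and w: "set w \<subseteq> {..<n}" using Cons.prems by auto
  have "q k (b i \<otimes> word_eval w) \<le> q k (b i) * q k (word_eval w)"
    by (rule p_mult[OF b_carrier[OF i] word_eval_carrier[OF w]])
  also have "\<dots> \<le> radius k * (q k \<one> * radius k ^ length w)"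
    using Cons.IH[OF w] radius_ge(2)[OF i, of k] radius_ge(1)[of k] word_eval_carrier[OF w]
    by (intro mult_mono) auto
  finally show ?case by (simp add: mult_ac)
qed simp

definition partial_eval :: "nat \<Rightarrow> (nat list \<Rightarrow> complex) \<Rightarrow> 'b" where
  "partial_eval N a = (\<Oplus>w\<in>words n N. a w \<odot> word_eval w)"

lemma partial_eval_carrier: "partial_eval N a \<in> carrier B"
  unfolding partial_eval_def by (intro M.finsum_closed Pi_I scale_closed words_carrier)

definition majorant :: "(nat list \<Rightarrow> complex) \<Rightarrow> nat \<Rightarrow> nat \<Rightarrow> real" where
  "majorant a k N = q k \<one> * (\<Sum>w\<in>words n N. cmod (a w) * radius k ^ length w)"

lemma q_finsum_words_le:
  assumes "S \<subseteq> words n N"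
  shows "q k (\<Oplus>w\<in>S. a w \<odot> word_eval w) \<le> q k \<one> * (\<Sum>w\<in>S. cmod (a w) * radius k ^ length w)"
proof -
  have S: "finite S" using assms finite_subset finite_words by metis
  have wc: "word_eval w \<in> carrier B" if "w \<in> S" for w using that assms words_carrier by blast
  have "q k (\<Oplus>w\<in>S. a w \<odot> word_eval w) \<le> (\<Sum>w\<in>S. q k (a w \<odot> word_eval w))"
    using wc by (intro p_finsum_le[OF S]) auto
  also have "\<dots> \<le> (\<Sum>w\<in>S. cmod (a w) * (q k \<one> * radius k ^ length w))"
  proof (rule sum_mono)
    fix w assume w: "w \<in> S"
    have "set w \<subseteq> {..<n}" using assms w by (auto simp: words_def)
    thus "q k (a w \<odot> word_eval w) \<le> cmod (a w) * (q k \<one> * radius k ^ length w)"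
      unfolding p_scale[OF wc[OF w]] by (intro mult_left_mono word_eval_le) auto
  qed
  also have "\<dots> = q k \<one> * (\<Sum>w\<in>S. cmod (a w) * radius k ^ length w)"
    by (simp add: sum_distrib_left mult_ac)
  finally show ?thesis .
qed

lemma partial_eval_diff:
  assumes "M \<le> N"
  shows "partial_eval N a \<ominus> partial_eval M a = (\<Oplus>w\<in>words n N - words n M. a w \<odot> word_eval w)"
proof -
  let ?f = "\<lambda>w. a w \<odot> word_eval w"
  have c: "?f \<in> words n M \<rightarrow> carrier B" "?f \<in> words n N - words n M \<rightarrow> carrier B"
    using words_carrier by auto
  have "words n M \<union> (words n N - words n M) = words n N" using words_mono[OF assms] by blast
  hence "partial_eval N a = partial_eval M a \<oplus> (\<Oplus>w\<in>words n N - words n M. ?f w)"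
    using M.finsum_Un_disjoint[of "words n M" "words n N - words n M" ?f] c
    by (simp add: partial_eval_def Diff_disjoint)
  thus ?thesis
    using add_diff_cancel_left'[OF partial_eval_carrier M.finsum_closed[OF c(2)]] by simp
qed

lemma partial_eval_cauchy:
  assumes a: "a \<in> carrier (free_entire n)"
  shows "cauchy_seq B (\<lambda>N. partial_eval N a)"
proof (rule cauchy_seq_majorized[OF partial_eval_carrier])
  fix k M N :: nat assume MN: "M \<le> N"
  have "(\<Sum>w\<in>words n N - words n M. cmod (a w) * radius k ^ length w) =
      (\<Sum>w\<in>words n N. cmod (a w) * radius k ^ length w) - (\<Sum>w\<in>words n M. cmod (a w) * radius k ^ length w)"
    by (rule sum_diff[OF finite_words words_mono[OF MN]])
  thus "q k (partial_eval N a \<ominus> partial_eval M a) \<le> majorant a k N - majorant a k M"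
    unfolding partial_eval_diff[OF MN] majorant_def
    using q_finsum_words_le[of "words n N - words n M" N k a] by (simp add: right_diff_distrib)
next
  fix k
  have r: "0 < radius k" using radius_ge(1)[of k] by simp
  have "norm (\<Sum>w\<in>words n N. cmod (a w) * radius k ^ length w) \<le> free_entire_norm (radius k) a" for N
    using finite_sum_le_free_entire_norm[OF free_entire_carrierD(2)[OF a r] r finite_words, of n N] r
    by (simp add: sum_nonneg)
  hence "Bseq (\<lambda>N. \<Sum>w\<in>words n N. cmod (a w) * radius k ^ length w)" by (rule BseqI')
  moreover have "\<forall>M N. M \<le> N \<longrightarrow> (\<Sum>w\<in>words n M. cmod (a w) * radius k ^ length w) \<le>
      (\<Sum>w\<in>words n N. cmod (a w) * radius k ^ length w)"
    using r by (intro allI impI sum_mono2 words_mono finite_words) auto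
  ultimately have "convergent (\<lambda>N. \<Sum>w\<in>words n N. cmod (a w) * radius k ^ length w)"
    by (rule Bseq_mono_convergent)
  thus "convergent (majorant a k)" unfolding majorant_def
    by (rule convergent_mult[OF convergent_const])
qed

definition evaluation :: "(nat list \<Rightarrow> complex) \<Rightarrow> 'b" where
  "evaluation a = (SOME l. converges B (\<lambda>N. partial_eval N a) l)"

lemma partial_eval_converges:
  assumes "a \<in> carrier (free_entire n)"
  shows "converges B (\<lambda>N. partial_eval N a) (evaluation a)"
  unfolding evaluation_def using someI_ex[OF complete[OF partial_eval_cauchy[OF assms]]] .

lemma evaluation_eqI:
  assumes "a \<in> carrier (free_entire n)" "converges B (\<lambda>N. partial_eval N a) l"
  shows "evaluation a = l"
  by (rule converges_unique[OF partial_eval_converges[OF assms(1)] assms(2)])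

lemma evaluation_eqI_Suc:
  assumes "a \<in> carrier (free_entire n)" "converges B (\<lambda>N. partial_eval (Suc N) a) l"
  shows "evaluation a = l"
proof (rule converges_unique[OF _ assms(2)])
  show "converges B (\<lambda>N. partial_eval (Suc N) a) (evaluation a)"
  proof (rule convergesI[OF partial_eval_carrier])
    show "evaluation a \<in> carrier B" by (rule convergesD(2)[OF partial_eval_converges[OF assms(1)]])
    show "(\<lambda>N. q k (partial_eval (Suc N) a \<ominus> evaluation a)) \<longlonglongrightarrow> 0" for k
      using convergesD(3)[OF partial_eval_converges[OF assms(1)], of k]
      by (rule LIMSEQ_Suc)
  qed
qed

lemma linear_partial_eval: "linear_on (free_entire n) B (partial_eval N)"
  unfolding linear_on_def
proof (intro conjI ballI allI Pi_I partial_eval_carrier)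
  fix x y
  have c: "(\<lambda>w. x w \<odot> word_eval w) \<in> words n N \<rightarrow> carrier B" for x using words_carrier by auto
  have "partial_eval N (\<lambda>w. x w + y w) = (\<Oplus>w\<in>words n N. x w \<odot> word_eval w \<oplus> y w \<odot> word_eval w)"
    unfolding partial_eval_def using words_carrier
    by (intro M.finsum_cong') (auto simp: scale_left_distrib)
  thus "partial_eval N (x \<oplus>\<^bsub>free_entire n\<^esub> y) = partial_eval N x \<oplus> partial_eval N y"
    using M.finsum_addf[OF c[of x] c[of y]] by (simp add: free_entire_simps partial_eval_def)
next
  fix c x
  have c: "(\<lambda>w. x w \<odot> word_eval w) \<in> words n N \<rightarrow> carrier B" using words_carrier by auto
  have "partial_eval N (\<lambda>w. c * x w) = (\<Oplus>w\<in>words n N. c \<odot> (x w \<odot> word_eval w))"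
    unfolding partial_eval_def using words_carrier
    by (intro M.finsum_cong') (auto simp: scale_scale)
  thus "partial_eval N (c \<odot>\<^bsub>free_entire n\<^esub> x) = c \<odot> partial_eval N x"
    using scale_finsum[OF c, of c] by (simp add: free_entire_simps partial_eval_def)
qed

sublocale F: complete_algebra "free_entire n" fe_norm
  by (rule complete_algebra_free_entire)

lemma linear_evaluation: "linear_on (free_entire n) B evaluation"
  unfolding linear_on_def
proof (intro conjI ballI allI Pi_I)
  fix x assume x: "x \<in> carrier (free_entire n)"
  show "evaluation x \<in> carrier B" by (rule convergesD(2)[OF partial_eval_converges[OF x]])
  show "evaluation (c \<odot>\<^bsub>free_entire n\<^esub> x) = c \<odot> evaluation x" for c
    using converges_scale[OF partial_eval_converges[OF x], of c]
      linear_onD(3)[OF linear_partial_eval x, of _ c] F.scale_closed[OF x]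
    by (intro evaluation_eqI) simp_all
  fix y assume y: "y \<in> carrier (free_entire n)"
  show "evaluation (x \<oplus>\<^bsub>free_entire n\<^esub> y) = evaluation x \<oplus> evaluation y"
    using converges_add[OF partial_eval_converges[OF x] partial_eval_converges[OF y]]
      linear_onD(2)[OF linear_partial_eval x y] F.M.a_closed[OF x y]
    by (intro evaluation_eqI) simp_all
qed

lemma evaluation_le:
  assumes a: "a \<in> carrier (free_entire n)"
  shows "q k (evaluation a) \<le> q k \<one> * free_entire_norm (radius k) a"
proof (rule LIMSEQ_le_const2[OF converges_p[OF partial_eval_converges[OF a]]])
  have r: "0 < radius k" using radius_ge(1)[of k] by simp
  have "q k (partial_eval N a) \<le> q k \<one> * free_entire_norm (radius k) a" for N
  proof -
    have "q k (partial_eval N a) \<le> q k \<one> * (\<Sum>w\<in>words n N. cmod (a w) * radius k ^ length w)"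
      unfolding partial_eval_def by (rule q_finsum_words_le[OF order_refl])
    also have "\<dots> \<le> q k \<one> * free_entire_norm (radius k) a"
      by (intro mult_left_mono finite_sum_le_free_entire_norm free_entire_carrierD(2)[OF a] r finite_words) simp
    finally show ?thesis .
  qed
  thus "\<exists>N. \<forall>m\<ge>N. q k (partial_eval m a) \<le> q k \<one> * free_entire_norm (radius k) a" by blast
qed

lemma cont_linear_evaluation: "cont_linear (free_entire n) B evaluation"
proof (rule cont_linearI[OF F.seminormed_space_axioms seminormed_space_axioms linear_evaluation])
  fix k
  obtain j0 where "radius k \<le> real j0" using real_arch_simple[of "radius k"] ..
  then obtain j where j: "radius k \<le> real (Suc j)" by (intro that[of j0]) simp
  have r: "0 < radius k" using radius_ge(1)[of k] by simp
  have "q k (evaluation a) \<le> q k \<one> * fe_norm j a" if a: "a \<in> carrier (free_entire n)" for a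
  proof -
    have "free_entire_norm (radius k) a \<le> fe_norm j a"
      unfolding fe_norm_def by (rule summable_at_le[OF r j free_entire_carrierD(2)[OF a]]) simp
    hence "q k \<one> * free_entire_norm (radius k) a \<le> q k \<one> * fe_norm j a"
      by (intro mult_left_mono) auto
    thus ?thesis using evaluation_le[OF a, of k] by linarith
  qed
  thus "\<exists>j C. \<forall>a\<in>carrier (free_entire n). q k (evaluation a) \<le> C * fe_norm j a" by metis
qed

lemma evaluation_one: "evaluation \<one>\<^bsub>free_entire n\<^esub> = \<one>"
proof (rule evaluation_eqI)
  have "partial_eval N \<one>\<^bsub>free_entire n\<^esub> = \<one>" for N
  proof -
    have "partial_eval N \<one>\<^bsub>free_entire n\<^esub> = (\<Oplus>w\<in>words n N. if [] = w then word_eval w else \<zero>)"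
      unfolding partial_eval_def free_entire_simps using words_carrier
      by (intro M.finsum_cong') auto
    also have "\<dots> = word_eval []"
    proof (rule M.add.finprod_singleton[OF _ finite_words])
      show "[] \<in> words n N" by (simp add: words_def)
    qed (use words_carrier in auto)
    finally show ?thesis by simp
  qed
  thus "converges B (\<lambda>N. partial_eval N \<one>\<^bsub>free_entire n\<^esub>) \<one>" using converges_const by simp
qed simp

text \<open>Words of length at most \<open>N + 1\<close> that begin with \<open>i\<close> correspond to words of length at most \<open>N\<close>;
  the other coefficients of the product with the generator vanish. This is why the truncation
  indices on the two sides differ by one.\<close>

lemma evaluation_gen_mult:
  assumes i: "i < n" and a: "a \<in> carrier (free_entire n)"
  shows "evaluation (free_gen i \<otimes>\<^bsub>free_entire n\<^esub> a) = b i \<otimes> evaluation a"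
proof (rule evaluation_eqI_Suc)
  show "free_gen i \<otimes>\<^bsub>free_entire n\<^esub> a \<in> carrier (free_entire n)"
    using free_gen_carrier[OF i] a by simp
  have "partial_eval (Suc N) (free_gen i \<otimes>\<^bsub>free_entire n\<^esub> a) = b i \<otimes> partial_eval N a" for N
  proof -
    let ?f = "\<lambda>w. word_conv (free_gen i) a w \<odot> word_eval w"
    have sub: "(#) i ` words n N \<subseteq> words n (Suc N)" using i by (auto simp: words_def)
    have zero: "?f w = \<zero>" if w: "w \<in> words n (Suc N) - (#) i ` words n N" for w
    proof -
      have "word_conv (free_gen i) a w = 0"
      proof (cases w)
        case (Cons j v)
        have "v \<in> words n N" using w Cons by (auto simp: words_def)
        hence "j \<noteq> i" using w Cons by auto
        thus ?thesis using Cons by (simp add: word_conv_gen_Cons)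
      qed (simp add: free_gen_def)
      thus ?thesis using words_carrier[of w "Suc N"] w by simp
    qed
    have "partial_eval (Suc N) (free_gen i \<otimes>\<^bsub>free_entire n\<^esub> a) = (\<Oplus>w\<in>words n (Suc N). ?f w)"
      by (simp add: partial_eval_def free_entire_simps)
    also have "\<dots> = (\<Oplus>w\<in>(#) i ` words n N. ?f w)"
      using sub zero words_carrier by (intro M.add.finprod_mono_neutral_cong_right) auto
    also have "\<dots> = (\<Oplus>w\<in>words n N. ?f (i # w))"
      using sub words_carrier by (intro M.finsum_reindex) (auto simp: inj_on_def)
    also have "\<dots> = (\<Oplus>w\<in>words n N. b i \<otimes> (a w \<odot> word_eval w))"
      using words_carrier b_carrier[OF i]
      by (intro M.finsum_cong') (auto simp: word_conv_gen_Cons scale_mult_right)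
    also have "\<dots> = b i \<otimes> partial_eval N a"
      unfolding partial_eval_def using words_carrier b_carrier[OF i]
      by (intro finsum_rdistr[symmetric]) auto
    finally show ?thesis .
  qed
  thus "converges B (\<lambda>N. partial_eval (Suc N) (free_gen i \<otimes>\<^bsub>free_entire n\<^esub> a)) (b i \<otimes> evaluation a)"
    using converges_mult[OF converges_const[OF b_carrier[OF i]] partial_eval_converges[OF a]] by simp
qed

lemma evaluation_gen: "i < n \<Longrightarrow> evaluation (free_gen i) = b i"
  using evaluation_gen_mult[of i "\<one>\<^bsub>free_entire n\<^esub>"] free_gen_carrier[of i n] b_carrier[of i]
  by (simp add: evaluation_one)

text \<open>The elements \<open>x\<close> for which left multiplication by \<open>x\<close> is respected form a closed subalgebra, so
  the generators suffice.\<close>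

lemma evaluation_mult:
  assumes x: "x \<in> carrier (free_entire n)" and y: "y \<in> carrier (free_entire n)"
  shows "evaluation (x \<otimes>\<^bsub>free_entire n\<^esub> y) = evaluation x \<otimes> evaluation y"
proof -
  let ?A = "free_entire n"
  let ?M = "{x \<in> carrier ?A. \<forall>y\<in>carrier ?A. evaluation (x \<otimes>\<^bsub>?A\<^esub> y) = evaluation x \<otimes> evaluation y}"
  note ec = linear_onD(1)[OF linear_evaluation]
  have "closed_subspace ?A ?M"
    unfolding closed_subspace_def
  proof (intro conjI ballI allI impI)
    show "\<zero>\<^bsub>?A\<^esub> \<in> ?M"
      using ec by (simp add: linear_on_zero[OF linear_evaluation F.vspace_axioms vspace_axioms])
    fix x x' assume "x \<in> ?M" "x' \<in> ?M"
    thus "x \<oplus>\<^bsub>?A\<^esub> x' \<in> ?M"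
      using ec by (simp add: linear_onD(2)[OF linear_evaluation] F.l_distr l_distr)
  next
    fix c x assume "x \<in> ?M"
    thus "c \<odot>\<^bsub>?A\<^esub> x \<in> ?M"
      using ec by (simp add: linear_onD(3)[OF linear_evaluation] F.scale_mult_left scale_mult_left)
  next
    fix s l assume sl: "(\<forall>m. s m \<in> ?M) \<and> converges ?A s l"
    hence l: "l \<in> carrier ?A" and s: "converges ?A s l" using F.convergesD(2) by auto
    have "evaluation (l \<otimes>\<^bsub>?A\<^esub> y) = evaluation l \<otimes> evaluation y" if y: "y \<in> carrier ?A" for y
    proof (rule converges_unique)
      show "converges B (\<lambda>m. evaluation (s m \<otimes>\<^bsub>?A\<^esub> y)) (evaluation (l \<otimes>\<^bsub>?A\<^esub> y))"
        by (rule cont_linear_converges[OF cont_linear_evaluation F.converges_mult[OF s F.converges_const[OF y]]])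
      have "(\<lambda>m. evaluation (s m \<otimes>\<^bsub>?A\<^esub> y)) = (\<lambda>m. evaluation (s m) \<otimes> evaluation y)"
        using sl y by auto
      thus "converges B (\<lambda>m. evaluation (s m \<otimes>\<^bsub>?A\<^esub> y)) (evaluation l \<otimes> evaluation y)"
        using converges_mult[OF cont_linear_converges[OF cont_linear_evaluation s] converges_const[OF ec[OF y]]]
        by simp
    qed
    thus "l \<in> ?M" using l by simp
  qed auto
  moreover have "\<one>\<^bsub>?A\<^esub> \<in> ?M" using ec by (simp add: evaluation_one)
  moreover have "x \<otimes>\<^bsub>?A\<^esub> x' \<in> ?M" if "x \<in> ?M" "x' \<in> ?M" for x x'
    using that ec by (simp add: F.m_assoc m_assoc)
  ultimately have "closed_subalgebra ?A ?M" unfolding closed_subalgebra_def by blast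
  moreover have "free_gen ` {..<n} \<subseteq> ?M"
    using free_gen_carrier evaluation_gen_mult evaluation_gen by auto
  ultimately have "carrier ?A \<subseteq> ?M" using free_entire_generates unfolding generates_def by blast
  thus ?thesis using x y by blast
qed

lemma cont_hom_evaluation: "cont_hom (free_entire n) B evaluation"
  using cont_linear_evaluation evaluation_mult evaluation_one linear_onD[OF linear_evaluation]
  by (auto simp: cont_hom_def ring_hom_def)

end

section \<open>Universal HFG algebras\<close>

definition universal_norm :: "nat \<Rightarrow> (nat list \<Rightarrow> complex) set \<Rightarrow> nat \<Rightarrow> (nat list \<Rightarrow> complex) set \<Rightarrow> real" where
  "universal_norm n R = quotient_norm (free_entire n) (closed_ideal_gen (free_entire n) R) fe_norm"

locale hfg_presentation =
  fixes n :: nat and R :: "(nat list \<Rightarrow> complex) set"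
  assumes R_carrier: "R \<subseteq> carrier (free_entire n)"
begin

sublocale closed_ideal_quotient "free_entire n" fe_norm "closed_ideal_gen (free_entire n) R"
  by (intro closed_ideal_quotient.intro complete_algebra_free_entire closed_ideal_quotient_axioms.intro
      closed_ideal_closed_ideal_gen[OF complete_algebra_free_entire R_carrier])

abbreviation "U \<equiv> universal_hfg n R"

lemma complete_algebra_U: "complete_algebra U (universal_norm n R)"
  using complete_algebra_Q by (simp add: universal_hfg_def universal_norm_def)

lemma generates_U: "generates U (universal_hfg_gen n R ` {..<n})"
  using generates_quotient[OF free_entire_generates]
  by (simp add: universal_hfg_def universal_hfg_gen_def image_image)

lemma hfg_U: "hfg U"
proof -
  interpret U: complete_algebra U "universal_norm n R" by (rule complete_algebra_U)
  have "topologically_isomorphic U (quotient_talg (free_entire n) (closed_ideal_gen (free_entire n) R))"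
    unfolding topologically_isomorphic_def
    using cont_hom_id[of U] homeomorphic_map_id[of "topo U"]
    by (intro exI[of _ "\<lambda>x. x"]) (simp add: universal_hfg_def id_def)
  thus ?thesis using U.frechet_arens_michael closed_ideal unfolding hfg_def by blast
qed

lemma proj_relation: "r \<in> R \<Longrightarrow> proj r = \<zero>\<^bsub>U\<^esub>"
proof -
  assume r: "r \<in> R"
  hence "r \<in> closed_ideal_gen (free_entire n) R" by (auto simp: closed_ideal_gen_def)
  hence "proj r = proj \<zero>\<^bsub>free_entire n\<^esub>" using r R_carrier by (subst proj_eq_iff) auto
  thus ?thesis using proj_zero by (simp add: universal_hfg_def)
qed

lemma cont_hom_U_proj: "cont_hom (free_entire n) U proj"
  using cont_hom_proj by (simp add: universal_hfg_def)

text \<open>Relations need only be checked for continuous homomorphisms with the prescribed values on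
  generators. This allows relations that contain infinite series, such as exponentials, to be
  evaluated by continuity rather than coefficient by coefficient.\<close>

lemma universal_lift:
  assumes B: "complete_algebra B q" and b: "\<And>i. i < n \<Longrightarrow> b i \<in> carrier B"
    and rel: "\<And>f r. \<lbrakk>cont_hom (free_entire n) B f; \<And>i. i < n \<Longrightarrow> f (free_gen i) = b i; r \<in> R\<rbrakk>
      \<Longrightarrow> f r = \<zero>\<^bsub>B\<^esub>"
  obtains f where "cont_hom U B f" "\<And>i. i < n \<Longrightarrow> f (universal_hfg_gen n R i) = b i"
proof -
  interpret E: free_evaluation B q n b
    by (intro free_evaluation.intro B free_evaluation_axioms.intro b)
  have e: "E.evaluation r = \<zero>\<^bsub>B\<^esub>" if "r \<in> R" for r
    by (rule rel[OF E.cont_hom_evaluation E.evaluation_gen that])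
  obtain g where g: "cont_hom Q B g" "\<And>x. x \<in> carrier (free_entire n) \<Longrightarrow> g (proj x) = E.evaluation x"
    using quotient_lift[OF B E.cont_hom_evaluation]
      closed_ideal_gen_subset_kernel[OF complete_algebra_free_entire B E.cont_hom_evaluation R_carrier e]
    by metis
  show thesis
  proof (rule that)
    show "cont_hom U B g" using g by (simp add: universal_hfg_def)
    show "g (universal_hfg_gen n R i) = b i" if "i < n" for i
      using g(2)[OF free_gen_carrier[OF that]] E.evaluation_gen[OF that] by (simp add: universal_hfg_gen_def)
  qed
qed

end

section \<open>Algebraic tensor products\<close>

lemma lookup_free_scale [simp]:
  "Poly_Mapping.lookup (free_scale c u) z = c * Poly_Mapping.lookup u z"
  by (simp add: free_scale_def Poly_Mapping.map.rep_eq when_def)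

interpretation FS: Modules.module free_scale
  by unfold_locales (auto intro!: poly_mapping_eqI simp: lookup_add algebra_simps)

lemma free_scale_single [simp]:
  "free_scale c (Poly_Mapping.single z d) = Poly_Mapping.single z (c * d)"
  by (auto intro!: poly_mapping_eqI simp: lookup_single when_def)

lemma keys_free_scale: "Poly_Mapping.keys (free_scale c u) \<subseteq> Poly_Mapping.keys u"
  by (auto simp: in_keys_iff)

text \<open>The linear extension of a map from a basis to another free vector space.\<close>

definition lin_ext :: "('k \<Rightarrow> 'l \<Rightarrow>\<^sub>0 complex) \<Rightarrow> ('k \<Rightarrow>\<^sub>0 complex) \<Rightarrow> 'l \<Rightarrow>\<^sub>0 complex" where
  "lin_ext f u = (\<Sum>k\<in>Poly_Mapping.keys u. free_scale (Poly_Mapping.lookup u k) (f k))"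

lemma lin_ext_superset:
  assumes "finite S" "Poly_Mapping.keys u \<subseteq> S"
  shows "lin_ext f u = (\<Sum>k\<in>S. free_scale (Poly_Mapping.lookup u k) (f k))"
  unfolding lin_ext_def using assms
  by (intro sum.mono_neutral_left) (auto simp: in_keys_iff)

lemma lin_ext_add: "lin_ext f (u + v) = lin_ext f u + lin_ext f v"
proof -
  let ?S = "Poly_Mapping.keys u \<union> Poly_Mapping.keys v"
  have "finite ?S" by simp
  note S = lin_ext_superset[OF this]
  show ?thesis
    using S[of "u + v" f] S[of u f] S[of v f] Poly_Mapping.keys_add[of u v]
    by (simp add: lookup_add FS.scale_left_distrib sum.distrib)
qed

lemma lin_ext_scale: "lin_ext f (free_scale c u) = free_scale c (lin_ext f u)"
  using lin_ext_superset[OF finite_keys keys_free_scale, of f c u]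
  by (simp add: lin_ext_def FS.scale_sum_right)

lemma lin_ext_minus: "lin_ext f (u - v) = lin_ext f u - lin_ext f v"
  using lin_ext_add[of f u "- v"] lin_ext_scale[of f "-1" v] by simp

lemma lin_ext_single [simp]: "lin_ext f (Poly_Mapping.single k c) = free_scale c (f k)"
  by (simp add: lin_ext_def)

lemma lin_ext_zero [simp]: "lin_ext f 0 = 0"
  by (simp add: lin_ext_def)

lemma lin_ext_in_span:
  "(\<And>k. k \<in> Poly_Mapping.keys u \<Longrightarrow> f k \<in> FS.span S) \<Longrightarrow> lin_ext f u \<in> FS.span S"
  unfolding lin_ext_def by (intro FS.span_sum FS.span_scale)

lemma subspace_free_vectors: "FS.subspace (free_vectors A B)"
proof (rule FS.subspaceI)
  fix c u v assume u: "u \<in> free_vectors A B"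
  show "free_scale c u \<in> free_vectors A B"
    using u keys_free_scale[of c u] unfolding free_vectors_def by blast
  assume v: "v \<in> free_vectors A B"
  show "u + v \<in> free_vectors A B"
    using u v Poly_Mapping.keys_add[of u v] unfolding free_vectors_def by blast
qed (simp add: free_vectors_def)

lemma sum_single_lookup:
  "(\<Sum>z\<in>Poly_Mapping.keys u. Poly_Mapping.single z (Poly_Mapping.lookup u z)) = u"
  by (rule poly_mapping_eqI) (simp add: lookup_sum lookup_single when_def in_keys_iff)

text \<open>A list of pairs stands for the sum of the corresponding pure tensors. Every element of the
  algebraic tensor product is of this form.\<close>

definition list_vector :: "('a \<times> 'b) list \<Rightarrow> ('a \<times> 'b) \<Rightarrow>\<^sub>0 complex" where
  "list_vector xs = (\<Sum>z\<leftarrow>xs. Poly_Mapping.single z 1)"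

definition list_tensor :: "'a talg \<Rightarrow> 'b talg \<Rightarrow> ('a \<times> 'b) list \<Rightarrow> (('a \<times> 'b) \<Rightarrow>\<^sub>0 complex) set" where
  "list_tensor A B xs = tensor_class A B (list_vector xs)"

definition pair_lists :: "'a talg \<Rightarrow> 'b talg \<Rightarrow> ('a \<times> 'b) list set" where
  "pair_lists A B = lists (carrier A \<times> carrier B)"

definition list_cost :: "('a \<Rightarrow> real) \<Rightarrow> ('b \<Rightarrow> real) \<Rightarrow> ('a \<times> 'b) list \<Rightarrow> real" where
  "list_cost p q xs = (\<Sum>(a, b)\<leftarrow>xs. p a * q b)"

lemma list_vector_simps [simp]:
  "list_vector [] = 0" "list_vector (z # xs) = Poly_Mapping.single z 1 + list_vector xs"
  "list_vector (xs @ ys) = list_vector xs + list_vector ys"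
  by (simp_all add: list_vector_def)

lemma list_cost_simps [simp]:
  "list_cost p q [] = 0" "list_cost p q (z # xs) = p (fst z) * q (snd z) + list_cost p q xs"
  "list_cost p q (xs @ ys) = list_cost p q xs + list_cost p q ys"
  by (simp_all add: list_cost_def case_prod_beta)

lemma projective_seminorm_eq:
  "projective_seminorm A B p q = image_norm (pair_lists A B) (list_tensor A B) (list_cost p q)"
  by (rule ext)
     (auto simp: projective_seminorm_def image_norm_def list_tensor_def list_vector_def list_cost_def
       pair_lists_def in_lists_conv_set subset_iff intro!: arg_cong[where f = Inf])

lemma alg_tensor_simps:
  "carrier (alg_tensor A B) = tensor_class A B ` free_vectors A B"
  "one (alg_tensor A B) = tensor_class A B (Poly_Mapping.single (\<one>\<^bsub>A\<^esub>, \<one>\<^bsub>B\<^esub>) 1)"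
  "zero (alg_tensor A B) = tensor_class A B 0"
  "add (alg_tensor A B) = (\<lambda>X Y. \<Union>u\<in>X. \<Union>v\<in>Y. tensor_class A B (u + v))"
  "smult (alg_tensor A B) = (\<lambda>c X. \<Union>u\<in>X. tensor_class A B (free_scale c u))"
  by (simp_all add: alg_tensor_def alg_tensor_module_def)

definition bilinear_on :: "'a talg \<Rightarrow> 'b talg \<Rightarrow> 'c talg \<Rightarrow> ('a \<Rightarrow> 'b \<Rightarrow> 'c) \<Rightarrow> bool" where
  "bilinear_on A B C \<beta> \<longleftrightarrow>
    (\<forall>b\<in>carrier B. linear_on A C (\<lambda>a. \<beta> a b)) \<and> (\<forall>a\<in>carrier A. linear_on B C (\<beta> a))"

locale tensor_pair = A: vspace A + B: vspace B
  for A :: "'a talg" and B :: "'b talg"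
begin

abbreviation "N \<equiv> FS.span (bilinearity_relations A B)"
abbreviation "tc \<equiv> tensor_class A B"
abbreviation "FV \<equiv> free_vectors A B"
abbreviation "T \<equiv> alg_tensor A B"
abbreviation "lt \<equiv> list_tensor A B"
abbreviation "PL \<equiv> pair_lists A B"

lemma tc_eq_iff: "tc u = tc v \<longleftrightarrow> u - v \<in> N"
proof
  assume "tc u = tc v"
  moreover have "u \<in> tc u" by (simp add: tensor_class_def FS.span_zero)
  ultimately show "u - v \<in> N" by (simp add: tensor_class_def)
next
  assume *: "u - v \<in> N"
  have "w - u \<in> N \<longleftrightarrow> w - v \<in> N" for w
    using FS.span_add[OF _ *, of "w - u"] FS.span_diff[OF _ *, of "w - v"] by auto
  thus "tc u = tc v" by (simp add: tensor_class_def)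
qed

lemma tc_self: "u \<in> tc u"
  by (simp add: tensor_class_def FS.span_zero)

lemmas FV_add = FS.subspace_add[OF subspace_free_vectors[of A B]]
  and FV_scale = FS.subspace_scale[OF subspace_free_vectors[of A B]]
  and FV_0 = FS.subspace_0[OF subspace_free_vectors[of A B]]
  and FV_neg = FS.subspace_neg[OF subspace_free_vectors[of A B]]
  and FV_diff = FS.subspace_diff[OF subspace_free_vectors[of A B]]

lemma relations_in_FV: "bilinearity_relations A B \<subseteq> FV"
proof -
  have s: "Poly_Mapping.single (a, b) c \<in> FV" if "a \<in> carrier A" "b \<in> carrier B" for a b c
    using that by (simp add: free_vectors_def)
  show ?thesis
    unfolding bilinearity_relations_def
    by (auto intro!: FV_diff s)
qed

lemma N_in_FV: "N \<subseteq> FV"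
  by (rule FS.span_minimal[OF relations_in_FV subspace_free_vectors])

lemma single_in_FV: "z \<in> carrier A \<times> carrier B \<Longrightarrow> Poly_Mapping.single z c \<in> FV"
  by (auto simp: free_vectors_def)

lemma tc_subset_FV: "u \<in> FV \<Longrightarrow> v \<in> tc u \<Longrightarrow> v \<in> FV"
  using N_in_FV FV_add[of u "v - u"]
  by (auto simp: tensor_class_def)

lemma tc_add: "tc u \<oplus>\<^bsub>T\<^esub> tc v = tc (u + v)"
proof -
  have "tc (u' + v') = tc (u + v)" if "u' \<in> tc u" "v' \<in> tc v" for u' v'
    using FS.span_add[of "u' - u" _ "v' - v"] that
    by (simp add: tensor_class_def[of A B u] tensor_class_def[of A B v] tc_eq_iff algebra_simps)
  hence "(\<Union>u'\<in>tc u. \<Union>v'\<in>tc v. tc (u' + v')) = tc (u + v)" using tc_self by blast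
  thus ?thesis by (simp add: alg_tensor_simps)
qed

lemma tc_scale: "c \<odot>\<^bsub>T\<^esub> tc u = tc (free_scale c u)"
proof -
  have "tc (free_scale c u') = tc (free_scale c u)" if "u' \<in> tc u" for u'
    using FS.span_scale[of "u' - u" _ c] that
    by (simp add: tensor_class_def[of A B u] tc_eq_iff FS.scale_right_diff_distrib)
  hence "(\<Union>u'\<in>tc u. tc (free_scale c u')) = tc (free_scale c u)" using tc_self by blast
  thus ?thesis by (simp add: alg_tensor_simps)
qed

lemma vspace_T: "vspace T"
proof -
  define X :: "(('a \<times> 'b) \<Rightarrow>\<^sub>0 complex) talg" where
    "X = \<lparr>carrier = FV, mult = undefined, one = undefined, zero = 0, add = (+),
      smult = free_scale, topo = undefined\<rparr>"
  note sub = FV_add FV_0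
    FV_scale FV_neg
  have "vspace X"
    unfolding vspace_def
  proof (intro moduleI cring_complex_talg abelian_groupI)
    fix x assume "x \<in> carrier X"
    thus "\<exists>y\<in>carrier X. y \<oplus>\<^bsub>X\<^esub> x = \<zero>\<^bsub>X\<^esub>"
      using sub(4)[of x] by (intro bexI[of _ "- x"]) (auto simp: X_def)
  qed (auto simp: X_def sub algebra_simps FS.scale_left_distrib FS.scale_right_distrib)
  thus ?thesis
    by (rule vspace_image[where f = tc])
       (simp_all add: X_def tc_add tc_scale alg_tensor_simps(1,3))
qed

sublocale T: vspace T by (rule vspace_T)

lemma tc_bilinear:
  assumes "a \<in> carrier A" "b \<in> carrier B"
  shows "a' \<in> carrier A \<Longrightarrow> tc (Poly_Mapping.single (a \<oplus>\<^bsub>A\<^esub> a', b) 1) =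
      tc (Poly_Mapping.single (a, b) 1) \<oplus>\<^bsub>T\<^esub> tc (Poly_Mapping.single (a', b) 1)"
    and "b' \<in> carrier B \<Longrightarrow> tc (Poly_Mapping.single (a, b \<oplus>\<^bsub>B\<^esub> b') 1) =
      tc (Poly_Mapping.single (a, b) 1) \<oplus>\<^bsub>T\<^esub> tc (Poly_Mapping.single (a, b') 1)"
    and "tc (Poly_Mapping.single (c \<odot>\<^bsub>A\<^esub> a, b) 1) = c \<odot>\<^bsub>T\<^esub> tc (Poly_Mapping.single (a, b) 1)"
    and "tc (Poly_Mapping.single (a, c \<odot>\<^bsub>B\<^esub> b) 1) = c \<odot>\<^bsub>T\<^esub> tc (Poly_Mapping.single (a, b) 1)"
proof -
  have r: "u \<in> bilinearity_relations A B \<Longrightarrow> u \<in> N" for u by (rule FS.span_base)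
  show "tc (Poly_Mapping.single (a \<oplus>\<^bsub>A\<^esub> a', b) 1) =
      tc (Poly_Mapping.single (a, b) 1) \<oplus>\<^bsub>T\<^esub> tc (Poly_Mapping.single (a', b) 1)" if "a' \<in> carrier A"
    unfolding tc_add tc_eq_iff diff_diff_add[symmetric]
    by (rule r) (use assms that in \<open>unfold bilinearity_relations_def, blast\<close>)
  show "tc (Poly_Mapping.single (a, b \<oplus>\<^bsub>B\<^esub> b') 1) =
      tc (Poly_Mapping.single (a, b) 1) \<oplus>\<^bsub>T\<^esub> tc (Poly_Mapping.single (a, b') 1)" if "b' \<in> carrier B"
    unfolding tc_add tc_eq_iff diff_diff_add[symmetric]
    by (rule r) (use assms that in \<open>unfold bilinearity_relations_def, blast\<close>)
  show "tc (Poly_Mapping.single (c \<odot>\<^bsub>A\<^esub> a, b) 1) = c \<odot>\<^bsub>T\<^esub> tc (Poly_Mapping.single (a, b) 1)"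
    unfolding tc_scale tc_eq_iff free_scale_single mult_1_right
    by (rule r) (use assms in \<open>unfold bilinearity_relations_def, blast\<close>)
  show "tc (Poly_Mapping.single (a, c \<odot>\<^bsub>B\<^esub> b) 1) = c \<odot>\<^bsub>T\<^esub> tc (Poly_Mapping.single (a, b) 1)"
    unfolding tc_scale tc_eq_iff free_scale_single mult_1_right
    by (rule r) (use assms in \<open>unfold bilinearity_relations_def, blast\<close>)
qed

lemma list_vector_in_FV: "xs \<in> PL \<Longrightarrow> list_vector xs \<in> FV"
  by (induction xs)
     (auto simp: pair_lists_def FV_0
       intro!: FV_add single_in_FV)

lemma lt_append: "lt (xs @ ys) = lt xs \<oplus>\<^bsub>T\<^esub> lt ys"
  by (simp add: list_tensor_def tc_add)

lemma lt_Nil: "lt [] = \<zero>\<^bsub>T\<^esub>"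
  by (simp add: list_tensor_def alg_tensor_simps)

lemma lt_carrier: "xs \<in> PL \<Longrightarrow> lt xs \<in> carrier T"
  by (simp add: list_tensor_def alg_tensor_simps list_vector_in_FV)

lemma lt_Cons: "lt (z # xs) = lt [z] \<oplus>\<^bsub>T\<^esub> lt xs"
  using lt_append[of "[z]" xs] by simp

lemma lt_scale:
  assumes "xs \<in> PL" shows "lt (map (\<lambda>(a, b). (c \<odot>\<^bsub>A\<^esub> a, b)) xs) = c \<odot>\<^bsub>T\<^esub> lt xs"
  using assms
proof (induction xs)
  case (Cons z xs)
  obtain a b where z: "z = (a, b)" by (cases z)
  have ab: "a \<in> carrier A" "b \<in> carrier B" "xs \<in> PL" using Cons.prems z by (auto simp: pair_lists_def)
  have zc: "lt [z] \<in> carrier T" using Cons.prems by (intro lt_carrier) (auto simp: pair_lists_def)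
  have "lt [(c \<odot>\<^bsub>A\<^esub> a, b)] = c \<odot>\<^bsub>T\<^esub> lt [(a, b)]"
    using tc_bilinear(3)[OF ab(1,2)] by (simp add: list_tensor_def)
  thus ?case
    using Cons.IH[OF ab(3)] lt_Cons[of z xs] lt_Cons[of "(c \<odot>\<^bsub>A\<^esub> a, b)" "map (\<lambda>(a, b). (c \<odot>\<^bsub>A\<^esub> a, b)) xs"] zc lt_carrier[OF ab(3)]
    unfolding z list.map prod.case by (simp only: T.scale_right_distrib)
qed (simp add: lt_Nil)

lemma map_scale_PL: "xs \<in> PL \<Longrightarrow> map (\<lambda>(a, b). (c \<odot>\<^bsub>A\<^esub> a, b)) xs \<in> PL"
  by (induction xs) (auto simp: pair_lists_def)

text \<open>Coefficients can be absorbed into the first factors.\<close>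

lemma lt_surj: "lt ` PL = carrier T"
proof
  show "lt ` PL \<subseteq> carrier T" using lt_carrier by blast
  show "carrier T \<subseteq> lt ` PL"
  proof
    fix X assume "X \<in> carrier T"
    then obtain u where u: "u \<in> FV" "X = tc u" by (auto simp: alg_tensor_simps)
    have "\<exists>xs\<in>PL. tc (\<Sum>z\<in>S. Poly_Mapping.single z (Poly_Mapping.lookup u z)) = lt xs"
      if "finite S" "S \<subseteq> carrier A \<times> carrier B" for S
      using that
    proof (induction S rule: finite_induct)
      case empty
      show ?case by (intro bexI[of _ "[]"]) (auto simp: pair_lists_def list_tensor_def)
    next
      case (insert z S)
      obtain xs where xs: "xs \<in> PL" "tc (\<Sum>z\<in>S. Poly_Mapping.single z (Poly_Mapping.lookup u z)) = lt xs"
        using insert by auto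
      have z: "[z] \<in> PL" using insert.prems by (auto simp: pair_lists_def)
      define ys where "ys = map (\<lambda>(a, b). (Poly_Mapping.lookup u z \<odot>\<^bsub>A\<^esub> a, b)) [z]"
      have ys: "ys \<in> PL" "lt ys = Poly_Mapping.lookup u z \<odot>\<^bsub>T\<^esub> lt [z]"
        unfolding ys_def by (rule map_scale_PL[OF z], rule lt_scale[OF z])
      have "tc (\<Sum>z\<in>insert z S. Poly_Mapping.single z (Poly_Mapping.lookup u z)) = lt ys \<oplus>\<^bsub>T\<^esub> lt xs"
      proof -
        have "lt ys = tc (Poly_Mapping.single z (Poly_Mapping.lookup u z))"
          unfolding ys(2) by (simp add: list_tensor_def tc_scale)
        thus ?thesis using insert.hyps xs(2) by (simp add: tc_add[symmetric])
      qed
      also have "\<dots> = lt (ys @ xs)" by (simp add: lt_append)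
      finally show ?case using xs(1) ys(1) by (intro bexI[of _ "ys @ xs"]) (auto simp: pair_lists_def)
    qed
    from this[of "Poly_Mapping.keys u"] u
    show "X \<in> lt ` PL" by (auto simp: free_vectors_def sum_single_lookup)
  qed
qed

text \<open>The linear extension of a bilinear map to the free vector space vanishes on the relations.\<close>

lemma alg_tensor_lift:
  assumes C: "vspace C" and \<beta>: "bilinear_on A B C \<beta>"
  obtains f where "linear_on T C f"
    "\<And>a b. \<lbrakk>a \<in> carrier A; b \<in> carrier B\<rbrakk> \<Longrightarrow> f (lt [(a, b)]) = \<beta> a b"
proof -
  interpret C: vspace C by fact
  have l1: "linear_on A C (\<lambda>a. \<beta> a b)" if "b \<in> carrier B" for b using \<beta> that by (simp add: bilinear_on_def)
  have l2: "linear_on B C (\<beta> a)" if "a \<in> carrier A" for a using \<beta> that by (simp add: bilinear_on_def)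
  define g where "g u = finsum C (\<lambda>z. Poly_Mapping.lookup u z \<odot>\<^bsub>C\<^esub> \<beta> (fst z) (snd z)) (Poly_Mapping.keys u)" for u
  have \<beta>c: "\<beta> (fst z) (snd z) \<in> carrier C" if "z \<in> carrier A \<times> carrier B" for z
    using linear_onD(1)[OF l1] that by auto
  have sup: "g u = finsum C (\<lambda>z. Poly_Mapping.lookup u z \<odot>\<^bsub>C\<^esub> \<beta> (fst z) (snd z)) S"
    if "finite S" "Poly_Mapping.keys u \<subseteq> S" "S \<subseteq> carrier A \<times> carrier B" for u S
    unfolding g_def using that \<beta>c
    by (intro C.M.add.finprod_mono_neutral_cong_left) (auto simp: in_keys_iff subset_iff)
  have g_add: "g (u + v) = g u \<oplus>\<^bsub>C\<^esub> g v" if "u \<in> FV" "v \<in> FV" for u v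
  proof -
    let ?S = "Poly_Mapping.keys u \<union> Poly_Mapping.keys v"
    have S: "finite ?S" "?S \<subseteq> carrier A \<times> carrier B" using that by (auto simp: free_vectors_def)
    have "g (u + v) = finsum C (\<lambda>z. Poly_Mapping.lookup u z \<odot>\<^bsub>C\<^esub> \<beta> (fst z) (snd z) \<oplus>\<^bsub>C\<^esub>
        Poly_Mapping.lookup v z \<odot>\<^bsub>C\<^esub> \<beta> (fst z) (snd z)) ?S"
      unfolding sup[OF S(1) Poly_Mapping.keys_add S(2)]
    proof (rule C.M.finsum_cong')
      fix z assume "z \<in> ?S"
      hence "\<beta> (fst z) (snd z) \<in> carrier C" using S(2) by (intro \<beta>c) (rule subsetD)
      thus "Poly_Mapping.lookup (u + v) z \<odot>\<^bsub>C\<^esub> \<beta> (fst z) (snd z) =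
          Poly_Mapping.lookup u z \<odot>\<^bsub>C\<^esub> \<beta> (fst z) (snd z) \<oplus>\<^bsub>C\<^esub> Poly_Mapping.lookup v z \<odot>\<^bsub>C\<^esub> \<beta> (fst z) (snd z)"
        by (simp add: lookup_add C.scale_left_distrib)
    qed (use S(2) \<beta>c in auto)
    also have "\<dots> = g u \<oplus>\<^bsub>C\<^esub> g v"
      unfolding sup[OF S(1) Un_upper1 S(2)] sup[OF S(1) Un_upper2 S(2)]
      by (intro C.M.finsum_addf) (use S(2) \<beta>c in auto)
    finally show ?thesis .
  qed
  have g_scale: "g (free_scale c u) = c \<odot>\<^bsub>C\<^esub> g u" if "u \<in> FV" for c u
  proof -
    have S: "Poly_Mapping.keys u \<subseteq> carrier A \<times> carrier B" using that by (simp add: free_vectors_def)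
    have "g (free_scale c u) =
        finsum C (\<lambda>z. c \<odot>\<^bsub>C\<^esub> (Poly_Mapping.lookup u z \<odot>\<^bsub>C\<^esub> \<beta> (fst z) (snd z))) (Poly_Mapping.keys u)"
      unfolding sup[OF finite_keys keys_free_scale S]
      by (intro C.M.finsum_cong') (use S \<beta>c in \<open>auto simp: C.scale_scale\<close>)
    also have "\<dots> = c \<odot>\<^bsub>C\<^esub> g u"
      unfolding g_def by (rule C.scale_finsum[symmetric]) (use S \<beta>c in auto)
    finally show ?thesis .
  qed
  have g_single: "g (Poly_Mapping.single (a, b) c) = c \<odot>\<^bsub>C\<^esub> \<beta> a b" if "a \<in> carrier A" "b \<in> carrier B" for a b c
    using sup[of "{(a, b)}" "Poly_Mapping.single (a, b) c"] \<beta>c[of "(a, b)"] that by simp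
  have g_carrier: "g u \<in> carrier C" if "u \<in> FV" for u
    unfolding g_def by (rule C.M.finsum_closed) (use that \<beta>c in \<open>auto simp: free_vectors_def\<close>)
  have g_minus: "g (u - v) = g u \<ominus>\<^bsub>C\<^esub> g v" if "u \<in> FV" "v \<in> FV" for u v
    using g_add[of u "free_scale (-1) v"] g_scale[of v "-1"] that g_carrier
      FV_neg[OF that(2)]
    by (simp add: C.minus_eq_scale)
  have FVs: "Poly_Mapping.single (a, b) c \<in> FV" if "a \<in> carrier A" "b \<in> carrier B" for a b c
    using that by (intro single_in_FV) auto
  note FVd = FV_diff
  have cancel: "(x \<oplus>\<^bsub>C\<^esub> y) \<ominus>\<^bsub>C\<^esub> x \<ominus>\<^bsub>C\<^esub> y = \<zero>\<^bsub>C\<^esub>" if "x \<in> carrier C" "y \<in> carrier C" for x y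
    using that by (simp add: C.add_diff_cancel_left')
  have rel: "g u = \<zero>\<^bsub>C\<^esub>" if "u \<in> bilinearity_relations A B" for u
    using that unfolding bilinearity_relations_def
  proof (elim UnE CollectE exE conjE)
    fix a a' b assume u: "u = Poly_Mapping.single (a \<oplus>\<^bsub>A\<^esub> a', b) 1 - Poly_Mapping.single (a, b) 1
       - Poly_Mapping.single (a', b) 1" and c: "a \<in> carrier A" "a' \<in> carrier A" "b \<in> carrier B"
    show "g u = \<zero>\<^bsub>C\<^esub>"
      unfolding u using c linear_onD(1,2)[OF l1[OF c(3)]]
      by (simp add: g_minus FVs FVd g_single cancel)
  next
    fix a b b' assume u: "u = Poly_Mapping.single (a, b \<oplus>\<^bsub>B\<^esub> b') 1 - Poly_Mapping.single (a, b) 1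
       - Poly_Mapping.single (a, b') 1" and c: "a \<in> carrier A" "b \<in> carrier B" "b' \<in> carrier B"
    show "g u = \<zero>\<^bsub>C\<^esub>"
      unfolding u using c linear_onD(1,2)[OF l2[OF c(1)]]
      by (simp add: g_minus FVs FVd g_single cancel)
  next
    fix d a b assume u: "u = Poly_Mapping.single (d \<odot>\<^bsub>A\<^esub> a, b) 1 - Poly_Mapping.single (a, b) d"
      and c: "a \<in> carrier A" "b \<in> carrier B"
    show "g u = \<zero>\<^bsub>C\<^esub>"
      unfolding u using c linear_onD(1,3)[OF l1[OF c(2)]]
      by (simp add: g_minus FVs g_single)
  next
    fix d a b assume u: "u = Poly_Mapping.single (a, d \<odot>\<^bsub>B\<^esub> b) 1 - Poly_Mapping.single (a, b) d"
      and c: "a \<in> carrier A" "b \<in> carrier B"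
    show "g u = \<zero>\<^bsub>C\<^esub>"
      unfolding u using c linear_onD(1,3)[OF l2[OF c(1)]]
      by (simp add: g_minus FVs g_single)
  qed
  have g0: "g 0 = \<zero>\<^bsub>C\<^esub>" by (simp add: g_def)
  have gN: "g u = \<zero>\<^bsub>C\<^esub>" if "u \<in> N" for u
  proof -
    have "u \<in> FV \<and> g u = \<zero>\<^bsub>C\<^esub>" using that
    proof (induction rule: FS.span_induct_alt)
      case base
      show ?case using g0 FV_0 by simp
    next
      case (step c x y)
      have x: "x \<in> FV" using step(1) relations_in_FV by blast
      thus ?case using step rel[OF step(1)] FV_scale[OF x, of c]
        FV_add[OF FV_scale[OF x], of y c] by (simp add: g_add g_scale)
    qed
    thus ?thesis ..
  qed
  define f where "f X = g (SOME u. u \<in> FV \<and> tc u = X)" for X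
  have f: "f (tc u) = g u" if u: "u \<in> FV" for u
  proof -
    define v where "v = (SOME v. v \<in> FV \<and> tc v = tc u)"
    have v: "v \<in> FV \<and> tc v = tc u" unfolding v_def by (rule someI[of _ u]) (simp add: u)
    hence "g (v - u) = \<zero>\<^bsub>C\<^esub>" by (intro gN) (simp add: tc_eq_iff)
    hence "g v = g u" using g_minus[of v u] v u g_carrier C.minus_eq_zeroD by simp
    thus ?thesis by (simp add: f_def v_def)
  qed
  have "linear_on T C f"
    unfolding linear_on_def
  proof (intro conjI ballI allI Pi_I)
    fix X assume "X \<in> carrier T"
    then obtain u where u: "u \<in> FV" "X = tc u" by (auto simp: alg_tensor_simps)
    show "f X \<in> carrier C" using u f g_carrier by simp
    show "f (c \<odot>\<^bsub>T\<^esub> X) = c \<odot>\<^bsub>C\<^esub> f X" for c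
      using u f[OF u(1)] f[OF FV_scale[OF u(1)]] g_scale[OF u(1)] by (simp add: tc_scale)
    fix Y assume "Y \<in> carrier T"
    then obtain v where v: "v \<in> FV" "Y = tc v" by (auto simp: alg_tensor_simps)
    show "f (X \<oplus>\<^bsub>T\<^esub> Y) = f X \<oplus>\<^bsub>C\<^esub> f Y"
      using u v f[OF u(1)] f[OF v(1)] f[OF FV_add[OF u(1) v(1)]] g_add[OF u(1) v(1)] by (simp add: tc_add)
  qed
  moreover have "f (lt [(a, b)]) = \<beta> a b" if "a \<in> carrier A" "b \<in> carrier B" for a b
    using f[OF FVs[OF that]] g_single[OF that] \<beta>c[of "(a, b)"] that by (simp add: list_tensor_def)
  ultimately show thesis using that by blast
qed

end

text \<open>The product of lists of pairs is associative and unital on the nose, and distributive up to the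
  order of entries. Hence the ring axioms of the tensor product reduce to identities of lists.\<close>

definition list_mult :: "'a talg \<Rightarrow> 'b talg \<Rightarrow> ('a \<times> 'b) list \<Rightarrow> ('a \<times> 'b) list \<Rightarrow> ('a \<times> 'b) list" where
  "list_mult A B xs ys = concat (map (\<lambda>(a, b). map (\<lambda>(a', b'). (a \<otimes>\<^bsub>A\<^esub> a', b \<otimes>\<^bsub>B\<^esub> b')) ys) xs)"

lemma list_mult_simps [simp]:
  "list_mult A B [] ys = []"
  "list_mult A B ((a, b) # xs) ys = map (\<lambda>(a', b'). (a \<otimes>\<^bsub>A\<^esub> a', b \<otimes>\<^bsub>B\<^esub> b')) ys @ list_mult A B xs ys"
  "list_mult A B (xs @ zs) ys = list_mult A B xs ys @ list_mult A B zs ys"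
  by (simp_all add: list_mult_def)

locale tensor_algebra_pair = A: calgebra A + B: calgebra B
  for A :: "'a talg" and B :: "'b talg"
begin

sublocale tensor_pair A B ..

abbreviation "pmult x y \<equiv> (fst x \<otimes>\<^bsub>A\<^esub> fst y, snd x \<otimes>\<^bsub>B\<^esub> snd y)"

definition free_mult :: "(('a \<times> 'b) \<Rightarrow>\<^sub>0 complex) \<Rightarrow> (('a \<times> 'b) \<Rightarrow>\<^sub>0 complex) \<Rightarrow> ('a \<times> 'b) \<Rightarrow>\<^sub>0 complex" where
  "free_mult u v = lin_ext (\<lambda>x. lin_ext (\<lambda>y. Poly_Mapping.single (pmult x y) 1) v) u"

lemma free_mult_swap:
  "free_mult u v = lin_ext (\<lambda>y. lin_ext (\<lambda>x. Poly_Mapping.single (pmult x y) 1) u) v"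
  unfolding free_mult_def lin_ext_def FS.scale_sum_right
  by (subst sum.swap) (simp add: mult.commute)

lemma free_mult_eq:
  "free_mult u v = (\<Sum>(a, b)\<in>Poly_Mapping.keys u. \<Sum>(a', b')\<in>Poly_Mapping.keys v.
     Poly_Mapping.single (a \<otimes>\<^bsub>A\<^esub> a', b \<otimes>\<^bsub>B\<^esub> b') (Poly_Mapping.lookup u (a, b) * Poly_Mapping.lookup v (a', b')))"
  by (simp add: free_mult_def lin_ext_def FS.scale_sum_right case_prod_beta)

lemma free_mult_minus_left: "free_mult (u - u') v = free_mult u v - free_mult u' v"
  by (simp add: free_mult_def lin_ext_minus)

lemma free_mult_minus_right: "free_mult u (v - v') = free_mult u v - free_mult u v'"
  by (simp add: free_mult_swap lin_ext_minus)

lemma free_mult_add_left: "free_mult (u + u') v = free_mult u v + free_mult u' v"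
  by (simp add: free_mult_def lin_ext_add)

lemma free_mult_add_right: "free_mult u (v + v') = free_mult u v + free_mult u v'"
  by (simp add: free_mult_swap lin_ext_add)

text \<open>Multiplication by a fixed element is linear in each factor, so it maps relations to relations.
  This makes the product independent of representatives.\<close>

lemma relation_mult_single:
  assumes "r \<in> bilinearity_relations A B" "y \<in> carrier A \<times> carrier B"
  shows "lin_ext (\<lambda>x. Poly_Mapping.single (pmult x y) 1) r \<in> N"
    "lin_ext (\<lambda>x. Poly_Mapping.single (pmult y x) 1) r \<in> N"
proof -
  have y: "fst y \<in> carrier A" "snd y \<in> carrier B" using assms(2) by auto
  have "lin_ext (\<lambda>x. Poly_Mapping.single (pmult x y) 1) r \<in> bilinearity_relations A B \<and>
    lin_ext (\<lambda>x. Poly_Mapping.single (pmult y x) 1) r \<in> bilinearity_relations A B"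
    using assms(1) unfolding bilinearity_relations_def[of A B]
  proof (elim UnE CollectE exE conjE, goal_cases)
    case (1 a a' b)
    show ?case unfolding 1(1) using 1(2-4) y
      by (auto simp: lin_ext_minus A.l_distr A.r_distr intro!: exI)
  next
    case (2 a b b')
    show ?case unfolding 2(1) using 2(2-4) y
      by (auto simp: lin_ext_minus B.l_distr B.r_distr intro!: exI)
  next
    case (3 c a b)
    show ?case unfolding 3(1) using 3(2-3) y
      by (auto simp: lin_ext_minus A.scale_mult_left A.scale_mult_right intro!: exI)
  next
    case (4 c a b)
    show ?case unfolding 4(1) using 4(2-3) y
      by (auto simp: lin_ext_minus B.scale_mult_left B.scale_mult_right intro!: exI)
  qed
  thus "lin_ext (\<lambda>x. Poly_Mapping.single (pmult x y) 1) r \<in> N"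
    "lin_ext (\<lambda>x. Poly_Mapping.single (pmult y x) 1) r \<in> N"
    by (auto intro: FS.span_base)
qed

lemma free_mult_N_left:
  assumes "u \<in> N" "v \<in> FV" shows "free_mult u v \<in> N"
  using assms(1)
proof (induction rule: FS.span_induct_alt)
  case base
  show ?case by (simp add: free_mult_def FS.span_zero)
next
  case (step c x y)
  have "free_mult x v \<in> N"
    unfolding free_mult_swap using assms(2)
    by (intro lin_ext_in_span relation_mult_single(1)[OF step(1)]) (auto simp: free_vectors_def)
  thus ?case using step
    by (simp add: free_mult_add_left) (simp add: free_mult_def lin_ext_scale FS.span_add FS.span_scale)
qed

lemma free_mult_N_right:
  assumes "u \<in> FV" "v \<in> N" shows "free_mult u v \<in> N"
  using assms(2)
proof (induction rule: FS.span_induct_alt)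
  case base
  show ?case by (simp add: free_mult_swap FS.span_zero)
next
  case (step c x y)
  have "free_mult u x \<in> N"
    unfolding free_mult_def using assms(1)
    by (intro lin_ext_in_span relation_mult_single(2)[OF step(1)]) (auto simp: free_vectors_def)
  thus ?case using step
    by (simp add: free_mult_add_right) (simp add: free_mult_swap lin_ext_scale FS.span_add FS.span_scale)
qed

lemma tc_mult:
  assumes "u \<in> FV" "v \<in> FV" shows "tc u \<otimes>\<^bsub>T\<^esub> tc v = tc (free_mult u v)"
proof -
  have eq: "tc (free_mult u' v') = tc (free_mult u v)" if "u' \<in> tc u" "v' \<in> tc v" for u' v'
  proof -
    have "u' - u \<in> N" "v' - v \<in> N" using that by (auto simp: tensor_class_def)
    moreover have "v' \<in> FV" using tc_subset_FV[OF assms(2) that(2)] .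
    ultimately have "free_mult (u' - u) v' + free_mult u (v' - v) \<in> N"
      using assms by (intro FS.span_add free_mult_N_left free_mult_N_right)
    thus ?thesis by (simp add: tc_eq_iff free_mult_minus_left free_mult_minus_right)
  qed
  have "tc u \<otimes>\<^bsub>T\<^esub> tc v = (\<Union>u'\<in>tc u. \<Union>v'\<in>tc v. tc (free_mult u' v'))"
    by (simp add: alg_tensor_def alg_tensor_module_def free_mult_eq)
  also have "\<dots> = tc (free_mult u v)" using eq tc_self by blast
  finally show ?thesis .
qed

lemma list_vector_mult: "free_mult (list_vector xs) (list_vector ys) = list_vector (list_mult A B xs ys)"
proof (induction xs)
  case (Cons x xs)
  obtain a b where x: "x = (a, b)" by (cases x)
  have "lin_ext (\<lambda>y. Poly_Mapping.single (pmult x y) 1) (list_vector ys) =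
      list_vector (map (\<lambda>(a', b'). (a \<otimes>\<^bsub>A\<^esub> a', b \<otimes>\<^bsub>B\<^esub> b')) ys)"
    by (induction ys) (auto simp: lin_ext_add x)
  hence "free_mult (Poly_Mapping.single x 1) (list_vector ys) =
      list_vector (map (\<lambda>(a', b'). (a \<otimes>\<^bsub>A\<^esub> a', b \<otimes>\<^bsub>B\<^esub> b')) ys)"
    by (simp add: free_mult_def)
  thus ?case using Cons.IH by (simp add: x free_mult_add_left)
qed (simp add: free_mult_def)

lemma lt_mult: "\<lbrakk>xs \<in> PL; ys \<in> PL\<rbrakk> \<Longrightarrow> lt xs \<otimes>\<^bsub>T\<^esub> lt ys = lt (list_mult A B xs ys)"
  by (simp add: list_tensor_def tc_mult list_vector_in_FV list_vector_mult)

lemma list_mult_PL: "\<lbrakk>xs \<in> PL; ys \<in> PL\<rbrakk> \<Longrightarrow> list_mult A B xs ys \<in> PL"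
  by (auto simp: list_mult_def pair_lists_def in_lists_conv_set) 

lemma list_mult_assoc:
  assumes "xs \<in> PL" "ys \<in> PL" "zs \<in> PL"
  shows "list_mult A B (list_mult A B xs ys) zs = list_mult A B xs (list_mult A B ys zs)"
  using assms(1)
proof (induction xs)
  case (Cons x xs)
  obtain a b where x: "x = (a, b)" by (cases x)
  have ab: "a \<in> carrier A" "b \<in> carrier B" using Cons.prems x by (auto simp: pair_lists_def)
  have "list_mult A B (map (\<lambda>(a', b'). (a \<otimes>\<^bsub>A\<^esub> a', b \<otimes>\<^bsub>B\<^esub> b')) ys) zs =
      map (\<lambda>(a', b'). (a \<otimes>\<^bsub>A\<^esub> a', b \<otimes>\<^bsub>B\<^esub> b')) (list_mult A B ys zs)"
    using assms(2)
  proof (induction ys)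
    case (Cons y ys)
    obtain c d where y: "y = (c, d)" by (cases y)
    have cd: "c \<in> carrier A" "d \<in> carrier B" using Cons.prems y by (auto simp: pair_lists_def)
    have "map (\<lambda>(a', b'). (a \<otimes>\<^bsub>A\<^esub> c \<otimes>\<^bsub>A\<^esub> a', b \<otimes>\<^bsub>B\<^esub> d \<otimes>\<^bsub>B\<^esub> b')) zs =
        map (\<lambda>(a', b'). (a \<otimes>\<^bsub>A\<^esub> a', b \<otimes>\<^bsub>B\<^esub> b')) (map (\<lambda>(a', b'). (c \<otimes>\<^bsub>A\<^esub> a', d \<otimes>\<^bsub>B\<^esub> b')) zs)"
      using assms(3) ab cd by (auto simp: pair_lists_def in_lists_conv_set A.m_assoc B.m_assoc)
    thus ?case using Cons by (simp add: y pair_lists_def)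
  qed simp
  thus ?case using Cons by (simp add: x pair_lists_def)
qed simp

lemma lt_mult_append_right: "lt (list_mult A B zs (xs @ ys)) = lt (list_mult A B zs xs @ list_mult A B zs ys)"
proof -
  have "list_vector (list_mult A B zs (xs @ ys)) = list_vector (list_mult A B zs xs @ list_mult A B zs ys)"
    by (induction zs) (auto simp: algebra_simps)
  thus ?thesis by (simp add: list_tensor_def)
qed

lemma ltE:
  assumes "X \<in> carrier T" obtains xs where "xs \<in> PL" "X = lt xs"
  using assms unfolding lt_surj[symmetric] by (elim imageE) simp

lemma PL_append: "\<lbrakk>xs \<in> PL; ys \<in> PL\<rbrakk> \<Longrightarrow> xs @ ys \<in> PL"
  by (simp add: pair_lists_def)

lemma lt_one: "\<one>\<^bsub>T\<^esub> = lt [(\<one>\<^bsub>A\<^esub>, \<one>\<^bsub>B\<^esub>)]" "[(\<one>\<^bsub>A\<^esub>, \<one>\<^bsub>B\<^esub>)] \<in> PL"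
  by (simp_all add: alg_tensor_simps list_tensor_def pair_lists_def)

lemma calgebra_T: "calgebra T"
proof (intro calgebra.intro T.vspace_axioms calgebra_axioms.intro ringI T.M.abelian_group_axioms monoidI)
  fix X Y assume X: "X \<in> carrier T" and Y: "Y \<in> carrier T"
  obtain xs where xs: "xs \<in> PL" "X = lt xs" using ltE[OF X] .
  obtain ys where ys: "ys \<in> PL" "Y = lt ys" using ltE[OF Y] .
  have ysc: "a \<in> carrier A" if "(a, b) \<in> set ys" for a b
    using that ys(1) by (auto simp: pair_lists_def in_lists_conv_set)
  show "X \<otimes>\<^bsub>T\<^esub> Y \<in> carrier T" using xs ys by (simp add: lt_mult list_mult_PL lt_carrier)
  show "(c \<odot>\<^bsub>T\<^esub> X) \<otimes>\<^bsub>T\<^esub> Y = c \<odot>\<^bsub>T\<^esub> (X \<otimes>\<^bsub>T\<^esub> Y)" for c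
  proof -
    have "list_mult A B (map (\<lambda>(a, b). (c \<odot>\<^bsub>A\<^esub> a, b)) xs) ys = map (\<lambda>(a, b). (c \<odot>\<^bsub>A\<^esub> a, b)) (list_mult A B xs ys)"
      using xs(1)
      by (induction xs) (auto simp: pair_lists_def intro!: A.scale_mult_left intro: ysc)
    thus ?thesis using xs ys
      by (simp add: lt_mult lt_scale[symmetric] map_scale_PL list_mult_PL)
  qed
  show "X \<otimes>\<^bsub>T\<^esub> (c \<odot>\<^bsub>T\<^esub> Y) = c \<odot>\<^bsub>T\<^esub> (X \<otimes>\<^bsub>T\<^esub> Y)" for c
  proof -
    have "list_mult A B xs (map (\<lambda>(a, b). (c \<odot>\<^bsub>A\<^esub> a, b)) ys) = map (\<lambda>(a, b). (c \<odot>\<^bsub>A\<^esub> a, b)) (list_mult A B xs ys)"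
      using xs(1)
      by (induction xs) (auto simp: pair_lists_def intro!: A.scale_mult_right intro: ysc)
    thus ?thesis using xs ys
      by (simp add: lt_mult lt_scale[symmetric] map_scale_PL list_mult_PL)
  qed
  fix Z assume Z: "Z \<in> carrier T"
  obtain zs where zs: "zs \<in> PL" "Z = lt zs" using ltE[OF Z] .
  show "X \<otimes>\<^bsub>T\<^esub> Y \<otimes>\<^bsub>T\<^esub> Z = X \<otimes>\<^bsub>T\<^esub> (Y \<otimes>\<^bsub>T\<^esub> Z)"
    using xs ys zs by (simp add: lt_mult list_mult_PL list_mult_assoc)
  show "(X \<oplus>\<^bsub>T\<^esub> Y) \<otimes>\<^bsub>T\<^esub> Z = X \<otimes>\<^bsub>T\<^esub> Z \<oplus>\<^bsub>T\<^esub> Y \<otimes>\<^bsub>T\<^esub> Z"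
    using xs ys zs by (simp add: lt_mult lt_append[symmetric] PL_append)
  show "Z \<otimes>\<^bsub>T\<^esub> (X \<oplus>\<^bsub>T\<^esub> Y) = Z \<otimes>\<^bsub>T\<^esub> X \<oplus>\<^bsub>T\<^esub> Z \<otimes>\<^bsub>T\<^esub> Y"
    using xs ys zs by (simp add: lt_mult lt_append[symmetric] PL_append lt_mult_append_right)
next
  show "\<one>\<^bsub>T\<^esub> \<in> carrier T" using lt_carrier[OF lt_one(2)] lt_one(1) by simp
next
  fix X assume X: "X \<in> carrier T"
  obtain xs where xs: "xs \<in> PL" "X = lt xs" using ltE[OF X] .
  have "list_mult A B [(\<one>\<^bsub>A\<^esub>, \<one>\<^bsub>B\<^esub>)] xs = xs"
    using xs(1) by (induction xs) (auto simp: pair_lists_def)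
  thus "\<one>\<^bsub>T\<^esub> \<otimes>\<^bsub>T\<^esub> X = X" using xs lt_one(2) unfolding lt_one(1) by (simp add: lt_mult del: list_mult_simps)
  have "list_mult A B xs [(\<one>\<^bsub>A\<^esub>, \<one>\<^bsub>B\<^esub>)] = xs"
    using xs(1) by (induction xs) (auto simp: pair_lists_def)
  thus "X \<otimes>\<^bsub>T\<^esub> \<one>\<^bsub>T\<^esub> = X" using xs lt_one(2) unfolding lt_one(1) by (simp add: lt_mult del: list_mult_simps)
qed

end

lemma image_norm_dominated:
  assumes "\<And>r. r \<in> R \<Longrightarrow> 0 \<le> c r" "\<And>r. r \<in> R \<Longrightarrow> 0 \<le> c' r" "\<And>r. r \<in> R \<Longrightarrow> c' r \<le> K * c r" "0 \<le> K" "X \<in> f ` R"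
  shows "image_norm R f c' X \<le> K * image_norm R f c X"
proof (rule le_mult_approx)
  fix u v assume u: "K < u" and v: "image_norm R f c X < v"
  obtain r where r: "r \<in> R" "f r = X" "c r < v" using image_norm_lessE[OF v assms(5)] .
  have "image_norm R f c' X \<le> c' r" using image_norm_le[of R c' r f] assms(2) r by simp
  also have "\<dots> \<le> K * c r" using assms(3) r by simp
  also have "\<dots> \<le> u * v" using u r assms(1)[OF r(1)] assms(4) by (intro mult_mono) auto
  finally show "image_norm R f c' X \<le> u * v" .
qed

lemma list_cost_nonneg:
  assumes "seminorm A p" "seminorm B q" "xs \<in> pair_lists A B"
  shows "0 \<le> list_cost p q xs"
  using assms(3) by (induction xs) (auto simp: pair_lists_def seminormD(1)[OF assms(1)] seminormD(1)[OF assms(2)])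

lemma list_cost_dominated:
  assumes "seminorm A p" "seminorm B q" "seminorm A p'" "seminorm B q'"
    "\<And>a. a \<in> carrier A \<Longrightarrow> p' a \<le> C * p a" "\<And>b. b \<in> carrier B \<Longrightarrow> q' b \<le> D * q b" "0 \<le> C" "0 \<le> D"
    "xs \<in> pair_lists A B"
  shows "list_cost p' q' xs \<le> (C * D) * list_cost p q xs"
  using assms(9)
proof (induction xs)
  case (Cons x xs)
  obtain a b where x: "x = (a, b)" by (cases x)
  have ab: "a \<in> carrier A" "b \<in> carrier B" "xs \<in> pair_lists A B" using Cons.prems x by (auto simp: pair_lists_def)
  have "p' a * q' b \<le> (C * p a) * (D * q b)"
    using ab assms(5-8) seminormD(1)[OF assms(1)] seminormD(1)[OF assms(2)] seminormD(1)[OF assms(3)] seminormD(1)[OF assms(4)]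
    by (intro mult_mono) auto
  thus ?case using Cons.IH[OF ab(3)] by (simp add: x algebra_simps)
qed simp

locale seminormed_tensor_pair = A: seminormed_space A p + B: seminormed_space B q
  for A :: "'a talg" and p and B :: "'b talg" and q
begin

sublocale tensor_pair A B ..

definition tnorm :: "nat \<Rightarrow> (('a \<times> 'b) \<Rightarrow>\<^sub>0 complex) set \<Rightarrow> real" where
  "tnorm k = projective_seminorm A B (p k) (q k)"

lemma seminorm_projective:
  assumes "seminorm A p'" "seminorm B q'"
  shows "seminorm T (projective_seminorm A B p' q')"
  unfolding projective_seminorm_eq
proof (rule image_norm_seminorm[OF T.vspace_axioms lt_surj])
  show "0 \<le> list_cost p' q' r" if "r \<in> PL" for r by (rule list_cost_nonneg[OF assms that])
  show "\<exists>t\<in>PL. lt t = lt r \<oplus>\<^bsub>T\<^esub> lt s \<and> list_cost p' q' t \<le> list_cost p' q' r + list_cost p' q' s"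
    if "r \<in> PL" "s \<in> PL" for r s
    using that by (intro bexI[of _ "r @ s"]) (auto simp: lt_append pair_lists_def)
  fix z r assume r: "r \<in> PL"
  have "list_cost p' q' (map (\<lambda>(a, b). (z \<odot>\<^bsub>A\<^esub> a, b)) r) = cmod z * list_cost p' q' r"
    using r by (induction r) (auto simp: pair_lists_def seminormD(3)[OF assms(1)] algebra_simps)
  thus "\<exists>t\<in>PL. lt t = z \<odot>\<^bsub>T\<^esub> lt r \<and> list_cost p' q' t \<le> cmod z * list_cost p' q' r"
    using lt_scale[OF r, of z] map_scale_PL[OF r, of z]
    by (intro bexI[of _ "map (\<lambda>(a, b). (z \<odot>\<^bsub>A\<^esub> a, b)) r"]) auto
qed

lemma projective_dominated:
  assumes "seminorm A p'" "seminorm B q'" "0 \<le> C" "0 \<le> D" "X \<in> carrier T"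
    "\<And>a. a \<in> carrier A \<Longrightarrow> p' a \<le> C * p k a" "\<And>b. b \<in> carrier B \<Longrightarrow> q' b \<le> D * q k b"
  shows "projective_seminorm A B p' q' X \<le> (C * D) * tnorm k X"
  unfolding projective_seminorm_eq tnorm_def
proof (rule image_norm_dominated)
  fix r assume r: "r \<in> PL"
  show "0 \<le> list_cost (p k) (q k) r" by (rule list_cost_nonneg[OF A.seminorm_p B.seminorm_p r])
  show "0 \<le> list_cost p' q' r" by (rule list_cost_nonneg[OF assms(1,2) r])
  show "list_cost p' q' r \<le> (C * D) * list_cost (p k) (q k) r"
    by (rule list_cost_dominated[OF A.seminorm_p B.seminorm_p assms(1,2,6,7,3,4) r])
qed (use assms lt_surj in auto)

lemma seminormed_space_T: "seminormed_space T tnorm"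
proof (intro seminormed_space.intro seminormed_space_axioms.intro T.vspace_axioms)
  show sn: "seminorm T (tnorm k)" for k
    unfolding tnorm_def by (rule seminorm_projective[OF A.seminorm_p B.seminorm_p])
  show "tnorm k x \<le> tnorm (Suc k) x" if "x \<in> carrier T" for k x
    using projective_dominated[OF A.seminorm_p[of k] B.seminorm_p[of k] zero_le_one zero_le_one that, of "Suc k"]
      A.p_Suc B.p_Suc by (simp add: tnorm_def)
  have "topo T = lc_topology T {projective_seminorm A B p q | p q. cont_seminorm A p \<and> cont_seminorm B q}"
    by (simp add: alg_tensor_def lc_topology_with_topology)
  also have "\<dots> = lc_topology T (range tnorm)"
  proof (rule lc_topology_eqI[OF T.vspace_axioms])
    show "range tnorm \<subseteq> {projective_seminorm A B p q | p q. cont_seminorm A p \<and> cont_seminorm B q}"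
      using A.cont_seminorm_p B.cont_seminorm_p by (auto simp: tnorm_def)
    show "0 \<le> tnorm k x" if "x \<in> carrier T" for k x by (rule seminormD(1)[OF sn that])
    fix r assume "r \<in> {projective_seminorm A B p q | p q. cont_seminorm A p \<and> cont_seminorm B q}"
    then obtain p' q' where r: "r = projective_seminorm A B p' q'" "cont_seminorm A p'" "cont_seminorm B q'" by blast
    obtain i C where C: "seminorm A p'" "\<forall>x\<in>carrier A. p' x \<le> C * p i x"
      using r(2) unfolding A.cont_seminorm_iff by blast
    obtain j D where D: "seminorm B q'" "\<forall>x\<in>carrier B. q' x \<le> D * q j x"
      using r(3) unfolding B.cont_seminorm_iff by blast
    have C': "p' x \<le> \<bar>C\<bar> * p (max i j) x" if "x \<in> carrier A" for x
    proof -
      have "p' x \<le> C * p i x" using C that by blast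
      also have "\<dots> \<le> \<bar>C\<bar> * p (max i j) x" using that by (intro mult_mono A.p_mono) auto
      finally show ?thesis .
    qed
    have D': "q' x \<le> \<bar>D\<bar> * q (max i j) x" if "x \<in> carrier B" for x
    proof -
      have "q' x \<le> D * q j x" using D that by blast
      also have "\<dots> \<le> \<bar>D\<bar> * q (max i j) x" using that by (intro mult_mono B.p_mono) auto
      finally show ?thesis .
    qed
    have "r X \<le> (\<bar>C\<bar> * \<bar>D\<bar>) * tnorm (max i j) X" if "X \<in> carrier T" for X
      unfolding r(1) by (rule projective_dominated[OF C(1) D(1) _ _ that C' D']) auto
    thus "\<exists>k C. \<forall>x\<in>carrier T. r x \<le> C * tnorm k x" by metis
  qed
  finally show "topo T = lc_topology T (range tnorm)" .
qed

lemma tnorm_pure: "\<lbrakk>a \<in> carrier A; b \<in> carrier B\<rbrakk> \<Longrightarrow> tnorm k (lt [(a, b)]) \<le> p k a * q k b"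
  using image_norm_le[of PL "list_cost (p k) (q k)" "[(a, b)]" lt]
    list_cost_nonneg[OF A.seminorm_p B.seminorm_p]
  by (simp add: tnorm_def projective_seminorm_eq pair_lists_def)

text \<open>Bounds on pure tensors suffice, since the cost of a representation adds them up; they persist in the
  infimum over all representations.\<close>

lemma tnorm_greatest:
  assumes C: "vspace C" and r: "seminorm C r" and f: "linear_on T C f" and K: "0 \<le> K"
    and le: "\<And>a b. \<lbrakk>a \<in> carrier A; b \<in> carrier B\<rbrakk> \<Longrightarrow> r (f (lt [(a, b)])) \<le> K * (p k a * q k b)"
    and X: "X \<in> carrier T"
  shows "r (f X) \<le> K * tnorm k X"
proof (rule le_mult_approx)
  interpret C: vspace C by fact
  fix u v assume u: "K < u" and v: "tnorm k X < v"
  have *: "r (f (lt xs)) \<le> K * list_cost (p k) (q k) xs" if "xs \<in> PL" for xs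
    using that
  proof (induction xs)
    case Nil
    show ?case using linear_on_zero[OF f T.vspace_axioms C] seminormD(3)[OF r C.M.zero_closed, of 0] by (simp add: lt_Nil)
  next
    case (Cons x xs)
    obtain a b where x: "x = (a, b)" by (cases x)
    have ab: "a \<in> carrier A" "b \<in> carrier B" "xs \<in> PL" "[x] \<in> PL" using Cons.prems x by (auto simp: pair_lists_def)
    have "r (f (lt (x # xs))) = r (f (lt [x]) \<oplus>\<^bsub>C\<^esub> f (lt xs))"
      using linear_onD(2)[OF f lt_carrier[OF ab(4)] lt_carrier[OF ab(3)]] lt_Cons[of x xs] by simp
    also have "\<dots> \<le> r (f (lt [x])) + r (f (lt xs))"
      by (intro seminormD(2)[OF r] linear_onD(1)[OF f] lt_carrier ab)
    also have "\<dots> \<le> K * (p k a * q k b) + K * list_cost (p k) (q k) xs"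
      unfolding x by (intro add_mono le ab Cons.IH)
    finally show ?case by (simp add: x algebra_simps)
  qed
  have "X \<in> lt ` PL" using X lt_surj by simp
  from image_norm_lessE[OF v[unfolded tnorm_def projective_seminorm_eq] this]
  obtain xs where xs: "xs \<in> PL" "lt xs = X" "list_cost (p k) (q k) xs < v" .
  have "r (f X) \<le> K * list_cost (p k) (q k) xs" using *[OF xs(1)] xs(2) by simp
  also have "\<dots> \<le> u * v"
    using u xs K list_cost_nonneg[OF A.seminorm_p B.seminorm_p xs(1), of k k] by (intro mult_mono) auto
  finally show "r (f X) \<le> u * v" .
qed

end

locale seminormed_tensor_algebra_pair = A: seminormed_algebra A p + B: seminormed_algebra B q
  for A :: "'a talg" and p and B :: "'b talg" and q
begin

sublocale seminormed_tensor_pair A p B q ..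
sublocale tensor_algebra_pair A B ..

lemma list_cost_mult:
  assumes "xs \<in> PL" "ys \<in> PL"
  shows "list_cost (p k) (q k) (list_mult A B xs ys) \<le> list_cost (p k) (q k) xs * list_cost (p k) (q k) ys"
  using assms(1)
proof (induction xs)
  case (Cons x xs)
  obtain a b where x: "x = (a, b)" by (cases x)
  have ab: "a \<in> carrier A" "b \<in> carrier B" "xs \<in> PL" using Cons.prems x by (auto simp: pair_lists_def)
  have "list_cost (p k) (q k) (map (\<lambda>(a', b'). (a \<otimes>\<^bsub>A\<^esub> a', b \<otimes>\<^bsub>B\<^esub> b')) ys) \<le> p k a * q k b * list_cost (p k) (q k) ys"
    using assms(2)
  proof (induction ys)
    case (Cons y ys)
    obtain c d where y: "y = (c, d)" by (cases y)
    have cd: "c \<in> carrier A" "d \<in> carrier B" "ys \<in> PL" using Cons.prems y by (auto simp: pair_lists_def)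
    have "p k (a \<otimes>\<^bsub>A\<^esub> c) * q k (b \<otimes>\<^bsub>B\<^esub> d) \<le> (p k a * p k c) * (q k b * q k d)"
      using ab cd by (intro mult_mono A.p_mult B.p_mult) auto
    thus ?case using Cons.IH[OF cd(3)] by (simp add: y algebra_simps)
  qed simp
  thus ?case using Cons.IH[OF ab(3)] by (simp add: x algebra_simps)
qed simp

lemma seminormed_algebra_T: "seminormed_algebra T tnorm"
proof (intro seminormed_algebra.intro seminormed_space_T seminormed_algebra_axioms.intro calgebra_T)
  fix X Y k assume X: "X \<in> carrier T" and Y: "Y \<in> carrier T"
  show "tnorm k (X \<otimes>\<^bsub>T\<^esub> Y) \<le> tnorm k X * tnorm k Y"
    unfolding tnorm_def projective_seminorm_eq
  proof (rule image_norm_mult_le)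
    show "0 \<le> list_cost (p k) (q k) r" if "r \<in> PL" for r
      by (rule list_cost_nonneg[OF A.seminorm_p B.seminorm_p that])
    show "\<exists>t\<in>PL. lt t = X \<otimes>\<^bsub>T\<^esub> Y \<and> list_cost (p k) (q k) t \<le> list_cost (p k) (q k) r * list_cost (p k) (q k) s"
      if "r \<in> PL" "s \<in> PL" "lt r = X" "lt s = Y" for r s
      using lt_mult[OF that(1,2)] list_mult_PL[OF that(1,2)] list_cost_mult[OF that(1,2)] that(3,4)
      by (intro bexI[of _ "list_mult A B r s"]) auto
  qed (use X Y lt_surj in auto)
qed

end

section \<open>Completions\<close>

lemma completion_simps:
  "carrier (completion V) = completion_class V ` Collect (cauchy_seq V)"
  "mult (completion V) = (\<lambda>X Y. \<Union>s\<in>X. \<Union>t\<in>Y. completion_class V (\<lambda>n. s n \<otimes>\<^bsub>V\<^esub> t n))"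
  "one (completion V) = completion_class V (\<lambda>n. \<one>\<^bsub>V\<^esub>)"
  "zero (completion V) = completion_class V (\<lambda>n. \<zero>\<^bsub>V\<^esub>)"
  "add (completion V) = (\<lambda>X Y. \<Union>s\<in>X. \<Union>t\<in>Y. completion_class V (\<lambda>n. s n \<oplus>\<^bsub>V\<^esub> t n))"
  "smult (completion V) = (\<lambda>c X. \<Union>s\<in>X. completion_class V (\<lambda>n. c \<odot>\<^bsub>V\<^esub> s n))"
  by (simp_all add: completion_def completion_module_def)

context seminormed_space
begin

abbreviation "W \<equiv> completion V"
abbreviation "cc \<equiv> completion_class V"

definition null_equiv :: "(nat \<Rightarrow> 'a) \<Rightarrow> (nat \<Rightarrow> 'a) \<Rightarrow> bool" where
  "null_equiv s t \<longleftrightarrow> (\<forall>k. (\<lambda>n. p k (s n \<ominus> t n)) \<longlonglongrightarrow> 0)"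

lemma cauchy_carrier: "cauchy_seq V s \<Longrightarrow> s n \<in> carrier V"
  by (simp add: cauchy_seq_iff)

lemma cauchyD:
  assumes "cauchy_seq V s" "e > 0"
  obtains N where "\<And>m n. m \<ge> N \<Longrightarrow> n \<ge> N \<Longrightarrow> p k (s m \<ominus> s n) < e"
  using assms unfolding cauchy_seq_iff by blast

lemma null_equiv_refl: "(\<And>n. s n \<in> carrier V) \<Longrightarrow> null_equiv s s"
  by (simp add: null_equiv_def)

lemma null_equiv_sym:
  assumes "\<And>n. s n \<in> carrier V" "\<And>n. t n \<in> carrier V" "null_equiv s t"
  shows "null_equiv t s"
  using assms(3) p_diff_commute[OF assms(1,2)] by (simp add: null_equiv_def)

lemma null_equiv_trans:
  assumes c: "\<And>n. s n \<in> carrier V" "\<And>n. t n \<in> carrier V" "\<And>n. u n \<in> carrier V"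
    and "null_equiv s t" "null_equiv t u"
  shows "null_equiv s u"
  unfolding null_equiv_def
proof (intro allI)
  fix k show "(\<lambda>n. p k (s n \<ominus> u n)) \<longlonglongrightarrow> 0"
  proof (rule tendsto_zero_le)
    show "(\<lambda>n. p k (s n \<ominus> t n) + p k (t n \<ominus> u n)) \<longlonglongrightarrow> 0"
      using tendsto_add[of "\<lambda>n. p k (s n \<ominus> t n)" 0 _ "\<lambda>n. p k (t n \<ominus> u n)" 0] assms(4,5)
      unfolding null_equiv_def by simp
    show "p k (s n \<ominus> u n) \<le> p k (s n \<ominus> t n) + p k (t n \<ominus> u n)" for n
      by (rule p_diff_triangle[OF c])
  qed (simp add: c)
qed

lemma cc_mem_iff:
  assumes s: "cauchy_seq V s"
  shows "t \<in> cc s \<longleftrightarrow> cauchy_seq V t \<and> null_equiv t s"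
proof -
  have "limitin (topo V) (\<lambda>n. t n \<ominus> s n) \<zero> sequentially \<longleftrightarrow> null_equiv t s" if t: "cauchy_seq V t"
  proof -
    have c: "t n \<ominus> s n \<in> carrier V" for n using cauchy_carrier[OF s] cauchy_carrier[OF t] by simp
    have "limitin (topo V) (\<lambda>n. t n \<ominus> s n) \<zero> sequentially \<longleftrightarrow> converges V (\<lambda>n. t n \<ominus> s n) \<zero>"
      using c by (simp add: converges_def)
    also have "\<dots> \<longleftrightarrow> null_equiv t s" using c by (simp add: converges_iff null_equiv_def)
    finally show ?thesis .
  qed
  thus ?thesis by (auto simp: completion_class_def)
qed

lemma cc_self: "cauchy_seq V s \<Longrightarrow> s \<in> cc s"
  by (simp add: cc_mem_iff null_equiv_refl cauchy_carrier)

lemma cc_eq_iff: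
  assumes s: "cauchy_seq V s" and t: "cauchy_seq V t"
  shows "cc s = cc t \<longleftrightarrow> null_equiv s t"
proof
  assume "cc s = cc t"
  thus "null_equiv s t" using cc_self[OF s] cc_mem_iff[OF t] by simp
next
  assume e: "null_equiv s t"
  note sc = cauchy_carrier[OF s] and tc = cauchy_carrier[OF t]
  have "u \<in> cc s \<longleftrightarrow> u \<in> cc t" for u
  proof -
    have "null_equiv u s \<longleftrightarrow> null_equiv u t" if u: "cauchy_seq V u"
      using null_equiv_trans[of u s t, OF cauchy_carrier[OF u] sc tc _ e]
        null_equiv_trans[of u t s, OF cauchy_carrier[OF u] tc sc _ null_equiv_sym[OF sc tc e]] by blast
    thus ?thesis using cc_mem_iff[OF s] cc_mem_iff[OF t] by blast
  qed
  thus "cc s = cc t" by blast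
qed

lemma cc_eq_if_mem: "\<lbrakk>cauchy_seq V s; t \<in> cc s\<rbrakk> \<Longrightarrow> cc t = cc s"
  by (subst cc_eq_iff) (simp_all add: cc_mem_iff)

lemma cauchy_add:
  assumes s: "cauchy_seq V s" and t: "cauchy_seq V t"
  shows "cauchy_seq V (\<lambda>n. s n \<oplus> t n)"
  unfolding cauchy_seq_iff
proof (intro conjI allI impI)
  note c = cauchy_carrier[OF s] cauchy_carrier[OF t]
  show "s n \<oplus> t n \<in> carrier V" for n using c by simp
  fix k and e :: real assume e: "e > 0"
  obtain N where N: "\<And>m n. m \<ge> N \<Longrightarrow> n \<ge> N \<Longrightarrow> p k (s m \<ominus> s n) < e / 2"
    using cauchyD[OF s, of "e / 2" k] e by auto
  obtain M where M: "\<And>m n. m \<ge> M \<Longrightarrow> n \<ge> M \<Longrightarrow> p k (t m \<ominus> t n) < e / 2"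
    using cauchyD[OF t, of "e / 2" k] e by auto
  show "\<exists>N. \<forall>m\<ge>N. \<forall>n\<ge>N. p k ((s m \<oplus> t m) \<ominus> (s n \<oplus> t n)) < e"
  proof (intro exI[of _ "max M N"] allI impI)
    fix m n assume mn: "max M N \<le> m" "max M N \<le> n"
    have "p k ((s m \<oplus> t m) \<ominus> (s n \<oplus> t n)) \<le> p k (s m \<ominus> s n) + p k (t m \<ominus> t n)"
      using c by (simp add: add_diff_add p_triangle)
    thus "p k ((s m \<oplus> t m) \<ominus> (s n \<oplus> t n)) < e" using N[of m n] M[of m n] mn by simp
  qed
qed

lemma cauchy_scale:
  assumes s: "cauchy_seq V s"
  shows "cauchy_seq V (\<lambda>n. c \<odot> s n)"
  unfolding cauchy_seq_iff
proof (intro conjI allI impI)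
  note sc = cauchy_carrier[OF s]
  show "c \<odot> s n \<in> carrier V" for n using sc by simp
  fix k and e :: real assume e: "e > 0"
  obtain N where N: "\<And>m n. m \<ge> N \<Longrightarrow> n \<ge> N \<Longrightarrow> p k (s m \<ominus> s n) < e / (cmod c + 1)"
    using cauchyD[OF s, of "e / (cmod c + 1)" k] e by (auto simp: add_nonneg_pos)
  show "\<exists>N. \<forall>m\<ge>N. \<forall>n\<ge>N. p k (c \<odot> s m \<ominus> c \<odot> s n) < e"
  proof (intro exI[of _ N] allI impI)
    fix m n assume mn: "N \<le> m" "N \<le> n"
    have "p k (c \<odot> s m \<ominus> c \<odot> s n) = cmod c * p k (s m \<ominus> s n)"
      using sc by (simp add: scale_minus_distrib[symmetric] p_scale)
    also have "\<dots> \<le> (cmod c + 1) * p k (s m \<ominus> s n)" using sc by (intro mult_right_mono) auto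
    also have "\<dots> < (cmod c + 1) * (e / (cmod c + 1))"
      using N[OF mn] by (intro mult_strict_left_mono) (auto simp: add_nonneg_pos)
    also have "\<dots> = e"
    proof -
      have "cmod c + 1 \<noteq> 0" using norm_ge_zero[of c] by linarith
      thus ?thesis by simp
    qed
    finally show "p k (c \<odot> s m \<ominus> c \<odot> s n) < e" .
  qed
qed

lemma cauchy_const: "x \<in> carrier V \<Longrightarrow> cauchy_seq V (\<lambda>n. x)"
  by (simp add: cauchy_seq_iff)

lemma cc_add:
  assumes s: "cauchy_seq V s" and t: "cauchy_seq V t"
  shows "cc s \<oplus>\<^bsub>W\<^esub> cc t = cc (\<lambda>n. s n \<oplus> t n)"
proof -
  note c = cauchy_carrier[OF s] cauchy_carrier[OF t]
  have "cc (\<lambda>n. s' n \<oplus> t' n) = cc (\<lambda>n. s n \<oplus> t n)" if s': "s' \<in> cc s" and t': "t' \<in> cc t" for s' t'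
  proof -
    have s'': "cauchy_seq V s'" "null_equiv s' s" and t'': "cauchy_seq V t'" "null_equiv t' t"
      using s' t' cc_mem_iff[OF s] cc_mem_iff[OF t] by auto
    note c' = cauchy_carrier[OF s''(1)] cauchy_carrier[OF t''(1)]
    have "null_equiv (\<lambda>n. s' n \<oplus> t' n) (\<lambda>n. s n \<oplus> t n)"
      unfolding null_equiv_def
    proof
      fix k show "(\<lambda>n. p k ((s' n \<oplus> t' n) \<ominus> (s n \<oplus> t n))) \<longlonglongrightarrow> 0"
      proof (rule tendsto_zero_le)
        show "(\<lambda>n. p k (s' n \<ominus> s n) + p k (t' n \<ominus> t n)) \<longlonglongrightarrow> 0"
          using tendsto_add[of "\<lambda>n. p k (s' n \<ominus> s n)" 0 _ "\<lambda>n. p k (t' n \<ominus> t n)" 0] s''(2) t''(2)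
          unfolding null_equiv_def by simp
        show "p k ((s' n \<oplus> t' n) \<ominus> (s n \<oplus> t n)) \<le> p k (s' n \<ominus> s n) + p k (t' n \<ominus> t n)" for n
          using c c' by (simp add: add_diff_add p_triangle)
        show "0 \<le> p k ((s' n \<oplus> t' n) \<ominus> (s n \<oplus> t n))" for n using c c' by simp
      qed
    qed
    thus ?thesis by (subst cc_eq_iff[OF cauchy_add[OF s''(1) t''(1)] cauchy_add[OF s t]])
  qed
  hence "(\<Union>s'\<in>cc s. \<Union>t'\<in>cc t. cc (\<lambda>n. s' n \<oplus> t' n)) = cc (\<lambda>n. s n \<oplus> t n)"
    using cc_self[OF s] cc_self[OF t] by blast
  thus ?thesis by (simp add: completion_simps)
qed

lemma cc_scale:
  assumes s: "cauchy_seq V s"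
  shows "c \<odot>\<^bsub>W\<^esub> cc s = cc (\<lambda>n. c \<odot> s n)"
proof -
  note sc = cauchy_carrier[OF s]
  have "cc (\<lambda>n. c \<odot> s' n) = cc (\<lambda>n. c \<odot> s n)" if s': "s' \<in> cc s" for s'
  proof -
    have s'': "cauchy_seq V s'" "null_equiv s' s" using s' cc_mem_iff[OF s] by auto
    note c' = cauchy_carrier[OF s''(1)]
    have "null_equiv (\<lambda>n. c \<odot> s' n) (\<lambda>n. c \<odot> s n)"
      unfolding null_equiv_def
    proof
      fix k
      have "(\<lambda>n. cmod c * p k (s' n \<ominus> s n)) \<longlonglongrightarrow> cmod c * 0"
        using s''(2) unfolding null_equiv_def by (intro tendsto_mult_left) simp
      thus "(\<lambda>n. p k (c \<odot> s' n \<ominus> c \<odot> s n)) \<longlonglongrightarrow> 0"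
        using sc c' by (simp add: scale_minus_distrib[symmetric] p_scale)
    qed
    thus ?thesis by (subst cc_eq_iff[OF cauchy_scale[OF s''(1)] cauchy_scale[OF s]])
  qed
  hence "(\<Union>s'\<in>cc s. cc (\<lambda>n. c \<odot> s' n)) = cc (\<lambda>n. c \<odot> s n)" using cc_self[OF s] by blast
  thus ?thesis by (simp add: completion_simps)
qed

text \<open>Cauchy sequences with pointwise operations; the completion is its quotient by null sequences.\<close>

definition cauchy_talg :: "(nat \<Rightarrow> 'a) talg" where
  "cauchy_talg = \<lparr>carrier = Collect (cauchy_seq V), mult = (\<lambda>s t n. s n \<otimes> t n), one = (\<lambda>n. \<one>),
    zero = (\<lambda>n. \<zero>), add = (\<lambda>s t n. s n \<oplus> t n), smult = (\<lambda>c s n. c \<odot> s n), topo = undefined\<rparr>"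

lemma vspace_cauchy_talg: "vspace cauchy_talg"
  unfolding vspace_def
proof (intro moduleI cring_complex_talg abelian_groupI)
  fix s assume "s \<in> carrier cauchy_talg"
  hence s: "cauchy_seq V s" by (simp add: cauchy_talg_def)
  show "\<exists>t\<in>carrier cauchy_talg. t \<oplus>\<^bsub>cauchy_talg\<^esub> s = \<zero>\<^bsub>cauchy_talg\<^esub>"
  proof
    show "(\<lambda>n. (-1) \<odot> s n) \<in> carrier cauchy_talg" using cauchy_scale[OF s] by (simp add: cauchy_talg_def)
    show "(\<lambda>n. (-1) \<odot> s n) \<oplus>\<^bsub>cauchy_talg\<^esub> s = \<zero>\<^bsub>cauchy_talg\<^esub>"
      using cauchy_carrier[OF s] by (simp add: cauchy_talg_def uminus_eq_scale[symmetric] M.l_neg)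
  qed
qed (auto simp: cauchy_talg_def cauchy_add cauchy_scale cauchy_const fun_eq_iff cauchy_carrier M.a_ac
    scale_left_distrib scale_right_distrib scale_scale)

lemma cc_surj: "cc ` Collect (cauchy_seq V) = carrier W"
  by (simp add: completion_simps)

lemma vspace_W: "vspace W"
  by (rule vspace_image[OF vspace_cauchy_talg, of cc])
     (simp_all add: cauchy_talg_def cc_surj cc_add cc_scale completion_simps(4))

lemma ccE:
  assumes "X \<in> carrier W" obtains s where "cauchy_seq V s" "X = cc s"
  using assms unfolding completion_simps by auto

lemma cc_carrier: "cauchy_seq V s \<Longrightarrow> cc s \<in> carrier W"
  by (simp add: completion_simps)

definition cnorm :: "nat \<Rightarrow> (nat \<Rightarrow> 'a) set \<Rightarrow> real" where
  "cnorm k = completion_seminorm (p k)"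

lemma p_cauchy_convergent:
  assumes s: "cauchy_seq V s" and q: "seminorm V q" and dom: "\<And>x. x \<in> carrier V \<Longrightarrow> q x \<le> C * p j x"
  shows "convergent (\<lambda>n. q (s n))"
proof (rule Cauchy_convergent, rule metric_CauchyI)
  fix e :: real assume e: "e > 0"
  note sc = cauchy_carrier[OF s]
  obtain N where N: "\<And>m n. m \<ge> N \<Longrightarrow> n \<ge> N \<Longrightarrow> p j (s m \<ominus> s n) < e / (\<bar>C\<bar> + 1)"
    using cauchyD[OF s, of "e / (\<bar>C\<bar> + 1)" j] e by (auto simp: add_nonneg_pos)
  have *: "q (s m) - q (s n) < e" if "m \<ge> N" "n \<ge> N" for m n
  proof -
    have "q (s m) \<le> q (s n) + q (s m \<ominus> s n)"
      using seminormD(2)[OF q sc[of n], of "s m \<ominus> s n"] sc by (simp add: add_minus_cancel)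
    moreover have "q (s m \<ominus> s n) < e"
    proof -
      have "q (s m \<ominus> s n) \<le> C * p j (s m \<ominus> s n)" using sc by (intro dom) auto
      also have "\<dots> \<le> (\<bar>C\<bar> + 1) * p j (s m \<ominus> s n)" using sc by (intro mult_right_mono) auto
      also have "\<dots> < (\<bar>C\<bar> + 1) * (e / (\<bar>C\<bar> + 1))" using N[OF that] by (intro mult_strict_left_mono) auto
      also have "\<dots> = e" by simp
      finally show ?thesis .
    qed
    ultimately show ?thesis by simp
  qed
  show "\<exists>M. \<forall>m\<ge>M. \<forall>n\<ge>M. dist (q (s m)) (q (s n)) < e"
  proof (intro exI allI impI)
    fix m n assume mn: "N \<le> m" "N \<le> n"
    show "dist (q (s m)) (q (s n)) < e" using *[OF mn] *[OF mn(2,1)] by (simp add: dist_real_def abs_less_iff)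
  qed
qed

text \<open>The seminorm of a class is computed from an arbitrarily chosen representative, but equivalent
  sequences give the same limit.\<close>

lemma p_tendsto_cnorm:
  assumes s: "cauchy_seq V s"
  shows "(\<lambda>n. p k (s n)) \<longlonglongrightarrow> cnorm k (cc s)"
proof -
  define t where "t = (SOME t. t \<in> cc s)"
  have "t \<in> cc s" unfolding t_def by (rule someI[of _ s]) (rule cc_self[OF s])
  hence t: "cauchy_seq V t" "null_equiv t s" using cc_mem_iff[OF s] by auto
  note c = cauchy_carrier[OF s] cauchy_carrier[OF t(1)]
  have "convergent (\<lambda>n. p k (t n))" by (rule p_cauchy_convergent[OF t(1) seminorm_p, of k 1 k]) simp
  hence "(\<lambda>n. p k (t n)) \<longlonglongrightarrow> cnorm k (cc s)"
    by (simp add: cnorm_def completion_seminorm_def t_def[symmetric] convergent_LIMSEQ_iff)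
  moreover have "(\<lambda>n. p k (s n) - p k (t n)) \<longlonglongrightarrow> 0"
  proof (rule tendsto_rabs_zero_cancel, rule tendsto_zero_le)
    show "(\<lambda>n. p k (t n \<ominus> s n)) \<longlonglongrightarrow> 0" using t(2) by (simp add: null_equiv_def)
    show "\<bar>p k (s n) - p k (t n)\<bar> \<le> p k (t n \<ominus> s n)" for n
      using p_abs_diff_le[OF c(2) c(1), of k n n] by (simp add: abs_minus_commute)
  qed simp
  ultimately show ?thesis using tendsto_add[of "\<lambda>n. p k (s n) - p k (t n)" 0 _ "\<lambda>n. p k (t n)"] by simp
qed

lemma seminorm_cnorm: "seminorm W (cnorm k)"
  unfolding seminorm_def
proof (intro conjI ballI allI)
  fix X assume "X \<in> carrier W"
  then obtain s where s: "cauchy_seq V s" "X = cc s" by (rule ccE)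
  note sc = cauchy_carrier[OF s(1)]
  show "0 \<le> cnorm k X" unfolding s(2)
    by (rule LIMSEQ_le_const[OF p_tendsto_cnorm[OF s(1)]]) (use sc in auto)
  show "cnorm k (c \<odot>\<^bsub>W\<^esub> X) = cmod c * cnorm k X" for c
  proof (rule LIMSEQ_unique)
    show "(\<lambda>n. p k (c \<odot> s n)) \<longlonglongrightarrow> cnorm k (c \<odot>\<^bsub>W\<^esub> X)"
      using p_tendsto_cnorm[OF cauchy_scale[OF s(1)]] by (simp add: s(2) cc_scale[OF s(1)])
    show "(\<lambda>n. p k (c \<odot> s n)) \<longlonglongrightarrow> cmod c * cnorm k X"
      using tendsto_mult_left[OF p_tendsto_cnorm[OF s(1)], of "cmod c" k] sc by (simp add: s(2) p_scale)
  qed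
  fix Y assume "Y \<in> carrier W"
  then obtain t where t: "cauchy_seq V t" "Y = cc t" by (rule ccE)
  note tc = cauchy_carrier[OF t(1)]
  show "cnorm k (X \<oplus>\<^bsub>W\<^esub> Y) \<le> cnorm k X + cnorm k Y"
    unfolding s(2) t(2) cc_add[OF s(1) t(1)]
    by (rule LIMSEQ_le[OF p_tendsto_cnorm[OF cauchy_add[OF s(1) t(1)]]
          tendsto_add[OF p_tendsto_cnorm[OF s(1)] p_tendsto_cnorm[OF t(1)]]])
       (use p_triangle[OF sc tc] in auto)
qed

lemma seminormed_space_W: "seminormed_space W cnorm"
proof (intro seminormed_space.intro seminormed_space_axioms.intro vspace_W seminorm_cnorm)
  show "cnorm k X \<le> cnorm (Suc k) X" if X: "X \<in> carrier W" for k X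
  proof -
    obtain s where s: "cauchy_seq V s" "X = cc s" using ccE[OF X] .
    show ?thesis unfolding s(2)
      by (rule LIMSEQ_le[OF p_tendsto_cnorm[OF s(1)] p_tendsto_cnorm[OF s(1)]])
         (use p_Suc[OF cauchy_carrier[OF s(1)]] in auto)
  qed
  have "topo W = lc_topology W (completion_seminorm ` Collect (cont_seminorm V))"
    by (simp add: completion_def lc_topology_with_topology)
  also have "\<dots> = lc_topology W (range cnorm)"
  proof (rule lc_topology_eqI[OF vspace_W])
    show "range cnorm \<subseteq> completion_seminorm ` Collect (cont_seminorm V)"
      using cont_seminorm_p by (auto simp: cnorm_def)
    show "0 \<le> cnorm k X" if "X \<in> carrier W" for k X by (rule seminormD(1)[OF seminorm_cnorm that])
    fix r assume "r \<in> completion_seminorm ` Collect (cont_seminorm V)"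
    then obtain q where r: "r = completion_seminorm q" "cont_seminorm V q" by auto
    obtain j C where q: "seminorm V q" "\<And>x. x \<in> carrier V \<Longrightarrow> q x \<le> C * p j x"
      using r(2) unfolding cont_seminorm_iff by blast
    have "r X \<le> C * cnorm j X" if X: "X \<in> carrier W" for X
    proof -
      obtain s where s: "cauchy_seq V s" "X = cc s" using ccE[OF X] .
      define t where "t = (SOME t. t \<in> cc s)"
      have tm: "t \<in> cc s" unfolding t_def by (rule someI[of _ s]) (rule cc_self[OF s(1)])
      hence t: "cauchy_seq V t" using cc_mem_iff[OF s(1)] by auto
      have "(\<lambda>n. q (t n)) \<longlonglongrightarrow> r X"
        using p_cauchy_convergent[OF t q]
        by (simp add: r(1) s(2) completion_seminorm_def t_def[symmetric] convergent_LIMSEQ_iff)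
      moreover have "(\<lambda>n. C * p j (t n)) \<longlonglongrightarrow> C * cnorm j X"
        using tendsto_mult_left[OF p_tendsto_cnorm[OF t]] cc_eq_if_mem[OF s(1) tm] s(2) by simp
      ultimately show ?thesis
        by (rule LIMSEQ_le) (use q(2) cauchy_carrier[OF t] in auto)
    qed
    thus "\<exists>k C. \<forall>X\<in>carrier W. r X \<le> C * cnorm k X" by metis
  qed
  finally show "topo W = lc_topology W (range cnorm)" .
qed

definition embed :: "'a \<Rightarrow> (nat \<Rightarrow> 'a) set" where
  "embed x = cc (\<lambda>n. x)"

lemma embed_carrier: "x \<in> carrier V \<Longrightarrow> embed x \<in> carrier W"
  unfolding embed_def by (intro cc_carrier cauchy_const)

lemma linear_embed: "linear_on V W embed"
  unfolding linear_on_def embed_def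
  by (auto simp: cc_carrier cauchy_const cc_add cc_scale)

lemma cnorm_embed: "x \<in> carrier V \<Longrightarrow> cnorm k (embed x) = p k x"
  unfolding embed_def by (rule LIMSEQ_unique[OF p_tendsto_cnorm[OF cauchy_const]]) auto

lemma cc_minus:
  assumes s: "cauchy_seq V s" and t: "cauchy_seq V t"
  shows "cc s \<ominus>\<^bsub>W\<^esub> cc t = cc (\<lambda>n. s n \<ominus> t n)" and "cauchy_seq V (\<lambda>n. s n \<ominus> t n)"
proof -
  interpret W: vspace W by (rule vspace_W)
  have *: "(\<lambda>n. s n \<ominus> t n) = (\<lambda>n. s n \<oplus> (-1) \<odot> t n)"
    using cauchy_carrier[OF s] cauchy_carrier[OF t] by (simp add: minus_eq_scale)
  show "cauchy_seq V (\<lambda>n. s n \<ominus> t n)" unfolding * by (rule cauchy_add[OF s cauchy_scale[OF t]])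
  show "cc s \<ominus>\<^bsub>W\<^esub> cc t = cc (\<lambda>n. s n \<ominus> t n)" unfolding *
    using cc_add[OF s cauchy_scale[OF t, of "-1"]] cc_scale[OF t, of "-1"]
      W.minus_eq_scale[OF cc_carrier[OF s] cc_carrier[OF t]] by simp
qed

lemma embed_converges:
  assumes s: "cauchy_seq V s"
  shows "converges W (\<lambda>n. embed (s n)) (cc s)"
proof -
  interpret W: seminormed_space W cnorm by (rule seminormed_space_W)
  note sc = cauchy_carrier[OF s]
  show ?thesis
  proof (rule W.convergesI[OF embed_carrier[OF sc] cc_carrier[OF s]])
    fix k
    show "(\<lambda>n. cnorm k (embed (s n) \<ominus>\<^bsub>W\<^esub> cc s)) \<longlonglongrightarrow> 0"
    proof (rule LIMSEQ_I)
      fix e :: real assume e: "e > 0"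
      obtain N where N: "\<And>m n. m \<ge> N \<Longrightarrow> n \<ge> N \<Longrightarrow> p k (s m \<ominus> s n) < e / 2"
        using cauchyD[OF s, of "e / 2" k] e by auto
      have "norm (cnorm k (embed (s n) \<ominus>\<^bsub>W\<^esub> cc s) - 0) < e" if n: "n \<ge> N" for n
      proof -
        have "cnorm k (embed (s n) \<ominus>\<^bsub>W\<^esub> cc s) \<le> e / 2"
          unfolding embed_def cc_minus(1)[OF cauchy_const[OF sc] s]
          by (rule LIMSEQ_le_const2[OF p_tendsto_cnorm[OF cc_minus(2)[OF cauchy_const[OF sc] s]]])
             (use N[OF n] in \<open>auto intro!: exI[of _ N] less_imp_le\<close>)
        moreover have "0 \<le> cnorm k (embed (s n) \<ominus>\<^bsub>W\<^esub> cc s)"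
          using W.p_nonneg[OF W.minus_closed'[OF embed_carrier[OF sc] cc_carrier[OF s]]] .
        ultimately show ?thesis using e by simp
      qed
      thus "\<exists>N. \<forall>n\<ge>N. norm (cnorm k (embed (s n) \<ominus>\<^bsub>W\<^esub> cc s) - 0) < e" by blast
    qed
  qed
qed

lemma total_embed: "total W (embed ` carrier V)"
  unfolding total_def
proof (intro conjI allI impI)
  show "embed ` carrier V \<subseteq> carrier W" using embed_carrier by blast
  fix M assume M: "closed_subspace W M \<and> embed ` carrier V \<subseteq> M"
  show "carrier W \<subseteq> M"
  proof
    fix X assume "X \<in> carrier W"
    then obtain s where s: "cauchy_seq V s" "X = cc s" by (rule ccE)
    have "embed (s n) \<in> M" for n using M cauchy_carrier[OF s(1)] by blast
    thus "X \<in> M" using M embed_converges[OF s(1)] s(2) unfolding closed_subspace_def by metis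
  qed
qed

text \<open>Approximating the terms of a rapidly converging sequence of classes by embedded vectors yields a
  Cauchy sequence in the original space, whose class is the limit.\<close>

lemma complete_space_W: "complete_space W cnorm"
proof -
  interpret W: seminormed_space W cnorm by (rule seminormed_space_W)
  show ?thesis
  proof (intro complete_space.intro complete_space_axioms.intro W.seminormed_space_axioms)
    fix X assume X: "X \<in> carrier W" and z: "\<And>k. cnorm k X = 0"
    obtain s where s: "cauchy_seq V s" "X = cc s" using ccE[OF X] .
    have "null_equiv s (\<lambda>n. \<zero>)"
      unfolding null_equiv_def
    proof
      fix k show "(\<lambda>n. p k (s n \<ominus> \<zero>)) \<longlonglongrightarrow> 0"
        using p_tendsto_cnorm[OF s(1), of k] z[of k] cauchy_carrier[OF s(1)] by (simp add: s(2))
    qed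
    thus "X = \<zero>\<^bsub>W\<^esub>" unfolding s(2) completion_simps
      by (subst cc_eq_iff[OF s(1) cauchy_const]) auto
  next
    fix S assume "cauchy_seq W S"
    thus "\<exists>L. converges W S L"
    proof (rule W.complete_if_fast[rotated])
      fix S assume Sc: "\<And>n. S n \<in> carrier W"
        and fast: "\<And>n. cnorm n (S (Suc n) \<ominus>\<^bsub>W\<^esub> S n) < (1 / 2) ^ n"
      have "\<exists>a. a \<in> carrier V \<and> cnorm n (embed a \<ominus>\<^bsub>W\<^esub> S n) < (1 / 2) ^ n" for n
      proof -
        obtain s where s: "cauchy_seq V s" "S n = cc s" using ccE[OF Sc] .
        have "\<forall>\<^sub>F m in sequentially. cnorm n (embed (s m) \<ominus>\<^bsub>W\<^esub> cc s) < (1 / 2) ^ n"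
          by (rule order_tendstoD(2)[OF W.convergesD(3)[OF embed_converges[OF s(1)]]]) simp
        then obtain m where "cnorm n (embed (s m) \<ominus>\<^bsub>W\<^esub> cc s) < (1 / 2) ^ n"
          using eventually_happens'[OF trivial_limit_sequentially] by blast
        thus ?thesis using cauchy_carrier[OF s(1)] s(2) by metis
      qed
      then obtain a where a: "\<And>n. a n \<in> carrier V" "\<And>n. cnorm n (embed (a n) \<ominus>\<^bsub>W\<^esub> S n) < (1 / 2) ^ n"
        by metis
      note ec = embed_carrier[OF a(1)]
      \<comment> \<open>three errors: two approximations and one step of the given sequence\<close>
      have ca: "cauchy_seq V a"
      proof (rule cauchy_seq_fast[OF a(1)])
        fix n
        have "p n (a (Suc n) \<ominus> a n) = cnorm n (embed (a (Suc n)) \<ominus>\<^bsub>W\<^esub> embed (a n))"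
          using cnorm_embed[of "a (Suc n) \<ominus> a n" n] linear_on_minus[OF linear_embed vspace_axioms vspace_W a(1) a(1)]
            a(1) by simp
        also have "\<dots> \<le> cnorm n (embed (a (Suc n)) \<ominus>\<^bsub>W\<^esub> S (Suc n)) + cnorm n (S (Suc n) \<ominus>\<^bsub>W\<^esub> embed (a n))"
          by (rule W.p_diff_triangle[OF ec Sc ec])
        also have "cnorm n (S (Suc n) \<ominus>\<^bsub>W\<^esub> embed (a n)) \<le> cnorm n (S (Suc n) \<ominus>\<^bsub>W\<^esub> S n) + cnorm n (S n \<ominus>\<^bsub>W\<^esub> embed (a n))"
          by (rule W.p_diff_triangle[OF Sc Sc ec])
        also have "cnorm n (embed (a (Suc n)) \<ominus>\<^bsub>W\<^esub> S (Suc n)) \<le> cnorm (Suc n) (embed (a (Suc n)) \<ominus>\<^bsub>W\<^esub> S (Suc n))"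
          by (rule W.p_Suc[OF W.minus_closed'[OF ec Sc]])
        also have "\<dots> \<le> (1 / 2) ^ n" using a(2)[of "Suc n"] by (rule order_trans[OF less_imp_le]) simp
        also have "cnorm n (S n \<ominus>\<^bsub>W\<^esub> embed (a n)) = cnorm n (embed (a n) \<ominus>\<^bsub>W\<^esub> S n)"
          by (rule W.p_diff_commute[OF Sc ec])
        finally show "p n (a (Suc n) \<ominus> a n) \<le> 3 * (1 / 2) ^ n"
          using fast[of n] a(2)[of n] by simp
      qed
      have "converges W S (cc a)"
      proof (rule W.convergesI[OF Sc cc_carrier[OF ca]])
        fix k
        show "(\<lambda>n. cnorm k (S n \<ominus>\<^bsub>W\<^esub> cc a)) \<longlonglongrightarrow> 0"
        proof (rule tendsto_sandwich)
          show "(\<lambda>n. 0 :: real) \<longlonglongrightarrow> 0" by simp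
          show "(\<lambda>n. (1 / 2) ^ n + cnorm k (embed (a n) \<ominus>\<^bsub>W\<^esub> cc a)) \<longlonglongrightarrow> 0"
            using tendsto_add[OF LIMSEQ_realpow_zero[of "1/2"] W.convergesD(3)[OF embed_converges[OF ca], of k]] by simp
          show "\<forall>\<^sub>F n in sequentially. 0 \<le> cnorm k (S n \<ominus>\<^bsub>W\<^esub> cc a)"
            by (rule always_eventually) (use W.p_nonneg[OF W.minus_closed'[OF Sc cc_carrier[OF ca]]] in simp)
          show "\<forall>\<^sub>F n in sequentially. cnorm k (S n \<ominus>\<^bsub>W\<^esub> cc a) \<le> (1 / 2) ^ n + cnorm k (embed (a n) \<ominus>\<^bsub>W\<^esub> cc a)"
            unfolding eventually_sequentially
          proof (intro exI[of _ k] allI impI)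
            fix n assume n: "k \<le> n"
            have "cnorm k (S n \<ominus>\<^bsub>W\<^esub> cc a) \<le> cnorm k (S n \<ominus>\<^bsub>W\<^esub> embed (a n)) + cnorm k (embed (a n) \<ominus>\<^bsub>W\<^esub> cc a)"
              by (rule W.p_diff_triangle[OF Sc ec cc_carrier[OF ca]])
            also have "cnorm k (S n \<ominus>\<^bsub>W\<^esub> embed (a n)) \<le> cnorm n (S n \<ominus>\<^bsub>W\<^esub> embed (a n))"
              by (rule W.p_mono[OF W.minus_closed'[OF Sc ec] n])
            also have "\<dots> = cnorm n (embed (a n) \<ominus>\<^bsub>W\<^esub> S n)" by (rule W.p_diff_commute[OF Sc ec])
            also have "\<dots> \<le> (1 / 2) ^ n" using a(2)[of n] by simp
            finally show "cnorm k (S n \<ominus>\<^bsub>W\<^esub> cc a) \<le> (1 / 2) ^ n + cnorm k (embed (a n) \<ominus>\<^bsub>W\<^esub> cc a)" by simp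
          qed
        qed
      qed
      thus "\<exists>L. converges W S L" by (intro exI[of _ "cc a"])
    qed
  qed
qed

text \<open>The extension is the limit along any representative. The bounds that it inherits are recorded,
  because iterated tensor products need them with explicit constants.\<close>

lemma completion_lift:
  assumes C: "complete_space C r" and f: "cont_linear V C f"
  obtains g where "cont_linear W C g" "\<And>x. x \<in> carrier V \<Longrightarrow> g (embed x) = f x"
    "\<And>k j K X. \<lbrakk>\<And>x. x \<in> carrier V \<Longrightarrow> r k (f x) \<le> K * p j x; X \<in> carrier W\<rbrakk> \<Longrightarrow> r k (g X) \<le> K * cnorm j X"
proof -
  interpret C: complete_space C r by fact
  have lin: "linear_on V C f" using f by (simp add: cont_linear_iff)
  note fc = linear_onD(1)[OF lin]
  have cauchy: "cauchy_seq C (\<lambda>n. f (s n))" if s: "cauchy_seq V s" for s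
    unfolding C.cauchy_seq_iff
  proof (intro conjI allI impI)
    note sc = cauchy_carrier[OF s]
    show "f (s n) \<in> carrier C" for n by (rule fc[OF sc])
    fix k and e :: real assume e: "e > 0"
    obtain j K where K: "K \<ge> 0" "\<And>x. x \<in> carrier V \<Longrightarrow> r k (f x) \<le> K * p j x"
      using cont_linear_bound[OF seminormed_space_axioms C.seminormed_space_axioms f, of k] by metis
    obtain N where N: "\<And>m n. m \<ge> N \<Longrightarrow> n \<ge> N \<Longrightarrow> p j (s m \<ominus> s n) < e / (K + 1)"
      using cauchyD[OF s, of "e / (K + 1)" j] e K by auto
    show "\<exists>N. \<forall>m\<ge>N. \<forall>n\<ge>N. r k (f (s m) \<ominus>\<^bsub>C\<^esub> f (s n)) < e"
    proof (intro exI[of _ N] allI impI)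
      fix m n assume mn: "N \<le> m" "N \<le> n"
      have "r k (f (s m) \<ominus>\<^bsub>C\<^esub> f (s n)) = r k (f (s m \<ominus> s n))"
        using linear_on_minus[OF lin vspace_axioms C.vspace_axioms sc sc] by simp
      also have "\<dots> \<le> K * p j (s m \<ominus> s n)" using sc by (intro K(2)) auto
      also have "\<dots> \<le> (K + 1) * p j (s m \<ominus> s n)" using sc by (intro mult_right_mono) auto
      also have "\<dots> < (K + 1) * (e / (K + 1))" using N[OF mn] K(1) by (intro mult_strict_left_mono) auto
      also have "\<dots> = e" using K(1) by simp
      finally show "r k (f (s m) \<ominus>\<^bsub>C\<^esub> f (s n)) < e" .
    qed
  qed
  define g where "g X = (SOME l. \<exists>s. cauchy_seq V s \<and> cc s = X \<and> converges C (\<lambda>n. f (s n)) l)" for X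
  have g: "converges C (\<lambda>n. f (s n)) (g (cc s))" if s: "cauchy_seq V s" for s
  proof -
    have "\<exists>l t. cauchy_seq V t \<and> cc t = cc s \<and> converges C (\<lambda>n. f (t n)) l"
      using C.complete[OF cauchy[OF s]] s by blast
    hence "\<exists>t. cauchy_seq V t \<and> cc t = cc s \<and> converges C (\<lambda>n. f (t n)) (g (cc s))"
      unfolding g_def by (rule someI_ex)
    then obtain t where t: "cauchy_seq V t" "cc t = cc s" "converges C (\<lambda>n. f (t n)) (g (cc s))" by blast
    have e: "null_equiv s t" using t s cc_eq_iff by metis
    have z: "converges V (\<lambda>n. s n \<ominus> t n) \<zero>"
      using e cauchy_carrier[OF s] cauchy_carrier[OF t(1)] by (simp add: converges_iff null_equiv_def)
    have "converges C (\<lambda>n. f (t n) \<oplus>\<^bsub>C\<^esub> f (s n \<ominus> t n)) (g (cc s) \<oplus>\<^bsub>C\<^esub> f \<zero>)"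
      by (rule C.converges_add[OF t(3) cont_linear_converges[OF f z]])
    moreover have "f (t n) \<oplus>\<^bsub>C\<^esub> f (s n \<ominus> t n) = f (s n)" for n
      using linear_onD(2)[OF lin cauchy_carrier[OF t(1)] minus_closed'[OF cauchy_carrier[OF s] cauchy_carrier[OF t(1)]], of n n n]
        add_minus_cancel[OF cauchy_carrier[OF s] cauchy_carrier[OF t(1)], of n n] by simp
    moreover have "g (cc s) \<oplus>\<^bsub>C\<^esub> f \<zero> = g (cc s)"
      using linear_on_zero[OF lin vspace_axioms C.vspace_axioms] C.convergesD(2)[OF t(3)] by simp
    ultimately show ?thesis by simp
  qed
  have gc: "g X \<in> carrier C" if "X \<in> carrier W" for X
    using ccE[OF that] C.convergesD(2)[OF g] by metis
  have bound: "r k (g X) \<le> K * cnorm j X"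
    if le: "\<And>x. x \<in> carrier V \<Longrightarrow> r k (f x) \<le> K * p j x" and X: "X \<in> carrier W" for k j K X
  proof -
    obtain s where s: "cauchy_seq V s" "X = cc s" using ccE[OF X] .
    show ?thesis unfolding s(2)
      by (rule LIMSEQ_le[OF C.converges_p[OF g[OF s(1)]] tendsto_mult_left[OF p_tendsto_cnorm[OF s(1)]]])
         (use le[OF cauchy_carrier[OF s(1)]] in auto)
  qed
  have glin: "linear_on W C g"
    unfolding linear_on_def
  proof (intro conjI ballI allI Pi_I gc)
    fix X assume "X \<in> carrier W"
    then obtain s where s: "cauchy_seq V s" "X = cc s" by (rule ccE)
    note sc = cauchy_carrier[OF s(1)]
    show "g (c \<odot>\<^bsub>W\<^esub> X) = c \<odot>\<^bsub>C\<^esub> g X" for c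
    proof (rule C.converges_unique)
      show "converges C (\<lambda>n. f (c \<odot> s n)) (g (c \<odot>\<^bsub>W\<^esub> X))"
        unfolding s(2) cc_scale[OF s(1)] by (rule g[OF cauchy_scale[OF s(1)]])
      show "converges C (\<lambda>n. f (c \<odot> s n)) (c \<odot>\<^bsub>C\<^esub> g X)"
        unfolding s(2) linear_onD(3)[OF lin sc] by (rule C.converges_scale[OF g[OF s(1)]])
    qed
    fix Y assume "Y \<in> carrier W"
    then obtain t where t: "cauchy_seq V t" "Y = cc t" by (rule ccE)
    note tc = cauchy_carrier[OF t(1)]
    show "g (X \<oplus>\<^bsub>W\<^esub> Y) = g X \<oplus>\<^bsub>C\<^esub> g Y"
    proof (rule C.converges_unique)
      show "converges C (\<lambda>n. f (s n \<oplus> t n)) (g (X \<oplus>\<^bsub>W\<^esub> Y))"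
        unfolding s(2) t(2) cc_add[OF s(1) t(1)] by (rule g[OF cauchy_add[OF s(1) t(1)]])
      show "converges C (\<lambda>n. f (s n \<oplus> t n)) (g X \<oplus>\<^bsub>C\<^esub> g Y)"
        unfolding s(2) t(2) linear_onD(2)[OF lin sc tc] by (rule C.converges_add[OF g[OF s(1)] g[OF t(1)]])
    qed
  qed auto
  have "cont_linear W C g"
  proof (rule cont_linearI[OF seminormed_space_W C.seminormed_space_axioms glin])
    fix k
    obtain j K where "K \<ge> 0" "\<And>x. x \<in> carrier V \<Longrightarrow> r k (f x) \<le> K * p j x"
      using cont_linear_bound[OF seminormed_space_axioms C.seminormed_space_axioms f, of k] by metis
    thus "\<exists>j K. \<forall>X\<in>carrier W. r k (g X) \<le> K * cnorm j X" using bound by metis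
  qed
  moreover have "g (embed x) = f x" if x: "x \<in> carrier V" for x
    unfolding embed_def
    by (rule C.converges_unique[OF g[OF cauchy_const[OF x]] C.converges_const[OF fc[OF x]]])
  ultimately show thesis using that bound by blast
qed

end

context seminormed_algebra
begin

lemma cauchy_bounded:
  assumes s: "cauchy_seq V s"
  obtains K where "K > 0" "\<And>n. p k (s n) \<le> K"
proof -
  have "convergent (\<lambda>n. p k (s n))" by (rule p_cauchy_convergent[OF s seminorm_p, of k 1 k]) simp
  hence "Bseq (\<lambda>n. p k (s n))" by (rule convergent_imp_Bseq)
  then obtain K where "K > 0" "\<And>n. norm (p k (s n)) \<le> K" unfolding Bseq_def by blast
  thus thesis using that[of K] cauchy_carrier[OF s] by (simp add: abs_le_iff)
qed

lemma cauchy_mult: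
  assumes s: "cauchy_seq V s" and t: "cauchy_seq V t"
  shows "cauchy_seq V (\<lambda>n. s n \<otimes> t n)"
  unfolding cauchy_seq_iff
proof (intro conjI allI impI)
  note c = cauchy_carrier[OF s] cauchy_carrier[OF t]
  show "s n \<otimes> t n \<in> carrier V" for n using c by simp
  fix k and e :: real assume e: "e > 0"
  obtain K where K: "K > 0" "\<And>n. p k (s n) \<le> K" using cauchy_bounded[OF s] by metis
  obtain L where L: "L > 0" "\<And>n. p k (t n) \<le> L" using cauchy_bounded[OF t] by metis
  define d where "d = e / (K + L)"
  have d: "d > 0" "d * (K + L) = e" using e K(1) L(1) by (auto simp: d_def)
  obtain N where N: "\<And>m n. m \<ge> N \<Longrightarrow> n \<ge> N \<Longrightarrow> p k (s m \<ominus> s n) < d" using cauchyD[OF s d(1)] by metis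
  obtain M where M: "\<And>m n. m \<ge> M \<Longrightarrow> n \<ge> M \<Longrightarrow> p k (t m \<ominus> t n) < d" using cauchyD[OF t d(1)] by metis
  show "\<exists>N. \<forall>m\<ge>N. \<forall>n\<ge>N. p k (s m \<otimes> t m \<ominus> s n \<otimes> t n) < e"
  proof (intro exI[of _ "max M N"] allI impI)
    fix m n assume mn: "max M N \<le> m" "max M N \<le> n"
    have "p k (s m \<otimes> t m \<ominus> s n \<otimes> t n) \<le> p k (s m \<ominus> s n) * p k (t m) + p k (s n) * p k (t m \<ominus> t n)"
      by (rule p_mult_diff_le[OF c c])
    also have "\<dots> \<le> p k (s m \<ominus> s n) * L + K * p k (t m \<ominus> t n)"
      using c K L by (intro add_mono mult_mono) auto
    also have "\<dots> < d * L + K * d"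
      using N[of m n] M[of m n] mn K(1) L(1) by (intro add_strict_mono mult_strict_left_mono mult_strict_right_mono) auto
    also have "\<dots> = e" using d(2) by (simp add: algebra_simps)
    finally show "p k (s m \<otimes> t m \<ominus> s n \<otimes> t n) < e" .
  qed
qed

lemma cc_mult:
  assumes s: "cauchy_seq V s" and t: "cauchy_seq V t"
  shows "cc s \<otimes>\<^bsub>W\<^esub> cc t = cc (\<lambda>n. s n \<otimes> t n)"
proof -
  note c = cauchy_carrier[OF s] cauchy_carrier[OF t]
  have "cc (\<lambda>n. s' n \<otimes> t' n) = cc (\<lambda>n. s n \<otimes> t n)" if s': "s' \<in> cc s" and t': "t' \<in> cc t" for s' t'
  proof -
    have s'': "cauchy_seq V s'" "null_equiv s' s" and t'': "cauchy_seq V t'" "null_equiv t' t"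
      using s' t' cc_mem_iff[OF s] cc_mem_iff[OF t] by auto
    note c' = cauchy_carrier[OF s''(1)] cauchy_carrier[OF t''(1)]
    have "null_equiv (\<lambda>n. s' n \<otimes> t' n) (\<lambda>n. s n \<otimes> t n)"
      unfolding null_equiv_def
    proof
      fix k
      obtain K where K: "K > 0" "\<And>n. p k (s n) \<le> K" using cauchy_bounded[OF s] by metis
      obtain L where L: "L > 0" "\<And>n. p k (t' n) \<le> L" using cauchy_bounded[OF t''(1)] by metis
      show "(\<lambda>n. p k ((s' n \<otimes> t' n) \<ominus> (s n \<otimes> t n))) \<longlonglongrightarrow> 0"
      proof (rule tendsto_zero_le)
        have "(\<lambda>n. p k (s' n \<ominus> s n) * L + K * p k (t' n \<ominus> t n)) \<longlonglongrightarrow> 0 * L + K * 0"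
          using s''(2) t''(2) unfolding null_equiv_def by (intro tendsto_intros) auto
        thus "(\<lambda>n. p k (s' n \<ominus> s n) * L + K * p k (t' n \<ominus> t n)) \<longlonglongrightarrow> 0" by simp
        show "p k ((s' n \<otimes> t' n) \<ominus> (s n \<otimes> t n)) \<le> p k (s' n \<ominus> s n) * L + K * p k (t' n \<ominus> t n)" for n
        proof -
          have "p k ((s' n \<otimes> t' n) \<ominus> (s n \<otimes> t n)) \<le> p k (s' n \<ominus> s n) * p k (t' n) + p k (s n) * p k (t' n \<ominus> t n)"
            by (rule p_mult_diff_le[OF c' c])
          also have "\<dots> \<le> p k (s' n \<ominus> s n) * L + K * p k (t' n \<ominus> t n)"
            using c c' K L by (intro add_mono mult_mono) auto
          finally show ?thesis .
        qed
        show "0 \<le> p k ((s' n \<otimes> t' n) \<ominus> (s n \<otimes> t n))" for n using c c' by simp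
      qed
    qed
    thus ?thesis by (subst cc_eq_iff[OF cauchy_mult[OF s''(1) t''(1)] cauchy_mult[OF s t]])
  qed
  hence "(\<Union>s'\<in>cc s. \<Union>t'\<in>cc t. cc (\<lambda>n. s' n \<otimes> t' n)) = cc (\<lambda>n. s n \<otimes> t n)"
    using cc_self[OF s] cc_self[OF t] by blast
  thus ?thesis by (simp add: completion_simps)
qed

lemma calgebra_W: "calgebra W"
proof (rule calgebra_image[where X = cauchy_talg and f = cc])
  interpret X: vspace cauchy_talg by (rule vspace_cauchy_talg)
  show "calgebra cauchy_talg"
  proof (intro calgebra.intro X.vspace_axioms ringI X.M.abelian_group_axioms monoidI calgebra_axioms.intro)
  qed (auto simp: cauchy_talg_def cauchy_mult cauchy_const fun_eq_iff cauchy_carrier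
      m_assoc l_distr r_distr scale_mult_left scale_mult_right)
qed (simp_all add: cauchy_talg_def cc_surj cc_add cc_scale cc_mult completion_simps(3,4))

lemma complete_algebra_W: "complete_algebra W cnorm"
proof (intro complete_algebra.intro complete_space_W seminormed_algebra.intro seminormed_space_W
    calgebra_W seminormed_algebra_axioms.intro)
  fix X Y k assume X: "X \<in> carrier W" and Y: "Y \<in> carrier W"
  obtain s where s: "cauchy_seq V s" "X = cc s" using ccE[OF X] .
  obtain t where t: "cauchy_seq V t" "Y = cc t" using ccE[OF Y] .
  show "cnorm k (X \<otimes>\<^bsub>W\<^esub> Y) \<le> cnorm k X * cnorm k Y"
    unfolding s(2) t(2) cc_mult[OF s(1) t(1)]
    by (rule LIMSEQ_le[OF p_tendsto_cnorm[OF cauchy_mult[OF s(1) t(1)]]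
          tendsto_mult[OF p_tendsto_cnorm[OF s(1)] p_tendsto_cnorm[OF t(1)]]])
       (use p_mult[OF cauchy_carrier[OF s(1)] cauchy_carrier[OF t(1)]] in auto)
qed

lemma embed_mult: "\<lbrakk>x \<in> carrier V; y \<in> carrier V\<rbrakk> \<Longrightarrow> embed (x \<otimes> y) = embed x \<otimes>\<^bsub>W\<^esub> embed y"
  unfolding embed_def by (simp add: cc_mult cauchy_const)

lemma embed_one: "embed \<one> = \<one>\<^bsub>W\<^esub>"
  by (simp add: embed_def completion_simps)

end

section \<open>Complete projective tensor products\<close>

definition tensor_norm :: "'a talg \<Rightarrow> 'b talg \<Rightarrow> (nat \<Rightarrow> 'a \<Rightarrow> real) \<Rightarrow> (nat \<Rightarrow> 'b \<Rightarrow> real) \<Rightarrow>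
    nat \<Rightarrow> ('a, 'b) tensor \<Rightarrow> real" where
  "tensor_norm A B p q k = completion_seminorm (projective_seminorm A B (p k) (q k))"

lemma closed_subspace_preimage:
  assumes V: "seminormed_space V p" and W: "vspace W" and f: "cont_linear V W f" and M: "closed_subspace W M"
  shows "closed_subspace V {x \<in> carrier V. f x \<in> M}"
proof -
  interpret V: seminormed_space V p by fact
  have lf: "linear_on V W f" using f by (simp add: cont_linear_iff)
  have M': "\<zero>\<^bsub>W\<^esub> \<in> M" "\<And>x y. x \<in> M \<Longrightarrow> y \<in> M \<Longrightarrow> x \<oplus>\<^bsub>W\<^esub> y \<in> M" "\<And>c x. x \<in> M \<Longrightarrow> c \<odot>\<^bsub>W\<^esub> x \<in> M"
    "\<And>s l. (\<And>n. s n \<in> M) \<Longrightarrow> converges W s l \<Longrightarrow> l \<in> M"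
    using M unfolding closed_subspace_def by blast+
  show ?thesis
    unfolding closed_subspace_def
  proof (intro conjI ballI allI impI)
    show "\<zero>\<^bsub>V\<^esub> \<in> {x \<in> carrier V. f x \<in> M}"
      using linear_on_zero[OF lf V.vspace_axioms W] M'(1) by simp
    fix x y assume "x \<in> {x \<in> carrier V. f x \<in> M}" "y \<in> {x \<in> carrier V. f x \<in> M}"
    thus "x \<oplus>\<^bsub>V\<^esub> y \<in> {x \<in> carrier V. f x \<in> M}" by (simp add: linear_onD(2)[OF lf] M'(2))
  next
    fix c x assume "x \<in> {x \<in> carrier V. f x \<in> M}"
    thus "c \<odot>\<^bsub>V\<^esub> x \<in> {x \<in> carrier V. f x \<in> M}" by (simp add: linear_onD(3)[OF lf] M'(3))
  next
    fix s l assume sl: "(\<forall>n. s n \<in> {x \<in> carrier V. f x \<in> M}) \<and> converges V s l"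
    hence s: "converges V s l" and fs: "f (s n) \<in> M" for n by auto
    have "f l \<in> M" by (rule M'(4)[OF fs cont_linear_converges[OF f s]])
    thus "l \<in> {x \<in> carrier V. f x \<in> M}" using V.convergesD(2)[of s l] sl by simp
  qed auto
qed

locale ptensor_spaces = seminormed_tensor_pair A p B q
  for A :: "'a talg" and p and B :: "'b talg" and q
begin

sublocale TT: seminormed_space T tnorm by (rule seminormed_space_T)

abbreviation "P \<equiv> ptensor A B"
abbreviation "tn \<equiv> tensor_norm A B p q"
abbreviation "pure \<equiv> pure_tensor A B"

lemma tn_eq: "tn = TT.cnorm"
  by (simp add: fun_eq_iff tensor_norm_def TT.cnorm_def tnorm_def)

lemma complete_space_P: "complete_space P tn"
  using TT.complete_space_W by (simp add: ptensor_def tn_eq)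

sublocale P: complete_space P tn by (rule complete_space_P)

lemma pure_eq: "pure a b = TT.embed (lt [(a, b)])"
  by (simp add: pure_tensor_def TT.embed_def list_tensor_def)

lemma pure_lt_carrier: "\<lbrakk>a \<in> carrier A; b \<in> carrier B\<rbrakk> \<Longrightarrow> lt [(a, b)] \<in> carrier T"
  by (rule lt_carrier) (simp add: pair_lists_def)

lemma pure_carrier: "\<lbrakk>a \<in> carrier A; b \<in> carrier B\<rbrakk> \<Longrightarrow> pure a b \<in> carrier P"
  using TT.embed_carrier[OF pure_lt_carrier] by (simp add: pure_eq ptensor_def)

lemma tn_pure: "\<lbrakk>a \<in> carrier A; b \<in> carrier B\<rbrakk> \<Longrightarrow> tn k (pure a b) \<le> p k a * q k b"
  using TT.cnorm_embed[OF pure_lt_carrier] tnorm_pure by (simp add: pure_eq tn_eq)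

lemma lt_bilinear: "bilinear_on A B T (\<lambda>a b. lt [(a, b)])"
  unfolding bilinear_on_def linear_on_def
  using tc_bilinear pure_lt_carrier by (auto simp: list_tensor_def)

lemma pure_linear_left: "b \<in> carrier B \<Longrightarrow> linear_on A P (\<lambda>a. pure a b)"
  and pure_linear_right: "a \<in> carrier A \<Longrightarrow> linear_on B P (pure a)"
proof -
  have e: "linear_on T P TT.embed" using TT.linear_embed by (simp add: ptensor_def)
  show "linear_on A P (\<lambda>a. pure a b)" if "b \<in> carrier B"
  proof -
    have l: "linear_on A T (\<lambda>a. lt [(a, b)])" using lt_bilinear that by (simp add: bilinear_on_def)
    show ?thesis unfolding pure_eq linear_on_def
      using linear_onD[OF l] linear_onD[OF e] by simp
  qed
  show "linear_on B P (pure a)" if "a \<in> carrier A"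
  proof -
    have l: "linear_on B T (\<lambda>b. lt [(a, b)])" using lt_bilinear that by (simp add: bilinear_on_def)
    show ?thesis unfolding pure_eq linear_on_def
      using linear_onD[OF l] linear_onD[OF e] by simp
  qed
qed

lemma pure_add_left: "\<lbrakk>a \<in> carrier A; a' \<in> carrier A; b \<in> carrier B\<rbrakk> \<Longrightarrow>
    pure (a \<oplus>\<^bsub>A\<^esub> a') b = pure a b \<oplus>\<^bsub>P\<^esub> pure a' b"
  and pure_add_right: "\<lbrakk>a \<in> carrier A; b \<in> carrier B; b' \<in> carrier B\<rbrakk> \<Longrightarrow>
    pure a (b \<oplus>\<^bsub>B\<^esub> b') = pure a b \<oplus>\<^bsub>P\<^esub> pure a b'"
  and pure_scale_left: "\<lbrakk>a \<in> carrier A; b \<in> carrier B\<rbrakk> \<Longrightarrow> pure (c \<odot>\<^bsub>A\<^esub> a) b = c \<odot>\<^bsub>P\<^esub> pure a b"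
  and pure_scale_right: "\<lbrakk>a \<in> carrier A; b \<in> carrier B\<rbrakk> \<Longrightarrow> pure a (c \<odot>\<^bsub>B\<^esub> b) = c \<odot>\<^bsub>P\<^esub> pure a b"
  using linear_onD[OF pure_linear_left] linear_onD[OF pure_linear_right] by auto

lemma pure_cont_left: "b \<in> carrier B \<Longrightarrow> cont_linear A P (\<lambda>a. pure a b)"
  by (rule cont_linearI[OF A.seminormed_space_axioms P.seminormed_space_axioms pure_linear_left])
     (use tn_pure mult.commute in metis)+

lemma pure_cont_right: "a \<in> carrier A \<Longrightarrow> cont_linear B P (pure a)"
  by (rule cont_linearI[OF B.seminormed_space_axioms P.seminormed_space_axioms pure_linear_right])
     (use tn_pure in metis)+

text \<open>A closed subspace that contains the pure tensors of two total sets contains all pure tensors, one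
  factor at a time; their finite sums are dense by construction of the completion.\<close>

lemma total_pure:
  assumes G: "total A G" and H: "total B H"
  shows "total P {pure a b | a b. a \<in> G \<and> b \<in> H}"
  unfolding total_def
proof (intro conjI allI impI)
  have GA: "G \<subseteq> carrier A" and HB: "H \<subseteq> carrier B" using G H by (auto simp: total_def)
  thus "{pure a b | a b. a \<in> G \<and> b \<in> H} \<subseteq> carrier P" using pure_carrier by blast
  fix M assume M: "closed_subspace P M \<and> {pure a b | a b. a \<in> G \<and> b \<in> H} \<subseteq> M"
  have 1: "pure a b \<in> M" if a: "a \<in> carrier A" and b: "b \<in> H" for a b
    by (rule total_induct[OF G a closed_subspace_preimage[OF A.seminormed_space_axioms P.vspace_axioms
            pure_cont_left[OF subsetD[OF HB b]]]]) (use M b in auto)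
  have 2: "pure a b \<in> M" if a: "a \<in> carrier A" and b: "b \<in> carrier B" for a b
    by (rule total_induct[OF H b closed_subspace_preimage[OF B.seminormed_space_axioms P.vspace_axioms
            pure_cont_right[OF a]]]) (use M 1[OF a] in auto)
  have M': "\<zero>\<^bsub>P\<^esub> \<in> M" "\<And>x y. x \<in> M \<Longrightarrow> y \<in> M \<Longrightarrow> x \<oplus>\<^bsub>P\<^esub> y \<in> M"
    using M unfolding closed_subspace_def by blast+
  have e: "linear_on T P TT.embed" using TT.linear_embed by (simp add: ptensor_def)
  have 3: "TT.embed (lt xs) \<in> M" if "xs \<in> PL" for xs
    using that
  proof (induction xs)
    case Nil
    show ?case using M'(1) linear_on_zero[OF e T.vspace_axioms P.vspace_axioms] by (simp add: lt_Nil)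
  next
    case (Cons x xs)
    obtain a b where x: "x = (a, b)" by (cases x)
    have ab: "a \<in> carrier A" "b \<in> carrier B" "xs \<in> PL" using Cons.prems x by (auto simp: pair_lists_def)
    have "TT.embed (lt (x # xs)) = pure a b \<oplus>\<^bsub>P\<^esub> TT.embed (lt xs)"
      using linear_onD(2)[OF e pure_lt_carrier[OF ab(1,2)] lt_carrier[OF ab(3)]] lt_Cons[of x xs]
      by (simp add: x pure_eq)
    thus ?case using M'(2)[OF 2[OF ab(1,2)] Cons.IH[OF ab(3)]] by simp
  qed
  have "TT.embed ` carrier T \<subseteq> M"
    unfolding lt_surj[symmetric] using 3 by blast
  thus "carrier P \<subseteq> M" using M TT.total_embed unfolding total_def ptensor_def by blast
qed

lemma total_carrier: "vspace V \<Longrightarrow> total V (carrier V)"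
  by (auto simp: total_def)

lemma total_pure_all: "total P {pure a b | a b. a \<in> carrier A \<and> b \<in> carrier B}"
  by (rule total_pure[OF total_carrier[OF A.vspace_axioms] total_carrier[OF B.vspace_axioms]])

text \<open>The projective seminorm is an infimum over representations by pure tensors, so bounds on the
  bilinear map are inherited by its linearization.\<close>

lemma ptensor_lift:
  assumes C: "complete_space C r" and \<beta>: "bilinear_on A B C \<beta>"
    and cont: "\<And>k. \<exists>j K. 0 \<le> K \<and> (\<forall>a\<in>carrier A. \<forall>b\<in>carrier B. r k (\<beta> a b) \<le> K * (p j a * q j b))"
  obtains g where "cont_linear P C g"
    "\<And>a b. \<lbrakk>a \<in> carrier A; b \<in> carrier B\<rbrakk> \<Longrightarrow> g (pure a b) = \<beta> a b"
    "\<And>k j K X. \<lbrakk>\<And>a b. \<lbrakk>a \<in> carrier A; b \<in> carrier B\<rbrakk> \<Longrightarrow> r k (\<beta> a b) \<le> K * (p j a * q j b); 0 \<le> K;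
      X \<in> carrier P\<rbrakk> \<Longrightarrow> r k (g X) \<le> K * tn j X"
proof -
  interpret C: complete_space C r by fact
  obtain f where f: "linear_on T C f"
    "\<And>a b. \<lbrakk>a \<in> carrier A; b \<in> carrier B\<rbrakk> \<Longrightarrow> f (lt [(a, b)]) = \<beta> a b"
    using alg_tensor_lift[OF C.vspace_axioms \<beta>] by metis
  have fb: "r k (f X) \<le> K * tnorm j X"
    if "\<And>a b. \<lbrakk>a \<in> carrier A; b \<in> carrier B\<rbrakk> \<Longrightarrow> r k (\<beta> a b) \<le> K * (p j a * q j b)" "0 \<le> K" "X \<in> carrier T"
    for k j K X
    by (rule tnorm_greatest[OF C.vspace_axioms C.seminorm_p f(1) that(2) _ that(3)]) (simp add: f(2) that(1))
  have fc: "cont_linear T C f"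
  proof (rule cont_linearI[OF TT.seminormed_space_axioms C.seminormed_space_axioms f(1)])
    fix k
    obtain j K where "0 \<le> K" "\<forall>a\<in>carrier A. \<forall>b\<in>carrier B. r k (\<beta> a b) \<le> K * (p j a * q j b)" using cont[of k] by auto
    thus "\<exists>j K. \<forall>X\<in>carrier T. r k (f X) \<le> K * tnorm j X" using fb[of k K j] by blast
  qed
  obtain g where g: "cont_linear TT.W C g" "\<And>x. x \<in> carrier T \<Longrightarrow> g (TT.embed x) = f x"
    "\<And>k j K X. \<lbrakk>\<And>x. x \<in> carrier T \<Longrightarrow> r k (f x) \<le> K * tnorm j x; X \<in> carrier TT.W\<rbrakk> \<Longrightarrow> r k (g X) \<le> K * TT.cnorm j X"
    using TT.completion_lift[OF C.complete_space_axioms fc] by metis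
  show thesis
  proof (rule that)
    show "cont_linear P C g" using g(1) by (simp add: ptensor_def)
    show "g (pure a b) = \<beta> a b" if "a \<in> carrier A" "b \<in> carrier B" for a b
      using g(2)[OF pure_lt_carrier[OF that]] f(2)[OF that] by (simp add: pure_eq)
    show "r k (g X) \<le> K * tn j X"
      if "\<And>a b. \<lbrakk>a \<in> carrier A; b \<in> carrier B\<rbrakk> \<Longrightarrow> r k (\<beta> a b) \<le> K * (p j a * q j b)" "0 \<le> K" "X \<in> carrier P" for k j K X
      unfolding tn_eq by (rule g(3)[OF fb[OF that(1,2)]]) (use that(3) in \<open>simp_all add: ptensor_def\<close>)
  qed
qed

lemma ptensor_eq_on_pure:
  assumes "complete_space C r" "cont_linear P C f" "cont_linear P C g"
    "\<And>a b. \<lbrakk>a \<in> carrier A; b \<in> carrier B\<rbrakk> \<Longrightarrow> f (pure a b) = g (pure a b)" "X \<in> carrier P"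
  shows "f X = g X"
  by (rule cont_linear_eq_on_total[OF P.seminormed_space_axioms assms(1-3) total_pure_all _ assms(5)])
     (use assms(4) in auto)

lemma tensor_lift_props:
  assumes C: "complete_space C r" and \<beta>: "bilinear_on A B C \<beta>"
    and cont: "\<And>k. \<exists>j K. 0 \<le> K \<and> (\<forall>a\<in>carrier A. \<forall>b\<in>carrier B. r k (\<beta> a b) \<le> K * (p j a * q j b))"
  shows "cont_linear P C (tensor_lift A B C \<beta>)"
    and "\<And>a b. \<lbrakk>a \<in> carrier A; b \<in> carrier B\<rbrakk> \<Longrightarrow> tensor_lift A B C \<beta> (pure a b) = \<beta> a b"
proof -
  obtain g where g: "cont_linear P C g" "\<And>a b. \<lbrakk>a \<in> carrier A; b \<in> carrier B\<rbrakk> \<Longrightarrow> g (pure a b) = \<beta> a b"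
    using ptensor_lift[OF C \<beta> cont] by metis
  let ?Q = "\<lambda>f. f \<in> extensional (carrier P) \<and> cont_linear P C f \<and>
    (\<forall>a\<in>carrier A. \<forall>b\<in>carrier B. f (pure a b) = \<beta> a b)"
  have "\<exists>!f. ?Q f"
  proof (rule ex1I)
    show "?Q (restrict g (carrier P))"
      using cont_linear_cong[OF P.seminormed_space_axioms g(1), of "restrict g (carrier P)"] g(2) pure_carrier by simp
    fix f assume f: "?Q f"
    show "f = restrict g (carrier P)"
    proof (rule extensionalityI[where A = "carrier P"])
      fix X assume X: "X \<in> carrier P"
      have "f X = g X" by (rule ptensor_eq_on_pure[OF C _ g(1) _ X]) (use f g(2) in auto)
      thus "f X = restrict g (carrier P) X" using X by simp
    qed (use f in auto)
  qed
  hence "?Q (tensor_lift A B C \<beta>)" unfolding tensor_lift_def by (rule theI')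
  thus "cont_linear P C (tensor_lift A B C \<beta>)"
    "\<And>a b. \<lbrakk>a \<in> carrier A; b \<in> carrier B\<rbrakk> \<Longrightarrow> tensor_lift A B C \<beta> (pure a b) = \<beta> a b" by auto
qed

end

lemma ptensor_spacesI: "seminormed_space A p \<Longrightarrow> seminormed_space B q \<Longrightarrow> ptensor_spaces A p B q"
  by (intro ptensor_spaces.intro seminormed_tensor_pair.intro)

locale ptensor_algebras = A: complete_algebra A p + B: complete_algebra B q
  for A :: "'a talg" and p and B :: "'b talg" and q
begin

sublocale seminormed_tensor_algebra_pair A p B q ..
sublocale ptensor_spaces A p B q ..
sublocale TTA: seminormed_algebra T tnorm by (rule seminormed_algebra_T)

lemma complete_algebra_P: "complete_algebra P tn"
  using TTA.complete_algebra_W by (simp add: ptensor_def tn_eq)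

sublocale PA: complete_algebra P tn by (rule complete_algebra_P)

lemma pure_mult: "\<lbrakk>a \<in> carrier A; b \<in> carrier B; a' \<in> carrier A; b' \<in> carrier B\<rbrakk> \<Longrightarrow>
    pure a b \<otimes>\<^bsub>P\<^esub> pure a' b' = pure (a \<otimes>\<^bsub>A\<^esub> a') (b \<otimes>\<^bsub>B\<^esub> b')"
  using TTA.embed_mult[OF pure_lt_carrier pure_lt_carrier, of a b a' b'] lt_mult[of "[(a, b)]" "[(a', b')]"]
  by (simp add: pure_eq ptensor_def pair_lists_def)

lemma pure_one: "pure \<one>\<^bsub>A\<^esub> \<one>\<^bsub>B\<^esub> = \<one>\<^bsub>P\<^esub>"
  using TTA.embed_one lt_one(1) by (simp add: pure_eq ptensor_def)

lemma cont_hom_pure_left: "cont_hom A P (\<lambda>a. pure a \<one>\<^bsub>B\<^esub>)"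
  using pure_cont_left[of "\<one>\<^bsub>B\<^esub>"] linear_onD[OF pure_linear_left[of "\<one>\<^bsub>B\<^esub>"]]
  by (auto simp: cont_hom_def ring_hom_def pure_mult pure_one)

lemma cont_hom_pure_right: "cont_hom B P (\<lambda>b. pure \<one>\<^bsub>A\<^esub> b)"
  using pure_cont_right[of "\<one>\<^bsub>A\<^esub>"] linear_onD[OF pure_linear_right[of "\<one>\<^bsub>A\<^esub>"]]
  by (auto simp: cont_hom_def ring_hom_def pure_mult pure_one)

end

lemma ptensor_algebrasI: "complete_algebra A p \<Longrightarrow> complete_algebra B q \<Longrightarrow> ptensor_algebras A p B q"
  by (intro ptensor_algebras.intro)

section \<open>Maps between tensor products\<close>

lemma tensor_map_props:
  assumes A: "complete_space A p" and B: "complete_space B q"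
    and C: "complete_space C r" and D: "complete_space D s"
    and f: "cont_linear A C f" and g: "cont_linear B D g"
  shows "cont_linear (ptensor A B) (ptensor C D) (tensor_map A B C D f g)"
    and "\<And>a b. \<lbrakk>a \<in> carrier A; b \<in> carrier B\<rbrakk> \<Longrightarrow>
      tensor_map A B C D f g (pure_tensor A B a b) = pure_tensor C D (f a) (g b)"
proof -
  interpret A: complete_space A p by fact
  interpret B: complete_space B q by fact
  interpret C: complete_space C r by fact
  interpret D: complete_space D s by fact
  interpret AB: ptensor_spaces A p B q by (rule ptensor_spacesI) unfold_locales
  interpret CD: ptensor_spaces C r D s by (rule ptensor_spacesI) unfold_locales
  have lf: "linear_on A C f" and lg: "linear_on B D g" using f g by (auto simp: cont_linear_iff)
  have bil: "bilinear_on A B (ptensor C D) (\<lambda>a b. pure_tensor C D (f a) (g b))"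
    unfolding bilinear_on_def linear_on_def
    using linear_onD[OF lf] linear_onD[OF lg] CD.pure_carrier CD.pure_add_left CD.pure_add_right
      CD.pure_scale_left CD.pure_scale_right by simp
  have bd: "\<exists>j K. 0 \<le> K \<and> (\<forall>a\<in>carrier A. \<forall>b\<in>carrier B.
      tensor_norm C D r s k (pure_tensor C D (f a) (g b)) \<le> K * (p j a * q j b))" for k
  proof -
    obtain i K where K: "K \<ge> 0" "\<And>x. x \<in> carrier A \<Longrightarrow> r k (f x) \<le> K * p i x"
      using cont_linear_bound[OF A.seminormed_space_axioms C.seminormed_space_axioms f, of k] by metis
    obtain j L where L: "L \<ge> 0" "\<And>x. x \<in> carrier B \<Longrightarrow> s k (g x) \<le> L * q j x"
      using cont_linear_bound[OF B.seminormed_space_axioms D.seminormed_space_axioms g, of k] by metis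
    have "tensor_norm C D r s k (pure_tensor C D (f a) (g b)) \<le> (K * L) * (p (max i j) a * q (max i j) b)"
      if a: "a \<in> carrier A" and b: "b \<in> carrier B" for a b
    proof -
      have "tensor_norm C D r s k (pure_tensor C D (f a) (g b)) \<le> r k (f a) * s k (g b)"
        by (rule CD.tn_pure[OF linear_onD(1)[OF lf a] linear_onD(1)[OF lg b]])
      also have "\<dots> \<le> (K * p (max i j) a) * (L * q (max i j) b)"
      proof (rule mult_mono)
        show "r k (f a) \<le> K * p (max i j) a"
          using K(2)[OF a] mult_left_mono[OF A.p_mono[OF a, of i "max i j"] K(1)] by simp
        show "s k (g b) \<le> L * q (max i j) b"
          using L(2)[OF b] mult_left_mono[OF B.p_mono[OF b, of j "max i j"] L(1)] by simp
      qed (use a b K L linear_onD(1)[OF lg b] in auto)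
      finally show ?thesis by (simp add: mult_ac)
    qed
    thus ?thesis using K(1) L(1) by (intro exI[of _ "max i j"] exI[of _ "K * L"]) auto
  qed
  note * = AB.tensor_lift_props[OF CD.complete_space_P bil bd]
  show "cont_linear (ptensor A B) (ptensor C D) (tensor_map A B C D f g)"
    unfolding tensor_map_def by (rule *(1))
  show "tensor_map A B C D f g (pure_tensor A B a b) = pure_tensor C D (f a) (g b)"
    if "a \<in> carrier A" "b \<in> carrier B" for a b
    unfolding tensor_map_def by (rule *(2)[OF that])
qed

lemma tensor_map_hom:
  assumes A: "complete_algebra A p" and B: "complete_algebra B q"
    and C: "complete_algebra C r" and D: "complete_algebra D s"
    and f: "cont_hom A C f" and g: "cont_hom B D g"
  shows "cont_hom (ptensor A B) (ptensor C D) (tensor_map A B C D f g)"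
proof -
  interpret AB: ptensor_algebras A p B q by (rule ptensor_algebrasI[OF A B])
  interpret CD: ptensor_algebras C r D s by (rule ptensor_algebrasI[OF C D])
  note tm = tensor_map_props[OF AB.A.complete_space_axioms AB.B.complete_space_axioms
      CD.A.complete_space_axioms CD.B.complete_space_axioms cont_homD(1)[OF f] cont_homD(1)[OF g]]
  show ?thesis
  proof (rule cont_hom_if_mult_on_total[OF AB.PA.seminormed_algebra_axioms CD.complete_algebra_P tm(1) AB.total_pure_all])
    fix x y assume "x \<in> {pure_tensor A B a b |a b. a \<in> carrier A \<and> b \<in> carrier B}"
      "y \<in> {pure_tensor A B a b |a b. a \<in> carrier A \<and> b \<in> carrier B}"
    then obtain a b a' b' where *: "x = pure_tensor A B a b" "y = pure_tensor A B a' b'"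
      "a \<in> carrier A" "b \<in> carrier B" "a' \<in> carrier A" "b' \<in> carrier B" by blast
    show "tensor_map A B C D f g (x \<otimes>\<^bsub>ptensor A B\<^esub> y) =
        tensor_map A B C D f g x \<otimes>\<^bsub>ptensor C D\<^esub> tensor_map A B C D f g y"
      using * cont_homD(3,4)[OF f] cont_homD(3,4)[OF g]
      by (simp add: AB.pure_mult CD.pure_mult tm(2))
  next
    show "tensor_map A B C D f g \<one>\<^bsub>ptensor A B\<^esub> = \<one>\<^bsub>ptensor C D\<^esub>"
      using tm(2)[OF AB.A.one_closed AB.B.one_closed] cont_homD(5)[OF f] cont_homD(5)[OF g]
      by (simp add: AB.pure_one CD.pure_one)
  qed
qed

text \<open>For fixed \<open>c\<close> the map \<open>a \<otimes> b \<mapsto> a \<otimes> (b \<otimes> c)\<close> is linearized first. The bound that it inherits is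
  proportional to the seminorm of \<open>c\<close>, so the result is a continuous bilinear map on
  \<open>(A \<otimes> B) \<times> C\<close>, which is linearized in turn.\<close>

lemma tensor_assoc_props:
  assumes A: "complete_space A p" and B: "complete_space B q" and C: "complete_space C r"
  shows "cont_linear (ptensor (ptensor A B) C) (ptensor A (ptensor B C)) (tensor_assoc A B C)"
    and "\<And>a b c. \<lbrakk>a \<in> carrier A; b \<in> carrier B; c \<in> carrier C\<rbrakk> \<Longrightarrow>
      tensor_assoc A B C (pure_tensor (ptensor A B) C (pure_tensor A B a b) c) =
      pure_tensor A (ptensor B C) a (pure_tensor B C b c)"
    and "total (ptensor (ptensor A B) C) {pure_tensor (ptensor A B) C (pure_tensor A B a b) c | a b c.
      a \<in> carrier A \<and> b \<in> carrier B \<and> c \<in> carrier C}"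
proof -
  interpret A: complete_space A p by fact
  interpret B: complete_space B q by fact
  interpret C: complete_space C r by fact
  interpret AB: ptensor_spaces A p B q by (rule ptensor_spacesI) unfold_locales
  interpret BC: ptensor_spaces B q C r by (rule ptensor_spacesI) unfold_locales
  interpret L: ptensor_spaces "ptensor A B" "tensor_norm A B p q" C r by (rule ptensor_spacesI) unfold_locales
  interpret R: ptensor_spaces A p "ptensor B C" "tensor_norm B C q r" by (rule ptensor_spacesI) unfold_locales
  let ?T = "ptensor A (ptensor B C)" and ?N = "tensor_norm A (ptensor B C) p (tensor_norm B C q r)"
  let ?\<beta> = "\<lambda>c a b. pure_tensor A (ptensor B C) a (pure_tensor B C b c)"
  have bil: "bilinear_on A B ?T (?\<beta> c)" if "c \<in> carrier C" for c
    unfolding bilinear_on_def linear_on_def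
    using that R.pure_carrier R.pure_add_left R.pure_add_right R.pure_scale_left R.pure_scale_right
      BC.pure_carrier BC.pure_add_left BC.pure_scale_left by simp
  have bd: "?N k (?\<beta> c a b) \<le> r k c * (p k a * q k b)"
    if a: "a \<in> carrier A" and b: "b \<in> carrier B" and c: "c \<in> carrier C" for a b c k
  proof -
    have "?N k (?\<beta> c a b) \<le> p k a * tensor_norm B C q r k (pure_tensor B C b c)"
      by (rule R.tn_pure[OF a BC.pure_carrier[OF b c]])
    also have "\<dots> \<le> p k a * (q k b * r k c)"
      by (rule mult_left_mono[OF BC.tn_pure[OF b c] A.p_nonneg[OF a]])
    finally show ?thesis by (simp add: mult_ac)
  qed
  have "\<exists>g. cont_linear (ptensor A B) ?T g \<and> (\<forall>a\<in>carrier A. \<forall>b\<in>carrier B. g (pure_tensor A B a b) = ?\<beta> c a b) \<and>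
      (\<forall>k. \<forall>X\<in>carrier (ptensor A B). ?N k (g X) \<le> r k c * tensor_norm A B p q k X)" if c: "c \<in> carrier C" for c
  proof -
    have ex: "\<exists>j K. 0 \<le> K \<and> (\<forall>a\<in>carrier A. \<forall>b\<in>carrier B. ?N k (?\<beta> c a b) \<le> K * (p j a * q j b))" for k
      using bd[OF _ _ c] C.p_nonneg[OF c] by blast
    obtain g where g: "cont_linear (ptensor A B) ?T g"
      "\<And>a b. \<lbrakk>a \<in> carrier A; b \<in> carrier B\<rbrakk> \<Longrightarrow> g (pure_tensor A B a b) = ?\<beta> c a b"
      "\<And>k j K X. \<lbrakk>\<And>a b. \<lbrakk>a \<in> carrier A; b \<in> carrier B\<rbrakk> \<Longrightarrow> ?N k (?\<beta> c a b) \<le> K * (p j a * q j b); 0 \<le> K;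
        X \<in> carrier (ptensor A B)\<rbrakk> \<Longrightarrow> ?N k (g X) \<le> K * tensor_norm A B p q j X"
      using AB.ptensor_lift[OF R.complete_space_P bil[OF c] ex] by blast
    show ?thesis
      by (rule exI[of _ g]) (use g(1,2) g(3)[OF bd[OF _ _ c] C.p_nonneg[OF c]] in auto)
  qed
  then obtain g where g: "\<And>c. c \<in> carrier C \<Longrightarrow> cont_linear (ptensor A B) ?T (g c)"
    "\<And>a b c. \<lbrakk>a \<in> carrier A; b \<in> carrier B; c \<in> carrier C\<rbrakk> \<Longrightarrow> g c (pure_tensor A B a b) = ?\<beta> c a b"
    "\<And>k X c. \<lbrakk>X \<in> carrier (ptensor A B); c \<in> carrier C\<rbrakk> \<Longrightarrow> ?N k (g c X) \<le> r k c * tensor_norm A B p q k X"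
    by metis
  have glin: "linear_on (ptensor A B) ?T (g c)" if "c \<in> carrier C" for c using g(1)[OF that] by (simp add: cont_linear_iff)
  note gc = linear_onD(1)[OF glin]
  have g_add: "g (c \<oplus>\<^bsub>C\<^esub> c') X = g c X \<oplus>\<^bsub>?T\<^esub> g c' X"
    if "X \<in> carrier (ptensor A B)" "c \<in> carrier C" "c' \<in> carrier C" for X c c'
    by (rule AB.ptensor_eq_on_pure[OF R.complete_space_P g(1) cont_linear_add[OF AB.P.seminormed_space_axioms R.P.seminormed_space_axioms g(1) g(1)] _ that(1)])
       (use that g(2) BC.pure_add_right R.pure_add_right BC.pure_carrier in auto)
  have g_scale: "g (d \<odot>\<^bsub>C\<^esub> c) X = d \<odot>\<^bsub>?T\<^esub> g c X" if "X \<in> carrier (ptensor A B)" "c \<in> carrier C" for X c d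
    by (rule AB.ptensor_eq_on_pure[OF R.complete_space_P g(1) cont_linear_scale[OF AB.P.seminormed_space_axioms R.P.seminormed_space_axioms g(1)] _ that(1)])
       (use that g(2) BC.pure_scale_right R.pure_scale_right BC.pure_carrier in auto)
  have gbil: "bilinear_on (ptensor A B) C ?T (\<lambda>X c. g c X)"
    unfolding bilinear_on_def using glin gc g_add g_scale by (auto simp: linear_on_def[of C])
  have gbd: "\<exists>j K. 0 \<le> K \<and> (\<forall>X\<in>carrier (ptensor A B). \<forall>c\<in>carrier C.
      ?N k (g c X) \<le> K * (tensor_norm A B p q j X * r j c))" for k
    by (intro exI[of _ k] exI[of _ "1::real"]) (use g(3) in \<open>auto simp: mult.commute\<close>)
  obtain f where f: "cont_linear (ptensor (ptensor A B) C) ?T f"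
    "\<And>X c. \<lbrakk>X \<in> carrier (ptensor A B); c \<in> carrier C\<rbrakk> \<Longrightarrow> f (pure_tensor (ptensor A B) C X c) = g c X"
    using L.ptensor_lift[OF R.complete_space_P gbil gbd] by metis
  have "{pure_tensor (ptensor A B) C X c |X c. X \<in> {pure_tensor A B a b |a b. a \<in> carrier A \<and> b \<in> carrier B} \<and> c \<in> carrier C}
      = {pure_tensor (ptensor A B) C (pure_tensor A B a b) c | a b c. a \<in> carrier A \<and> b \<in> carrier B \<and> c \<in> carrier C}"
    by blast
  thus tot: "total (ptensor (ptensor A B) C) {pure_tensor (ptensor A B) C (pure_tensor A B a b) c | a b c.
      a \<in> carrier A \<and> b \<in> carrier B \<and> c \<in> carrier C}"
    using L.total_pure[OF AB.total_pure_all AB.total_carrier[OF C.vspace_axioms]] by simp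
  let ?Q = "\<lambda>f. f \<in> extensional (carrier (ptensor (ptensor A B) C)) \<and>
    cont_linear (ptensor (ptensor A B) C) ?T f \<and>
    (\<forall>a\<in>carrier A. \<forall>b\<in>carrier B. \<forall>c\<in>carrier C.
      f (pure_tensor (ptensor A B) C (pure_tensor A B a b) c) = ?\<beta> c a b)"
  have "\<exists>!f. ?Q f"
  proof (rule ex1I)
    show "?Q (restrict f (carrier (ptensor (ptensor A B) C)))"
      using cont_linear_cong[OF L.P.seminormed_space_axioms f(1), of "restrict f (carrier (ptensor (ptensor A B) C))"]
        f(2) g(2) L.pure_carrier AB.pure_carrier by simp
    fix f' assume f': "?Q f'"
    show "f' = restrict f (carrier (ptensor (ptensor A B) C))"
    proof (rule extensionalityI[where A = "carrier (ptensor (ptensor A B) C)"])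
      fix X assume X: "X \<in> carrier (ptensor (ptensor A B) C)"
      have "f' X = f X"
        by (rule cont_linear_eq_on_total[OF L.P.seminormed_space_axioms R.complete_space_P _ f(1) tot _ X])
           (use f' f(2) g(2) AB.pure_carrier in auto)
      thus "f' X = restrict f (carrier (ptensor (ptensor A B) C)) X" using X by simp
    qed (use f' in auto)
  qed
  hence "?Q (tensor_assoc A B C)" unfolding tensor_assoc_def by (rule theI')
  thus "cont_linear (ptensor (ptensor A B) C) ?T (tensor_assoc A B C)"
    "\<And>a b c. \<lbrakk>a \<in> carrier A; b \<in> carrier B; c \<in> carrier C\<rbrakk> \<Longrightarrow>
      tensor_assoc A B C (pure_tensor (ptensor A B) C (pure_tensor A B a b) c) = ?\<beta> c a b" by auto
qed

lemma tensor_assoc_hom: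
  assumes A: "complete_algebra A p" and B: "complete_algebra B q" and C: "complete_algebra C r"
  shows "cont_hom (ptensor (ptensor A B) C) (ptensor A (ptensor B C)) (tensor_assoc A B C)"
proof -
  interpret AB: ptensor_algebras A p B q by (rule ptensor_algebrasI[OF A B])
  interpret BC: ptensor_algebras B q C r by (rule ptensor_algebrasI[OF B C])
  interpret L: ptensor_algebras "ptensor A B" "tensor_norm A B p q" C r
    by (rule ptensor_algebrasI[OF AB.complete_algebra_P C])
  interpret R: ptensor_algebras A p "ptensor B C" "tensor_norm B C q r"
    by (rule ptensor_algebrasI[OF A BC.complete_algebra_P])
  note ta = tensor_assoc_props[OF AB.A.complete_space_axioms AB.B.complete_space_axioms BC.B.complete_space_axioms]
  show ?thesis
  proof (rule cont_hom_if_mult_on_total[OF L.PA.seminormed_algebra_axioms R.complete_algebra_P ta(1,3)])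
    fix x y assume "x \<in> {pure_tensor (ptensor A B) C (pure_tensor A B a b) c | a b c.
      a \<in> carrier A \<and> b \<in> carrier B \<and> c \<in> carrier C}" "y \<in> {pure_tensor (ptensor A B) C (pure_tensor A B a b) c | a b c.
      a \<in> carrier A \<and> b \<in> carrier B \<and> c \<in> carrier C}"
    then obtain a b c a' b' c' where *: "x = pure_tensor (ptensor A B) C (pure_tensor A B a b) c"
      "y = pure_tensor (ptensor A B) C (pure_tensor A B a' b') c'"
      "a \<in> carrier A" "b \<in> carrier B" "a' \<in> carrier A" "b' \<in> carrier B" "c \<in> carrier C" "c' \<in> carrier C" by blast
    show "tensor_assoc A B C (x \<otimes>\<^bsub>ptensor (ptensor A B) C\<^esub> y) =
        tensor_assoc A B C x \<otimes>\<^bsub>ptensor A (ptensor B C)\<^esub> tensor_assoc A B C y"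
      using *(3-8) unfolding *(1,2)
      by (simp add: L.pure_mult R.pure_mult AB.pure_mult BC.pure_mult AB.pure_carrier BC.pure_carrier ta(2))
  next
    show "tensor_assoc A B C \<one>\<^bsub>ptensor (ptensor A B) C\<^esub> = \<one>\<^bsub>ptensor A (ptensor B C)\<^esub>"
      using ta(2)[OF AB.A.one_closed AB.B.one_closed BC.B.one_closed]
      by (simp add: L.pure_one R.pure_one AB.pure_one BC.pure_one)
  qed
qed

lemma complete_algebra_complex: "complete_algebra complex_talg (\<lambda>k. cmod)"
proof -
  interpret V: vspace complex_talg by (rule complex_vspace)
  have minus: "x \<ominus>\<^bsub>complex_talg\<^esub> y = x - y" for x y by (simp add: V.minus_eq_scale)
  interpret S: seminormed_space complex_talg "\<lambda>k. cmod"
  proof (unfold_locales)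
    show "seminorm complex_talg cmod" by (simp add: seminorm_def norm_mult norm_triangle_ineq)
    show "topo complex_talg = lc_topology complex_talg (range (\<lambda>k::nat. cmod))"
    proof (rule topology_eq[THEN iffD2], intro allI)
      fix U :: "complex set"
      have "openin (lc_topology complex_talg (range (\<lambda>k::nat. cmod))) U \<longleftrightarrow>
          (\<forall>x\<in>U. \<exists>r. 0 < r \<and> {y. cmod (y - x) < r} \<subseteq> U)"
        by (subst openin_lc_topology_range[OF complex_vspace]) (auto simp: minus)
      also have "\<dots> \<longleftrightarrow> open U"
        unfolding open_contains_ball by (simp add: ball_def dist_norm norm_minus_commute)
      finally show "openin (topo complex_talg) U = openin (lc_topology complex_talg (range (\<lambda>k::nat. cmod))) U" by simp
    qed
  qed simp
  interpret R: Ring.ring complex_talg using cring_complex_talg by (rule cring.axioms)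
  show ?thesis
  proof (unfold_locales)
    fix x assume "\<And>k :: nat. cmod x = 0"
    thus "x = \<zero>\<^bsub>complex_talg\<^esub>" by simp
  next
    fix s assume s: "cauchy_seq complex_talg s"
    have "Cauchy s"
    proof (rule metric_CauchyI)
      fix e :: real assume "e > 0"
      thus "\<exists>M. \<forall>m\<ge>M. \<forall>n\<ge>M. dist (s m) (s n) < e"
        using s unfolding S.cauchy_seq_iff minus dist_norm by blast
    qed
    then obtain l where "s \<longlonglongrightarrow> l" by (auto simp: Cauchy_convergent_iff convergent_def)
    hence "converges complex_talg s l"
      unfolding S.converges_iff minus using tendsto_norm_zero[OF LIM_zero] by auto
    thus "\<exists>l. converges complex_talg s l" by (intro exI[of _ l])
  qed (auto simp: norm_mult)
qed

lemma left_unitor_props: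
  assumes A: "complete_algebra A p"
  shows "cont_hom (ptensor complex_talg A) A (left_unitor A)"
    and "\<And>c a. a \<in> carrier A \<Longrightarrow> left_unitor A (pure_tensor complex_talg A c a) = c \<odot>\<^bsub>A\<^esub> a"
proof -
  interpret T: ptensor_algebras complex_talg "\<lambda>k. cmod" A p by (rule ptensor_algebrasI[OF complete_algebra_complex A])
  have bil: "bilinear_on complex_talg A A (\<lambda>c a. c \<odot>\<^bsub>A\<^esub> a)"
    unfolding bilinear_on_def linear_on_def
    by (auto simp: T.B.scale_left_distrib T.B.scale_right_distrib T.B.scale_scale mult.commute)
  have bd: "\<exists>j K. 0 \<le> K \<and> (\<forall>c\<in>carrier complex_talg. \<forall>a\<in>carrier A. p k (c \<odot>\<^bsub>A\<^esub> a) \<le> K * (cmod c * p j a))" for k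
    by (intro exI[of _ k] exI[of _ "1::real"]) (auto simp: T.B.p_scale)
  note l = T.tensor_lift_props[OF T.B.complete_space_axioms bil bd, folded left_unitor_def]
  show v: "left_unitor A (pure_tensor complex_talg A c a) = c \<odot>\<^bsub>A\<^esub> a" if "a \<in> carrier A" for c a
    using l(2)[of c a] that by simp
  show "cont_hom (ptensor complex_talg A) A (left_unitor A)"
  proof (rule cont_hom_if_mult_on_total[OF T.PA.seminormed_algebra_axioms A l(1) T.total_pure_all])
    fix x y assume "x \<in> {pure_tensor complex_talg A c a |c a. c \<in> carrier complex_talg \<and> a \<in> carrier A}"
      "y \<in> {pure_tensor complex_talg A c a |c a. c \<in> carrier complex_talg \<and> a \<in> carrier A}"
    then obtain c a c' a' where *: "x = pure_tensor complex_talg A c a" "y = pure_tensor complex_talg A c' a'"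
      "a \<in> carrier A" "a' \<in> carrier A" by blast
    show "left_unitor A (x \<otimes>\<^bsub>ptensor complex_talg A\<^esub> y) = left_unitor A x \<otimes>\<^bsub>A\<^esub> left_unitor A y"
      using * by (simp add: T.pure_mult v T.B.scale_mult_left T.B.scale_mult_right T.B.scale_scale mult.commute)
  next
    show "left_unitor A \<one>\<^bsub>ptensor complex_talg A\<^esub> = \<one>\<^bsub>A\<^esub>"
      using v[OF T.B.one_closed, of 1] T.pure_one by simp
  qed
qed

lemma right_unitor_props:
  assumes A: "complete_algebra A p"
  shows "cont_hom (ptensor A complex_talg) A (right_unitor A)"
    and "\<And>c a. a \<in> carrier A \<Longrightarrow> right_unitor A (pure_tensor A complex_talg a c) = c \<odot>\<^bsub>A\<^esub> a"
proof -
  interpret T: ptensor_algebras A p complex_talg "\<lambda>k. cmod" by (rule ptensor_algebrasI[OF A complete_algebra_complex])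
  have bil: "bilinear_on A complex_talg A (\<lambda>a c. c \<odot>\<^bsub>A\<^esub> a)"
    unfolding bilinear_on_def linear_on_def
    by (auto simp: T.A.scale_left_distrib T.A.scale_right_distrib T.A.scale_scale mult.commute)
  have bd: "\<exists>j K. 0 \<le> K \<and> (\<forall>a\<in>carrier A. \<forall>c\<in>carrier complex_talg. p k (c \<odot>\<^bsub>A\<^esub> a) \<le> K * (p j a * cmod c))" for k
    by (intro exI[of _ k] exI[of _ "1::real"]) (auto simp: T.A.p_scale)
  note l = T.tensor_lift_props[OF T.A.complete_space_axioms bil bd, folded right_unitor_def]
  show v: "right_unitor A (pure_tensor A complex_talg a c) = c \<odot>\<^bsub>A\<^esub> a" if "a \<in> carrier A" for c a
    using l(2)[of a c] that by simp
  show "cont_hom (ptensor A complex_talg) A (right_unitor A)"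
  proof (rule cont_hom_if_mult_on_total[OF T.PA.seminormed_algebra_axioms A l(1) T.total_pure_all])
    fix x y assume "x \<in> {pure_tensor A complex_talg a c |a c. a \<in> carrier A \<and> c \<in> carrier complex_talg}"
      "y \<in> {pure_tensor A complex_talg a c |a c. a \<in> carrier A \<and> c \<in> carrier complex_talg}"
    then obtain c a c' a' where *: "x = pure_tensor A complex_talg a c" "y = pure_tensor A complex_talg a' c'"
      "a \<in> carrier A" "a' \<in> carrier A" by blast
    show "right_unitor A (x \<otimes>\<^bsub>ptensor A complex_talg\<^esub> y) = right_unitor A x \<otimes>\<^bsub>A\<^esub> right_unitor A y"
      using * by (simp add: T.pure_mult v T.A.scale_mult_left T.A.scale_mult_right T.A.scale_scale mult.commute)
  next
    show "right_unitor A \<one>\<^bsub>ptensor A complex_talg\<^esub> = \<one>\<^bsub>A\<^esub>"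
      using v[OF T.A.one_closed, of 1] T.pure_one by simp
  qed
qed

lemma mult_map_props:
  assumes A: "complete_algebra A p"
  shows "cont_linear (ptensor A A) A (mult_map A)"
    and "\<And>a b. \<lbrakk>a \<in> carrier A; b \<in> carrier A\<rbrakk> \<Longrightarrow> mult_map A (pure_tensor A A a b) = a \<otimes>\<^bsub>A\<^esub> b"
proof -
  interpret T: ptensor_algebras A p A p by (rule ptensor_algebrasI[OF A A])
  have bil: "bilinear_on A A A (\<lambda>a b. a \<otimes>\<^bsub>A\<^esub> b)"
    unfolding bilinear_on_def linear_on_def
    by (auto simp: T.A.l_distr T.A.r_distr T.A.scale_mult_left T.A.scale_mult_right)
  have bd: "\<exists>j K. 0 \<le> K \<and> (\<forall>a\<in>carrier A. \<forall>b\<in>carrier A. p k (a \<otimes>\<^bsub>A\<^esub> b) \<le> K * (p j a * p j b))" for k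
    by (intro exI[of _ k] exI[of _ "1::real"]) (auto simp: T.A.p_mult)
  note l = T.tensor_lift_props[OF T.A.complete_space_axioms bil bd, folded mult_map_def]
  show "cont_linear (ptensor A A) A (mult_map A)" by (rule l(1))
  show "mult_map A (pure_tensor A A a b) = a \<otimes>\<^bsub>A\<^esub> b" if "a \<in> carrier A" "b \<in> carrier A" for a b
    by (rule l(2)[OF that])
qed

section \<open>The exponential in a complete algebra\<close>

context complete_algebra
begin

definition exp_term :: "'a \<Rightarrow> nat \<Rightarrow> 'a" where
  "exp_term x k = (1 / fact k) \<odot> (x [^] k)"

definition exp_sum :: "'a \<Rightarrow> nat \<Rightarrow> 'a" where
  "exp_sum x N = (\<Oplus>k\<in>{..N}. exp_term x k)"

lemma exp_term_carrier [simp]: "x \<in> carrier V \<Longrightarrow> exp_term x k \<in> carrier V"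
  by (simp add: exp_term_def)

lemma exp_sum_carrier [simp]: "x \<in> carrier V \<Longrightarrow> exp_sum x N \<in> carrier V"
  unfolding exp_sum_def by (intro M.finsum_closed) auto

lemma exp_sum_0: "x \<in> carrier V \<Longrightarrow> exp_sum x 0 = exp_term x 0"
  by (simp add: exp_sum_def)

lemma exp_sum_Suc: "x \<in> carrier V \<Longrightarrow> exp_sum x (Suc N) = exp_sum x N \<oplus> exp_term x (Suc N)"
  unfolding exp_sum_def by (subst M.finsum_Suc) (auto intro!: M.a_comm M.finsum_closed)

lemma p_pow_le: "x \<in> carrier V \<Longrightarrow> p k (x [^] (j::nat)) \<le> p k \<one> * p k x ^ j"
proof (induction j)
  case (Suc j)
  have "p k (x [^] Suc j) \<le> p k (x [^] j) * p k x" using Suc.prems by (simp add: p_mult)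
  also have "\<dots> \<le> (p k \<one> * p k x ^ j) * p k x" using Suc by (intro mult_right_mono) auto
  finally show ?case by (simp add: mult_ac)
qed simp

lemma p_exp_term_le:
  assumes "x \<in> carrier V" shows "p k (exp_term x j) \<le> p k \<one> * (p k x ^ j / fact j)"
proof -
  have "p k (exp_term x j) = p k (x [^] j) / fact j"
    using assms by (simp add: exp_term_def p_scale norm_divide)
  thus ?thesis using divide_right_mono[OF p_pow_le[OF assms, of k j], of "fact j"] by simp
qed

definition exp_majorant :: "'a \<Rightarrow> nat \<Rightarrow> nat \<Rightarrow> real" where
  "exp_majorant x k N = (\<Sum>j\<le>N. p k x ^ j / fact j)"

lemma exp_majorant_tendsto: "exp_majorant x k \<longlonglongrightarrow> exp (p k x)"
proof -
  have "(\<lambda>n. p k x ^ n / fact n) sums exp (p k x)"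
    using exp_converges[of "p k x"] by (simp add: divide_inverse mult.commute)
  thus ?thesis unfolding sums_def_le exp_majorant_def[abs_def] .
qed

lemma exp_sum_diff_le:
  assumes x: "x \<in> carrier V" and "n \<le> m"
  shows "p k (exp_sum x m \<ominus> exp_sum x n) \<le> p k \<one> * (exp_majorant x k m - exp_majorant x k n)"
  using assms(2)
proof (induction m rule: dec_induct)
  case base
  show ?case using x by simp
next
  case (step m)
  have "p k (exp_sum x (Suc m) \<ominus> exp_sum x n) \<le>
      p k (exp_sum x (Suc m) \<ominus> exp_sum x m) + p k (exp_sum x m \<ominus> exp_sum x n)"
    using x by (intro p_diff_triangle) auto
  also have "exp_sum x (Suc m) \<ominus> exp_sum x m = exp_term x (Suc m)"
    unfolding exp_sum_Suc[OF x] using x by (intro add_diff_cancel_left') auto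
  also have "p k (exp_term x (Suc m)) \<le> p k \<one> * (p k x ^ Suc m / fact (Suc m))"
    by (rule p_exp_term_le[OF x])
  finally show ?case using step.IH by (simp add: exp_majorant_def algebra_simps)
qed

lemma exp_sum_converges:
  assumes x: "x \<in> carrier V" shows "converges V (exp_sum x) (alg_exp V x)"
proof -
  have "cauchy_seq V (exp_sum x)"
  proof (rule cauchy_seq_majorized)
    show "p k (exp_sum x m \<ominus> exp_sum x n) \<le> p k \<one> * exp_majorant x k m - p k \<one> * exp_majorant x k n"
      if "k \<le> n" "n \<le> m" for k m n
      using exp_sum_diff_le[OF x that(2), of k] by (simp add: right_diff_distrib)
    show "convergent (\<lambda>N. p k \<one> * exp_majorant x k N)" for k
      using tendsto_mult_left[OF exp_majorant_tendsto] by (rule convergentI)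
  qed (use x in simp)
  then obtain l where l: "converges V (exp_sum x) l" using complete by blast
  have "alg_exp V x = l"
    unfolding alg_exp_def
  proof (rule the_equality)
    show "limitin (topo V) (\<lambda>N. \<Oplus>k\<in>{..N}. (1 / fact k) \<odot> x [^] k) l sequentially"
      using l unfolding converges_def exp_sum_def[abs_def] exp_term_def by simp
    fix y assume y: "limitin (topo V) (\<lambda>N. \<Oplus>k\<in>{..N}. (1 / fact k) \<odot> x [^] k) y sequentially"
    hence "converges V (exp_sum x) y"
      unfolding converges_def using exp_sum_carrier[OF x] by (simp add: exp_sum_def[abs_def] exp_term_def[abs_def])
    thus "y = l" using converges_unique l by blast
  qed
  thus ?thesis using l by simp
qed

lemma alg_exp_carrier [simp]: "x \<in> carrier V \<Longrightarrow> alg_exp V x \<in> carrier V"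
  by (rule convergesD(2)[OF exp_sum_converges])

lemma pow_intertwine:
  assumes "x \<in> carrier V" "y \<in> carrier V" "z \<in> carrier V" "x \<otimes> z = z \<otimes> y"
  shows "x [^] (k::nat) \<otimes> z = z \<otimes> y [^] k"
proof (induction k)
  case (Suc k)
  have "x [^] Suc k \<otimes> z = x [^] k \<otimes> (x \<otimes> z)" using assms(1-3) by (simp add: m_assoc)
  also have "\<dots> = (x [^] k \<otimes> z) \<otimes> y" using assms by (simp add: m_assoc)
  also have "\<dots> = z \<otimes> y [^] Suc k" using assms(1-3) Suc.IH by (simp add: m_assoc)
  finally show ?case .
qed (use assms in simp)

lemma exp_term_intertwine:
  assumes "x \<in> carrier V" "y \<in> carrier V" "z \<in> carrier V" "x \<otimes> z = z \<otimes> y"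
  shows "exp_term x k \<otimes> z = z \<otimes> exp_term y k"
  using assms pow_intertwine[OF assms] by (simp add: exp_term_def scale_mult_left scale_mult_right)

text \<open>Powers, hence partial sums, hence limits intertwine. The case \<open>x = y\<close> says that exponentials
  commute with whatever commutes with the exponent.\<close>

lemma alg_exp_intertwine:
  assumes x: "x \<in> carrier V" and y: "y \<in> carrier V" and z: "z \<in> carrier V" and eq: "x \<otimes> z = z \<otimes> y"
  shows "alg_exp V x \<otimes> z = z \<otimes> alg_exp V y"
proof (rule converges_unique)
  have s: "exp_sum x N \<otimes> z = z \<otimes> exp_sum y N" for N
    by (induction N)
       (simp_all add: x y z exp_sum_0 exp_sum_Suc l_distr r_distr exp_term_intertwine[OF x y z eq])
  show "converges V (\<lambda>N. exp_sum x N \<otimes> z) (alg_exp V x \<otimes> z)"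
    by (rule converges_mult[OF exp_sum_converges[OF x] converges_const[OF z]])
  show "converges V (\<lambda>N. exp_sum x N \<otimes> z) (z \<otimes> alg_exp V y)"
    unfolding s by (rule converges_mult[OF converges_const[OF z] exp_sum_converges[OF y]])
qed

lemma mult_exp_term: "x \<in> carrier V \<Longrightarrow> x \<otimes> exp_term x k = of_nat (Suc k) \<odot> exp_term x (Suc k)"
proof -
  assume x: "x \<in> carrier V"
  have "x \<otimes> x [^] k = x [^] Suc k" by (rule nat_pow_Suc2[OF x, symmetric])
  moreover have "of_nat (Suc k) * (1 / fact (Suc k)) = (1 / fact k :: complex)"
    by (simp del: of_nat_Suc)
  ultimately show ?thesis
    unfolding exp_term_def
    by (simp only: scale_mult_right[OF x nat_pow_closed[OF x]] scale_scale[OF nat_pow_closed[OF x]])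
qed

definition exp_cauchy_term :: "'a \<Rightarrow> 'a \<Rightarrow> nat \<Rightarrow> 'a" where
  "exp_cauchy_term x y n = (\<Oplus>i\<in>{..n}. exp_term x i \<otimes> exp_term y (n - i))"

text \<open>The binomial theorem for commuting elements: multiplying the \<open>n\<close>-th Cauchy term by \<open>x + y\<close> gives
  \<open>n + 1\<close> times the next one, since the factors \<open>i\<close> and \<open>n + 1 - i\<close> that come from the two summands
  add up to \<open>n + 1\<close>.\<close>

lemma exp_cauchy_term_eq:
  assumes x: "x \<in> carrier V" and y: "y \<in> carrier V" and comm: "x \<otimes> y = y \<otimes> x"
  shows "exp_cauchy_term x y n = exp_term (x \<oplus> y) n"
proof (induction n)
  case 0
  show ?case using x y by (simp add: exp_cauchy_term_def exp_term_def)
next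
  case (Suc n)
  define w where "w i = exp_term x i \<otimes> exp_term y (Suc n - i)" for i
  have wc: "w i \<in> carrier V" for i using x y by (simp add: w_def)
  have xterm: "exp_term x i \<otimes> y = y \<otimes> exp_term x i" for i by (rule exp_term_intertwine[OF x x y comm])
  have C: "exp_cauchy_term x y n \<in> carrier V"
    unfolding exp_cauchy_term_def using x y by (intro M.finsum_closed) auto
  have "x \<otimes> exp_cauchy_term x y n = (\<Oplus>i\<in>{..n}. of_nat (Suc i) \<odot> w (Suc i))"
  proof -
    have "x \<otimes> exp_cauchy_term x y n = (\<Oplus>i\<in>{..n}. x \<otimes> (exp_term x i \<otimes> exp_term y (n - i)))"
      unfolding exp_cauchy_term_def using x y by (intro finsum_rdistr) auto
    also have "\<dots> = (\<Oplus>i\<in>{..n}. of_nat (Suc i) \<odot> w (Suc i))"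
    proof (rule M.finsum_cong')
      fix i
      have "x \<otimes> (exp_term x i \<otimes> exp_term y (n - i)) = (x \<otimes> exp_term x i) \<otimes> exp_term y (n - i)"
        using x y by (simp add: m_assoc)
      thus "x \<otimes> (exp_term x i \<otimes> exp_term y (n - i)) = of_nat (Suc i) \<odot> w (Suc i)"
        using x y unfolding mult_exp_term[OF x] by (simp add: w_def scale_mult_left del: of_nat_Suc)
    qed (use wc in auto)
    finally show ?thesis .
  qed
  also have "\<dots> = (\<Oplus>i\<in>{..Suc n}. of_nat i \<odot> w i)"
    by (subst M.finsum_Suc2) (use wc in \<open>auto simp del: of_nat_Suc\<close>)
  finally have 1: "x \<otimes> exp_cauchy_term x y n = (\<Oplus>i\<in>{..Suc n}. of_nat i \<odot> w i)" .
  have "y \<otimes> exp_cauchy_term x y n = (\<Oplus>i\<in>{..n}. of_nat (Suc n - i) \<odot> w i)"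
  proof -
    have "y \<otimes> exp_cauchy_term x y n = (\<Oplus>i\<in>{..n}. y \<otimes> (exp_term x i \<otimes> exp_term y (n - i)))"
      unfolding exp_cauchy_term_def using x y by (intro finsum_rdistr) auto
    also have "\<dots> = (\<Oplus>i\<in>{..n}. of_nat (Suc n - i) \<odot> w i)"
    proof (rule M.finsum_cong')
      fix i assume i: "i \<in> {..n}"
      have "y \<otimes> (exp_term x i \<otimes> exp_term y (n - i)) = (exp_term x i \<otimes> y) \<otimes> exp_term y (n - i)"
        using x y by (simp add: m_assoc[symmetric] xterm)
      also have "\<dots> = exp_term x i \<otimes> (y \<otimes> exp_term y (n - i))"
        using x y by (simp add: m_assoc)
      also have "\<dots> = of_nat (Suc (n - i)) \<odot> (exp_term x i \<otimes> exp_term y (Suc (n - i)))"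
        using x y unfolding mult_exp_term[OF y] by (simp add: scale_mult_right del: of_nat_Suc)
      finally show "y \<otimes> (exp_term x i \<otimes> exp_term y (n - i)) = of_nat (Suc n - i) \<odot> w i"
        using i by (simp add: w_def Suc_diff_le del: of_nat_Suc)
    qed (use wc in auto)
    finally show ?thesis .
  qed
  also have "\<dots> = (\<Oplus>i\<in>{..Suc n}. of_nat (Suc n - i) \<odot> w i)"
    by (subst M.finsum_Suc) (use wc in auto)
  finally have 2: "y \<otimes> exp_cauchy_term x y n = (\<Oplus>i\<in>{..Suc n}. of_nat (Suc n - i) \<odot> w i)" .
  have "(x \<oplus> y) \<otimes> exp_cauchy_term x y n =
      (\<Oplus>i\<in>{..Suc n}. of_nat i \<odot> w i) \<oplus> (\<Oplus>i\<in>{..Suc n}. of_nat (Suc n - i) \<odot> w i)"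
    using x y C by (simp add: l_distr 1 2)
  also have "\<dots> = (\<Oplus>i\<in>{..Suc n}. of_nat i \<odot> w i \<oplus> of_nat (Suc n - i) \<odot> w i)"
    using wc by (intro M.finsum_addf[symmetric]) auto
  also have "\<dots> = (\<Oplus>i\<in>{..Suc n}. of_nat (Suc n) \<odot> w i)"
  proof (rule M.finsum_cong')
    fix i assume "i \<in> {..Suc n}"
    hence "(of_nat i :: complex) + of_nat (Suc n - i) = of_nat (Suc n)" by (simp flip: of_nat_add)
    thus "of_nat i \<odot> w i \<oplus> of_nat (Suc n - i) \<odot> w i = of_nat (Suc n) \<odot> w i"
      by (simp only: scale_left_distrib[OF wc, symmetric])
  qed (use wc in auto)
  also have "\<dots> = of_nat (Suc n) \<odot> exp_cauchy_term x y (Suc n)"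
    unfolding exp_cauchy_term_def w_def[symmetric] using wc by (intro scale_finsum[symmetric]) auto
  finally have "of_nat (Suc n) \<odot> exp_cauchy_term x y (Suc n) = (x \<oplus> y) \<otimes> exp_term (x \<oplus> y) n"
    using Suc.IH by simp
  also have "\<dots> = of_nat (Suc n) \<odot> exp_term (x \<oplus> y) (Suc n)" by (rule mult_exp_term) (use x y in simp)
  finally have eq: "(of_nat (Suc n) :: complex) \<odot> exp_cauchy_term x y (Suc n) = of_nat (Suc n) \<odot> exp_term (x \<oplus> y) (Suc n)" .
  have "exp_cauchy_term x y (Suc n) \<in> carrier V"
    unfolding exp_cauchy_term_def using x y by (intro M.finsum_closed) auto
  moreover have "(1 / of_nat (Suc n) * of_nat (Suc n) :: complex) = 1" by (simp del: of_nat_Suc)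
  ultimately show ?case
    using arg_cong[OF eq, of "\<lambda>z. (1 / of_nat (Suc n)) \<odot> z"] x y
    by (simp only: scale_scale exp_term_carrier M.a_closed scale_one)
qed

lemma exp_sum_add:
  assumes x: "x \<in> carrier V" and y: "y \<in> carrier V" and comm: "x \<otimes> y = y \<otimes> x"
  shows "exp_sum (x \<oplus> y) N = (\<Oplus>i\<in>{..N}. exp_term x i \<otimes> exp_sum y (N - i))"
proof (induction N)
  case 0
  show ?case using x y by (simp add: exp_sum_0 exp_term_def)
next
  case (Suc N)
  have c: "(\<lambda>i. exp_term x i \<otimes> exp_sum y (N - i)) \<in> {..N} \<rightarrow> carrier V"
    "(\<lambda>i. exp_term x i \<otimes> exp_term y (Suc N - i)) \<in> {..N} \<rightarrow> carrier V"
    using x y by auto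
  have "(\<Oplus>i\<in>{..Suc N}. exp_term x i \<otimes> exp_sum y (Suc N - i)) =
      exp_term x (Suc N) \<otimes> exp_sum y 0 \<oplus> (\<Oplus>i\<in>{..N}. exp_term x i \<otimes> exp_sum y (Suc N - i))"
    by (subst M.finsum_Suc) (use x y in auto)
  also have "(\<Oplus>i\<in>{..N}. exp_term x i \<otimes> exp_sum y (Suc N - i)) =
      (\<Oplus>i\<in>{..N}. exp_term x i \<otimes> exp_sum y (N - i) \<oplus> exp_term x i \<otimes> exp_term y (Suc N - i))"
  proof (rule M.finsum_cong')
    fix i assume "i \<in> {..N}"
    thus "exp_term x i \<otimes> exp_sum y (Suc N - i) =
        exp_term x i \<otimes> exp_sum y (N - i) \<oplus> exp_term x i \<otimes> exp_term y (Suc N - i)"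
      using x y by (simp add: Suc_diff_le exp_sum_Suc r_distr)
  qed (use x y in auto)
  also have "\<dots> = exp_sum (x \<oplus> y) N \<oplus> (\<Oplus>i\<in>{..N}. exp_term x i \<otimes> exp_term y (Suc N - i))"
    unfolding Suc.IH by (rule M.finsum_addf[OF c])
  also have "exp_term x (Suc N) \<otimes> exp_sum y 0 \<oplus>
        (exp_sum (x \<oplus> y) N \<oplus> (\<Oplus>i\<in>{..N}. exp_term x i \<otimes> exp_term y (Suc N - i))) =
      exp_sum (x \<oplus> y) N \<oplus> (exp_term x (Suc N) \<otimes> exp_term y (Suc N - Suc N) \<oplus>
        (\<Oplus>i\<in>{..N}. exp_term x i \<otimes> exp_term y (Suc N - i)))"
    using x y M.finsum_closed[OF c(2)] by (simp add: exp_sum_0 M.a_ac)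
  also have "exp_term x (Suc N) \<otimes> exp_term y (Suc N - Suc N) \<oplus>
        (\<Oplus>i\<in>{..N}. exp_term x i \<otimes> exp_term y (Suc N - i)) = exp_cauchy_term x y (Suc N)"
    unfolding exp_cauchy_term_def by (rule M.finsum_Suc[symmetric]) (use x y in auto)
  also have "exp_sum (x \<oplus> y) N \<oplus> exp_cauchy_term x y (Suc N) = exp_sum (x \<oplus> y) (Suc N)"
    using x y by (simp add: exp_sum_Suc exp_cauchy_term_eq[OF x y comm])
  finally show ?case by simp
qed

lemma Cauchy_product_partial_sums:
  fixes a b :: "nat \<Rightarrow> real"
  shows "(\<Sum>i\<le>N. a i * (\<Sum>j\<le>N - i. b j)) = (\<Sum>n\<le>N. \<Sum>i\<le>n. a i * b (n - i))"
proof (induction N)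
  case (Suc N)
  have "(\<Sum>i\<le>Suc N. a i * (\<Sum>j\<le>Suc N - i. b j)) =
      (\<Sum>i\<le>N. a i * ((\<Sum>j\<le>N - i. b j) + b (Suc N - i))) + a (Suc N) * b 0"
    by (simp add: Suc_diff_le)
  thus ?case using Suc by (simp add: distrib_left sum.distrib)
qed simp

text \<open>The product of partial sums differs from the partial sum for \<open>x + y\<close> by terms of high total degree.
  Their seminorm is bounded by the same difference for the real exponential series, which tends to
  zero by the theorem on Cauchy products.\<close>

lemma alg_exp_add:
  assumes x: "x \<in> carrier V" and y: "y \<in> carrier V" and comm: "x \<otimes> y = y \<otimes> x"
  shows "alg_exp V (x \<oplus> y) = alg_exp V x \<otimes> alg_exp V y"
proof (rule converges_unique)
  have xy: "x \<oplus> y \<in> carrier V" using x y by simp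
  show "converges V (\<lambda>N. exp_sum x N \<otimes> exp_sum y N) (alg_exp V x \<otimes> alg_exp V y)"
    by (rule converges_mult[OF exp_sum_converges[OF x] exp_sum_converges[OF y]])
  have null: "converges V (\<lambda>N. exp_sum x N \<otimes> exp_sum y N \<ominus> exp_sum (x \<oplus> y) N) \<zero>"
  proof (rule convergesI)
    fix k
    define a where "a j = p k x ^ j / fact j" for j
    define b where "b j = p k y ^ j / fact j" for j
    have maj: "exp_majorant x k N = (\<Sum>j\<le>N. a j)" "exp_majorant y k N = (\<Sum>j\<le>N. b j)" for N
      by (simp_all add: exp_majorant_def a_def b_def)
    have nn: "0 \<le> a j" for j using x by (simp add: a_def)
    have nnb: "0 \<le> b j" for j using y by (simp add: b_def)
    have le: "p k (exp_sum x N \<otimes> exp_sum y N \<ominus> exp_sum (x \<oplus> y) N) \<le> p k \<one> * p k \<one> *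
        (exp_majorant x k N * exp_majorant y k N - (\<Sum>n\<le>N. \<Sum>i\<le>n. a i * b (n - i)))" for N
    proof -
      have c1: "(\<lambda>i. exp_term x i \<otimes> exp_sum y (N - i)) \<in> {..N} \<rightarrow> carrier V"
        and c2: "(\<lambda>i. exp_term x i \<otimes> (exp_sum y N \<ominus> exp_sum y (N - i))) \<in> {..N} \<rightarrow> carrier V"
        using x y by auto
      have "exp_sum x N \<otimes> exp_sum y N = (\<Oplus>i\<in>{..N}. exp_term x i \<otimes> exp_sum y N)"
        unfolding exp_sum_def[of x] using x y by (intro finsum_ldistr) auto
      also have "\<dots> = (\<Oplus>i\<in>{..N}. exp_term x i \<otimes> exp_sum y (N - i) \<oplus>
          exp_term x i \<otimes> (exp_sum y N \<ominus> exp_sum y (N - i)))"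
      proof (rule M.finsum_cong')
        fix i
        show "exp_term x i \<otimes> exp_sum y N =
            exp_term x i \<otimes> exp_sum y (N - i) \<oplus> exp_term x i \<otimes> (exp_sum y N \<ominus> exp_sum y (N - i))"
          using x y by (simp add: r_distr[symmetric] add_minus_cancel)
      qed (use x y in auto)
      also have "\<dots> = exp_sum (x \<oplus> y) N \<oplus> (\<Oplus>i\<in>{..N}. exp_term x i \<otimes> (exp_sum y N \<ominus> exp_sum y (N - i)))"
        unfolding exp_sum_add[OF x y comm] by (rule M.finsum_addf[OF c1 c2])
      finally have "exp_sum x N \<otimes> exp_sum y N \<ominus> exp_sum (x \<oplus> y) N =
          (\<Oplus>i\<in>{..N}. exp_term x i \<otimes> (exp_sum y N \<ominus> exp_sum y (N - i)))"
        using add_diff_cancel_left'[OF exp_sum_carrier[OF xy] M.finsum_closed[OF c2]] by simp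
      hence "p k (exp_sum x N \<otimes> exp_sum y N \<ominus> exp_sum (x \<oplus> y) N) \<le>
          (\<Sum>i\<le>N. p k (exp_term x i \<otimes> (exp_sum y N \<ominus> exp_sum y (N - i))))"
        using p_finsum_le[OF finite_atMost c2] by simp
      also have "\<dots> \<le> (\<Sum>i\<le>N. p k \<one> * p k \<one> * (a i * (exp_majorant y k N - exp_majorant y k (N - i))))"
      proof (rule sum_mono)
        fix i assume "i \<in> {..N}"
        have "p k (exp_term x i \<otimes> (exp_sum y N \<ominus> exp_sum y (N - i))) \<le>
            p k (exp_term x i) * p k (exp_sum y N \<ominus> exp_sum y (N - i))"
          using x y by (intro p_mult) auto
        also have "\<dots> \<le> (p k \<one> * a i) * (p k \<one> * (exp_majorant y k N - exp_majorant y k (N - i)))"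
          using x y nn unfolding a_def
          by (intro mult_mono p_exp_term_le exp_sum_diff_le) auto
        finally show "p k (exp_term x i \<otimes> (exp_sum y N \<ominus> exp_sum y (N - i))) \<le>
            p k \<one> * p k \<one> * (a i * (exp_majorant y k N - exp_majorant y k (N - i)))" by (simp add: mult_ac)
      qed
      also have "\<dots> = p k \<one> * p k \<one> * (exp_majorant x k N * exp_majorant y k N - (\<Sum>i\<le>N. a i * exp_majorant y k (N - i)))"
        by (simp add: sum_distrib_left[symmetric] right_diff_distrib sum_subtractf sum_distrib_right maj(1))
      finally show ?thesis by (simp add: maj Cauchy_product_partial_sums)
    qed
    have lim: "(\<lambda>N. exp_majorant x k N * exp_majorant y k N - (\<Sum>n\<le>N. \<Sum>i\<le>n. a i * b (n - i))) \<longlonglongrightarrow> 0"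
    proof -
      have s: "a sums exp (p k x)" "b sums exp (p k y)"
        using exp_majorant_tendsto[of x k] exp_majorant_tendsto[of y k]
        unfolding sums_def_le exp_majorant_def[abs_def] a_def b_def .
      have "(\<lambda>n. \<Sum>i\<le>n. a i * b (n - i)) sums (suminf a * suminf b)"
        using s nn nnb by (intro Cauchy_product_sums) (auto dest: sums_summable)
      hence "(\<lambda>N. \<Sum>n\<le>N. \<Sum>i\<le>n. a i * b (n - i)) \<longlonglongrightarrow> exp (p k x) * exp (p k y)"
        using sums_unique[OF s(1)] sums_unique[OF s(2)] by (simp add: sums_def_le)
      from tendsto_diff[OF tendsto_mult[OF exp_majorant_tendsto[of x k] exp_majorant_tendsto[of y k]] this]
      show ?thesis by simp
    qed
    show "(\<lambda>N. p k (exp_sum x N \<otimes> exp_sum y N \<ominus> exp_sum (x \<oplus> y) N \<ominus> \<zero>)) \<longlonglongrightarrow> 0"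
    proof (rule tendsto_zero_le)
      show "(\<lambda>N. p k \<one> * p k \<one> * (exp_majorant x k N * exp_majorant y k N - (\<Sum>n\<le>N. \<Sum>i\<le>n. a i * b (n - i)))) \<longlonglongrightarrow> 0"
        using tendsto_mult_left[OF lim] by simp
      show "p k (exp_sum x N \<otimes> exp_sum y N \<ominus> exp_sum (x \<oplus> y) N \<ominus> \<zero>) \<le> p k \<one> * p k \<one> *
        (exp_majorant x k N * exp_majorant y k N - (\<Sum>n\<le>N. \<Sum>i\<le>n. a i * b (n - i)))" for N
        using le[of N] x y by simp
    qed (use x y in simp)
  qed (use x y in auto)
  have "converges V (\<lambda>N. exp_sum (x \<oplus> y) N \<oplus> (exp_sum x N \<otimes> exp_sum y N \<ominus> exp_sum (x \<oplus> y) N)) (alg_exp V (x \<oplus> y) \<oplus> \<zero>)"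
    by (rule converges_add[OF exp_sum_converges[OF xy] null])
  moreover have "exp_sum (x \<oplus> y) N \<oplus> (exp_sum x N \<otimes> exp_sum y N \<ominus> exp_sum (x \<oplus> y) N) = exp_sum x N \<otimes> exp_sum y N" for N
    using x y by (intro add_minus_cancel) auto
  ultimately show "converges V (\<lambda>N. exp_sum x N \<otimes> exp_sum y N) (alg_exp V (x \<oplus> y))" using xy by simp
qed

end

text \<open>Only powers have to be preserved, so this covers homomorphisms and antihomomorphisms alike.\<close>

lemma alg_exp_cont_linear:
  assumes A: "complete_algebra A p" and B: "complete_algebra B q" and f: "cont_linear A B f"
    and x: "x \<in> carrier A" and pow: "\<And>k::nat. f (x [^]\<^bsub>A\<^esub> k) = f x [^]\<^bsub>B\<^esub> k"
  shows "f (alg_exp A x) = alg_exp B (f x)"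
proof -
  interpret A: complete_algebra A p by fact
  interpret B: complete_algebra B q by fact
  have lf: "linear_on A B f" using f by (simp add: cont_linear_iff)
  have fx: "f x \<in> carrier B" by (rule linear_onD(1)[OF lf x])
  have t: "f (A.exp_term x k) = B.exp_term (f x) k" for k
    unfolding A.exp_term_def B.exp_term_def using linear_onD(3)[OF lf A.nat_pow_closed[OF x]] pow by simp
  have s: "f (A.exp_sum x N) = B.exp_sum (f x) N" for N
    by (induction N) (simp_all add: x fx A.exp_sum_0 B.exp_sum_0 A.exp_sum_Suc B.exp_sum_Suc t linear_onD(2)[OF lf])
  show ?thesis
    using B.converges_unique[OF cont_linear_converges[OF f A.exp_sum_converges[OF x]]]
      B.exp_sum_converges[OF fx] unfolding s by simp
qed

lemma alg_exp_hom:
  assumes A: "complete_algebra A p" and B: "complete_algebra B q" and f: "cont_hom A B f" and x: "x \<in> carrier A"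
  shows "f (alg_exp A x) = alg_exp B (f x)"
proof -
  interpret A: complete_algebra A p by fact
  interpret B: complete_algebra B q by fact
  have "f (x [^]\<^bsub>A\<^esub> k) = f x [^]\<^bsub>B\<^esub> k" for k :: nat
    by (induction k) (simp_all add: cont_homD(4,5)[OF f] x)
  thus ?thesis by (rule alg_exp_cont_linear[OF A B cont_homD(1)[OF f] x])
qed

lemma alg_exp_complex:
  assumes C: "complete_algebra complex_talg q" shows "alg_exp complex_talg z = exp z"
proof -
  interpret C: complete_algebra complex_talg q by fact
  have pow: "z [^]\<^bsub>complex_talg\<^esub> (k::nat) = z ^ k" for k by (induction k) (simp_all add: mult.commute)
  have s: "C.exp_sum z N = (\<Sum>k\<le>N. z ^ k / fact k)" for N
    by (induction N) (simp_all add: C.exp_sum_0 C.exp_sum_Suc C.exp_term_def pow del: C.nat_pow_Suc)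
  have "(\<lambda>n. z ^ n / fact n) sums exp z"
    using exp_converges[of z] by (simp add: scaleR_conv_of_real divide_inverse mult.commute)
  hence "C.exp_sum z \<longlonglongrightarrow> exp z" unfolding sums_def_le s[abs_def] .
  hence "converges complex_talg (C.exp_sum z) (exp z)" by (simp add: converges_def)
  thus ?thesis using C.converges_unique C.exp_sum_converges[of z] by simp
qed

section \<open>Opposite algebras\<close>

text \<open>Antihomomorphisms are homomorphisms into the opposite algebra; thus the universal property also
  produces the antipode.\<close>

definition opposite :: "'a talg \<Rightarrow> 'a talg" where
  "opposite A = A\<lparr>mult := \<lambda>x y. y \<otimes>\<^bsub>A\<^esub> x\<rparr>"

lemma opposite_simps [simp]:
  "carrier (opposite A) = carrier A" "mult (opposite A) = (\<lambda>x y. y \<otimes>\<^bsub>A\<^esub> x)"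
  "one (opposite A) = one A" "zero (opposite A) = zero A" "add (opposite A) = add A"
  "smult (opposite A) = smult A" "topo (opposite A) = topo A"
  by (simp_all add: opposite_def)

lemma a_minus_opposite [simp]: "a_minus (opposite A) = a_minus A" "a_inv (opposite A) = a_inv A"
  by (simp_all add: a_minus_def a_inv_def m_inv_def fun_eq_iff)

lemma complete_algebra_opposite:
  assumes "complete_algebra A p" shows "complete_algebra (opposite A) p"
proof -
  interpret A: complete_algebra A p by fact
  have v: "vspace (opposite A)"
    by (rule vspace_image[OF A.vspace_axioms, of "\<lambda>x. x"]) simp_all
  interpret v: vspace "opposite A" by (rule v)
  interpret s: seminormed_space "opposite A" p
  proof (intro seminormed_space.intro v seminormed_space_axioms.intro)
    show "seminorm (opposite A) (p k)" for k using A.seminorm_p[of k] by (simp add: seminorm_def)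
    show "topo (opposite A) = lc_topology (opposite A) (range p)" by (simp add: A.topo_eq lc_topology_def)
  qed (simp add: A.p_Suc)
  have conv: "converges (opposite A) s l = converges A s l" for s l by (simp add: converges_def)
  have "cauchy_seq (opposite A) s = cauchy_seq A s" for s by (simp add: cauchy_seq_def)
  hence c: "complete_space (opposite A) p"
    using A.separated A.complete
    by (intro complete_space.intro complete_space_axioms.intro s.seminormed_space_axioms) (simp_all add: conv)
  have "calgebra (opposite A)"
    by (intro calgebra.intro v calgebra_axioms.intro ringI v.M.abelian_group_axioms monoidI)
       (simp_all add: A.m_assoc A.l_distr A.r_distr A.scale_mult_left A.scale_mult_right)
  moreover have "p k (y \<otimes>\<^bsub>A\<^esub> x) \<le> p k x * p k y" if "x \<in> carrier A" "y \<in> carrier A" for x y k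
    using A.p_mult[of y x k] that by (simp add: mult.commute)
  ultimately show ?thesis
    using c s.seminormed_space_axioms
    by (intro complete_algebra.intro seminormed_algebra.intro seminormed_algebra_axioms.intro) simp_all
qed

lemma cont_antihom_iff: "cont_antihom A B f \<longleftrightarrow> cont_hom A (opposite B) f"
  by (auto simp: cont_antihom_def cont_hom_def cont_linear_def ring_hom_def)

lemma alg_exp_opposite:
  assumes A: "complete_algebra A p" and x: "x \<in> carrier A"
  shows "alg_exp (opposite A) x = alg_exp A x"
proof -
  interpret A: complete_algebra A p by fact
  interpret O: complete_algebra "opposite A" p by (rule complete_algebra_opposite[OF A])
  have "x [^]\<^bsub>A\<^esub> k = x [^]\<^bsub>opposite A\<^esub> k" for k :: nat
  proof (induction k)
    case (Suc k)
    have "x [^]\<^bsub>A\<^esub> Suc k = x \<otimes>\<^bsub>A\<^esub> x [^]\<^bsub>A\<^esub> k" by (rule A.nat_pow_Suc2[OF x])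
    thus ?case using Suc.IH by simp
  qed simp
  moreover have "cont_linear A (opposite A) (\<lambda>x. x)" by (simp add: cont_linear_def continuous_map_id[unfolded id_def])
  ultimately show ?thesis
    using alg_exp_cont_linear[OF A O.complete_algebra_axioms, of "\<lambda>x. x" x] x by simp
qed

section \<open>Triples satisfying the defining relations\<close>

text \<open>The defining relations, with commutators written as reordering rules and the hyperbolic sine as a
  difference of exponentials.\<close>

definition sl2_triple :: "complex \<Rightarrow> 'a talg \<Rightarrow> 'a \<Rightarrow> 'a \<Rightarrow> 'a \<Rightarrow> bool" where
  "sl2_triple h B e f t \<longleftrightarrow> e \<in> carrier B \<and> f \<in> carrier B \<and> t \<in> carrier B \<and>
    t \<otimes>\<^bsub>B\<^esub> e = e \<otimes>\<^bsub>B\<^esub> t \<oplus>\<^bsub>B\<^esub> 2 \<odot>\<^bsub>B\<^esub> e \<and>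
    t \<otimes>\<^bsub>B\<^esub> f = f \<otimes>\<^bsub>B\<^esub> t \<oplus>\<^bsub>B\<^esub> (-2) \<odot>\<^bsub>B\<^esub> f \<and>
    e \<otimes>\<^bsub>B\<^esub> f = f \<otimes>\<^bsub>B\<^esub> e \<oplus>\<^bsub>B\<^esub> (1 / (2 * sinh h)) \<odot>\<^bsub>B\<^esub>
      (alg_exp B (h \<odot>\<^bsub>B\<^esub> t) \<ominus>\<^bsub>B\<^esub> alg_exp B ((- h) \<odot>\<^bsub>B\<^esub> t))"

lemma (in vspace) minus_minus_eq_zero_iff:
  assumes "x \<in> carrier V" "y \<in> carrier V" "z \<in> carrier V"
  shows "(x \<ominus> y) \<ominus> z = \<zero> \<longleftrightarrow> x = y \<oplus> z"
proof
  assume "(x \<ominus> y) \<ominus> z = \<zero>"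
  hence "x \<ominus> y = z" using minus_eq_zeroD[of "x \<ominus> y" z] assms by simp
  thus "x = y \<oplus> z" using add_minus_cancel[OF assms(1,2)] by simp
next
  assume "x = y \<oplus> z"
  thus "(x \<ominus> y) \<ominus> z = \<zero>" using add_diff_cancel_left'[OF assms(2,3)] assms(3) by simp
qed

lemma cont_hom_minus:
  assumes "complete_algebra A p" "complete_algebra B q" "cont_hom A B f" "x \<in> carrier A" "y \<in> carrier A"
  shows "f (x \<ominus>\<^bsub>A\<^esub> y) = f x \<ominus>\<^bsub>B\<^esub> f y"
proof -
  interpret A: complete_algebra A p by fact
  interpret B: complete_algebra B q by fact
  show ?thesis by (rule linear_on_minus[OF cont_homD(2)[OF assms(3)] A.vspace_axioms B.vspace_axioms assms(4,5)])
qed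

lemma free_gen_carrier_3:
  "free_gen 0 \<in> carrier (free_entire 3)" "free_gen (Suc 0) \<in> carrier (free_entire 3)" "free_gen 2 \<in> carrier (free_entire 3)"
  by (simp_all add: free_gen_carrier)

lemma (in complete_algebra) alg_sinh_scale:
  "t \<in> carrier V \<Longrightarrow> alg_sinh V (h \<odot> t) = (1 / 2) \<odot> (alg_exp V (h \<odot> t) \<ominus> alg_exp V ((- h) \<odot> t))"
  by (simp add: alg_sinh_def uminus_eq_scale scale_scale)

text \<open>Continuous homomorphisms commute with exponentials, so the relation that involves the hyperbolic
  sine can be transported. Applied to the projection this gives the relations between the generators
  of the quotient; applied to evaluations it gives the universal property.\<close>

lemma usl2_relations_killed_iff:
  assumes B: "complete_algebra B q" and f: "cont_hom (free_entire 3) B f"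
  shows "(\<forall>r\<in>usl2_relations h. f r = \<zero>\<^bsub>B\<^esub>) \<longleftrightarrow>
    sl2_triple h B (f (free_gen 0)) (f (free_gen 1)) (f (free_gen 2))"
    and "usl2_relations h \<subseteq> carrier (free_entire 3)"
proof -
  let ?A = "free_entire 3"
  interpret A: complete_algebra ?A fe_norm by (rule complete_algebra_free_entire)
  interpret B: complete_algebra B q by fact
  note minus = cont_hom_minus[OF A.complete_algebra_axioms B f]
  note hom = cont_homD(3,4,7)[OF f] minus
  let ?E = "free_gen 0" and ?F = "free_gen (Suc 0)" and ?H = "free_gen 2"
  note g = free_gen_carrier_3
  define s where "s = alg_sinh ?A (h \<odot>\<^bsub>?A\<^esub> ?H)"
  have sc: "s \<in> carrier ?A" using g by (simp add: s_def A.alg_sinh_scale)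
  have fs: "f s = (1 / 2) \<odot>\<^bsub>B\<^esub> (alg_exp B (h \<odot>\<^bsub>B\<^esub> f ?H) \<ominus>\<^bsub>B\<^esub> alg_exp B ((- h) \<odot>\<^bsub>B\<^esub> f ?H))"
    unfolding s_def A.alg_sinh_scale[OF g(3)] using g(3)
    by (simp add: hom alg_exp_hom[OF A.complete_algebra_axioms B f])
  have rel: "usl2_relations h =
      {(?H \<otimes>\<^bsub>?A\<^esub> ?E \<ominus>\<^bsub>?A\<^esub> ?E \<otimes>\<^bsub>?A\<^esub> ?H) \<ominus>\<^bsub>?A\<^esub> 2 \<odot>\<^bsub>?A\<^esub> ?E,
       (?H \<otimes>\<^bsub>?A\<^esub> ?F \<ominus>\<^bsub>?A\<^esub> ?F \<otimes>\<^bsub>?A\<^esub> ?H) \<ominus>\<^bsub>?A\<^esub> (-2) \<odot>\<^bsub>?A\<^esub> ?F,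
       (?E \<otimes>\<^bsub>?A\<^esub> ?F \<ominus>\<^bsub>?A\<^esub> ?F \<otimes>\<^bsub>?A\<^esub> ?E) \<ominus>\<^bsub>?A\<^esub> (1 / sinh h) \<odot>\<^bsub>?A\<^esub> s}"
    by (simp add: usl2_relations_def Let_def s_def)
  show "usl2_relations h \<subseteq> carrier ?A"
    unfolding rel using g sc by simp
  have 1: "f ((?H \<otimes>\<^bsub>?A\<^esub> ?E \<ominus>\<^bsub>?A\<^esub> ?E \<otimes>\<^bsub>?A\<^esub> ?H) \<ominus>\<^bsub>?A\<^esub> 2 \<odot>\<^bsub>?A\<^esub> ?E) = \<zero>\<^bsub>B\<^esub> \<longleftrightarrow>
      f ?H \<otimes>\<^bsub>B\<^esub> f ?E = f ?E \<otimes>\<^bsub>B\<^esub> f ?H \<oplus>\<^bsub>B\<^esub> 2 \<odot>\<^bsub>B\<^esub> f ?E"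
    using g by (simp add: hom B.minus_minus_eq_zero_iff)
  have 2: "f ((?H \<otimes>\<^bsub>?A\<^esub> ?F \<ominus>\<^bsub>?A\<^esub> ?F \<otimes>\<^bsub>?A\<^esub> ?H) \<ominus>\<^bsub>?A\<^esub> (-2) \<odot>\<^bsub>?A\<^esub> ?F) = \<zero>\<^bsub>B\<^esub> \<longleftrightarrow>
      f ?H \<otimes>\<^bsub>B\<^esub> f ?F = f ?F \<otimes>\<^bsub>B\<^esub> f ?H \<oplus>\<^bsub>B\<^esub> (-2) \<odot>\<^bsub>B\<^esub> f ?F"
    using g by (simp add: hom B.minus_minus_eq_zero_iff)
  have 3: "f ((?E \<otimes>\<^bsub>?A\<^esub> ?F \<ominus>\<^bsub>?A\<^esub> ?F \<otimes>\<^bsub>?A\<^esub> ?E) \<ominus>\<^bsub>?A\<^esub> (1 / sinh h) \<odot>\<^bsub>?A\<^esub> s) = \<zero>\<^bsub>B\<^esub> \<longleftrightarrow>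
      f ?E \<otimes>\<^bsub>B\<^esub> f ?F = f ?F \<otimes>\<^bsub>B\<^esub> f ?E \<oplus>\<^bsub>B\<^esub> (1 / sinh h) \<odot>\<^bsub>B\<^esub> f s"
    using g sc by (simp add: hom B.minus_minus_eq_zero_iff)
  have 4: "(1 / sinh h) \<odot>\<^bsub>B\<^esub> f s = (1 / (2 * sinh h)) \<odot>\<^bsub>B\<^esub>
      (alg_exp B (h \<odot>\<^bsub>B\<^esub> f ?H) \<ominus>\<^bsub>B\<^esub> alg_exp B ((- h) \<odot>\<^bsub>B\<^esub> f ?H))"
    unfolding fs using hom(1)[OF g(3)] by (simp add: B.scale_scale mult.commute)
  show "(\<forall>r\<in>usl2_relations h. f r = \<zero>\<^bsub>B\<^esub>) \<longleftrightarrow> sl2_triple h B (f ?E) (f (free_gen 1)) (f ?H)"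
    unfolding rel sl2_triple_def ball_simps 1 2 3 4 One_nat_def using hom(1) g by simp
qed

lemma usl2_presentation: "hfg_presentation 3 (usl2_relations h)"
proof
  show "usl2_relations h \<subseteq> carrier (free_entire 3)"
    by (rule usl2_relations_killed_iff(2)[OF complete_algebra_free_entire cont_hom_id])
qed

definition usl2_norm :: "complex \<Rightarrow> nat \<Rightarrow> (nat list \<Rightarrow> complex) set \<Rightarrow> real" where
  "usl2_norm h = universal_norm 3 (usl2_relations h)"

lemma complete_algebra_usl2: "complete_algebra (usl2 h) (usl2_norm h)"
  unfolding usl2_def usl2_norm_def by (rule hfg_presentation.complete_algebra_U[OF usl2_presentation])

lemma hfg_usl2: "hfg (usl2 h)"
  unfolding usl2_def by (rule hfg_presentation.hfg_U[OF usl2_presentation])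

lemma usl2_generates: "generates (usl2 h) {usl2_E h, usl2_F h, usl2_H h}"
proof -
  have "{..<3} = {0, 1, 2 :: nat}" by auto
  thus ?thesis
    using hfg_presentation.generates_U[OF usl2_presentation[of h]]
    by (simp add: usl2_def usl2_E_def usl2_F_def usl2_H_def)
qed

lemma usl2_triple: "sl2_triple h (usl2 h) (usl2_E h) (usl2_F h) (usl2_H h)"
proof -
  interpret hfg_presentation 3 "usl2_relations h" by (rule usl2_presentation)
  have "\<forall>r\<in>usl2_relations h. proj r = \<zero>\<^bsub>U\<^esub>" using proj_relation by blast
  thus ?thesis
    using usl2_relations_killed_iff(1)[OF complete_algebra_U cont_hom_U_proj, of h]
    by (simp add: usl2_def usl2_E_def usl2_F_def usl2_H_def universal_hfg_gen_def)
qed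

lemma cont_hom_cong:
  assumes "complete_algebra A p" "cont_hom A B f" "\<And>x. x \<in> carrier A \<Longrightarrow> f x = g x"
  shows "cont_hom A B g"
proof -
  interpret A: complete_algebra A p by fact
  have "cont_linear A B g"
    by (rule cont_linear_cong[OF A.seminormed_space_axioms cont_homD(1)[OF assms(2)] assms(3)])
  moreover have "g \<in> ring_hom A B"
    using assms(2) A.M.a_closed A.m_closed A.one_closed
    unfolding cont_hom_def ring_hom_def Pi_iff by (simp add: assms(3)[symmetric])
  ultimately show ?thesis by (simp add: cont_hom_def)
qed

lemma usl2_hom_eqI:
  assumes "complete_algebra B q" "cont_hom (usl2 h) B f" "cont_hom (usl2 h) B g"
    "f (usl2_E h) = g (usl2_E h)" "f (usl2_F h) = g (usl2_F h)" "f (usl2_H h) = g (usl2_H h)"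
    "x \<in> carrier (usl2 h)"
  shows "f x = g x"
proof -
  interpret U: complete_algebra "usl2 h" "usl2_norm h" by (rule complete_algebra_usl2)
  show ?thesis
    by (rule cont_hom_eq_on_generators[OF U.seminormed_algebra_axioms assms(1-3) usl2_generates _ assms(7)])
       (use assms(4-6) in auto)
qed

lemma usl2_hom_ex1:
  assumes B: "complete_algebra B q" and tr: "sl2_triple h B e f t"
  shows "\<exists>!\<phi>. \<phi> \<in> extensional (carrier (usl2 h)) \<and> cont_hom (usl2 h) B \<phi> \<and>
    \<phi> (usl2_E h) = e \<and> \<phi> (usl2_F h) = f \<and> \<phi> (usl2_H h) = t"
proof -
  interpret hfg_presentation 3 "usl2_relations h" by (rule usl2_presentation)
  define b where "b i = (if i = 0 then e else if i = 1 then f else t)" for i :: nat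
  have bc: "b i \<in> carrier B" for i using tr by (simp add: b_def sl2_triple_def)
  have rel: "g r = \<zero>\<^bsub>B\<^esub>"
    if g: "cont_hom (free_entire 3) B g" "\<And>i. i < 3 \<Longrightarrow> g (free_gen i) = b i" and r: "r \<in> usl2_relations h" for g r
  proof -
    have "g (free_gen 0) = e" "g (free_gen 1) = f" "g (free_gen 2) = t" using g(2) by (simp_all add: b_def)
    thus ?thesis using usl2_relations_killed_iff(1)[OF B g(1), of h] tr r by simp
  qed
  obtain \<phi> where \<phi>: "cont_hom U B \<phi>" "\<And>i. i < 3 \<Longrightarrow> \<phi> (universal_hfg_gen 3 (usl2_relations h) i) = b i"
  proof (rule universal_lift[where b = b, OF B])
    show "b i \<in> carrier B" for i by (rule bc)
    show "g r = \<zero>\<^bsub>B\<^esub>" if "cont_hom (free_entire 3) B g" "\<And>i. i < 3 \<Longrightarrow> g (free_gen i) = b i" "r \<in> usl2_relations h" for g r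
      by (rule rel[OF that])
  qed (rule that)
  have v: "\<phi> (usl2_E h) = e" "\<phi> (usl2_F h) = f" "\<phi> (usl2_H h) = t"
    using \<phi>(2)[of 0] \<phi>(2)[of 1] \<phi>(2)[of 2] by (simp_all add: b_def usl2_E_def usl2_F_def usl2_H_def)
  have gens: "usl2_E h \<in> carrier (usl2 h)" "usl2_F h \<in> carrier (usl2 h)" "usl2_H h \<in> carrier (usl2 h)"
    using usl2_triple[of h] by (auto simp: sl2_triple_def)
  have h\<phi>: "cont_hom (usl2 h) B \<phi>" using \<phi>(1) by (simp add: usl2_def)
  show ?thesis
  proof (rule ex1I)
    let ?r = "restrict \<phi> (carrier (usl2 h))"
    have "cont_hom (usl2 h) B ?r" by (rule cont_hom_cong[OF complete_algebra_usl2 h\<phi>]) simp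
    thus "?r \<in> extensional (carrier (usl2 h)) \<and> cont_hom (usl2 h) B ?r \<and>
        ?r (usl2_E h) = e \<and> ?r (usl2_F h) = f \<and> ?r (usl2_H h) = t"
      using gens v by simp
    fix \<psi> assume \<psi>: "\<psi> \<in> extensional (carrier (usl2 h)) \<and> cont_hom (usl2 h) B \<psi> \<and>
        \<psi> (usl2_E h) = e \<and> \<psi> (usl2_F h) = f \<and> \<psi> (usl2_H h) = t"
    show "\<psi> = ?r"
    proof (rule extensionalityI[where A = "carrier (usl2 h)"])
      fix x assume x: "x \<in> carrier (usl2 h)"
      have "\<psi> x = \<phi> x" by (rule usl2_hom_eqI[OF B _ h\<phi> _ _ _ x]) (use \<psi> v in auto)
      thus "\<psi> x = ?r x" using x by simp
    qed (use \<psi> in auto)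
  qed
qed

section \<open>Consequences of the relations\<close>

lemma (in complete_algebra) cont_hom_scalar: "cont_hom complex_talg V (\<lambda>c. c \<odot> \<one>)"
proof -
  interpret C: complete_algebra complex_talg "\<lambda>k. cmod" by (rule complete_algebra_complex)
  have "cont_linear complex_talg V (\<lambda>c. c \<odot> \<one>)"
  proof (rule cont_linearI[OF C.seminormed_space_axioms seminormed_space_axioms])
    show "linear_on complex_talg V (\<lambda>c. c \<odot> \<one>)"
      by (auto simp: linear_on_def scale_left_distrib scale_scale)
    show "\<exists>(j::nat) C. \<forall>x\<in>carrier complex_talg. p k (x \<odot> \<one>) \<le> C * cmod x" for k
      by (intro exI[of _ k] exI[of _ "p k \<one>"]) (auto simp: p_scale mult.commute)
  qed
  thus ?thesis
    by (auto simp: cont_hom_def ring_hom_def scale_left_distrib scale_mult_left scale_mult_right scale_scale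
        mult.commute)
qed

lemma (in complete_algebra) alg_exp_scalar: "alg_exp V (c \<odot> \<one>) = exp c \<odot> \<one>"
  using alg_exp_hom[OF complete_algebra_complex complete_algebra_axioms cont_hom_scalar, of c]
    alg_exp_complex[OF complete_algebra_complex, of c] by simp

lemma (in complete_algebra) alg_exp_zero: "alg_exp V \<zero> = \<one>"
  using alg_exp_scalar[of 0] by simp

text \<open>Moving \<open>z\<close> to the left of \<open>t\<close> replaces \<open>t\<close> by \<open>t + w\<close>, and the exponential turns the shift into a
  scalar factor.\<close>

lemma (in complete_algebra) alg_exp_weight:
  assumes t: "t \<in> carrier V" and z: "z \<in> carrier V" and w: "t \<otimes> z = z \<otimes> t \<oplus> w \<odot> z"
  shows "alg_exp V (c \<odot> t) \<otimes> z = exp (c * w) \<odot> (z \<otimes> alg_exp V (c \<odot> t))"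
proof -
  have s: "(c * w) \<odot> \<one> \<in> carrier V" "c \<odot> t \<in> carrier V" using t by auto
  have "alg_exp V (c \<odot> t) \<otimes> z = z \<otimes> alg_exp V (c \<odot> t \<oplus> (c * w) \<odot> \<one>)"
  proof (rule alg_exp_intertwine)
    show "c \<odot> t \<otimes> z = z \<otimes> (c \<odot> t \<oplus> (c * w) \<odot> \<one>)"
      using t z by (simp add: scale_mult_left scale_mult_right w r_distr scale_right_distrib scale_scale)
  qed (use t z in auto)
  also have "alg_exp V (c \<odot> t \<oplus> (c * w) \<odot> \<one>) = alg_exp V (c \<odot> t) \<otimes> (exp (c * w) \<odot> \<one>)"
  proof -
    have "(c \<odot> t) \<otimes> ((c * w) \<odot> \<one>) = ((c * w) \<odot> \<one>) \<otimes> (c \<odot> t)"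
      using t by (simp add: scale_mult_left scale_mult_right scale_scale mult_ac)
    thus ?thesis using alg_exp_add[OF s(2,1)] by (simp only: alg_exp_scalar)
  qed
  also have "z \<otimes> \<dots> = exp (c * w) \<odot> (z \<otimes> alg_exp V (c \<odot> t))"
    using t z by (simp add: scale_mult_right)
  finally show ?thesis .
qed

locale sl2_algebra = complete_algebra B q for B :: "'a talg" (structure) and q +
  fixes h :: complex and e f t :: 'a
  assumes triple: "sl2_triple h B e f t"
begin

definition "K = alg_exp B (h \<odot> t)"
definition "L = alg_exp B ((- h) \<odot> t)"
definition "\<gamma> = 1 / (2 * sinh h)"

lemma carriers [simp]: "e \<in> carrier B" "f \<in> carrier B" "t \<in> carrier B" "K \<in> carrier B" "L \<in> carrier B"
  using triple by (auto simp: sl2_triple_def K_def L_def)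

lemma te: "t \<otimes> e = e \<otimes> t \<oplus> 2 \<odot> e"
  and tf: "t \<otimes> f = f \<otimes> t \<oplus> (-2) \<odot> f"
  and ef: "e \<otimes> f = f \<otimes> e \<oplus> \<gamma> \<odot> (K \<ominus> L)"
  using triple by (auto simp: sl2_triple_def K_def L_def \<gamma>_def)

lemma KL: "K \<otimes> L = \<one>" and LK: "L \<otimes> K = \<one>"
proof -
  have z: "h \<odot> t \<oplus> (- h) \<odot> t = \<zero>" "(- h) \<odot> t \<oplus> h \<odot> t = \<zero>"
    by (simp_all add: scale_left_distrib[symmetric])
  have c: "(h \<odot> t) \<otimes> ((- h) \<odot> t) = ((- h) \<odot> t) \<otimes> (h \<odot> t)" by (simp add: scale_mult_left scale_mult_right scale_scale)
  show "K \<otimes> L = \<one>" unfolding K_def L_def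
    using alg_exp_add[of "h \<odot> t" "(- h) \<odot> t", OF _ _ c] z by (simp add: alg_exp_zero)
  show "L \<otimes> K = \<one>" unfolding K_def L_def
    using alg_exp_add[of "(- h) \<odot> t" "h \<odot> t", OF _ _ c[symmetric]] z by (simp add: alg_exp_zero)
qed

lemma Ke: "K \<otimes> e = exp (2 * h) \<odot> (e \<otimes> K)"
  and Kf: "K \<otimes> f = exp (- 2 * h) \<odot> (f \<otimes> K)"
  and Le: "L \<otimes> e = exp (- 2 * h) \<odot> (e \<otimes> L)"
  unfolding K_def L_def
  using alg_exp_weight[OF carriers(3) carriers(1) te, of h] alg_exp_weight[OF carriers(3) carriers(2) tf, of h]
    alg_exp_weight[OF carriers(3) carriers(1) te, of "- h"]
  by (simp_all add: mult.commute)

lemma tK: "t \<otimes> K = K \<otimes> t" and tL: "t \<otimes> L = L \<otimes> t"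
  unfolding K_def L_def
  by (rule alg_exp_intertwine[symmetric]; simp add: scale_mult_left scale_mult_right)+

lemma exp_cancel: "exp (- 2 * h) * exp (2 * h) = 1"
  by (simp add: exp_add[symmetric])

lemma uminus_mult_uminus: "\<lbrakk>x \<in> carrier B; y \<in> carrier B\<rbrakk> \<Longrightarrow> \<ominus> x \<otimes> \<ominus> y = x \<otimes> y"
  by (simp add: l_minus r_minus)

text \<open>The triple that defines the antipode. In the product of the images of \<open>f\<close> and \<open>e\<close> the factors \<open>K\<close>
  and \<open>L\<close> cancel, because \<open>f e\<close> has weight zero; and the antipode exchanges \<open>K\<close> and \<open>L\<close>.\<close>

lemma opposite_triple: "sl2_triple h (opposite B) (\<ominus> (e \<otimes> L)) (\<ominus> (K \<otimes> f)) (\<ominus> t)"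
proof -
  have exps: "alg_exp (opposite B) (h \<odot> \<ominus> t) = L" "alg_exp (opposite B) ((- h) \<odot> \<ominus> t) = K"
    by (simp_all add: alg_exp_opposite[OF complete_algebra_axioms] uminus_eq_scale scale_scale K_def L_def)
  have 1: "e \<otimes> L \<otimes> t = t \<otimes> (e \<otimes> L) \<oplus> 2 \<odot> \<ominus> (e \<otimes> L)"
  proof -
    have "t \<otimes> (e \<otimes> L) = (e \<otimes> t \<oplus> 2 \<odot> e) \<otimes> L" by (simp add: m_assoc[symmetric] te)
    also have "\<dots> = e \<otimes> L \<otimes> t \<oplus> 2 \<odot> (e \<otimes> L)" by (simp add: l_distr m_assoc tL scale_mult_left)
    finally have "t \<otimes> (e \<otimes> L) \<oplus> 2 \<odot> \<ominus> (e \<otimes> L) = e \<otimes> L \<otimes> t \<oplus> (2 \<odot> (e \<otimes> L) \<oplus> (-2) \<odot> (e \<otimes> L))"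
      by (simp add: M.a_assoc uminus_eq_scale scale_scale)
    thus ?thesis by (simp add: scale_left_distrib[symmetric])
  qed
  have 2: "K \<otimes> f \<otimes> t = t \<otimes> (K \<otimes> f) \<oplus> (-2) \<odot> \<ominus> (K \<otimes> f)"
  proof -
    have "t \<otimes> (K \<otimes> f) = K \<otimes> (f \<otimes> t \<oplus> (-2) \<odot> f)" by (simp add: m_assoc[symmetric] tK) (simp add: m_assoc tf)
    also have "\<dots> = K \<otimes> f \<otimes> t \<oplus> (-2) \<odot> (K \<otimes> f)" by (simp add: r_distr m_assoc scale_mult_right)
    finally have "t \<otimes> (K \<otimes> f) \<oplus> (-2) \<odot> \<ominus> (K \<otimes> f) = K \<otimes> f \<otimes> t \<oplus> ((-2) \<odot> (K \<otimes> f) \<oplus> 2 \<odot> (K \<otimes> f))"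
      by (simp add: M.a_assoc uminus_eq_scale scale_scale)
    thus ?thesis by (simp add: scale_left_distrib[symmetric])
  qed
  have 3: "(K \<otimes> f) \<otimes> (e \<otimes> L) = f \<otimes> e"
  proof -
    have "(K \<otimes> f) \<otimes> (e \<otimes> L) = (K \<otimes> f) \<otimes> e \<otimes> L" by (simp add: m_assoc)
    also have "(K \<otimes> f) \<otimes> e = exp (- 2 * h) \<odot> (f \<otimes> (K \<otimes> e))" by (simp add: Kf scale_mult_left m_assoc)
    also have "\<dots> = (exp (- 2 * h) * exp (2 * h)) \<odot> (f \<otimes> (e \<otimes> K))"
      unfolding Ke by (simp add: scale_mult_right scale_scale)
    also have "\<dots> = f \<otimes> e \<otimes> K" unfolding exp_cancel by (simp add: m_assoc)
    also have "f \<otimes> e \<otimes> K \<otimes> L = f \<otimes> e" by (simp add: m_assoc KL)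
    finally show ?thesis .
  qed
  have 4: "(e \<otimes> L) \<otimes> (K \<otimes> f) = e \<otimes> f"
  proof -
    have "(e \<otimes> L) \<otimes> (K \<otimes> f) = e \<otimes> ((L \<otimes> K) \<otimes> f)" by (simp add: m_assoc)
    thus ?thesis by (simp add: LK)
  qed
  have 5: "f \<otimes> e = e \<otimes> f \<oplus> \<gamma> \<odot> (L \<ominus> K)"
  proof -
    have "e \<otimes> f \<oplus> \<gamma> \<odot> (L \<ominus> K) = f \<otimes> e \<oplus> (\<gamma> \<odot> (K \<ominus> L) \<oplus> \<gamma> \<odot> (L \<ominus> K))"
      unfolding ef by (simp add: M.a_assoc)
    also have "\<gamma> \<odot> (K \<ominus> L) \<oplus> \<gamma> \<odot> (L \<ominus> K) = \<gamma> \<odot> (K \<ominus> K)"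
      by (subst diff_diff_eq_telescope[of K L K]) (simp_all add: scale_right_distrib del: minus_self)
    finally show ?thesis by simp
  qed
  show ?thesis
    unfolding sl2_triple_def opposite_simps a_minus_opposite exps
    by (simp add: uminus_mult_uminus 1 2 3 4 5[unfolded \<gamma>_def, symmetric])
qed

end

text \<open>Here \<open>te\<close>, \<open>tf\<close>, \<open>tt\<close> are the images of the generators under the comultiplication. The two algebras may
  differ.\<close>

locale sl2_pair = A: sl2_algebra A p h eA fA tA + B: sl2_algebra B q h eB fB tB
  for A :: "'a talg" and p and B :: "'b talg" and q and h and eA fA tA and eB fB tB
begin

sublocale ptensor_algebras A p B q ..

definition "te = pure eA B.K \<oplus>\<^bsub>P\<^esub> pure \<one>\<^bsub>A\<^esub> eB"
definition "tf = pure fA \<one>\<^bsub>B\<^esub> \<oplus>\<^bsub>P\<^esub> pure A.L fB"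
definition "tt = pure tA \<one>\<^bsub>B\<^esub> \<oplus>\<^bsub>P\<^esub> pure \<one>\<^bsub>A\<^esub> tB"

text \<open>The two summands of \<open>tt\<close> commute, so the exponential is multiplicative on them.\<close>

lemma exp_tt: "alg_exp P (c \<odot>\<^bsub>P\<^esub> tt) = pure (alg_exp A (c \<odot>\<^bsub>A\<^esub> tA)) (alg_exp B (c \<odot>\<^bsub>B\<^esub> tB))"
proof -
  have "c \<odot>\<^bsub>P\<^esub> tt = pure (c \<odot>\<^bsub>A\<^esub> tA) \<one>\<^bsub>B\<^esub> \<oplus>\<^bsub>P\<^esub> pure \<one>\<^bsub>A\<^esub> (c \<odot>\<^bsub>B\<^esub> tB)"
    by (simp add: tt_def P.scale_right_distrib pure_carrier pure_scale_left pure_scale_right)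
  moreover have "pure (c \<odot>\<^bsub>A\<^esub> tA) \<one>\<^bsub>B\<^esub> \<otimes>\<^bsub>P\<^esub> pure \<one>\<^bsub>A\<^esub> (c \<odot>\<^bsub>B\<^esub> tB) =
      pure \<one>\<^bsub>A\<^esub> (c \<odot>\<^bsub>B\<^esub> tB) \<otimes>\<^bsub>P\<^esub> pure (c \<odot>\<^bsub>A\<^esub> tA) \<one>\<^bsub>B\<^esub>"
    by (simp add: pure_mult)
  ultimately have "alg_exp P (c \<odot>\<^bsub>P\<^esub> tt) =
      alg_exp P (pure (c \<odot>\<^bsub>A\<^esub> tA) \<one>\<^bsub>B\<^esub>) \<otimes>\<^bsub>P\<^esub> alg_exp P (pure \<one>\<^bsub>A\<^esub> (c \<odot>\<^bsub>B\<^esub> tB))"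
    by (simp add: PA.alg_exp_add pure_carrier)
  also have "alg_exp P (pure (c \<odot>\<^bsub>A\<^esub> tA) \<one>\<^bsub>B\<^esub>) = pure (alg_exp A (c \<odot>\<^bsub>A\<^esub> tA)) \<one>\<^bsub>B\<^esub>"
    by (rule alg_exp_hom[OF A.complete_algebra_axioms PA.complete_algebra_axioms cont_hom_pure_left, symmetric]) simp
  also have "alg_exp P (pure \<one>\<^bsub>A\<^esub> (c \<odot>\<^bsub>B\<^esub> tB)) = pure \<one>\<^bsub>A\<^esub> (alg_exp B (c \<odot>\<^bsub>B\<^esub> tB))"
    by (rule alg_exp_hom[OF B.complete_algebra_axioms PA.complete_algebra_axioms cont_hom_pure_right, symmetric]) simp
  finally show ?thesis by (simp add: pure_mult)
qed

lemma telescope_sum: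
  assumes "a \<in> carrier P" "b \<in> carrier P" "c \<in> carrier P" "d \<in> carrier P"
    "u \<in> carrier P" "v \<in> carrier P" "w \<in> carrier P"
  shows "(a \<oplus>\<^bsub>P\<^esub> (u \<ominus>\<^bsub>P\<^esub> v)) \<oplus>\<^bsub>P\<^esub> b \<oplus>\<^bsub>P\<^esub> (c \<oplus>\<^bsub>P\<^esub> (d \<oplus>\<^bsub>P\<^esub> (v \<ominus>\<^bsub>P\<^esub> w))) =
    (a \<oplus>\<^bsub>P\<^esub> c) \<oplus>\<^bsub>P\<^esub> (b \<oplus>\<^bsub>P\<^esub> d) \<oplus>\<^bsub>P\<^esub> (u \<ominus>\<^bsub>P\<^esub> w)"
proof -
  have "u \<ominus>\<^bsub>P\<^esub> w = (u \<ominus>\<^bsub>P\<^esub> v) \<oplus>\<^bsub>P\<^esub> (v \<ominus>\<^bsub>P\<^esub> w)" by (rule P.diff_diff_eq_telescope) fact+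
  moreover have "u \<ominus>\<^bsub>P\<^esub> v \<in> carrier P" "v \<ominus>\<^bsub>P\<^esub> w \<in> carrier P" using assms by auto
  ultimately show ?thesis using assms by (simp only: P.M.a_ac P.M.a_closed)
qed

text \<open>In the last relation the mixed terms \<open>e L \<otimes> K f\<close> and \<open>L e \<otimes> f K\<close> agree, since the weights of \<open>e\<close>
  and \<open>f\<close> are opposite. What remains is \<open>(K - L) \<otimes> K + L \<otimes> (K - L)\<close>, which telescopes to
  \<open>K \<otimes> K - L \<otimes> L\<close>, the difference of the exponentials of \<open>h tt\<close> and \<open>- h tt\<close>.\<close>

lemma comult_triple: "sl2_triple h P te tf tt"
proof -
  have c: "te \<in> carrier P" "tf \<in> carrier P" "tt \<in> carrier P"
    by (simp_all add: te_def tf_def tt_def pure_carrier)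
  note ring = PA.l_distr PA.r_distr pure_mult pure_carrier
  note pures = pure_add_left pure_add_right pure_scale_left pure_scale_right
  have 1: "tt \<otimes>\<^bsub>P\<^esub> te = te \<otimes>\<^bsub>P\<^esub> tt \<oplus>\<^bsub>P\<^esub> 2 \<odot>\<^bsub>P\<^esub> te"
    unfolding te_def tt_def
    by (simp add: ring A.te B.te B.tK pures P.scale_right_distrib P.M.a_ac)
  have 2: "tt \<otimes>\<^bsub>P\<^esub> tf = tf \<otimes>\<^bsub>P\<^esub> tt \<oplus>\<^bsub>P\<^esub> (-2) \<odot>\<^bsub>P\<^esub> tf"
    unfolding tf_def tt_def
    by (simp add: ring A.tf B.tf A.tL pures P.scale_right_distrib P.M.a_ac)
  have 3: "te \<otimes>\<^bsub>P\<^esub> tf = tf \<otimes>\<^bsub>P\<^esub> te \<oplus>\<^bsub>P\<^esub> A.\<gamma> \<odot>\<^bsub>P\<^esub> (pure A.K B.K \<ominus>\<^bsub>P\<^esub> pure A.L B.L)"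
  proof -
    let ?a = "pure (fA \<otimes>\<^bsub>A\<^esub> eA) B.K" and ?b = "pure (eA \<otimes>\<^bsub>A\<^esub> A.L) (B.K \<otimes>\<^bsub>B\<^esub> fB)"
      and ?c = "pure fA eB" and ?d = "pure A.L (fB \<otimes>\<^bsub>B\<^esub> eB)"
    let ?u = "A.\<gamma> \<odot>\<^bsub>P\<^esub> pure A.K B.K" and ?v = "A.\<gamma> \<odot>\<^bsub>P\<^esub> pure A.L B.K" and ?w = "A.\<gamma> \<odot>\<^bsub>P\<^esub> pure A.L B.L"
    have minus: "pure (x \<ominus>\<^bsub>A\<^esub> x') y = pure x y \<ominus>\<^bsub>P\<^esub> pure x' y" "pure x (y \<ominus>\<^bsub>B\<^esub> y') = pure x y \<ominus>\<^bsub>P\<^esub> pure x y'"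
      if "x \<in> carrier A" "x' \<in> carrier A" "y \<in> carrier B" "y' \<in> carrier B" for x x' y y'
      using that linear_on_minus[OF pure_linear_left A.vspace_axioms P.vspace_axioms]
        linear_on_minus[OF pure_linear_right B.vspace_axioms P.vspace_axioms] by simp_all
    have efA: "pure (eA \<otimes>\<^bsub>A\<^esub> fA) B.K = ?a \<oplus>\<^bsub>P\<^esub> (?u \<ominus>\<^bsub>P\<^esub> ?v)"
      unfolding A.ef using minus(1)[of A.K A.L B.K B.K]
      by (simp add: pures P.scale_minus_distrib pure_carrier)
    have efB: "pure A.L (eB \<otimes>\<^bsub>B\<^esub> fB) = ?d \<oplus>\<^bsub>P\<^esub> (?v \<ominus>\<^bsub>P\<^esub> ?w)"
      unfolding B.ef using minus(2)[of A.L A.L B.K B.L]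
      by (simp add: pures P.scale_minus_distrib pure_carrier)
    have b: "pure (A.L \<otimes>\<^bsub>A\<^esub> eA) (fB \<otimes>\<^bsub>B\<^esub> B.K) = ?b"
      by (simp add: A.Le B.Kf pures)
    have "te \<otimes>\<^bsub>P\<^esub> tf = (?a \<oplus>\<^bsub>P\<^esub> (?u \<ominus>\<^bsub>P\<^esub> ?v)) \<oplus>\<^bsub>P\<^esub> ?b \<oplus>\<^bsub>P\<^esub> (?c \<oplus>\<^bsub>P\<^esub> (?d \<oplus>\<^bsub>P\<^esub> (?v \<ominus>\<^bsub>P\<^esub> ?w)))"
      unfolding efA[symmetric] efB[symmetric] te_def tf_def by (simp add: ring P.M.a_ac)
    also have "\<dots> = (?a \<oplus>\<^bsub>P\<^esub> ?c) \<oplus>\<^bsub>P\<^esub> (?b \<oplus>\<^bsub>P\<^esub> ?d) \<oplus>\<^bsub>P\<^esub> (?u \<ominus>\<^bsub>P\<^esub> ?w)"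
      by (rule telescope_sum) (simp_all add: pure_carrier)
    also have "(?a \<oplus>\<^bsub>P\<^esub> ?c) \<oplus>\<^bsub>P\<^esub> (?b \<oplus>\<^bsub>P\<^esub> ?d) = tf \<otimes>\<^bsub>P\<^esub> te"
      unfolding b[symmetric] te_def tf_def by (simp add: ring P.M.a_ac)
    also have "?u \<ominus>\<^bsub>P\<^esub> ?w = A.\<gamma> \<odot>\<^bsub>P\<^esub> (pure A.K B.K \<ominus>\<^bsub>P\<^esub> pure A.L B.L)"
      by (simp add: P.scale_minus_distrib pure_carrier)
    finally show ?thesis .
  qed
  show ?thesis
    unfolding sl2_triple_def exp_tt using c 1 2 3
    by (simp add: A.K_def A.L_def B.K_def B.L_def A.\<gamma>_def)
qed

end

section \<open>The Hopf algebra structure\<close>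

text \<open>Arbitrary structure maps with the prescribed values on generators, so that the Hopf axioms are
  proved for the maps themselves and not only for their extensional representatives.\<close>

locale usl2_hopf =
  fixes h :: complex and \<Delta> and \<epsilon> and S
  assumes comult: "usl2_comult h \<Delta>" and counit: "usl2_counit h \<epsilon>" and antipode: "usl2_antipode h S"
begin

abbreviation "U \<equiv> usl2 h"
abbreviation "E \<equiv> usl2_E h"
abbreviation "F \<equiv> usl2_F h"
abbreviation "H \<equiv> usl2_H h"

sublocale U: sl2_algebra U "usl2_norm h" h E F H
  by (intro sl2_algebra.intro complete_algebra_usl2 sl2_algebra_axioms.intro usl2_triple)

sublocale UU: ptensor_algebras U "usl2_norm h" U "usl2_norm h"
  by (intro ptensor_algebrasI complete_algebra_usl2)

abbreviation "P \<equiv> ptensor U U"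
abbreviation "pure \<equiv> pure_tensor U U"

lemma expH: "usl2_expH h h = U.K" "usl2_expH h (- h) = U.L"
  by (simp_all add: usl2_expH_def U.K_def U.L_def)

lemma hom_comult: "cont_hom U P \<Delta>"
  and comult_gens: "\<Delta> H = pure H \<one>\<^bsub>U\<^esub> \<oplus>\<^bsub>P\<^esub> pure \<one>\<^bsub>U\<^esub> H"
    "\<Delta> E = pure E U.K \<oplus>\<^bsub>P\<^esub> pure \<one>\<^bsub>U\<^esub> E"
    "\<Delta> F = pure F \<one>\<^bsub>U\<^esub> \<oplus>\<^bsub>P\<^esub> pure U.L F"
  using comult by (simp_all add: usl2_comult_def Let_def expH)

lemma hom_counit: "cont_hom U complex_talg \<epsilon>"
  and counit_gens: "\<epsilon> H = 0" "\<epsilon> E = 0" "\<epsilon> F = 0"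
  using counit by (simp_all add: usl2_counit_def)

lemma hom_antipode: "cont_hom U (opposite U) S"
  and antipode_gens: "S H = \<ominus>\<^bsub>U\<^esub> H" "S E = \<ominus>\<^bsub>U\<^esub> (E \<otimes>\<^bsub>U\<^esub> U.L)" "S F = \<ominus>\<^bsub>U\<^esub> (U.K \<otimes>\<^bsub>U\<^esub> F)"
  using antipode by (simp_all add: usl2_antipode_def Let_def expH cont_antihom_iff)

lemma antipode_props:
  "x \<in> carrier U \<Longrightarrow> S x \<in> carrier U"
  "\<lbrakk>x \<in> carrier U; y \<in> carrier U\<rbrakk> \<Longrightarrow> S (x \<otimes>\<^bsub>U\<^esub> y) = S y \<otimes>\<^bsub>U\<^esub> S x"
  "S \<one>\<^bsub>U\<^esub> = \<one>\<^bsub>U\<^esub>" "cont_linear U U S" "linear_on U U S"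
proof -
  show "x \<in> carrier U \<Longrightarrow> S x \<in> carrier U"
    "\<lbrakk>x \<in> carrier U; y \<in> carrier U\<rbrakk> \<Longrightarrow> S (x \<otimes>\<^bsub>U\<^esub> y) = S y \<otimes>\<^bsub>U\<^esub> S x"
    "S \<one>\<^bsub>U\<^esub> = \<one>\<^bsub>U\<^esub>"
    using cont_homD(3,4,5)[OF hom_antipode] by simp_all
  show "cont_linear U U S" using cont_homD(1)[OF hom_antipode] by (simp add: cont_linear_def)
  thus "linear_on U U S" by (simp add: cont_linear_iff)
qed

lemma gens_carrier: "E \<in> carrier U" "F \<in> carrier U" "H \<in> carrier U" "U.K \<in> carrier U" "U.L \<in> carrier U" "\<one>\<^bsub>U\<^esub> \<in> carrier U"
  by simp_all

lemma comult_exp: "\<Delta> U.K = pure U.K U.K" "\<Delta> U.L = pure U.L U.L"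
proof -
  interpret pr: sl2_pair U "usl2_norm h" U "usl2_norm h" h E F H E F H ..
  have d: "\<Delta> (c \<odot>\<^bsub>U\<^esub> H) = c \<odot>\<^bsub>P\<^esub> pr.tt" for c
    using cont_homD(7)[OF hom_comult gens_carrier(3)] by (simp add: comult_gens pr.tt_def)
  have "\<Delta> (alg_exp U (c \<odot>\<^bsub>U\<^esub> H)) = pure (alg_exp U (c \<odot>\<^bsub>U\<^esub> H)) (alg_exp U (c \<odot>\<^bsub>U\<^esub> H))" for c
    using alg_exp_hom[OF U.complete_algebra_axioms UU.complete_algebra_P hom_comult, of "c \<odot>\<^bsub>U\<^esub> H"] pr.exp_tt[of c]
    by (simp add: d)
  thus "\<Delta> U.K = pure U.K U.K" "\<Delta> U.L = pure U.L U.L" by (simp_all add: U.K_def U.L_def)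
qed

lemma counit_exp: "\<epsilon> U.K = 1" "\<epsilon> U.L = 1"
proof -
  have "\<epsilon> (c \<odot>\<^bsub>U\<^esub> H) = 0" for c using cont_homD(7)[OF hom_counit gens_carrier(3)] by (simp add: counit_gens)
  hence "\<epsilon> (alg_exp U (c \<odot>\<^bsub>U\<^esub> H)) = 1" for c
    using alg_exp_hom[OF U.complete_algebra_axioms complete_algebra_complex hom_counit, of "c \<odot>\<^bsub>U\<^esub> H"]
    by (simp add: alg_exp_complex[OF complete_algebra_complex])
  thus "\<epsilon> U.K = 1" "\<epsilon> U.L = 1" by (simp_all add: U.K_def U.L_def)
qed

lemma antipode_exp: "S U.K = U.L" "S U.L = U.K"
proof -
  have "S (c \<odot>\<^bsub>U\<^esub> H) = (- c) \<odot>\<^bsub>U\<^esub> H" for c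
    using linear_onD(3)[OF antipode_props(5) gens_carrier(3)]
    by (simp add: antipode_gens U.uminus_eq_scale U.scale_scale)
  hence "S (alg_exp U (c \<odot>\<^bsub>U\<^esub> H)) = alg_exp U ((- c) \<odot>\<^bsub>U\<^esub> H)" for c
    using alg_exp_hom[OF U.complete_algebra_axioms complete_algebra_opposite[OF U.complete_algebra_axioms] hom_antipode,
        of "c \<odot>\<^bsub>U\<^esub> H"] by (simp add: alg_exp_opposite[OF U.complete_algebra_axioms])
  from this[of h] this[of "- h"] show "S U.K = U.L" "S U.L = U.K" by (simp_all add: U.K_def U.L_def)
qed

text \<open>Both sides are continuous homomorphisms, and they agree on the generators because \<open>K\<close> and \<open>L\<close> are
  group-like.\<close>

lemma coassociative:
  assumes "x \<in> carrier U"
  shows "tensor_assoc U U U (tensor_map U U P U \<Delta> (\<lambda>y. y) (\<Delta> x)) = tensor_map U U U P (\<lambda>y. y) \<Delta> (\<Delta> x)"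
proof -
  interpret L: ptensor_algebras P UU.tn U "usl2_norm h"
    by (intro ptensor_algebrasI UU.complete_algebra_P U.complete_algebra_axioms)
  interpret R: ptensor_algebras U "usl2_norm h" P UU.tn
    by (intro ptensor_algebrasI UU.complete_algebra_P U.complete_algebra_axioms)
  note cU = U.complete_algebra_axioms and cP = UU.complete_algebra_P
  note sU = U.complete_space_axioms and sP = UU.complete_space_P
  note m1 = tensor_map_hom[OF cU cU cP cU hom_comult cont_hom_id]
    and v1 = tensor_map_props(2)[OF sU sU sP sU cont_homD(1)[OF hom_comult] cont_linear_id]
  note m2 = tensor_map_hom[OF cU cU cU cP cont_hom_id hom_comult]
    and v2 = tensor_map_props(2)[OF sU sU sU sP cont_linear_id cont_homD(1)[OF hom_comult]]
  note m3 = tensor_assoc_hom[OF cU cU cU] and v3 = tensor_assoc_props(2)[OF sU sU sU]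
  note add = cont_homD(6)[OF m1] cont_homD(6)[OF m2] cont_homD(6)[OF m3]
  note simps = add v1 v2 v3 comult_gens comult_exp cont_homD(5)[OF hom_comult] UU.pure_one[symmetric]
    UU.pure_carrier L.pure_carrier R.pure_carrier L.pure_add_left R.pure_add_right R.P.M.a_assoc
  have c: "pure a b \<in> carrier P" if "a \<in> carrier U" "b \<in> carrier U" for a b using UU.pure_carrier that .
  show ?thesis
  proof (rule usl2_hom_eqI[OF R.complete_algebra_P _ _ _ _ _ assms])
    show "cont_hom U (ptensor U P) (\<lambda>x. tensor_assoc U U U (tensor_map U U P U \<Delta> (\<lambda>y. y) (\<Delta> x)))"
      by (rule cont_hom_compose[OF cont_hom_compose[OF hom_comult m1] m3])
    show "cont_hom U (ptensor U P) (\<lambda>x. tensor_map U U U P (\<lambda>y. y) \<Delta> (\<Delta> x))"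
      by (rule cont_hom_compose[OF hom_comult m2])
  qed (simp_all add: simps gens_carrier)
qed

lemma left_counit:
  assumes "x \<in> carrier U"
  shows "left_unitor U (tensor_map U U complex_talg U \<epsilon> (\<lambda>y. y) (\<Delta> x)) = x"
proof -
  note cU = U.complete_algebra_axioms and cC = complete_algebra_complex
  interpret C: ptensor_algebras complex_talg "\<lambda>k. cmod" U "usl2_norm h" by (rule ptensor_algebrasI[OF cC cU])
  note m = tensor_map_hom[OF cU cU cC cU hom_counit cont_hom_id]
    and v = tensor_map_props(2)[OF U.complete_space_axioms U.complete_space_axioms C.A.complete_space_axioms
      U.complete_space_axioms cont_homD(1)[OF hom_counit] cont_linear_id]
  note u = left_unitor_props[OF cU]
  note simps = cont_homD(6)[OF m] cont_homD(6)[OF u(1)] v u(2) comult_gens counit_gens counit_exp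
    cont_homD(5)[OF hom_counit] UU.pure_carrier C.pure_carrier
  show ?thesis
  proof (rule usl2_hom_eqI[OF cU _ _ _ _ _ assms])
    show "cont_hom U U (\<lambda>x. left_unitor U (tensor_map U U complex_talg U \<epsilon> (\<lambda>y. y) (\<Delta> x)))"
      by (rule cont_hom_compose[OF cont_hom_compose[OF hom_comult m] u(1)])
  qed (simp_all add: simps cont_hom_id)
qed

lemma right_counit:
  assumes "x \<in> carrier U"
  shows "right_unitor U (tensor_map U U U complex_talg (\<lambda>y. y) \<epsilon> (\<Delta> x)) = x"
proof -
  note cU = U.complete_algebra_axioms and cC = complete_algebra_complex
  interpret C: ptensor_algebras U "usl2_norm h" complex_talg "\<lambda>k. cmod" by (rule ptensor_algebrasI[OF cU cC])
  note m = tensor_map_hom[OF cU cU cU cC cont_hom_id hom_counit]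
    and v = tensor_map_props(2)[OF U.complete_space_axioms U.complete_space_axioms U.complete_space_axioms
      C.B.complete_space_axioms cont_linear_id cont_homD(1)[OF hom_counit]]
  note u = right_unitor_props[OF cU]
  note simps = cont_homD(6)[OF m] cont_homD(6)[OF u(1)] v u(2) comult_gens counit_gens counit_exp
    cont_homD(5)[OF hom_counit] UU.pure_carrier C.pure_carrier
  show ?thesis
  proof (rule usl2_hom_eqI[OF cU _ _ _ _ _ assms])
    show "cont_hom U U (\<lambda>x. right_unitor U (tensor_map U U U complex_talg (\<lambda>y. y) \<epsilon> (\<Delta> x)))"
      by (rule cont_hom_compose[OF cont_hom_compose[OF hom_comult m] u(1)])
  qed (simp_all add: simps cont_hom_id)
qed

text \<open>The convolution identities hold on the generators, and the set where they hold is a closed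
  subalgebra. Multiplicativity is not formal, because neither side is a homomorphism: it rests on
  the hypothesis below, which says that an element with scalar value can be pulled out.\<close>

lemma convolution_identity:
  assumes \<phi>: "cont_linear P U \<phi>" and one: "\<phi> \<one>\<^bsub>P\<^esub> = \<one>\<^bsub>U\<^esub>"
    and mult: "\<And>X Y l m. \<lbrakk>X \<in> carrier P; Y \<in> carrier P; \<phi> X = l \<odot>\<^bsub>U\<^esub> \<one>\<^bsub>U\<^esub>; \<phi> Y = m \<odot>\<^bsub>U\<^esub> \<one>\<^bsub>U\<^esub>\<rbrakk>
      \<Longrightarrow> \<phi> (X \<otimes>\<^bsub>P\<^esub> Y) = (l * m) \<odot>\<^bsub>U\<^esub> \<one>\<^bsub>U\<^esub>"
    and gens: "\<phi> (\<Delta> E) = \<zero>\<^bsub>U\<^esub>" "\<phi> (\<Delta> F) = \<zero>\<^bsub>U\<^esub>" "\<phi> (\<Delta> H) = \<zero>\<^bsub>U\<^esub>"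
    and x: "x \<in> carrier U"
  shows "\<phi> (\<Delta> x) = \<epsilon> x \<odot>\<^bsub>U\<^esub> \<one>\<^bsub>U\<^esub>"
proof -
  let ?M = "{x \<in> carrier U. \<phi> (\<Delta> x) = \<epsilon> x \<odot>\<^bsub>U\<^esub> \<one>\<^bsub>U\<^esub>}"
  have "closed_subspace U ?M"
    by (rule closed_subspace_equalizer[OF U.seminormed_space_axioms U.complete_space_axioms
          cont_linear_compose[OF cont_homD(1)[OF hom_comult] \<phi>]
          cont_linear_compose[OF cont_homD(1)[OF hom_counit] cont_homD(1)[OF U.cont_hom_scalar]]])
  moreover have "\<one>\<^bsub>U\<^esub> \<in> ?M"
    using cont_homD(5)[OF hom_comult] cont_homD(5)[OF hom_counit] one by simp
  moreover have "x \<otimes>\<^bsub>U\<^esub> y \<in> ?M" if "x \<in> ?M" "y \<in> ?M" for x y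
    using that mult[of "\<Delta> x" "\<Delta> y" "\<epsilon> x" "\<epsilon> y"] cont_homD(3,4)[OF hom_comult] cont_homD(4)[OF hom_counit] by simp
  ultimately have "closed_subalgebra U ?M" by (simp add: closed_subalgebra_def)
  moreover have "{E, F, H} \<subseteq> ?M" using gens by (simp add: counit_gens)
  ultimately have "carrier U \<subseteq> ?M" using usl2_generates[of h] unfolding generates_def by meson
  thus ?thesis using x by blast
qed

text \<open>The map \<open>\<phi>\<close> satisfies \<open>\<phi> (X (b \<otimes> c)) = S b \<phi>(X) c\<close>, by continuity in \<open>X\<close>. If \<open>\<phi> X\<close> is a scalar,
  it can be pulled out, and by continuity in the other factor \<open>b \<otimes> c\<close> may be any element.\<close>

lemma left_antipode:
  assumes "x \<in> carrier U"
  shows "mult_map U (tensor_map U U U U S (\<lambda>y. y) (\<Delta> x)) = \<epsilon> x \<odot>\<^bsub>U\<^esub> \<one>\<^bsub>U\<^esub>"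
proof -
  note cU = U.complete_algebra_axioms and sU = U.complete_space_axioms
  define \<phi> where "\<phi> X = mult_map U (tensor_map U U U U S (\<lambda>y. y) X)" for X
  have \<phi>: "cont_linear P U \<phi>"
    unfolding \<phi>_def[abs_def]
    by (rule cont_linear_compose[OF tensor_map_props(1)[OF sU sU sU sU antipode_props(4) cont_linear_id] mult_map_props(1)[OF cU]])
  have pure: "\<phi> (pure a b) = S a \<otimes>\<^bsub>U\<^esub> b" if "a \<in> carrier U" "b \<in> carrier U" for a b
    using that antipode_props(1)
    by (simp add: \<phi>_def tensor_map_props(2)[OF sU sU sU sU antipode_props(4) cont_linear_id] mult_map_props(2)[OF cU])
  have lin: "linear_on P U \<phi>" using \<phi> by (simp add: cont_linear_iff)
  have 1: "\<phi> (X \<otimes>\<^bsub>P\<^esub> pure b c) = S b \<otimes>\<^bsub>U\<^esub> (\<phi> X \<otimes>\<^bsub>U\<^esub> c)"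
    if X: "X \<in> carrier P" and bc: "b \<in> carrier U" "c \<in> carrier U" for X b c
  proof (rule UU.ptensor_eq_on_pure[OF sU _ _ _ X])
    show "cont_linear P U (\<lambda>X. \<phi> (X \<otimes>\<^bsub>P\<^esub> pure b c))"
      by (rule cont_linear_compose[OF cont_linear_mult_right[OF UU.PA.seminormed_algebra_axioms UU.pure_carrier[OF bc]] \<phi>])
    show "cont_linear P U (\<lambda>X. S b \<otimes>\<^bsub>U\<^esub> (\<phi> X \<otimes>\<^bsub>U\<^esub> c))"
      by (rule cont_linear_compose[OF cont_linear_compose[OF \<phi> cont_linear_mult_right[OF U.seminormed_algebra_axioms bc(2)]]
            cont_linear_mult_left[OF U.seminormed_algebra_axioms antipode_props(1)[OF bc(1)]]])
    show "\<phi> (pure a a' \<otimes>\<^bsub>P\<^esub> pure b c) = S b \<otimes>\<^bsub>U\<^esub> (\<phi> (pure a a') \<otimes>\<^bsub>U\<^esub> c)"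
      if "a \<in> carrier U" "a' \<in> carrier U" for a a'
      using that bc by (simp add: UU.pure_mult pure antipode_props(1,2) U.m_assoc)
  qed
  have 2: "\<phi> (X \<otimes>\<^bsub>P\<^esub> Y) = (l \<odot>\<^bsub>U\<^esub> \<one>\<^bsub>U\<^esub>) \<otimes>\<^bsub>U\<^esub> \<phi> Y"
    if X: "X \<in> carrier P" "\<phi> X = l \<odot>\<^bsub>U\<^esub> \<one>\<^bsub>U\<^esub>" and Y: "Y \<in> carrier P" for X Y l
  proof (rule UU.ptensor_eq_on_pure[OF sU _ _ _ Y])
    show "cont_linear P U (\<lambda>Y. \<phi> (X \<otimes>\<^bsub>P\<^esub> Y))"
      by (rule cont_linear_compose[OF cont_linear_mult_left[OF UU.PA.seminormed_algebra_axioms X(1)] \<phi>])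
    show "cont_linear P U (\<lambda>Y. (l \<odot>\<^bsub>U\<^esub> \<one>\<^bsub>U\<^esub>) \<otimes>\<^bsub>U\<^esub> \<phi> Y)"
      by (rule cont_linear_compose[OF \<phi> cont_linear_mult_left[OF U.seminormed_algebra_axioms]]) simp
    show "\<phi> (X \<otimes>\<^bsub>P\<^esub> pure b c) = (l \<odot>\<^bsub>U\<^esub> \<one>\<^bsub>U\<^esub>) \<otimes>\<^bsub>U\<^esub> \<phi> (pure b c)"
      if "b \<in> carrier U" "c \<in> carrier U" for b c
      using that antipode_props(1)[of b]
      by (simp add: 1[OF X(1)] X(2) pure U.scale_mult_left U.scale_mult_right)
  qed
  have "\<phi> (\<Delta> x) = \<epsilon> x \<odot>\<^bsub>U\<^esub> \<one>\<^bsub>U\<^esub>"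
  proof (rule convolution_identity[OF \<phi> _ _ _ _ _ assms])
    show "\<phi> \<one>\<^bsub>P\<^esub> = \<one>\<^bsub>U\<^esub>" by (simp add: UU.pure_one[symmetric] pure antipode_props(3))
    show "\<phi> (X \<otimes>\<^bsub>P\<^esub> Y) = (l * m) \<odot>\<^bsub>U\<^esub> \<one>\<^bsub>U\<^esub>"
      if "X \<in> carrier P" "Y \<in> carrier P" "\<phi> X = l \<odot>\<^bsub>U\<^esub> \<one>\<^bsub>U\<^esub>" "\<phi> Y = m \<odot>\<^bsub>U\<^esub> \<one>\<^bsub>U\<^esub>" for X Y l m
      using 2[OF that(1,3,2)] that(4) by (simp add: U.scale_mult_left U.scale_scale)
    show "\<phi> (\<Delta> H) = \<zero>\<^bsub>U\<^esub>"
      by (simp add: comult_gens linear_onD(2)[OF lin] UU.pure_carrier pure antipode_gens antipode_props(3) U.M.l_neg)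
    show "\<phi> (\<Delta> E) = \<zero>\<^bsub>U\<^esub>"
      by (simp add: comult_gens linear_onD(2)[OF lin] UU.pure_carrier pure antipode_gens antipode_props(3)
          U.l_minus U.m_assoc U.LK U.M.l_neg)
    show "\<phi> (\<Delta> F) = \<zero>\<^bsub>U\<^esub>"
      by (simp add: comult_gens linear_onD(2)[OF lin] UU.pure_carrier pure antipode_gens antipode_exp U.M.l_neg)
  qed
  thus ?thesis by (simp add: \<phi>_def)
qed

text \<open>Here \<open>\<phi> ((a \<otimes> b) Y) = a \<phi>(Y) S b\<close>, so the scalar is pulled out of the right factor.\<close>

lemma right_antipode:
  assumes "x \<in> carrier U"
  shows "mult_map U (tensor_map U U U U (\<lambda>y. y) S (\<Delta> x)) = \<epsilon> x \<odot>\<^bsub>U\<^esub> \<one>\<^bsub>U\<^esub>"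
proof -
  note cU = U.complete_algebra_axioms and sU = U.complete_space_axioms
  define \<phi> where "\<phi> X = mult_map U (tensor_map U U U U (\<lambda>y. y) S X)" for X
  have \<phi>: "cont_linear P U \<phi>"
    unfolding \<phi>_def[abs_def]
    by (rule cont_linear_compose[OF tensor_map_props(1)[OF sU sU sU sU cont_linear_id antipode_props(4)] mult_map_props(1)[OF cU]])
  have pure: "\<phi> (pure a b) = a \<otimes>\<^bsub>U\<^esub> S b" if "a \<in> carrier U" "b \<in> carrier U" for a b
    using that antipode_props(1)
    by (simp add: \<phi>_def tensor_map_props(2)[OF sU sU sU sU cont_linear_id antipode_props(4)] mult_map_props(2)[OF cU])
  have lin: "linear_on P U \<phi>" using \<phi> by (simp add: cont_linear_iff)
  have 1: "\<phi> (pure a b \<otimes>\<^bsub>P\<^esub> Y) = a \<otimes>\<^bsub>U\<^esub> (\<phi> Y \<otimes>\<^bsub>U\<^esub> S b)"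
    if Y: "Y \<in> carrier P" and ab: "a \<in> carrier U" "b \<in> carrier U" for Y a b
  proof (rule UU.ptensor_eq_on_pure[OF sU _ _ _ Y])
    show "cont_linear P U (\<lambda>Y. \<phi> (pure a b \<otimes>\<^bsub>P\<^esub> Y))"
      by (rule cont_linear_compose[OF cont_linear_mult_left[OF UU.PA.seminormed_algebra_axioms UU.pure_carrier[OF ab]] \<phi>])
    show "cont_linear P U (\<lambda>Y. a \<otimes>\<^bsub>U\<^esub> (\<phi> Y \<otimes>\<^bsub>U\<^esub> S b))"
      by (rule cont_linear_compose[OF cont_linear_compose[OF \<phi>
            cont_linear_mult_right[OF U.seminormed_algebra_axioms antipode_props(1)[OF ab(2)]]]
            cont_linear_mult_left[OF U.seminormed_algebra_axioms ab(1)]])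
    show "\<phi> (pure a b \<otimes>\<^bsub>P\<^esub> pure c c') = a \<otimes>\<^bsub>U\<^esub> (\<phi> (pure c c') \<otimes>\<^bsub>U\<^esub> S b)"
      if "c \<in> carrier U" "c' \<in> carrier U" for c c'
      using that ab by (simp add: UU.pure_mult pure antipode_props(1,2) U.m_assoc)
  qed
  have 2: "\<phi> (X \<otimes>\<^bsub>P\<^esub> Y) = (m \<odot>\<^bsub>U\<^esub> \<one>\<^bsub>U\<^esub>) \<otimes>\<^bsub>U\<^esub> \<phi> X"
    if Y: "Y \<in> carrier P" "\<phi> Y = m \<odot>\<^bsub>U\<^esub> \<one>\<^bsub>U\<^esub>" and X: "X \<in> carrier P" for X Y m
  proof (rule UU.ptensor_eq_on_pure[OF sU _ _ _ X])
    show "cont_linear P U (\<lambda>X. \<phi> (X \<otimes>\<^bsub>P\<^esub> Y))"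
      by (rule cont_linear_compose[OF cont_linear_mult_right[OF UU.PA.seminormed_algebra_axioms Y(1)] \<phi>])
    show "cont_linear P U (\<lambda>X. (m \<odot>\<^bsub>U\<^esub> \<one>\<^bsub>U\<^esub>) \<otimes>\<^bsub>U\<^esub> \<phi> X)"
      by (rule cont_linear_compose[OF \<phi> cont_linear_mult_left[OF U.seminormed_algebra_axioms]]) simp
    show "\<phi> (pure a b \<otimes>\<^bsub>P\<^esub> Y) = (m \<odot>\<^bsub>U\<^esub> \<one>\<^bsub>U\<^esub>) \<otimes>\<^bsub>U\<^esub> \<phi> (pure a b)"
      if "a \<in> carrier U" "b \<in> carrier U" for a b
      using that antipode_props(1)[of b]
      by (simp add: 1[OF Y(1)] Y(2) pure U.scale_mult_left U.scale_mult_right)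
  qed
  have "\<phi> (\<Delta> x) = \<epsilon> x \<odot>\<^bsub>U\<^esub> \<one>\<^bsub>U\<^esub>"
  proof (rule convolution_identity[OF \<phi> _ _ _ _ _ assms])
    show "\<phi> \<one>\<^bsub>P\<^esub> = \<one>\<^bsub>U\<^esub>" by (simp add: UU.pure_one[symmetric] pure antipode_props(3))
    show "\<phi> (X \<otimes>\<^bsub>P\<^esub> Y) = (l * m) \<odot>\<^bsub>U\<^esub> \<one>\<^bsub>U\<^esub>"
      if "X \<in> carrier P" "Y \<in> carrier P" "\<phi> X = l \<odot>\<^bsub>U\<^esub> \<one>\<^bsub>U\<^esub>" "\<phi> Y = m \<odot>\<^bsub>U\<^esub> \<one>\<^bsub>U\<^esub>" for X Y l m
      using 2[OF that(2,4,1)] that(3) by (simp add: U.scale_mult_left U.scale_scale mult.commute)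
    show "\<phi> (\<Delta> H) = \<zero>\<^bsub>U\<^esub>"
      by (simp add: comult_gens linear_onD(2)[OF lin] UU.pure_carrier pure antipode_gens antipode_props(3) U.M.r_neg)
    show "\<phi> (\<Delta> E) = \<zero>\<^bsub>U\<^esub>"
      by (simp add: comult_gens linear_onD(2)[OF lin] UU.pure_carrier pure antipode_gens antipode_exp U.M.r_neg)
    show "\<phi> (\<Delta> F) = \<zero>\<^bsub>U\<^esub>"
      by (simp add: comult_gens linear_onD(2)[OF lin] UU.pure_carrier pure antipode_gens antipode_props(3)
          U.r_minus U.m_assoc[symmetric] U.LK U.M.r_neg)
  qed
  thus ?thesis by (simp add: \<phi>_def)
qed

lemma hopf: "hfg_hopf_algebra U \<Delta> \<epsilon> S"
  unfolding hfg_hopf_algebra_def frechet_hopf_algebra_def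
  by (intro conjI ballI U.frechet_algebra hom_comult hom_counit antipode_props(4) coassociative
      left_counit right_counit left_antipode right_antipode hfg_usl2)

text \<open>The squared antipode is an endomorphism, so it can be identified on generators. Being conjugation
  by \<open>K\<close>, it is bijective, and hence so is the antipode.\<close>

lemma antipode_squared:
  assumes "x \<in> carrier U" shows "S (S x) = U.K \<otimes>\<^bsub>U\<^esub> x \<otimes>\<^bsub>U\<^esub> U.L"
proof (rule usl2_hom_eqI[OF U.complete_algebra_axioms _ _ _ _ _ assms])
  show "cont_hom U U (\<lambda>x. S (S x))"
    using cont_linear_compose[OF antipode_props(4,4)] linear_onD[OF antipode_props(5)] antipode_props
    by (simp add: cont_hom_def ring_hom_def Pi_iff)
  have "cont_linear U U (\<lambda>x. U.K \<otimes>\<^bsub>U\<^esub> x \<otimes>\<^bsub>U\<^esub> U.L)"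
    by (rule cont_linear_compose[OF cont_linear_mult_left[OF U.seminormed_algebra_axioms]
          cont_linear_mult_right[OF U.seminormed_algebra_axioms]]) simp_all
  moreover have "U.K \<otimes>\<^bsub>U\<^esub> (x \<otimes>\<^bsub>U\<^esub> y) \<otimes>\<^bsub>U\<^esub> U.L =
      (U.K \<otimes>\<^bsub>U\<^esub> x \<otimes>\<^bsub>U\<^esub> U.L) \<otimes>\<^bsub>U\<^esub> (U.K \<otimes>\<^bsub>U\<^esub> y \<otimes>\<^bsub>U\<^esub> U.L)" if xy: "x \<in> carrier U" "y \<in> carrier U" for x y
  proof -
    have "(U.K \<otimes>\<^bsub>U\<^esub> x \<otimes>\<^bsub>U\<^esub> U.L) \<otimes>\<^bsub>U\<^esub> (U.K \<otimes>\<^bsub>U\<^esub> y \<otimes>\<^bsub>U\<^esub> U.L) =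
        U.K \<otimes>\<^bsub>U\<^esub> x \<otimes>\<^bsub>U\<^esub> (U.L \<otimes>\<^bsub>U\<^esub> U.K) \<otimes>\<^bsub>U\<^esub> (y \<otimes>\<^bsub>U\<^esub> U.L)" using xy by (simp add: U.m_assoc)
    thus ?thesis using xy by (simp add: U.LK U.m_assoc)
  qed
  ultimately show "cont_hom U U (\<lambda>x. U.K \<otimes>\<^bsub>U\<^esub> x \<otimes>\<^bsub>U\<^esub> U.L)"
    by (simp add: cont_hom_def ring_hom_def U.KL U.l_distr U.r_distr)
  have neg: "S (\<ominus>\<^bsub>U\<^esub> x) = \<ominus>\<^bsub>U\<^esub> S x" if "x \<in> carrier U" for x
    using linear_onD(3)[OF antipode_props(5) that, of "-1"] antipode_props(1)[OF that] that
    by (simp add: U.uminus_eq_scale)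
  show "S (S E) = U.K \<otimes>\<^bsub>U\<^esub> E \<otimes>\<^bsub>U\<^esub> U.L"
    by (simp add: antipode_gens neg antipode_props(2) antipode_exp U.r_minus U.m_assoc)
  show "S (S F) = U.K \<otimes>\<^bsub>U\<^esub> F \<otimes>\<^bsub>U\<^esub> U.L"
    by (simp add: antipode_gens neg antipode_props(2) antipode_exp U.l_minus U.m_assoc)
  have "U.K \<otimes>\<^bsub>U\<^esub> H \<otimes>\<^bsub>U\<^esub> U.L = H" by (simp add: U.tK[symmetric] U.m_assoc U.KL)
  thus "S (S H) = U.K \<otimes>\<^bsub>U\<^esub> H \<otimes>\<^bsub>U\<^esub> U.L" by (simp add: antipode_gens neg)
qed

lemma antipode_invertible: "cont_invertible U S"
  unfolding cont_invertible_def
proof (intro exI conjI ballI)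
  let ?T = "\<lambda>x. U.L \<otimes>\<^bsub>U\<^esub> S x \<otimes>\<^bsub>U\<^esub> U.K"
  show "cont_linear U U ?T"
    by (rule cont_linear_compose[OF cont_linear_compose[OF antipode_props(4)
            cont_linear_mult_left[OF U.seminormed_algebra_axioms]]
          cont_linear_mult_right[OF U.seminormed_algebra_axioms]]) simp_all
  fix x assume x: "x \<in> carrier U"
  have key: "U.L \<otimes>\<^bsub>U\<^esub> (U.K \<otimes>\<^bsub>U\<^esub> x \<otimes>\<^bsub>U\<^esub> U.L) \<otimes>\<^bsub>U\<^esub> U.K = x"
  proof -
    have "U.L \<otimes>\<^bsub>U\<^esub> (U.K \<otimes>\<^bsub>U\<^esub> x \<otimes>\<^bsub>U\<^esub> U.L) \<otimes>\<^bsub>U\<^esub> U.K = (U.L \<otimes>\<^bsub>U\<^esub> U.K) \<otimes>\<^bsub>U\<^esub> x \<otimes>\<^bsub>U\<^esub> (U.L \<otimes>\<^bsub>U\<^esub> U.K)"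
      using x by (simp add: U.m_assoc)
    thus ?thesis using x by (simp add: U.LK)
  qed
  show "?T (S x) = x" using x key by (simp add: antipode_squared)
  show "S (?T x) = x"
    using x key antipode_props(1)[OF x]
    by (simp add: antipode_props(1,2) antipode_exp antipode_squared U.m_assoc)
qed

end

section \<open>Infinite dimension\<close>

lemma linear_functional_finsum:
  assumes "vspace V" "linear_on V complex_talg f" "finite S" "g \<in> S \<rightarrow> carrier V"
  shows "f (finsum V g S) = (\<Sum>i\<in>S. f (g i))"
proof -
  interpret C: vspace complex_talg by (rule complex_vspace)
  have "f (finsum V g S) = finsum complex_talg (\<lambda>i. f (g i)) S"
    by (rule linear_on_finsum[OF assms(2,1) complex_vspace assms(3,4)])
  also have "\<dots> = (\<Sum>i\<in>S. f (g i))" using assms(3) by (induction S rule: finite_induct) simp_all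
  finally show ?thesis .
qed

lemma sum_fun_apply: "(\<Sum>i\<in>S. f i) k = (\<Sum>i\<in>S. f i k)"
  by (induction S rule: infinite_finite_induct) simp_all

text \<open>For \<open>E = F = 0\<close> the relations only ask that \<open>sinh (h * H)\<close> vanishes, so there is a character for
  each \<open>H = k * pi * i / h\<close>. Infinitely many values of \<open>H\<close> make its powers linearly independent.\<close>

lemma usl2_character:
  assumes "h \<noteq> 0"
  obtains \<xi> where "cont_hom (usl2 h) complex_talg \<xi>" "\<xi> (usl2_H h) = of_nat k * (pi * \<i>) / h"
proof -
  let ?z = "of_nat k * (complex_of_real pi * \<i>) / h"
  interpret C: complete_algebra complex_talg "\<lambda>k. cmod" by (rule complete_algebra_complex)
  have e: "exp (of_nat k * (complex_of_real pi * \<i>)) = (- 1) ^ k"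
    using exp_of_nat_mult[of k "complex_of_real pi * \<i>"] by (simp add: exp_pi_i)
  hence "exp (h * ?z) = exp (- h * ?z)" using assms by (simp add: exp_minus power_inverse[symmetric])
  hence "sl2_triple h complex_talg 0 0 ?z"
    by (simp add: sl2_triple_def alg_exp_complex[OF complete_algebra_complex])
  from usl2_hom_ex1[OF complete_algebra_complex this] show thesis using that by blast
qed

lemma usl2_infinite_dimensional:
  assumes "h \<noteq> 0" shows "\<not> finite_dimensional (usl2 h)"
proof
  let ?U = "usl2 h"
  interpret U: sl2_algebra ?U "usl2_norm h" h "usl2_E h" "usl2_F h" "usl2_H h"
    by (intro sl2_algebra.intro complete_algebra_usl2 sl2_algebra_axioms.intro usl2_triple)
  have "\<exists>\<xi>. cont_hom ?U complex_talg \<xi> \<and> \<xi> (usl2_H h) = of_nat k * (pi * \<i>) / h" for k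
    using usl2_character[OF assms, of k] by metis
  then obtain \<xi> where \<xi>: "\<And>k. cont_hom ?U complex_talg (\<xi> k)"
    "\<And>k. \<xi> k (usl2_H h) = of_nat k * (pi * \<i>) / h" by metis
  define z where "z k = \<xi> k (usl2_H h)" for k
  have inj: "inj z" using assms by (auto simp: inj_def z_def \<xi>(2))
  have pow: "\<xi> k (usl2_H h [^]\<^bsub>?U\<^esub> (j::nat)) = z k ^ j" for k j
    by (induction j) (simp_all add: cont_homD(4,5)[OF \<xi>(1)] z_def mult.commute)
  interpret fv: vector_space "\<lambda>(c::complex) (f::nat \<Rightarrow> complex) k. c * f k"
    by unfold_locales (auto simp: fun_eq_iff algebra_simps)
  assume "finite_dimensional ?U"
  then obtain B where B: "finite B" "B \<subseteq> carrier ?U"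
    "\<And>x. x \<in> carrier ?U \<Longrightarrow> \<exists>c. x = finsum ?U (\<lambda>b. c b \<odot>\<^bsub>?U\<^esub> b) B"
    unfolding finite_dimensional_def by blast
  define \<Phi> where "\<Phi> x k = \<xi> k x" for x k
  have sp: "\<Phi> x \<in> fv.span (\<Phi> ` B)" if x: "x \<in> carrier ?U" for x
  proof -
    obtain c where c: "x = finsum ?U (\<lambda>b. c b \<odot>\<^bsub>?U\<^esub> b) B" using B(3)[OF x] by blast
    have "\<Phi> x k = (\<Sum>b\<in>B. c b * \<Phi> b k)" for k
    proof -
      have "\<Phi> x k = (\<Sum>b\<in>B. \<xi> k (c b \<odot>\<^bsub>?U\<^esub> b))"
        unfolding \<Phi>_def c
        by (rule linear_functional_finsum[OF U.vspace_axioms cont_homD(2)[OF \<xi>(1)] B(1)]) (use B(2) in auto)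
      also have "\<dots> = (\<Sum>b\<in>B. c b * \<Phi> b k)"
        using B(2) cont_homD(7)[OF \<xi>(1)] by (intro sum.cong) (auto simp: \<Phi>_def)
      finally show ?thesis .
    qed
    hence "\<Phi> x = (\<Sum>b\<in>B. (\<lambda>k. c b * \<Phi> b k))" by (simp add: fun_eq_iff sum_fun_apply)
    also have "\<dots> \<in> fv.span (\<Phi> ` B)" by (intro fv.span_sum fv.span_scale fv.span_base) auto
    finally show ?thesis .
  qed
  define v where "v j k = z k ^ j" for j k :: nat
  have v\<Phi>: "v j = \<Phi> (usl2_H h [^]\<^bsub>?U\<^esub> j)" for j by (simp add: fun_eq_iff v_def \<Phi>_def pow)
  have zero: "\<forall>j\<in>J. c j = 0" if J: "finite J" and s: "\<And>k. (\<Sum>j\<in>J. c j * z k ^ j) = 0" for J and c :: "nat \<Rightarrow> complex"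
  proof -
    define q where "q = (\<Sum>j\<in>J. monom (c j) j)"
    have "poly q (z k) = 0" for k using s[of k] by (simp add: q_def poly_sum poly_monom)
    hence "range z \<subseteq> {x. poly q x = 0}" by blast
    moreover have "infinite (range z)" using inj by (simp add: finite_image_iff)
    ultimately have "q = 0" using poly_roots_finite finite_subset by blast
    moreover have "coeff q j = c j" if "j \<in> J" for j
      unfolding q_def coeff_sum using J that by (simp add: coeff_monom sum.delta)
    ultimately show ?thesis by auto
  qed
  have injv: "inj v"
  proof (rule injI)
    fix i j assume eq: "v i = v j"
    show "i = j"
    proof (rule ccontr)
      assume "i \<noteq> j"
      define c :: "nat \<Rightarrow> complex" where "c = (\<lambda>l. if l = i then 1 else -1)"
      have "(\<Sum>l\<in>{i, j}. c l * z k ^ l) = 0" for k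
        using fun_cong[OF eq, of k] \<open>i \<noteq> j\<close> by (simp add: v_def c_def)
      hence "c i = 0" using zero[of "{i, j}" c] by simp
      thus False by (simp add: c_def)
    qed
  qed
  have "fv.independent (range v)"
    unfolding fv.independent_explicit_module
  proof (intro allI impI)
    fix T u w assume T: "finite T" "T \<subseteq> range v" and s: "(\<Sum>w\<in>T. (\<lambda>k. u w * w k)) = 0" and w: "w \<in> T"
    define J where "J = v -` T"
    have J: "finite J" "T = v ` J" using T injv by (auto simp: J_def finite_vimageI)
    have "(\<Sum>j\<in>J. u (v j) * z k ^ j) = 0" for k
    proof -
      have "(\<Sum>j\<in>J. u (v j) * z k ^ j) = (\<Sum>w\<in>T. u w * w k)"
        unfolding J(2) using inj_on_subset[OF injv] by (subst sum.reindex) (auto simp: v_def)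
      also have "\<dots> = (\<Sum>w\<in>T. (\<lambda>k. u w * w k)) k" by (simp add: sum_fun_apply)
      finally show ?thesis using s by simp
    qed
    thus "u w = 0" using zero[OF J(1), of "\<lambda>j. u (v j)"] w J(2) by auto
  qed
  moreover have "range v \<subseteq> fv.span (\<Phi> ` B)" using sp by (auto simp: v\<Phi>)
  ultimately have "finite (range v)" using fv.independent_span_bound[of "\<Phi> ` B" "range v"] B(1) by blast
  thus False using injv by (simp add: finite_image_iff)
qed

section \<open>Quantum \<open>sl\<^sub>2\<close> as an HFG Hopf algebra\<close>

theorem proposition5p2:
  fixes h :: complex
  assumes "sinh h \<noteq> 0"
  shows "hfg (usl2 h) \<and> \<not> finite_dimensional (usl2 h) \<and>
    (\<exists>!\<Delta>. \<Delta> \<in> extensional (carrier (usl2 h)) \<and> usl2_comult h \<Delta>) \<and>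
    (\<exists>!\<epsilon>. \<epsilon> \<in> extensional (carrier (usl2 h)) \<and> usl2_counit h \<epsilon>) \<and>
    (\<exists>!S. S \<in> extensional (carrier (usl2 h)) \<and> usl2_antipode h S) \<and>
    (\<forall>\<Delta> \<epsilon> S. usl2_comult h \<Delta> \<and> usl2_counit h \<epsilon> \<and> usl2_antipode h S \<longrightarrow>
      hfg_hopf_algebra (usl2 h) \<Delta> \<epsilon> S \<and> cont_invertible (usl2 h) S)"
proof (intro conjI allI impI)
  let ?U = "usl2 h"
  interpret U: sl2_algebra ?U "usl2_norm h" h "usl2_E h" "usl2_F h" "usl2_H h"
    by (intro sl2_algebra.intro complete_algebra_usl2 sl2_algebra_axioms.intro usl2_triple)
  interpret UU: sl2_pair ?U "usl2_norm h" ?U "usl2_norm h" h "usl2_E h" "usl2_F h" "usl2_H h"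
    "usl2_E h" "usl2_F h" "usl2_H h" ..
  have expH: "usl2_expH h h = U.K" "usl2_expH h (- h) = U.L"
    by (simp_all add: usl2_expH_def U.K_def U.L_def)
  show "hfg ?U" by (rule hfg_usl2)
  have "h \<noteq> 0" using assms by auto
  thus "\<not> finite_dimensional ?U" by (rule usl2_infinite_dimensional)
  have "usl2_comult h \<Delta> \<longleftrightarrow> cont_hom ?U (ptensor ?U ?U) \<Delta> \<and> \<Delta> (usl2_E h) = UU.te \<and>
      \<Delta> (usl2_F h) = UU.tf \<and> \<Delta> (usl2_H h) = UU.tt" for \<Delta>
    by (auto simp: usl2_comult_def Let_def expH UU.te_def UU.tf_def UU.tt_def)
  thus "\<exists>!\<Delta>. \<Delta> \<in> extensional (carrier ?U) \<and> usl2_comult h \<Delta>"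
    using usl2_hom_ex1[OF UU.complete_algebra_P UU.comult_triple] by simp
  interpret C: complete_algebra complex_talg "\<lambda>k. cmod" by (rule complete_algebra_complex)
  have "sl2_triple h complex_talg 0 0 0" by (simp add: sl2_triple_def)
  moreover have "usl2_counit h \<epsilon> \<longleftrightarrow> cont_hom ?U complex_talg \<epsilon> \<and> \<epsilon> (usl2_E h) = 0 \<and>
      \<epsilon> (usl2_F h) = 0 \<and> \<epsilon> (usl2_H h) = 0" for \<epsilon>
    by (auto simp: usl2_counit_def)
  ultimately show "\<exists>!\<epsilon>. \<epsilon> \<in> extensional (carrier ?U) \<and> usl2_counit h \<epsilon>"
    using usl2_hom_ex1[OF complete_algebra_complex, of h 0 0 0] by simp
  have "usl2_antipode h S \<longleftrightarrow> cont_hom ?U (opposite ?U) S \<and> S (usl2_E h) = \<ominus>\<^bsub>?U\<^esub> (usl2_E h \<otimes>\<^bsub>?U\<^esub> U.L) \<and>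
      S (usl2_F h) = \<ominus>\<^bsub>?U\<^esub> (U.K \<otimes>\<^bsub>?U\<^esub> usl2_F h) \<and> S (usl2_H h) = \<ominus>\<^bsub>?U\<^esub> usl2_H h" for S
    by (auto simp: usl2_antipode_def Let_def expH cont_antihom_iff)
  thus "\<exists>!S. S \<in> extensional (carrier ?U) \<and> usl2_antipode h S"
    using usl2_hom_ex1[OF complete_algebra_opposite[OF U.complete_algebra_axioms] U.opposite_triple] by simp
next
  fix \<Delta> \<epsilon> S assume *: "usl2_comult h \<Delta> \<and> usl2_counit h \<epsilon> \<and> usl2_antipode h S"
  then interpret usl2_hopf h \<Delta> \<epsilon> S by unfold_locales auto
  show "hfg_hopf_algebra (usl2 h) \<Delta> \<epsilon> S" by (rule hopf)
  show "cont_invertible (usl2 h) S" by (rule antipode_invertible)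
qed

end
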